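(* Let $n\in\mathbb Z$, $a\ge1$, and let $\phi^n\colon\Lambda\to\mathrm{END}_{\mathcal U}(\mathbf 1_n)$ be the ring isomorphism with $\phi^n(h_r)=\circlearrowright_n(r)$ for all $r\ge0$. For all partitions $\alpha,\beta\in P(a)$, the thick bubbles in the region of weight $n$ satisfy $$(\phi^n)^{-1}\big(\circlearrowright^{(a)}(\alpha)\big)=(-1)^{\frac{a(a-1)}2}\,\pi_\alpha,\qquad(\phi^n)^{-1}\big(\circlearrowleft^{(a)}(\beta)\big)=(-1)^{\frac{a(a-1)}2+|\beta|}\,\pi_{\bar\beta}.$$
   Context: **Symmetric functions.** $\Lambda$ is the ring of symmetric functions in infinitely many variables with coefficients in the ground ring $\Bbbk$; $h_r$ complete symmetric functions, $\pi_\alpha$ Schur functions; $\bar\beta$ is the conjugate partition, $|\beta|=\sum\beta_i$. $P(a)$: partitions with at most $a$ parts; $\alpha+m$ means adding the integer $m$ to each of the $a$ entries. That $\phi^n$ is an isomorphism is a known theorem of Lauda (with $\Bbbk$ a field) and may be assumed; it also satisfies $\phi^n((-1)^r\varepsilon_r)=\circlearrowleft_n(r)$ with $\varepsilon_r$ the elementary symmetric functions. **The 2-category $\mathcal U$** (over a ground ring $\Bbbk$). Objects: integers $n$. 1-morphisms $n\to n'$: finite formal direct sums of symbols $W\mathbf 1_n\{t\}$, $t\in\mathbb Z$, $W$ a word in letters $\mathcal E,\mathcal F$ with $n'=n+2(\#\mathcal E-\#\mathcal F)$; so $\mathcal E\mathbf 1_n\colon n\to n+2$, $\mathcal F\mathbf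 1_n\colon n\to n-2$; composition is concatenation (rightmost letter first) and shifts add. 2-morphisms: let $\mathcal H$ be the strict $\Bbbk$-linear 2-category with 1-morphisms $W\mathbf 1_n$ and graded 2-hom modules generated, under vertical composition $\circ$ and horizontal composition (juxtaposition; a letter also denotes its identity 2-morphism), for all $n$, by: dots $x\colon\mathcal E\mathbf 1_n\to\mathcal E\mathbf 1_n$, $x_{F}\colon\mathcal F\mathbf 1_n\to\mathcal F\mathbf 1_n$ (degree 2); crossings $\chi\colon\mathcal{EE}\mathbf 1_n\to\mathcal{EE}\mathbf 1_n$, $\chi_F\colon\mathcal{FF}\mathbf 1_n\to\mathcal{FF}\mathbf 1_n$ (degree $-2$); cups $\eta_n\colon\mathbf 1_n\to\mathcal{FE}\mathbf 1_n$ (degree $1+n$), $\eta'_n\colon\mathbf 1_n\to\mathcal{EF}\mathbf 1_n$ (degree $1-n$); caps $\epsilon_n\colon\mathcal{FE}\mathbf 1_n\to\mathbf 1_n$ (degree $1+n$), $\epsilon'_n\colon\mathcal{EF}\mathbf 1_n\to\mathbf 1_n$ (degree $1-n$), subject to relations (1)-(6) below. $\mathrm{Hom}_{\mathcal U}(W\mathbf 1_n\{t\},W'\mathbf 1_n\{t'\})$ is the degree $t-t'$ part of $\mathcal H(W\mathbf 1_n,W'\mathbf 1_n)$, extended additively; $\mathrm{END}_{\mathcal U}(\mathbf 1_n)=\bigoplus_t\mathrm{Hom}(\mathbf 1_n\{t\},\mathbf 1_n)$. Relations (for all weights; indices of summation are nonnegative integers, empty sums are $0$): (1) $(\epsilon'\mathcal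 E)\circ(\mathcal E\eta)=\mathcal E=(\mathcal E\epsilon)\circ(\eta'\mathcal E)$, $(\mathcal F\epsilon')\circ(\eta\mathcal F)=\mathcal F=(\epsilon\mathcal F)\circ(\mathcal F\eta')$. (2) $\chi^2=0$; $(\chi\mathcal E)(\mathcal E\chi)(\chi\mathcal E)=(\mathcal E\chi)(\chi\mathcal E)(\mathcal E\chi)$; $\mathcal{EE}=\chi\circ(x\mathcal E)-(\mathcal Ex)\circ\chi=(x\mathcal E)\circ\chi-\chi\circ(\mathcal Ex)$. (3) $x_F=(\mathcal F\epsilon')(\mathcal Fx\mathcal F)(\eta\mathcal F)=(\epsilon\mathcal F)(\mathcal Fx\mathcal F)(\mathcal F\eta')$, and $\chi_F=(\mathcal{FF}\epsilon'^{(2)})(\mathcal{FF}\chi\mathcal{FF})(\eta^{(2)}\mathcal{FF})=(\epsilon^{(2)}\mathcal{FF})(\mathcal{FF}\chi\mathcal{FF})(\mathcal{FF}\eta'^{(2)})$, where $\eta^{(a)}\colon\mathbf 1_n\to\mathcal F^a\mathcal E^a\mathbf 1_n$, $\eta'^{(a)}\colon\mathbf 1_n\to\mathcal E^a\mathcal F^a\mathbf 1_n$, $\epsilon^{(a)}\colon\mathcal F^a\mathcal E^a\mathbf 1_n\to\mathbf 1_n$, $\epsilon'^{(a)}\colon\mathcal E^a\mathcal F^a\mathbf 1_n\to\mathbf 1_n$ denote $a$ nested cups/caps. (4) Bubbles. For $r\in\mathbb Z$ put $\circlearrowleft_n(r)=\epsilon_n\circ(\mathcal Fx^{r-n-1})\circ\eta_n$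 if $r-n-1\ge0$, and $\circlearrowright_n(r)=\epsilon'_n\circ(x^{r+n-1}\mathcal F)\circ\eta'_n$ if $r+n-1\ge 0$ (both of degree $2r$). These are $0$ if $r<0$ and $1$ if $r=0$. When the number of dots is negative: for $r<0$ the symbol is $0$; for $r\ge0$ the symbols ("fake bubbles") are defined inductively by $\circlearrowleft_n(0)=\circlearrowright_n(0)=1$ and $\sum_{r+s=k}\circlearrowleft_n(r)\circlearrowright_n(s)=\delta_{k,0}$. (5) $(\mathcal E\epsilon'_n)(\chi\mathcal F)(\mathcal E\eta'_n)=-\sum_{f_1+f_2=-n}x^{f_1}\circlearrowright_n(f_2)$ on $\mathcal E\mathbf 1_n$ (bubble to the right); $(\epsilon_n\mathcal E)(\mathcal F\chi)(\eta_n\mathcal E)=\sum_{g_1+g_2=n}\circlearrowleft_n(g_2)\,x^{g_1}$ on $\mathbf 1_n\mathcal E$ (bubble to the left). (6) With $s=(\mathcal{FE}\epsilon')(\mathcal F\chi\mathcal F)(\eta\mathcal{EF})\colon\mathcal{EF}\mathbf 1_n\to\mathcal{FE}\mathbf 1_n$ and $s'=(\epsilon\mathcal{EF})(\mathcal F\chi\mathcal F)(\mathcal{FE}\eta')\colon\mathcal{FE}\mathbf 1_n\to\mathcal{EF}\mathbf 1_n$: $\mathcal{EF}\mathbf 1_n=-s's+\sum_{f_1+f_2+f_3=n-1}(x^{f_1}\mathcal F)\eta'_n\circlearrowleft_n(f_2)\,\epsilon'_n(x^{f_3}\mathcal F)$ and $\mathcal{FE}\mathbf 1_n=-ss'+\sum_{g_1+g_2+g_3=-n-1}(\mathcal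 Fx^{g_1})\eta_n\circlearrowright_n(g_2)\,\epsilon_n(\mathcal Fx^{g_3})$. **Thick bubbles.** The nilHecke ring $NH_a$ (endomorphisms of $\mathbb Z[x_1,\dots,x_a]$ generated by multiplications by $x_i$ and divided differences $\partial_i(f)=(f-s_if)/(x_i-x_{i+1})$) acts on $\mathcal E^a$: $x_i$ is a dot on the $i$-th $\mathcal E$ from the left, $\partial_i$ a crossing of the $i$-th and $(i+1)$-st. Put $e_a=x_1^{a-1}x_2^{a-2}\cdots x_{a-1}\,\partial_{w_0}$ ($w_0\in S_a$ longest), an idempotent. For $\alpha\in P(a)$: $\circlearrowright^{(a)}(\alpha)=\epsilon'^{(a)}\circ(\pi_{\alpha+(n-a)}(x_1,\dots,x_a)e_a\,\mathcal F^a)\circ\eta'^{(a)}$ if $\alpha_a\ge a-n$, and otherwise $\circlearrowright^{(a)}(\alpha):=(-1)^{a(a-1)/2}\det[\circlearrowright_n(\alpha_s-s+t)]_{s,t=1}^a$; $\circlearrowleft^{(a)}(\beta)=\epsilon^{(a)}\circ(\mathcal F^a\,\pi_{\beta-(n+a)}(x_1,\dots,x_a)e_a)\circ\eta^{(a)}$ if $\beta_a\ge n+a$, and otherwise $\circlearrowleft^{(a)}(\beta):=(-1)^{a(a-1)/2}\det[\circlearrowleft_n(\beta_s-s+t)]_{s,t=1}^a$. *)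

theory Defs
  imports
    "HOL-Library.Multiset"
    "HOL-Library.FuncSet"
    "HOL-Library.Poly_Mapping"
    "HOL-Combinatorics.Permutations"
    "HOL-Algebra.QuotRing"
begin

section \<open>Symmetric functions\<close>

text \<open>A monomial in the variables \<open>x\<^sub>0, x\<^sub>1, x\<^sub>2, \<dots>\<close> is the finite multiset of the indices of its
  variables, so that the product of monomials is the sum of multisets and the degree is the size.
  A formal power series is the function that gives the coefficient of each monomial.\<close>

definition Lambda :: "(nat multiset \<Rightarrow> 'k::comm_ring_1) ring" where
  "Lambda =
    \<lparr>carrier = {f. (\<forall>\<sigma>. bij \<sigma> \<longrightarrow> (\<forall>m. f (image_mset \<sigma> m) = f m)) \<and>
                   (\<exists>N. \<forall>m. f m \<noteq> 0 \<longrightarrow> size m \<le> N)},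
     mult = (\<lambda>f g m. \<Sum>p | p \<subseteq># m. f p * g (m - p)),
     one = (\<lambda>m. if m = {#} then 1 else 0),
     zero = (\<lambda>m. 0),
     add = (\<lambda>f g m. f m + g m)\<rparr>"

definition complete_sym :: "nat \<Rightarrow> nat multiset \<Rightarrow> 'k::comm_ring_1" where
  "complete_sym r = (\<lambda>m. if size m = r then 1 else 0)"

text \<open>The partitions with at most \<open>a\<close> parts, padded with zeros to exactly \<open>a\<close> entries.\<close>

definition partitions_atmost :: "nat \<Rightarrow> nat list set" where
  "partitions_atmost a = {\<alpha>. length \<alpha> = a \<and> sorted_wrt (\<ge>) \<alpha>}"

definition conjugate :: "nat list \<Rightarrow> nat list" where
  "conjugate \<beta> = map (\<lambda>j. card {i. i < length \<beta> \<and> j < \<beta> ! i}) [0..<Max (insert 0 (set \<beta>))]"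

definition cells :: "nat list \<Rightarrow> (nat \<times> nat) set" where
  "cells \<alpha> = (SIGMA i:{..<length \<alpha>}. {..<\<alpha> ! i})"

definition ssyt :: "nat list \<Rightarrow> (nat \<times> nat \<Rightarrow> nat) set" where
  "ssyt \<alpha> = {T \<in> extensional (cells \<alpha>).
     (\<forall>i j j'. (i, j) \<in> cells \<alpha> \<and> (i, j') \<in> cells \<alpha> \<and> j < j' \<longrightarrow> T (i, j) \<le> T (i, j')) \<and>
     (\<forall>i i' j. (i, j) \<in> cells \<alpha> \<and> (i', j) \<in> cells \<alpha> \<and> i < i' \<longrightarrow> T (i, j) < T (i', j))}"

definition schur :: "nat list \<Rightarrow> nat multiset \<Rightarrow> 'k::comm_ring_1" where
  "schur \<alpha> = (\<lambda>m. of_nat (card {T \<in> ssyt \<alpha>. image_mset T (mset_set (cells \<alpha>)) = m}))"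


section \<open>The 2-category\<close>

subsection \<open>Diagrams\<close>

datatype letter = \<E> | \<F>

type_synonym word = "letter list"

definition wt :: "word \<Rightarrow> int" where
  "wt W = 2 * (int (count_list W \<E>) - int (count_list W \<F>))"

text \<open>The integer argument of a generator is the weight \<open>n\<close> of its rightmost region: the
  generators are 2-morphisms between 1-morphisms \<open>W 1\<^sub>n\<close>. \<open>Cup\<close>, \<open>Cap\<close> are
  \<open>\<eta>\<^sub>n\<close>, \<open>\<epsilon>\<^sub>n\<close>, and \<open>Cup'\<close>, \<open>Cap'\<close> are \<open>\<eta>'\<^sub>n\<close>, \<open>\<epsilon>'\<^sub>n\<close>. In \<open>VComp f g\<close> the diagram \<open>g\<close> is applied
  first; in \<open>HComp f g\<close> the diagram \<open>g\<close> stands on the right.\<close>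

datatype diagram =
    Ident word int
  | Dot int | DotF int
  | Cross int | CrossF int
  | Cup int | Cup' int
  | Cap int | Cap' int
  | VComp diagram diagram
  | HComp diagram diagram

primrec rwt :: "diagram \<Rightarrow> int" where
  "rwt (Ident W n) = n"
| "rwt (Dot n) = n" | "rwt (DotF n) = n"
| "rwt (Cross n) = n" | "rwt (CrossF n) = n"
| "rwt (Cup n) = n" | "rwt (Cup' n) = n"
| "rwt (Cap n) = n" | "rwt (Cap' n) = n"
| "rwt (VComp f g) = rwt g"
| "rwt (HComp f g) = rwt g"

primrec src :: "diagram \<Rightarrow> word" where
  "src (Ident W n) = W"
| "src (Dot n) = [\<E>]" | "src (DotF n) = [\<F>]"
| "src (Cross n) = [\<E>, \<E>]" | "src (CrossF n) = [\<F>, \<F>]"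
| "src (Cup n) = []" | "src (Cup' n) = []"
| "src (Cap n) = [\<F>, \<E>]" | "src (Cap' n) = [\<E>, \<F>]"
| "src (VComp f g) = src g"
| "src (HComp f g) = src f @ src g"

primrec tgt :: "diagram \<Rightarrow> word" where
  "tgt (Ident W n) = W"
| "tgt (Dot n) = [\<E>]" | "tgt (DotF n) = [\<F>]"
| "tgt (Cross n) = [\<E>, \<E>]" | "tgt (CrossF n) = [\<F>, \<F>]"
| "tgt (Cup n) = [\<F>, \<E>]" | "tgt (Cup' n) = [\<E>, \<F>]"
| "tgt (Cap n) = []" | "tgt (Cap' n) = []"
| "tgt (VComp f g) = tgt f"
| "tgt (HComp f g) = tgt f @ tgt g"

primrec deg :: "diagram \<Rightarrow> int" where
  "deg (Ident W n) = 0"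
| "deg (Dot n) = 2" | "deg (DotF n) = 2"
| "deg (Cross n) = - 2" | "deg (CrossF n) = - 2"
| "deg (Cup n) = 1 + n" | "deg (Cup' n) = 1 - n"
| "deg (Cap n) = 1 + n" | "deg (Cap' n) = 1 - n"
| "deg (VComp f g) = deg f + deg g"
| "deg (HComp f g) = deg f + deg g"

definition lwt :: "diagram \<Rightarrow> int" where
  "lwt f = rwt f + wt (src f)"

primrec wf_diagram :: "diagram \<Rightarrow> bool" where
  "wf_diagram (Ident W n) = True"
| "wf_diagram (Dot n) = True" | "wf_diagram (DotF n) = True"
| "wf_diagram (Cross n) = True" | "wf_diagram (CrossF n) = True"
| "wf_diagram (Cup n) = True" | "wf_diagram (Cup' n) = True"
| "wf_diagram (Cap n) = True" | "wf_diagram (Cap' n) = True"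
| "wf_diagram (VComp f g) =
    (wf_diagram f \<and> wf_diagram g \<and> rwt f = rwt g \<and> src f = tgt g)"
| "wf_diagram (HComp f g) = (wf_diagram f \<and> wf_diagram g \<and> rwt f = lwt g)"


subsection \<open>Linear combinations of diagrams\<close>

type_synonym 'k lin = "diagram \<Rightarrow>\<^sub>0 'k"

definition gen :: "diagram \<Rightarrow> 'k::comm_ring_1 lin" where
  "gen d = Poly_Mapping.single d 1"

definition scal :: "'k::comm_ring_1 \<Rightarrow> 'k lin \<Rightarrow> 'k lin" where
  "scal c f = Poly_Mapping.map ((*) c) f"

definition bilinear_ext ::
  "(diagram \<Rightarrow> diagram \<Rightarrow> diagram) \<Rightarrow> 'k::comm_ring_1 lin \<Rightarrow> 'k lin \<Rightarrow> 'k lin" where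
  "bilinear_ext C f g = (\<Sum>a\<in>Poly_Mapping.keys f. \<Sum>b\<in>Poly_Mapping.keys g.
     Poly_Mapping.single (C a b) (Poly_Mapping.lookup f a * Poly_Mapping.lookup g b))"

definition vcomp :: "'k::comm_ring_1 lin \<Rightarrow> 'k lin \<Rightarrow> 'k lin"  (infixr "\<circ>\<^sub>v" 70) where
  "f \<circ>\<^sub>v g = bilinear_ext VComp f g"

definition hcomp :: "'k::comm_ring_1 lin \<Rightarrow> 'k lin \<Rightarrow> 'k lin"  (infixr "\<star>" 75) where
  "f \<star> g = bilinear_ext HComp f g"

abbreviation idm :: "word \<Rightarrow> int \<Rightarrow> 'k::comm_ring_1 lin" where
  "idm W n \<equiv> gen (Ident W n)"
abbreviation idE :: "int \<Rightarrow> 'k::comm_ring_1 lin" where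
  "idE n \<equiv> idm [\<E>] n"
abbreviation idF :: "int \<Rightarrow> 'k::comm_ring_1 lin" where
  "idF n \<equiv> idm [\<F>] n"
abbreviation dot :: "int \<Rightarrow> 'k::comm_ring_1 lin" where
  "dot n \<equiv> gen (Dot n)"
abbreviation dotF :: "int \<Rightarrow> 'k::comm_ring_1 lin" where
  "dotF n \<equiv> gen (DotF n)"
abbreviation cross :: "int \<Rightarrow> 'k::comm_ring_1 lin" where
  "cross n \<equiv> gen (Cross n)"
abbreviation crossF :: "int \<Rightarrow> 'k::comm_ring_1 lin" where
  "crossF n \<equiv> gen (CrossF n)"
abbreviation cup :: "int \<Rightarrow> 'k::comm_ring_1 lin" where
  "cup n \<equiv> gen (Cup n)"
abbreviation cup' :: "int \<Rightarrow> 'k::comm_ring_1 lin" where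
  "cup' n \<equiv> gen (Cup' n)"
abbreviation cap :: "int \<Rightarrow> 'k::comm_ring_1 lin" where
  "cap n \<equiv> gen (Cap n)"
abbreviation cap' :: "int \<Rightarrow> 'k::comm_ring_1 lin" where
  "cap' n \<equiv> gen (Cap' n)"

text \<open>The vertical composite of a list, its last entry being applied first, on the identity
  \<open>i\<close>.\<close>

definition vlist :: "'k::comm_ring_1 lin \<Rightarrow> 'k lin list \<Rightarrow> 'k lin" where
  "vlist i fs = foldr (\<circ>\<^sub>v) fs i"

definition dots :: "int \<Rightarrow> nat \<Rightarrow> 'k::comm_ring_1 lin" where
  "dots n k = vlist (idE n) (replicate k (dot n))"


subsection \<open>Bubbles\<close>

definition ccw_dots :: "int \<Rightarrow> nat \<Rightarrow> 'k::comm_ring_1 lin" where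
  "ccw_dots n k = cap n \<circ>\<^sub>v (idF (n + 2) \<star> dots n k) \<circ>\<^sub>v cup n"

definition cw_dots :: "int \<Rightarrow> nat \<Rightarrow> 'k::comm_ring_1 lin" where
  "cw_dots n k = cap' n \<circ>\<^sub>v (dots (n - 2) k \<star> idF n) \<circ>\<^sub>v cup' n"

text \<open>The fake bubbles solve \<open>\<Sum>\<^bsub>r+s=k\<^esub> ccw n r \<circ> cw n s = \<delta>\<^bsub>k,0\<^esub>\<close>. A counterclockwise
  bubble of degree \<open>2r\<close>, \<open>r \<ge> 0\<close>, is fake only if \<open>r \<le> n\<close>; then \<open>n \<ge> 0\<close> and the clockwise
  bubbles of positive degree are real, with \<open>s + n - 1 \<ge> 0\<close> dots. Symmetrically for the
  clockwise fake bubbles. Outside this range \<open>ccw_fake\<close> and \<open>cw_fake\<close> are never used.\<close>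

fun ccw_fake :: "int \<Rightarrow> nat \<Rightarrow> 'k::comm_ring_1 lin" where
  "ccw_fake n 0 = idm [] n"
| "ccw_fake n (Suc k) =
    - (\<Sum>r\<le>k. ccw_fake n r \<circ>\<^sub>v cw_dots n (nat (int (Suc k - r) + n - 1)))"

fun cw_fake :: "int \<Rightarrow> nat \<Rightarrow> 'k::comm_ring_1 lin" where
  "cw_fake n 0 = idm [] n"
| "cw_fake n (Suc k) =
    - (\<Sum>s\<le>k. ccw_dots n (nat (int (Suc k - s) - n - 1)) \<circ>\<^sub>v cw_fake n s)"

definition ccw :: "int \<Rightarrow> int \<Rightarrow> 'k::comm_ring_1 lin" where
  "ccw n r = (if r - n - 1 \<ge> 0 then ccw_dots n (nat (r - n - 1))
              else if r < 0 then 0 else ccw_fake n (nat r))"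

definition cw :: "int \<Rightarrow> int \<Rightarrow> 'k::comm_ring_1 lin" where
  "cw n r = (if r + n - 1 \<ge> 0 then cw_dots n (nat (r + n - 1))
             else if r < 0 then 0 else cw_fake n (nat r))"


subsection \<open>Nested cups and caps\<close>

fun ncup :: "nat \<Rightarrow> int \<Rightarrow> 'k::comm_ring_1 lin" where
  "ncup 0 n = idm [] n"
| "ncup (Suc a) n = (idF (n + 2) \<star> ncup a (n + 2) \<star> idE n) \<circ>\<^sub>v cup n"

fun ncup' :: "nat \<Rightarrow> int \<Rightarrow> 'k::comm_ring_1 lin" where
  "ncup' 0 n = idm [] n"
| "ncup' (Suc a) n = (idE (n - 2) \<star> ncup' a (n - 2) \<star> idF n) \<circ>\<^sub>v cup' n"

fun ncap :: "nat \<Rightarrow> int \<Rightarrow> 'k::comm_ring_1 lin" where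
  "ncap 0 n = idm [] n"
| "ncap (Suc a) n = cap n \<circ>\<^sub>v (idF (n + 2) \<star> ncap a (n + 2) \<star> idE n)"

fun ncap' :: "nat \<Rightarrow> int \<Rightarrow> 'k::comm_ring_1 lin" where
  "ncap' 0 n = idm [] n"
| "ncap' (Suc a) n = cap' n \<circ>\<^sub>v (idE (n - 2) \<star> ncap' a (n - 2) \<star> idF n)"


subsection \<open>Relations\<close>

definition sideways :: "int \<Rightarrow> 'k::comm_ring_1 lin" where
  "sideways n = (idm [\<F>, \<E>] n \<star> cap' n) \<circ>\<^sub>v (idF (n + 2) \<star> cross (n - 2) \<star> idF n)
                  \<circ>\<^sub>v (cup n \<star> idm [\<E>, \<F>] n)"

definition sideways' :: "int \<Rightarrow> 'k::comm_ring_1 lin" where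
  "sideways' n = (cap n \<star> idm [\<E>, \<F>] n) \<circ>\<^sub>v (idF (n + 2) \<star> cross (n - 2) \<star> idF n)
                  \<circ>\<^sub>v (idm [\<F>, \<E>] n \<star> cup' n)"

text \<open>The rules from \<open>vassoc\<close> to \<open>interchange\<close> are the axioms of a strict 2-category; the rules
  after them are the defining relations.\<close>

inductive rel :: "'k::comm_ring_1 lin \<Rightarrow> 'k lin \<Rightarrow> bool" where
  vassoc: "wf_diagram (VComp (VComp a b) c) \<Longrightarrow>
    rel (gen (VComp (VComp a b) c)) (gen (VComp a (VComp b c)))"
| vunit_left: "wf_diagram a \<Longrightarrow> rel (gen (VComp (Ident (tgt a) (rwt a)) a)) (gen a)"
| vunit_right: "wf_diagram a \<Longrightarrow> rel (gen (VComp a (Ident (src a) (rwt a)))) (gen a)"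
| hassoc: "wf_diagram (HComp (HComp a b) c) \<Longrightarrow>
    rel (gen (HComp (HComp a b) c)) (gen (HComp a (HComp b c)))"
| hunit_left: "wf_diagram a \<Longrightarrow> rel (gen (HComp (Ident [] (lwt a)) a)) (gen a)"
| hunit_right: "wf_diagram a \<Longrightarrow> rel (gen (HComp a (Ident [] (rwt a)))) (gen a)"
| hident: "rel (gen (HComp (Ident V (n + wt W)) (Ident W n))) (gen (Ident (V @ W) n))"
| interchange: "wf_diagram (HComp (VComp a c) (VComp b d)) \<Longrightarrow>
    rel (gen (VComp (HComp a b) (HComp c d))) (gen (HComp (VComp a c) (VComp b d)))"

| adj1: "rel ((cap' (n + 2) \<star> idE n) \<circ>\<^sub>v (idE n \<star> cup n)) (idE n)"
| adj2: "rel ((idE n \<star> cap n) \<circ>\<^sub>v (cup' (n + 2) \<star> idE n)) (idE n)"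
| adj3: "rel ((idF n \<star> cap' n) \<circ>\<^sub>v (cup (n - 2) \<star> idF n)) (idF n)"
| adj4: "rel ((cap (n - 2) \<star> idF n) \<circ>\<^sub>v (idF n \<star> cup' n)) (idF n)"

| nil: "rel (cross n \<circ>\<^sub>v cross n) 0"
| braid: "rel
    ((cross (n + 2) \<star> idE n) \<circ>\<^sub>v (idE (n + 4) \<star> cross n) \<circ>\<^sub>v (cross (n + 2) \<star> idE n))
    ((idE (n + 4) \<star> cross n) \<circ>\<^sub>v (cross (n + 2) \<star> idE n) \<circ>\<^sub>v (idE (n + 4) \<star> cross n))"
| slide1: "rel (idm [\<E>, \<E>] n)
    (cross n \<circ>\<^sub>v (dot (n + 2) \<star> idE n) - (idE (n + 2) \<star> dot n) \<circ>\<^sub>v cross n)"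
| slide2: "rel (idm [\<E>, \<E>] n)
    ((dot (n + 2) \<star> idE n) \<circ>\<^sub>v cross n - cross n \<circ>\<^sub>v (idE (n + 2) \<star> dot n))"

| dotF1: "rel (dotF n)
    ((idF n \<star> cap' n) \<circ>\<^sub>v (idF n \<star> dot (n - 2) \<star> idF n) \<circ>\<^sub>v (cup (n - 2) \<star> idF n))"
| dotF2: "rel (dotF n)
    ((cap (n - 2) \<star> idF n) \<circ>\<^sub>v (idF n \<star> dot (n - 2) \<star> idF n) \<circ>\<^sub>v (idF n \<star> cup' n))"
| crossF1: "rel (crossF n)
    ((idm [\<F>, \<F>] n \<star> ncap' 2 n) \<circ>\<^sub>v (idm [\<F>, \<F>] n \<star> cross (n - 4) \<star> idm [\<F>, \<F>] n)
       \<circ>\<^sub>v (ncup 2 (n - 4) \<star> idm [\<F>, \<F>] n))"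
| crossF2: "rel (crossF n)
    ((ncap 2 (n - 4) \<star> idm [\<F>, \<F>] n) \<circ>\<^sub>v (idm [\<F>, \<F>] n \<star> cross (n - 4) \<star> idm [\<F>, \<F>] n)
       \<circ>\<^sub>v (idm [\<F>, \<F>] n \<star> ncup' 2 n))"

| ccw_neg: "r < 0 \<Longrightarrow> rel (ccw n r) 0"
| ccw_zero: "rel (ccw n 0) (idm [] n)"
| cw_neg: "r < 0 \<Longrightarrow> rel (cw n r) 0"
| cw_zero: "rel (cw n 0) (idm [] n)"

| curl_right: "rel ((idE n \<star> cap' n) \<circ>\<^sub>v (cross (n - 2) \<star> idF n) \<circ>\<^sub>v (idE n \<star> cup' n))
    (- (\<Sum>(f1, f2) | int f1 + int f2 = - n. dots n f1 \<star> cw n (int f2)))"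
| curl_left: "rel
    ((cap n \<star> idE (n - 2)) \<circ>\<^sub>v (idF (n + 2) \<star> cross (n - 2)) \<circ>\<^sub>v (cup n \<star> idE (n - 2)))
    (\<Sum>(g1, g2) | int g1 + int g2 = n. ccw n (int g2) \<star> dots (n - 2) g1)"

| decomp_EF: "rel (idm [\<E>, \<F>] n)
    (- (sideways' n \<circ>\<^sub>v sideways n) +
      (\<Sum>(f1, f2, f3) | int f1 + int f2 + int f3 = n - 1.
        (dots (n - 2) f1 \<star> idF n) \<circ>\<^sub>v cup' n \<circ>\<^sub>v ccw n (int f2)
          \<circ>\<^sub>v cap' n \<circ>\<^sub>v (dots (n - 2) f3 \<star> idF n)))"
| decomp_FE: "rel (idm [\<F>, \<E>] n)
    (- (sideways n \<circ>\<^sub>v sideways' n) +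
      (\<Sum>(g1, g2, g3) | int g1 + int g2 + int g3 = - n - 1.
        (idF (n + 2) \<star> dots n g1) \<circ>\<^sub>v cup n \<circ>\<^sub>v cw n (int g2)
          \<circ>\<^sub>v cap n \<circ>\<^sub>v (idF (n + 2) \<star> dots n g3)))"

text \<open>The linear combinations that vanish. Composites with incompatible boundaries are harmless:
  every relation is a combination of well-formed diagrams with the same boundary, and a composite
  is well-formed only if its parts are.\<close>

inductive_set null :: "'k::comm_ring_1 lin set" where
  null_rel: "rel f g \<Longrightarrow> f - g \<in> null"
| null_zero: "0 \<in> null"
| null_add: "f \<in> null \<Longrightarrow> g \<in> null \<Longrightarrow> f + g \<in> null"
| null_scal: "f \<in> null \<Longrightarrow> scal c f \<in> null"
| null_vcomp_left: "f \<in> null \<Longrightarrow> f \<circ>\<^sub>v g \<in> null"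
| null_vcomp_right: "g \<in> null \<Longrightarrow> f \<circ>\<^sub>v g \<in> null"
| null_hcomp_left: "f \<in> null \<Longrightarrow> f \<star> g \<in> null"
| null_hcomp_right: "g \<in> null \<Longrightarrow> f \<star> g \<in> null"

lemma null_uminus: "f \<in> null \<Longrightarrow> - f \<in> null"
proof -
  have "- f = scal (- 1) f"
    by (rule poly_mapping_eqI) (simp add: scal_def Poly_Mapping.map.rep_eq when_def)
  then show "f \<in> null \<Longrightarrow> - f \<in> null"
    by (simp add: null_scal)
qed

lemma bilinear_ext_superset:
  assumes "finite A" "finite B" "Poly_Mapping.keys f \<subseteq> A" "Poly_Mapping.keys g \<subseteq> B"
  shows "bilinear_ext C f g = (\<Sum>a\<in>A. \<Sum>b\<in>B.
    Poly_Mapping.single (C a b) (Poly_Mapping.lookup f a * Poly_Mapping.lookup g b))"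
proof -
  have "(\<Sum>b\<in>Poly_Mapping.keys g.
      Poly_Mapping.single (C a b) (Poly_Mapping.lookup f a * Poly_Mapping.lookup g b)) =
    (\<Sum>b\<in>B. Poly_Mapping.single (C a b) (Poly_Mapping.lookup f a * Poly_Mapping.lookup g b))" for a
    by (rule sum.mono_neutral_left) (use assms in \<open>auto simp: in_keys_iff\<close>)
  then show ?thesis
    unfolding bilinear_ext_def
    by simp (rule sum.mono_neutral_left; use assms in \<open>auto simp: in_keys_iff\<close>)
qed

lemma bilinear_ext_diff_left:
  "bilinear_ext C (f - f') g = bilinear_ext C f g - bilinear_ext C f' g"
proof -
  let ?A = "Poly_Mapping.keys f \<union> Poly_Mapping.keys f'"
  let ?B = "Poly_Mapping.keys g"
  have "Poly_Mapping.keys (f - f') \<subseteq> ?A"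
    by (auto simp: in_keys_iff lookup_minus)
  then show ?thesis
    by (subst (1 2 3) bilinear_ext_superset[of ?A ?B])
      (auto simp: lookup_minus left_diff_distrib single_diff sum_subtractf)
qed

lemma bilinear_ext_diff_right:
  "bilinear_ext C f (g - g') = bilinear_ext C f g - bilinear_ext C f g'"
proof -
  let ?B = "Poly_Mapping.keys g \<union> Poly_Mapping.keys g'"
  let ?A = "Poly_Mapping.keys f"
  have "Poly_Mapping.keys (g - g') \<subseteq> ?B"
    by (auto simp: in_keys_iff lookup_minus)
  then show ?thesis
    by (subst (1 2 3) bilinear_ext_superset[of ?A ?B])
      (auto simp: lookup_minus right_diff_distrib single_diff sum_subtractf)
qed

lemma null_diff_comp:
  assumes "f - f' \<in> null" "g - g' \<in> null"
  shows "f \<circ>\<^sub>v g - f' \<circ>\<^sub>v g' \<in> null" and "f \<star> g - f' \<star> g' \<in> null"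
proof -
  have "f \<circ>\<^sub>v g - f' \<circ>\<^sub>v g' = (f - f') \<circ>\<^sub>v g + f' \<circ>\<^sub>v (g - g')"
    by (simp add: vcomp_def bilinear_ext_diff_left bilinear_ext_diff_right)
  then show "f \<circ>\<^sub>v g - f' \<circ>\<^sub>v g' \<in> null"
    by (simp add: assms null_add null_vcomp_left null_vcomp_right)
  have "f \<star> g - f' \<star> g' = (f - f') \<star> g + f' \<star> (g - g')"
    by (simp add: hcomp_def bilinear_ext_diff_left bilinear_ext_diff_right)
  then show "f \<star> g - f' \<star> g' \<in> null"
    by (simp add: assms null_add null_hcomp_left null_hcomp_right)
qed


subsection \<open>2-morphisms\<close>

quotient_type (overloaded) 'k mor = "('k::comm_ring_1) lin" / "\<lambda>f g. f - g \<in> null"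
  morphisms rep_mor cls
proof (rule equivpI)
  show "reflp (\<lambda>f g :: 'k lin. f - g \<in> null)"
    by (simp add: reflp_def null_zero)
  show "symp (\<lambda>f g :: 'k lin. f - g \<in> null)"
    by (metis (no_types, lifting) minus_diff_eq null_uminus sympI)
  show "transp (\<lambda>f g :: 'k lin. f - g \<in> null)"
  proof (rule transpI)
    fix f g h :: "'k lin"
    assume "f - g \<in> null" "g - h \<in> null"
    then have "(f - g) + (g - h) \<in> null"
      by (rule null_add)
    then show "f - h \<in> null"
      by simp
  qed
qed

instantiation mor :: (comm_ring_1) ab_group_add
begin

lift_definition zero_mor :: "'a mor" is 0 .

lift_definition plus_mor :: "'a mor \<Rightarrow> 'a mor \<Rightarrow> 'a mor" is "(+)"
  proof -
  fix f f' g g' :: "'a lin"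
  assume "f - f' \<in> null" "g - g' \<in> null"
  then have "(f - f') + (g - g') \<in> null"
    by (rule null_add)
  then show "(f + g) - (f' + g') \<in> null"
    by (simp add: algebra_simps)
qed

lift_definition uminus_mor :: "'a mor \<Rightarrow> 'a mor" is uminus
proof -
  fix f f' :: "'a lin"
  assume "f - f' \<in> null"
  then have "- (f - f') \<in> null"
    by (rule null_uminus)
  then show "- f - - f' \<in> null"
    by (simp add: algebra_simps)
qed

lift_definition minus_mor :: "'a mor \<Rightarrow> 'a mor \<Rightarrow> 'a mor" is "(-)"
proof -
  fix f f' g g' :: "'a lin"
  assume "f - f' \<in> null" "g - g' \<in> null"
  then have "(f - f') + - (g - g') \<in> null"
    by (intro null_add null_uminus)
  then show "(f - g) - (f' - g') \<in> null"
    by (simp add: algebra_simps)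
qed

instance
  by standard (transfer, simp add: null_zero)+

end

lift_definition mor_vcomp :: "'k::comm_ring_1 mor \<Rightarrow> 'k mor \<Rightarrow> 'k mor" is "(\<circ>\<^sub>v)"
  by (rule null_diff_comp)

lift_definition mor_hcomp :: "'k::comm_ring_1 mor \<Rightarrow> 'k mor \<Rightarrow> 'k mor" is "(\<star>)"
  by (rule null_diff_comp)

text \<open>\<open>Hom_U n W t W' t'\<close> is the module of 2-morphisms from \<open>W 1\<^sub>n{t}\<close> to \<open>W' 1\<^sub>n{t'}\<close>.\<close>

definition Hom_U :: "int \<Rightarrow> word \<Rightarrow> int \<Rightarrow> word \<Rightarrow> int \<Rightarrow> 'k::comm_ring_1 mor set" where
  "Hom_U n W t W' t' = {cls f | f. \<forall>d \<in> Poly_Mapping.keys f.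
     wf_diagram d \<and> rwt d = n \<and> src d = W \<and> tgt d = W' \<and> deg d = t - t'}"

text \<open>The relations being homogeneous, the sum over all shifts \<open>t\<close> that forms the carrier is
  direct. The product of \<open>f : 1\<^sub>n{s} \<rightarrow> 1\<^sub>n\<close> and \<open>g : 1\<^sub>n{t} \<rightarrow> 1\<^sub>n\<close> is
  \<open>f \<circ> g{s} : 1\<^sub>n{s+t} \<rightarrow> 1\<^sub>n\<close>; shifts do not change the underlying 2-morphism.\<close>

definition END_U :: "int \<Rightarrow> 'k::comm_ring_1 mor ring" where
  "END_U n =
    \<lparr>carrier = {(\<Sum>t\<in>T. g t) | T g. finite T \<and> (\<forall>t\<in>T. g t \<in> Hom_U n [] t [] 0)},
     mult = mor_vcomp,
     one = cls (idm [] n),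
     zero = 0,
     add = (+)\<rparr>"


section \<open>Thick bubbles\<close>

text \<open>Strands of \<open>\<E>\<^sup>a 1\<^sub>n\<close> are numbered from the left, starting with \<open>0\<close>, so that the
  variables \<open>x\<^sub>1, \<dots>, x\<^sub>a\<close> of the nilHecke ring become \<open>x\<^sub>0, \<dots>, x\<^bsub>a-1\<^esub>\<close>.\<close>

definition nh_dot :: "int \<Rightarrow> nat \<Rightarrow> nat \<Rightarrow> 'k::comm_ring_1 lin" where
  "nh_dot n a i =
    idm (replicate i \<E>) (n + 2 * (int a - int i)) \<star> dot (n + 2 * (int a - int i - 1))
      \<star> idm (replicate (a - i - 1) \<E>) n"

definition nh_cross :: "int \<Rightarrow> nat \<Rightarrow> nat \<Rightarrow> 'k::comm_ring_1 lin" where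
  "nh_cross n a i =
    idm (replicate i \<E>) (n + 2 * (int a - int i)) \<star> cross (n + 2 * (int a - int i - 2))
      \<star> idm (replicate (a - i - 2) \<E>) n"

definition nh_monomial :: "int \<Rightarrow> nat \<Rightarrow> nat multiset \<Rightarrow> 'k::comm_ring_1 lin" where
  "nh_monomial n a m = vlist (idm (replicate a \<E>) n)
     (concat (map (\<lambda>i. replicate (count m i) (nh_dot n a i)) [0..<a]))"

text \<open>The action of \<open>P(x\<^sub>0, \<dots>, x\<^bsub>a-1\<^esub>)\<close>, i.e. of \<open>P\<close> with all other variables set to \<open>0\<close>.\<close>

definition nh_poly :: "int \<Rightarrow> nat \<Rightarrow> (nat multiset \<Rightarrow> 'k) \<Rightarrow> 'k::comm_ring_1 lin" where
  "nh_poly n a P =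
    (\<Sum>m | set_mset m \<subseteq> {..<a} \<and> P m \<noteq> 0. scal (P m) (nh_monomial n a m))"

text \<open>The action of \<open>\<partial>\<^bsub>w\<^sub>0\<^esub>\<close>, for the reduced expression
  \<open>w\<^sub>0 = s\<^sub>0 (s\<^sub>1 s\<^sub>0) (s\<^sub>2 s\<^sub>1 s\<^sub>0) \<cdots> (s\<^bsub>a-2\<^esub> \<cdots> s\<^sub>0)\<close>.\<close>

definition nh_longest :: "int \<Rightarrow> nat \<Rightarrow> 'k::comm_ring_1 lin" where
  "nh_longest n a = vlist (idm (replicate a \<E>) n)
     (map (nh_cross n a) (concat (map (\<lambda>j. rev [0..<j]) [1..<a])))"

definition nh_idem :: "int \<Rightarrow> nat \<Rightarrow> 'k::comm_ring_1 lin" where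
  "nh_idem n a = nh_monomial n a (\<Sum>i<a. replicate_mset (a - 1 - i) i) \<circ>\<^sub>v nh_longest n a"

definition bubble_det :: "int \<Rightarrow> nat \<Rightarrow> (nat \<Rightarrow> nat \<Rightarrow> 'k::comm_ring_1 lin) \<Rightarrow> 'k lin" where
  "bubble_det n a M =
    (\<Sum>p | p permutes {..<a}.
      scal (of_int (sign p)) (vlist (idm [] n) (map (\<lambda>s. M s (p s)) [0..<a])))"

text \<open>\<open>add_all \<alpha> m\<close> is \<open>\<alpha> + m\<close>; it is only used if all its entries are nonnegative.\<close>

definition add_all :: "nat list \<Rightarrow> int \<Rightarrow> nat list" where
  "add_all \<alpha> m = map (\<lambda>p. nat (int p + m)) \<alpha>"

definition thick_cw :: "int \<Rightarrow> nat \<Rightarrow> nat list \<Rightarrow> 'k::comm_ring_1 lin" where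
  "thick_cw n a \<alpha> =
    (if int (\<alpha> ! (a - 1)) \<ge> int a - n
     then ncap' a n
            \<circ>\<^sub>v ((nh_poly (n - 2 * int a) a (schur (add_all \<alpha> (n - int a)))
                 \<circ>\<^sub>v nh_idem (n - 2 * int a) a) \<star> idm (replicate a \<F>) n)
            \<circ>\<^sub>v ncup' a n
     else scal ((- 1) ^ (a * (a - 1) div 2))
            (bubble_det n a (\<lambda>s t. cw n (int (\<alpha> ! s) - int s + int t))))"

definition thick_ccw :: "int \<Rightarrow> nat \<Rightarrow> nat list \<Rightarrow> 'k::comm_ring_1 lin" where
  "thick_ccw n a \<beta> =
    (if int (\<beta> ! (a - 1)) \<ge> n + int a
     then ncap a n
            \<circ>\<^sub>v (idm (replicate a \<F>) (n + 2 * int a)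
                 \<star> (nh_poly n a (schur (add_all \<beta> (- (n + int a)))) \<circ>\<^sub>v nh_idem n a))
            \<circ>\<^sub>v ncup a n
     else scal ((- 1) ^ (a * (a - 1) div 2))
            (bubble_det n a (\<lambda>s t. ccw n (int (\<beta> ! s) - int s + int t))))"

end

theory Submission
  imports Defs "HOL-Computational_Algebra.Formal_Power_Series"
begin

text \<open>Closing \<open>b\<close> upward strands that carry \<open>x\<^sup>k \<partial>\<^bsub>w\<^sub>0\<^esub>\<close>, one strand after the other, the curl relation, the
  nilHecke relations and the bubble slides produce the Laplace expansion of a determinant of bubbles
  along its last row. So the closure is, up to sign, \<open>det[\<circlearrowright>\<^sub>n(k\<^sub>s - n + 1 + t)]\<close> for every exponent \<open>k\<close>.
  This expression is alternating in \<open>k\<close>, which straightens the product of the Schur polynomial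
  \<open>\<pi>\<^sub>\<gamma>\<close> and \<open>x\<^sup>\<delta>\<close> to the single exponent \<open>\<gamma> + \<delta>\<close>, and the Jacobi--Trudi formula identifies the result. The
  counterclockwise case is the mirror image, with \<open>h\<^sub>r\<close> replaced by \<open>(-1)\<^sup>r \<epsilon>\<^sub>r\<close> and the dual
  Jacobi--Trudi formula.\<close>

section \<open>The graded pieces of the diagram calculus as a ring\<close>

text \<open>The ground ring is arbitrary, so nothing can be divided, and antisymmetry alone does not
  make a value at equal exponents vanish; the alternating arguments carry that vanishing as a second
  property. The presentation makes vertical composition associative only where diagrams are
  composable. Killing the ill-formed diagrams as well gives an honest non-unital ring, and
  homogeneity of the relations shows that no well-formed combination is lost. The recursion in the
  number of strands works because the longest element on one more strand has a reduced word in which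
  exactly one crossing meets the new strand, so closing that strand is a single dotted curl. The
  obstacle is that curls and slides involve fake bubbles. Real clockwise bubbles slide by the
  decomposition of \<open>\<F>\<E>\<close>; the other degrees follow by inverting the slide of the
  counterclockwise bubbles, which is the clockwise slide of the mirror image. The inversion uses the
  infinite Grassmannian relation, obtained by evaluating a figure eight in two ways.\<close>

lemma poly_mapping_additive_induct [case_names zero single add]:
  fixes f :: "'a \<Rightarrow>\<^sub>0 'b::comm_monoid_add"
  assumes "P 0" "\<And>d c. P (Poly_Mapping.single d c)" "\<And>f g. P f \<Longrightarrow> P g \<Longrightarrow> P (f + g)"
  shows "P f"
proof -
  have "f = (\<Sum>d\<in>Poly_Mapping.keys f. Poly_Mapping.single d (Poly_Mapping.lookup f d))"
    by (rule poly_mapping_eqI)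
      (auto simp: lookup_sum lookup_single when_def sum.delta in_keys_iff)
  moreover have "P (\<Sum>d\<in>A. Poly_Mapping.single d (Poly_Mapping.lookup f d))" if "finite A" for A
    using that by (induction A) (auto intro: assms)
  ultimately show ?thesis
    by (metis finite_keys)
qed

lemma bilinear_ext_single:
  "bilinear_ext C (Poly_Mapping.single a x) (Poly_Mapping.single b y) =
    Poly_Mapping.single (C a b) (x * y)"
  by (subst bilinear_ext_superset[of "{a}" "{b}"]) (auto simp: lookup_single)

lemma bilinear_ext_zero [simp]: "bilinear_ext C 0 g = 0" "bilinear_ext C f 0 = 0"
  by (simp_all add: bilinear_ext_def)

lemma bilinear_ext_add_left:
  "bilinear_ext C (f + f') g = bilinear_ext C f g + bilinear_ext C f' g"
proof -
  have "bilinear_ext C (f - (0 - f')) g = bilinear_ext C f g + bilinear_ext C f' g"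
    by (simp only: bilinear_ext_diff_left bilinear_ext_zero) simp
  then show ?thesis
    by simp
qed

lemma bilinear_ext_add_right:
  "bilinear_ext C f (g + g') = bilinear_ext C f g + bilinear_ext C f g'"
proof -
  have "bilinear_ext C f (g - (0 - g')) = bilinear_ext C f g + bilinear_ext C f g'"
    by (simp only: bilinear_ext_diff_right bilinear_ext_zero) simp
  then show ?thesis
    by simp
qed

lemma scal_single: "scal c (Poly_Mapping.single d x) = Poly_Mapping.single d (c * x)"
  by (rule poly_mapping_eqI) (simp add: scal_def Poly_Mapping.map.rep_eq lookup_single when_def)

lemma lookup_scal: "Poly_Mapping.lookup (scal c f) d = c * Poly_Mapping.lookup f d"
  by (simp add: scal_def Poly_Mapping.map.rep_eq when_def)

lemma scal_add: "scal c (f + g) = scal c f + scal c g"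
  by (rule poly_mapping_eqI) (simp add: lookup_scal lookup_add algebra_simps)

lemma scal_diff: "scal c (f - g) = scal c f - scal c g"
  by (rule poly_mapping_eqI) (simp add: lookup_scal lookup_minus algebra_simps)

lemma scal_zero [simp]: "scal c 0 = 0"
  by (rule poly_mapping_eqI) (simp add: lookup_scal)

lemma bilinear_ext_scal_left: "bilinear_ext C (scal c f) g = scal c (bilinear_ext C f g)"
proof (induction f rule: poly_mapping_additive_induct)
  case (single d x)
  show ?case
    by (induction g rule: poly_mapping_additive_induct)
      (simp_all add: scal_single bilinear_ext_single scal_add bilinear_ext_add_right mult.assoc)
qed (simp_all add: scal_add bilinear_ext_add_left)

lemma bilinear_ext_scal_right: "bilinear_ext C f (scal c g) = scal c (bilinear_ext C f g)"
proof (induction g rule: poly_mapping_additive_induct)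
  case (single d x)
  show ?case
    by (induction f rule: poly_mapping_additive_induct)
      (simp_all add: scal_single bilinear_ext_single scal_add bilinear_ext_add_left mult.left_commute)
qed (simp_all add: scal_add bilinear_ext_add_right)

section \<open>Weights and boundaries of linear combinations\<close>

lemma wt_simps [simp]:
  "wt [] = 0" "wt (\<E> # W) = 2 + wt W" "wt (\<F> # W) = wt W - 2" "wt (V @ W) = wt V + wt W"
  "wt (rev W) = wt W" "wt (replicate a \<E>) = 2 * int a" "wt (replicate a \<F>) = - 2 * int a"
proof -
  show "wt (replicate a \<E>) = 2 * int a" "wt (replicate a \<F>) = - 2 * int a"
    by (induction a) (auto simp: wt_def)
qed (auto simp: wt_def)

lemma wf_diagram_wt: "wf_diagram d \<Longrightarrow> wt (src d) = wt (tgt d)"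
  by (induction d) (auto simp: lwt_def)

definition typed :: "int \<Rightarrow> word \<Rightarrow> word \<Rightarrow> 'k::comm_ring_1 lin set" where
  "typed n V W = {f. \<forall>d \<in> Poly_Mapping.keys f. wf_diagram d \<and> rwt d = n \<and> src d = V \<and> tgt d = W}"

lemma typed_zero: "0 \<in> typed n V W"
  by (simp add: typed_def)

lemma typed_add: "f \<in> typed n V W \<Longrightarrow> g \<in> typed n V W \<Longrightarrow> f + g \<in> typed n V W"
  using Poly_Mapping.keys_add[of f g] by (auto simp: typed_def)

lemma typed_uminus: "f \<in> typed n V W \<Longrightarrow> - f \<in> typed n V W"
  by (auto simp: typed_def)

lemma typed_diff: "f \<in> typed n V W \<Longrightarrow> g \<in> typed n V W \<Longrightarrow> f - g \<in> typed n V W"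
  using typed_add[OF _ typed_uminus] by fastforce

lemma typed_scal: "f \<in> typed n V W \<Longrightarrow> scal c f \<in> typed n V W"
  by (auto simp: typed_def in_keys_iff lookup_scal)

lemma typed_sum: "(\<And>i. i \<in> A \<Longrightarrow> f i \<in> typed n V W) \<Longrightarrow> sum f A \<in> typed n V W"
  by (induction A rule: infinite_finite_induct) (auto intro: typed_zero typed_add)

lemma typed_gen:
  "wf_diagram d \<Longrightarrow> rwt d = n \<Longrightarrow> src d = V \<Longrightarrow> tgt d = W \<Longrightarrow> gen d \<in> typed n V W"
  by (auto simp: typed_def gen_def)

lemma keys_bilinear_ext:
  "Poly_Mapping.keys (bilinear_ext C f g) \<subseteq>
    {C a b | a b. a \<in> Poly_Mapping.keys f \<and> b \<in> Poly_Mapping.keys g}"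
  by (force simp: bilinear_ext_def in_keys_iff lookup_sum lookup_single when_def
      elim!: sum.not_neutral_contains_not_neutral split: if_splits)

lemma typed_vcomp: "f \<in> typed n V W \<Longrightarrow> g \<in> typed n U V \<Longrightarrow> f \<circ>\<^sub>v g \<in> typed n U W"
  using keys_bilinear_ext[of VComp f g] unfolding typed_def vcomp_def by fastforce

lemma typed_hcomp:
  "f \<in> typed k V W \<Longrightarrow> g \<in> typed n V' W' \<Longrightarrow> k = n + wt V' \<Longrightarrow> V @ V' = A \<Longrightarrow> W @ W' = B
    \<Longrightarrow> f \<star> g \<in> typed n A B"
  using keys_bilinear_ext[of HComp f g] unfolding typed_def hcomp_def lwt_def
  by (fastforce simp: lwt_def)

lemma typed_vlist:
  "(\<And>f. f \<in> set fs \<Longrightarrow> f \<in> typed n W W) \<Longrightarrow> i \<in> typed n W W \<Longrightarrow> vlist i fs \<in> typed n W W"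
  unfolding vlist_def by (induction fs) (auto intro: typed_vcomp)

lemma typed_idm: "idm W n \<in> typed n W W"
  by (rule typed_gen) auto

lemma typed_gens:
  "dot n \<in> typed n [\<E>] [\<E>]" "dotF n \<in> typed n [\<F>] [\<F>]"
  "cross n \<in> typed n [\<E>, \<E>] [\<E>, \<E>]" "crossF n \<in> typed n [\<F>, \<F>] [\<F>, \<F>]"
  "cup n \<in> typed n [] [\<F>, \<E>]" "cup' n \<in> typed n [] [\<E>, \<F>]"
  "cap n \<in> typed n [\<F>, \<E>] []" "cap' n \<in> typed n [\<E>, \<F>] []"
  by (auto intro!: typed_gen)

lemma typed_dots: "dots n k \<in> typed n [\<E>] [\<E>]"
  unfolding dots_def by (rule typed_vlist) (auto intro: typed_gens typed_idm)

lemma typed_bubbles: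
  "ccw_dots n k \<in> typed n [] []" "cw_dots n k \<in> typed n [] []"
  unfolding ccw_dots_def cw_dots_def
  by (rule typed_vcomp typed_gens typed_hcomp typed_idm typed_dots | simp)+

lemma typed_ccw_fake: "ccw_fake n k \<in> typed n [] []"
proof (induction k rule: less_induct)
  case (less k)
  then show ?case
    by (cases k) (auto intro!: typed_idm typed_sum typed_uminus typed_vcomp typed_bubbles)
qed

lemma typed_cw_fake: "cw_fake n k \<in> typed n [] []"
proof (induction k rule: less_induct)
  case (less k)
  then show ?case
    by (cases k) (auto intro!: typed_idm typed_sum typed_uminus typed_vcomp typed_bubbles)
qed

lemmas typed_fake = typed_ccw_fake typed_cw_fake

lemma typed_ccw_cw: "ccw n r \<in> typed n [] []" "cw n r \<in> typed n [] []"
  by (auto simp: ccw_def cw_def intro: typed_zero typed_bubbles typed_fake)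

lemma typed_ncup: "ncup a n \<in> typed n [] (replicate a \<F> @ replicate a \<E>)"
proof (induction a arbitrary: n)
  case (Suc a)
  show ?case
    by simp (rule typed_vcomp typed_gens typed_hcomp typed_idm Suc refl
      | simp add: replicate_append_same)+
qed (simp add: typed_idm)

lemma typed_ncup': "ncup' a n \<in> typed n [] (replicate a \<E> @ replicate a \<F>)"
proof (induction a arbitrary: n)
  case (Suc a)
  show ?case
    by simp (rule typed_vcomp typed_gens typed_hcomp typed_idm Suc refl
      | simp add: replicate_append_same)+
qed (simp add: typed_idm)

lemma typed_ncap: "ncap a n \<in> typed n (replicate a \<F> @ replicate a \<E>) []"
proof (induction a arbitrary: n)
  case (Suc a)
  show ?case
    by simp (rule typed_vcomp typed_gens typed_hcomp typed_idm Suc refl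
      | simp add: replicate_append_same)+
qed (simp add: typed_idm)

lemma typed_ncap': "ncap' a n \<in> typed n (replicate a \<E> @ replicate a \<F>) []"
proof (induction a arbitrary: n)
  case (Suc a)
  show ?case
    by simp (rule typed_vcomp typed_gens typed_hcomp typed_idm Suc refl
      | simp add: replicate_append_same)+
qed (simp add: typed_idm)


lemmas typed_intros = typed_vcomp typed_hcomp typed_idm typed_gens typed_dots typed_ccw_cw
  typed_zero typed_uminus typed_add typed_diff typed_sum

lemma typed_sideways:
  "sideways n \<in> typed n [\<E>, \<F>] [\<F>, \<E>]" "sideways' n \<in> typed n [\<F>, \<E>] [\<E>, \<F>]"
  unfolding sideways_def sideways'_def by (rule typed_intros refl | simp)+

lemma typed_ncup_2:
  "ncup 2 n \<in> typed n [] [\<F>, \<F>, \<E>, \<E>]" "ncup' 2 n \<in> typed n [] [\<E>, \<E>, \<F>, \<F>]"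
  "ncap 2 n \<in> typed n [\<F>, \<F>, \<E>, \<E>] []" "ncap' 2 n \<in> typed n [\<E>, \<E>, \<F>, \<F>] []"
  using typed_ncup[of 2 n] typed_ncup'[of 2 n] typed_ncap[of 2 n] typed_ncap'[of 2 n]
  by (simp_all add: numeral_2_eq_2)

text \<open>Checked relation by relation. It is the base case for splitting \<open>null\<close> by
  boundary. A zero side, as in \<open>nil\<close> or \<open>cw_neg\<close>, lies in every class and
  so takes the class of the other side.\<close>

lemma rel_typed: "rel f g \<Longrightarrow> \<exists>n V W. f \<in> typed n V W \<and> g \<in> typed n V W"
proof (induction rule: rel.induct)
  case (vassoc a b c)
  then show ?case by (intro exI conjI typed_gen) auto
next
  case (vunit_left a)
  then show ?case by (intro exI conjI typed_gen) auto
next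
  case (vunit_right a)
  then show ?case by (intro exI conjI typed_gen) auto
next
  case (hassoc a b c)
  then show ?case by (intro exI conjI typed_gen) (auto simp: lwt_def)
next
  case (hunit_left a)
  then show ?case by (intro exI conjI typed_gen) (auto simp: lwt_def)
next
  case (hunit_right a)
  then show ?case by (intro exI conjI typed_gen) (auto simp: lwt_def)
next
  case (hident V n W)
  then show ?case by (intro exI conjI typed_gen) (auto simp: lwt_def)
next
  case (interchange a c b d)
  \<comment> \<open>The left side needs the weights to match between the two levels. This holds
    because a well-formed diagram has source and target of equal weight.\<close>
  then show ?case
    using wf_diagram_wt[of b] wf_diagram_wt[of d]
    by (intro exI conjI typed_gen) (auto simp: lwt_def)
next
  case (crossF1 n)
  have "((idm [\<F>, \<F>] n \<star> ncap' 2 n) \<circ>\<^sub>v (idm [\<F>, \<F>] n \<star> cross (n - 4) \<star> idm [\<F>, \<F>] n)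
       \<circ>\<^sub>v (ncup 2 (n - 4) \<star> idm [\<F>, \<F>] n)) \<in> typed n [\<F>, \<F>] [\<F>, \<F>]"
    by (rule typed_intros typed_ncup_2 refl | simp)+
  then show ?case using typed_gens(4) by blast
next
  case (crossF2 n)
  have "((ncap 2 (n - 4) \<star> idm [\<F>, \<F>] n) \<circ>\<^sub>v (idm [\<F>, \<F>] n \<star> cross (n - 4) \<star> idm [\<F>, \<F>] n)
       \<circ>\<^sub>v (idm [\<F>, \<F>] n \<star> ncup' 2 n)) \<in> typed n [\<F>, \<F>] [\<F>, \<F>]"
    by (rule typed_intros typed_ncup_2 refl | simp)+
  then show ?case using typed_gens(4) by blast
next
  case (dotF1 n)
  have "((idF n \<star> cap' n) \<circ>\<^sub>v (idF n \<star> dot (n - 2) \<star> idF n) \<circ>\<^sub>v (cup (n - 2) \<star> idF n))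
    \<in> typed n [\<F>] [\<F>]"
    by (rule typed_intros refl | simp)+
  then show ?case using typed_gens(2) by blast
next
  case (dotF2 n)
  have "((cap (n - 2) \<star> idF n) \<circ>\<^sub>v (idF n \<star> dot (n - 2) \<star> idF n) \<circ>\<^sub>v (idF n \<star> cup' n))
    \<in> typed n [\<F>] [\<F>]"
    by (rule typed_intros refl | simp)+
  then show ?case using typed_gens(2) by blast
next
  case (adj1 n)
  have "((cap' (n + 2) \<star> idE n) \<circ>\<^sub>v (idE n \<star> cup n)) \<in> typed n [\<E>] [\<E>]"
    by (rule typed_intros refl | simp)+
  then show ?case using typed_idm by blast
next
  case (adj2 n)
  have "((idE n \<star> cap n) \<circ>\<^sub>v (cup' (n + 2) \<star> idE n)) \<in> typed n [\<E>] [\<E>]"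
    by (rule typed_intros refl | simp)+
  then show ?case using typed_idm by blast
next
  case (adj3 n)
  have "((idF n \<star> cap' n) \<circ>\<^sub>v (cup (n - 2) \<star> idF n)) \<in> typed n [\<F>] [\<F>]"
    by (rule typed_intros refl | simp)+
  then show ?case using typed_idm by blast
next
  case (adj4 n)
  have "((cap (n - 2) \<star> idF n) \<circ>\<^sub>v (idF n \<star> cup' n)) \<in> typed n [\<F>] [\<F>]"
    by (rule typed_intros refl | simp)+
  then show ?case using typed_idm by blast
next
  case (nil n)
  have "cross n \<circ>\<^sub>v cross n \<in> typed n [\<E>, \<E>] [\<E>, \<E>]"
    by (rule typed_intros refl)+
  then show ?case using typed_zero by blast
next
  case (braid n)
  have "(cross (n + 2) \<star> idE n) \<circ>\<^sub>v (idE (n + 4) \<star> cross n) \<circ>\<^sub>v (cross (n + 2) \<star> idE n)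
      \<in> typed n [\<E>, \<E>, \<E>] [\<E>, \<E>, \<E>]"
    "(idE (n + 4) \<star> cross n) \<circ>\<^sub>v (cross (n + 2) \<star> idE n) \<circ>\<^sub>v (idE (n + 4) \<star> cross n)
      \<in> typed n [\<E>, \<E>, \<E>] [\<E>, \<E>, \<E>]"
    by (rule typed_intros refl | simp)+
  then show ?case by blast
next
  case (slide1 n)
  have "cross n \<circ>\<^sub>v (dot (n + 2) \<star> idE n) - (idE (n + 2) \<star> dot n) \<circ>\<^sub>v cross n
      \<in> typed n [\<E>, \<E>] [\<E>, \<E>]"
    by (rule typed_diff typed_vcomp typed_gens typed_hcomp typed_idm refl | simp)+
  then show ?case using typed_idm by blast
next
  case (slide2 n)
  have "(dot (n + 2) \<star> idE n) \<circ>\<^sub>v cross n - cross n \<circ>\<^sub>v (idE (n + 2) \<star> dot n)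
      \<in> typed n [\<E>, \<E>] [\<E>, \<E>]"
    by (rule typed_diff typed_vcomp typed_gens typed_hcomp typed_idm refl | simp)+
  then show ?case using typed_idm by blast
next
  case (curl_right n)
  have "(idE n \<star> cap' n) \<circ>\<^sub>v (cross (n - 2) \<star> idF n) \<circ>\<^sub>v (idE n \<star> cup' n) \<in> typed n [\<E>] [\<E>]"
    by (rule typed_intros refl | simp)+
  moreover have "- (\<Sum>(f1, f2) | int f1 + int f2 = - n. dots n f1 \<star> cw n (int f2)) \<in> typed n [\<E>] [\<E>]"
  proof -
    have "dots n f1 \<star> cw n (int f2) \<in> typed n [\<E>] [\<E>]" for f1 f2
      by (rule typed_hcomp[OF typed_dots typed_ccw_cw(2)]) auto
    then show ?thesis
      by (intro typed_uminus typed_sum) auto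
  qed
  ultimately show ?case by blast
next
  case (curl_left n)
  have "(cap n \<star> idE (n - 2)) \<circ>\<^sub>v (idF (n + 2) \<star> cross (n - 2)) \<circ>\<^sub>v (cup n \<star> idE (n - 2))
      \<in> typed (n - 2) [\<E>] [\<E>]"
    by (rule typed_intros refl | simp)+
  moreover have "(\<Sum>(g1, g2) | int g1 + int g2 = n. ccw n (int g2) \<star> dots (n - 2) g1)
      \<in> typed (n - 2) [\<E>] [\<E>]"
  proof -
    have "ccw n (int g2) \<star> dots (n - 2) g1 \<in> typed (n - 2) [\<E>] [\<E>]" for g1 g2
      by (rule typed_hcomp[OF typed_ccw_cw(1) typed_dots]) auto
    then show ?thesis
      by (intro typed_sum) auto
  qed
  ultimately show ?case by blast
next
  case (decomp_EF n)
  have "(dots (n - 2) f1 \<star> idF n) \<circ>\<^sub>v cup' n \<circ>\<^sub>v ccw n (int f2)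
      \<circ>\<^sub>v cap' n \<circ>\<^sub>v (dots (n - 2) f3 \<star> idF n) \<in> typed n [\<E>, \<F>] [\<E>, \<F>]" for f1 f2 f3
    by (rule typed_intros refl | simp)+
  then have "- (sideways' n \<circ>\<^sub>v sideways n) +
      (\<Sum>(f1, f2, f3) | int f1 + int f2 + int f3 = n - 1.
        (dots (n - 2) f1 \<star> idF n) \<circ>\<^sub>v cup' n \<circ>\<^sub>v ccw n (int f2)
          \<circ>\<^sub>v cap' n \<circ>\<^sub>v (dots (n - 2) f3 \<star> idF n)) \<in> typed n [\<E>, \<F>] [\<E>, \<F>]"
    by (intro typed_add typed_uminus typed_sum typed_vcomp[OF typed_sideways(2,1)]) auto
  then show ?case using typed_idm by blast
next
  case (decomp_FE n)
  have "(idF (n + 2) \<star> dots n g1) \<circ>\<^sub>v cup n \<circ>\<^sub>v cw n (int g2)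
      \<circ>\<^sub>v cap n \<circ>\<^sub>v (idF (n + 2) \<star> dots n g3) \<in> typed n [\<F>, \<E>] [\<F>, \<E>]" for g1 g2 g3
    by (rule typed_intros refl | simp)+
  then have "- (sideways n \<circ>\<^sub>v sideways' n) +
      (\<Sum>(g1, g2, g3) | int g1 + int g2 + int g3 = - n - 1.
        (idF (n + 2) \<star> dots n g1) \<circ>\<^sub>v cup n \<circ>\<^sub>v cw n (int g2)
          \<circ>\<^sub>v cap n \<circ>\<^sub>v (idF (n + 2) \<star> dots n g3)) \<in> typed n [\<F>, \<E>] [\<F>, \<E>]"
    by (intro typed_add typed_uminus typed_sum typed_vcomp[OF typed_sideways(1,2)]) auto
  then show ?case using typed_idm by blast
next
  case (ccw_neg r n)
  then show ?case using typed_ccw_cw(1) typed_zero by blast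
next
  case (ccw_zero n)
  then show ?case using typed_ccw_cw(1) typed_idm by blast
next
  case (cw_neg r n)
  then show ?case using typed_ccw_cw(2) typed_zero by blast
next
  case (cw_zero n)
  then show ?case using typed_ccw_cw(2) typed_idm by blast
qed

section \<open>Homogeneity of the relations with respect to boundaries\<close>

definition part :: "diagram set \<Rightarrow> 'k::comm_ring_1 lin \<Rightarrow> 'k lin" where
  "part T f = (\<Sum>d \<in> Poly_Mapping.keys f \<inter> T. Poly_Mapping.single d (Poly_Mapping.lookup f d))"

lemma lookup_part:
  "Poly_Mapping.lookup (part T f) d = (if d \<in> T then Poly_Mapping.lookup f d else 0)"
  by (auto simp: part_def lookup_sum lookup_single when_def sum.delta in_keys_iff)

lemma part_simps [simp]:
  "part T 0 = 0" "part T (f + g) = part T f + part T g" "part T (f - g) = part T f - part T g"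
  "part T (scal c f) = scal c (part T f)"
  "part T (Poly_Mapping.single d c) = (if d \<in> T then Poly_Mapping.single d c else 0)"
  by (rule poly_mapping_eqI, simp add: lookup_part lookup_add lookup_minus lookup_scal
      lookup_single when_def; fail)+

definition typeset :: "int \<Rightarrow> word \<Rightarrow> word \<Rightarrow> diagram set" where
  "typeset n V W = {d. wf_diagram d \<and> rwt d = n \<and> src d = V \<and> tgt d = W}"

lemma part_typed:
  assumes "f \<in> typed n V W"
  shows "part (typeset k A B) f = (if k = n \<and> A = V \<and> B = W then f else 0)"
  by (rule poly_mapping_eqI)
    (use assms in \<open>auto simp: lookup_part typed_def typeset_def in_keys_iff\<close>)

text \<open>The ideal of relations is homogeneous for the grading of diagrams by their boundary, with
  one further piece for the ill-formed diagrams.\<close>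

lemma part_null: "f \<in> null \<Longrightarrow> part (typeset n V W) f \<in> null"
proof (induction arbitrary: n V W rule: null.induct)
  case (null_rel f g)
  then obtain k A B where "f \<in> typed k A B" "g \<in> typed k A B"
    using rel_typed by blast
  then show ?case
    using null_rel by (simp add: part_typed null.null_rel null_zero)
next
  case (null_vcomp_left f g)
  show ?case
  proof (induction g rule: poly_mapping_additive_induct)
    case (single d c)
    \<comment> \<open>A well-formed composite determines its inner boundary. Hence projecting a
      composite with a fixed diagram \<open>d\<close> is the same as projecting the other factor to
      one class, or is zero.\<close>
    have "VComp a d \<in> typeset n V W \<longleftrightarrow>
      wf_diagram d \<and> rwt d = n \<and> src d = V \<and> a \<in> typeset n (tgt d) W" for a
      unfolding typeset_def wf_diagram.simps rwt.simps src.simps tgt.simps mem_Collect_eq by metis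
    then have "part (typeset n V W) (f \<circ>\<^sub>v Poly_Mapping.single d c) =
      (if wf_diagram d \<and> rwt d = n \<and> src d = V
       then part (typeset n (tgt d) W) f \<circ>\<^sub>v Poly_Mapping.single d c else 0)"
      unfolding vcomp_def
      by (induction f rule: poly_mapping_additive_induct)
        (simp_all add: bilinear_ext_single bilinear_ext_add_left)
    then show ?case
      using null_vcomp_left.IH by (auto simp: null_zero null.null_vcomp_left)
  qed (simp_all add: vcomp_def null_zero bilinear_ext_add_right null_add)
next
  case (null_vcomp_right f g)
  show ?case
  proof (induction g rule: poly_mapping_additive_induct)
    case (single d c)
    have "VComp d a \<in> typeset n V W \<longleftrightarrow>
      wf_diagram d \<and> rwt d = n \<and> tgt d = W \<and> a \<in> typeset n V (src d)" for a
      unfolding typeset_def wf_diagram.simps rwt.simps src.simps tgt.simps mem_Collect_eq by metis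
    then have "part (typeset n V W) (Poly_Mapping.single d c \<circ>\<^sub>v f) =
      (if wf_diagram d \<and> rwt d = n \<and> tgt d = W
       then Poly_Mapping.single d c \<circ>\<^sub>v part (typeset n V (src d)) f else 0)"
      unfolding vcomp_def
      by (induction f rule: poly_mapping_additive_induct)
        (simp_all add: bilinear_ext_single bilinear_ext_add_right)
    then show ?case
      using null_vcomp_right.IH by (auto simp: null_zero null.null_vcomp_right)
  qed (simp_all add: vcomp_def null_zero bilinear_ext_add_left null_add)
next
  case (null_hcomp_left f g)
  show ?case
  proof (induction g rule: poly_mapping_additive_induct)
    case (single d c)
    \<comment> \<open>The boundary words of \<open>d\<close> can be cut off the end of
      \<open>V\<close> and \<open>W\<close> in at most one way. If they cannot be cut off, no
      composite with \<open>d\<close> lies in the class.\<close>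
    show ?case
    proof (cases "wf_diagram d \<and> rwt d = n \<and> (\<exists>V' W'. V = V' @ src d \<and> W = W' @ tgt d)")
      case True
      then obtain V' W' where VW: "V = V' @ src d" "W = W' @ tgt d"
        by blast
      have "HComp a d \<in> typeset n V W \<longleftrightarrow> a \<in> typeset (lwt d) V' W'" for a
        using True unfolding VW typeset_def by auto
      then have "part (typeset n V W) (f \<star> Poly_Mapping.single d c) =
         part (typeset (lwt d) V' W') f \<star> Poly_Mapping.single d c"
        unfolding hcomp_def
        by (induction f rule: poly_mapping_additive_induct)
          (simp_all add: bilinear_ext_single bilinear_ext_add_left)
      then show ?thesis
        using null_hcomp_left.IH by (auto simp: null_zero null.null_hcomp_left)
    next
      case False
      then have "HComp a d \<notin> typeset n V W" for a
        unfolding typeset_def by force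
      then have "part (typeset n V W) (f \<star> Poly_Mapping.single d c) = 0"
        unfolding hcomp_def
        by (induction f rule: poly_mapping_additive_induct)
          (simp_all add: bilinear_ext_single bilinear_ext_add_left)
      then show ?thesis
        by (simp add: null_zero)
    qed
  qed (simp_all add: hcomp_def null_zero bilinear_ext_add_right null_add)
next
  case (null_hcomp_right f g)
  show ?case
  proof (induction g rule: poly_mapping_additive_induct)
    case (single d c)
    show ?case
    proof (cases "wf_diagram d \<and> (\<exists>V' W'. V = src d @ V' \<and> W = tgt d @ W' \<and> rwt d = n + wt V')")
      case True
      then obtain V' W' where VW: "V = src d @ V'" "W = tgt d @ W'" "rwt d = n + wt V'"
        by blast
      have "HComp d a \<in> typeset n V W \<longleftrightarrow> a \<in> typeset n V' W'" for a
        using True VW(3) unfolding VW(1,2) typeset_def by (auto simp: lwt_def)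
      then have "part (typeset n V W) (Poly_Mapping.single d c \<star> f) =
         Poly_Mapping.single d c \<star> part (typeset n V' W') f"
        unfolding hcomp_def
        by (induction f rule: poly_mapping_additive_induct)
          (simp_all add: bilinear_ext_single bilinear_ext_add_right)
      then show ?thesis
        using null_hcomp_right.IH by (auto simp: null_zero null.null_hcomp_right)
    next
      case False
      then have "HComp d a \<notin> typeset n V W" for a
        unfolding typeset_def by (force simp: lwt_def)
      then have "part (typeset n V W) (Poly_Mapping.single d c \<star> f) = 0"
        unfolding hcomp_def
        by (induction f rule: poly_mapping_additive_induct)
          (simp_all add: bilinear_ext_single bilinear_ext_add_right)
      then show ?thesis
        by (simp add: null_zero)
    qed
  qed (simp_all add: hcomp_def null_zero bilinear_ext_add_left null_add)
qed (simp_all add: null_zero null_add null_scal)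


definition bad :: "'k::comm_ring_1 lin set" where
  "bad = {f. \<exists>g. (\<forall>d \<in> Poly_Mapping.keys g. \<not> wf_diagram d) \<and> f - g \<in> null}"

lemma null_subset_bad: "f \<in> null \<Longrightarrow> f \<in> bad"
  unfolding bad_def by (rule CollectI, rule exI[of _ 0]) auto

lemma ill_formed_bad: "(\<And>d. d \<in> Poly_Mapping.keys f \<Longrightarrow> \<not> wf_diagram d) \<Longrightarrow> f \<in> bad"
  unfolding bad_def by (rule CollectI, rule exI[of _ f]) (auto simp: null_zero)

lemma bad_add: "f \<in> bad \<Longrightarrow> g \<in> bad \<Longrightarrow> f + g \<in> bad"
proof -
  assume "f \<in> bad" "g \<in> bad"
  then obtain f' g' where *: "\<forall>d \<in> Poly_Mapping.keys f'. \<not> wf_diagram d" "f - f' \<in> null"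
    "\<forall>d \<in> Poly_Mapping.keys g'. \<not> wf_diagram d" "g - g' \<in> null"
    by (auto simp: bad_def)
  have "(f - f') + (g - g') \<in> null"
    using * by (intro null_add)
  then have "(f + g) - (f' + g') \<in> null"
    by (simp add: algebra_simps)
  moreover have "\<forall>d \<in> Poly_Mapping.keys (f' + g'). \<not> wf_diagram d"
    using Poly_Mapping.keys_add[of f' g'] * by blast
  ultimately show ?thesis
    unfolding bad_def by blast
qed

lemma bad_scal: "f \<in> bad \<Longrightarrow> scal c f \<in> bad"
proof -
  assume "f \<in> bad"
  then obtain f' where *: "\<forall>d \<in> Poly_Mapping.keys f'. \<not> wf_diagram d" "f - f' \<in> null"
    by (auto simp: bad_def)
  have "\<forall>d \<in> Poly_Mapping.keys (scal c f'). \<not> wf_diagram d"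
    using *(1) by (auto simp: in_keys_iff lookup_scal)
  then show ?thesis
    unfolding bad_def using null_scal[OF *(2), of c] by (auto simp: scal_diff)
qed

lemma bad_uminus: "f \<in> bad \<Longrightarrow> - f \<in> bad"
proof -
  have "- f = scal (- 1) f"
    by (rule poly_mapping_eqI) (simp add: lookup_scal)
  then show "f \<in> bad \<Longrightarrow> - f \<in> bad"
    by (simp add: bad_scal)
qed

lemma bad_diff: "f \<in> bad \<Longrightarrow> g \<in> bad \<Longrightarrow> f - g \<in> bad"
  using bad_add[OF _ bad_uminus] by fastforce

text \<open>A composite with an ill-formed part is ill-formed, so \<open>bad\<close> is a two-sided
  ideal for both compositions.\<close>

lemma bad_bilinear_ext:
  fixes f g :: "'k::comm_ring_1 lin"
  assumes C: "\<And>a b. wf_diagram (C a b) \<Longrightarrow> wf_diagram a \<and> wf_diagram b"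
    and L: "\<And>f g :: 'k lin. f \<in> null \<Longrightarrow> bilinear_ext C f g \<in> null"
    and R: "\<And>f g :: 'k lin. g \<in> null \<Longrightarrow> bilinear_ext C f g \<in> null"
  shows "f \<in> bad \<Longrightarrow> bilinear_ext C f g \<in> bad" "g \<in> bad \<Longrightarrow> bilinear_ext C f g \<in> bad"
proof -
  assume "f \<in> bad"
  then obtain f' where *: "\<forall>d \<in> Poly_Mapping.keys f'. \<not> wf_diagram d" "f - f' \<in> null"
    by (auto simp: bad_def)
  have "\<forall>d \<in> Poly_Mapping.keys (bilinear_ext C f' g). \<not> wf_diagram d"
    using keys_bilinear_ext[of C f' g] * C by blast
  then show "bilinear_ext C f g \<in> bad"
    unfolding bad_def using L[OF *(2), of g] by (auto simp: bilinear_ext_diff_left)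
next
  assume "g \<in> bad"
  then obtain f' where *: "\<forall>d \<in> Poly_Mapping.keys f'. \<not> wf_diagram d" "g - f' \<in> null"
    by (auto simp: bad_def)
  have "\<forall>d \<in> Poly_Mapping.keys (bilinear_ext C f f'). \<not> wf_diagram d"
    using keys_bilinear_ext[of C f f'] * C by blast
  then show "bilinear_ext C f g \<in> bad"
    unfolding bad_def using R[OF *(2), of f] by (auto simp: bilinear_ext_diff_right)
qed

lemma bad_comp:
  assumes "f - f' \<in> bad" "g - g' \<in> bad"
  shows "f \<circ>\<^sub>v g - f' \<circ>\<^sub>v g' \<in> bad" and "f \<star> g - f' \<star> g' \<in> bad"
proof -
  have *: "bilinear_ext C f g - bilinear_ext C f' g' =
      bilinear_ext C (f - f') g + bilinear_ext C f' (g - g')" for C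
    by (simp add: bilinear_ext_diff_left bilinear_ext_diff_right)
  show "f \<circ>\<^sub>v g - f' \<circ>\<^sub>v g' \<in> bad"
    unfolding vcomp_def *
    by (intro bad_add bad_bilinear_ext assms)
      (auto simp: vcomp_def[symmetric] intro: null.intros)
  show "f \<star> g - f' \<star> g' \<in> bad"
    unfolding hcomp_def *
    by (intro bad_add bad_bilinear_ext assms)
      (auto simp: hcomp_def[symmetric] intro: null.intros)
qed

text \<open>Projection to the class of \<open>f\<close> keeps \<open>f\<close>, kills the ill-formed
  summand and preserves \<open>null\<close>. So the passage from \<open>null\<close> to
  \<open>bad\<close> creates no new equation between combinations of a common boundary.\<close>

lemma bad_typed_null:
  assumes "f \<in> bad" "f \<in> typed n V W"
  shows "f \<in> null"
proof -
  obtain g where g: "\<forall>d \<in> Poly_Mapping.keys g. \<not> wf_diagram d" "f - g \<in> null"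
    using assms(1) by (auto simp: bad_def)
  have "part (typeset n V W) g = 0"
    by (rule poly_mapping_eqI) (use g(1) in \<open>auto simp: lookup_part typeset_def in_keys_iff\<close>)
  then show ?thesis
    using part_null[OF g(2), of n V W] part_typed[OF assms(2)] by simp
qed

text \<open>Modulo the ill-formed diagrams, vertical composition is associative without any condition
  on boundaries, so that the 2-morphisms form a non-unital ring.\<close>

quotient_type (overloaded) 'k cell = "('k::comm_ring_1) lin" / "\<lambda>f g. f - g \<in> bad"
  morphisms rep_cell cell
proof (rule equivpI)
  show "reflp (\<lambda>f g :: 'k lin. f - g \<in> bad)"
    by (simp add: reflp_def null_subset_bad null_zero)
  show "symp (\<lambda>f g :: 'k lin. f - g \<in> bad)"
    by (metis (no_types, lifting) minus_diff_eq bad_uminus sympI)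
  show "transp (\<lambda>f g :: 'k lin. f - g \<in> bad)"
  proof (rule transpI)
    fix f g h :: "'k lin"
    assume "f - g \<in> bad" "g - h \<in> bad"
    then have "(f - g) + (g - h) \<in> bad"
      by (rule bad_add)
    then show "f - h \<in> bad"
      by simp
  qed
qed

lemma cell_eq_iff: "cell f = cell g \<longleftrightarrow> f - g \<in> bad"
  by (rule cell.abs_eq_iff)

instantiation cell :: (comm_ring_1) ring
begin

lift_definition zero_cell :: "'a cell" is 0 .

lift_definition plus_cell :: "'a cell \<Rightarrow> 'a cell \<Rightarrow> 'a cell" is "(+)"
proof -
  fix f f' g g' :: "'a lin"
  assume "f - f' \<in> bad" "g - g' \<in> bad"
  then have "(f - f') + (g - g') \<in> bad"
    by (rule bad_add)
  then show "(f + g) - (f' + g') \<in> bad"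
    by (simp add: algebra_simps)
qed

lift_definition uminus_cell :: "'a cell \<Rightarrow> 'a cell" is uminus
proof -
  fix f f' :: "'a lin"
  assume "f - f' \<in> bad"
  then have "- (f - f') \<in> bad"
    by (rule bad_uminus)
  then show "- f - - f' \<in> bad"
    by (simp add: algebra_simps)
qed

lift_definition minus_cell :: "'a cell \<Rightarrow> 'a cell \<Rightarrow> 'a cell" is "(-)"
proof -
  fix f f' g g' :: "'a lin"
  assume "f - f' \<in> bad" "g - g' \<in> bad"
  then have "(f - f') + - (g - g') \<in> bad"
    by (intro bad_add bad_uminus)
  then show "(f - g) - (f' - g') \<in> bad"
    by (simp add: algebra_simps)
qed

lift_definition times_cell :: "'a cell \<Rightarrow> 'a cell \<Rightarrow> 'a cell" is "(\<circ>\<^sub>v)"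
  by (rule bad_comp)

text \<open>By trilinearity three single diagrams suffice. Their two bracketings are either both
  well-formed, where \<open>vassoc\<close> applies, or both ill-formed, where each lies in
  \<open>bad\<close>.\<close>

lemma vcomp_assoc_bad: "((f :: 'a lin) \<circ>\<^sub>v g) \<circ>\<^sub>v h - f \<circ>\<^sub>v g \<circ>\<^sub>v h \<in> bad"
proof (induction f rule: poly_mapping_additive_induct)
  case zero
  then show ?case by (simp add: vcomp_def null_subset_bad null_zero)
next
  case (add f f')
  then show ?case
    using bad_add[OF add] by (simp add: vcomp_def bilinear_ext_add_left algebra_simps)
next
  case f: (single a x)
  show ?case
  proof (induction g rule: poly_mapping_additive_induct)
    case zero
    then show ?case by (simp add: vcomp_def null_subset_bad null_zero)
  next
    case (add g g')
    then show ?case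
      using bad_add[OF add]
      by (simp add: vcomp_def bilinear_ext_add_left bilinear_ext_add_right algebra_simps)
  next
    case g: (single b y)
    show ?case
    proof (induction h rule: poly_mapping_additive_induct)
      case zero
      then show ?case by (simp add: vcomp_def null_subset_bad null_zero)
    next
      case (add h h')
      then show ?case
        using bad_add[OF add] by (simp add: vcomp_def bilinear_ext_add_right algebra_simps)
    next
      case (single c z)
      have "gen (VComp (VComp a b) c) - gen (VComp a (VComp b c)) \<in> bad"
      proof (cases "wf_diagram (VComp (VComp a b) c)")
        case True
        then show ?thesis
          by (intro null_subset_bad null_rel rel.vassoc)
      next
        case False
        then have "\<not> wf_diagram (VComp a (VComp b c))"
          by auto
        with False show ?thesis
          by (intro bad_diff ill_formed_bad) (auto simp: gen_def)
      qed
      from bad_scal[OF this, of "x * y * z"] show ?case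
        by (simp add: vcomp_def bilinear_ext_single scal_diff gen_def scal_single mult.assoc)
    qed
  qed
qed

instance
proof
  fix f g h :: "'a cell"
  show "f * g * h = f * (g * h)"
    by transfer (rule vcomp_assoc_bad)
qed (transfer, simp add: null_subset_bad null_zero vcomp_def bilinear_ext_add_left
    bilinear_ext_add_right algebra_simps)+

end

lift_definition hc :: "'k::comm_ring_1 cell \<Rightarrow> 'k cell \<Rightarrow> 'k cell"  (infixr "\<parallel>" 75) is "(\<star>)"
  by (rule bad_comp)

lift_definition smul :: "'k::comm_ring_1 \<Rightarrow> 'k cell \<Rightarrow> 'k cell" is scal
  by (metis bad_scal scal_diff)

lemma cell_hom:
  "cell 0 = 0" "cell (f + g) = cell f + cell g" "cell (f - g) = cell f - cell g"
  "cell (- f) = - cell f" "cell (f \<circ>\<^sub>v g) = cell f * cell g" "cell (f \<star> g) = cell f \<parallel> cell g"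
  "cell (scal c f) = smul c (cell f)"
  by (simp_all add: zero_cell_def plus_cell.abs_eq minus_cell.abs_eq uminus_cell.abs_eq
      times_cell.abs_eq hc.abs_eq smul.abs_eq)

lemma cell_sum: "cell (sum f A) = (\<Sum>i\<in>A. cell (f i))"
  by (induction A rule: infinite_finite_induct) (simp_all add: cell_hom)

lemma cell_rel: "rel f g \<Longrightarrow> cell f = cell g"
  by (simp add: cell_eq_iff null_rel null_subset_bad)

lemma hc_add: "(f + g) \<parallel> h = f \<parallel> h + g \<parallel> h" "f \<parallel> (g + h) = f \<parallel> g + f \<parallel> h"
  by (transfer, simp add: hcomp_def bilinear_ext_add_left bilinear_ext_add_right
      null_subset_bad null_zero)+

lemma hc_diff: "(f - g) \<parallel> h = f \<parallel> h - g \<parallel> h" "f \<parallel> (g - h) = f \<parallel> g - f \<parallel> h"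
  by (transfer, simp add: hcomp_def bilinear_ext_diff_left bilinear_ext_diff_right
      null_subset_bad null_zero)+

lemma hc_zero [simp]: "0 \<parallel> h = 0" "h \<parallel> 0 = 0"
  using hc_diff(1)[of 0 0 h] hc_diff(2)[of h 0 0] by simp_all

lemma hc_uminus: "(- f) \<parallel> h = - (f \<parallel> h)" "h \<parallel> (- f) = - (h \<parallel> f)"
  using hc_diff(1)[of 0 f h] hc_diff(2)[of h 0 f] by simp_all

lemma smul_add: "smul c (f + g) = smul c f + smul c g" "smul (c + d) f = smul c f + smul d f"
proof -
  show "smul c (f + g) = smul c f + smul c g"
    by transfer (simp add: scal_add null_subset_bad null_zero)
  have "scal (c + d) f = scal c f + scal d f" for f :: "'a lin"
    by (rule poly_mapping_eqI) (simp add: lookup_scal lookup_add algebra_simps)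
  then show "smul (c + d) f = smul c f + smul d f"
    by transfer (simp add: null_subset_bad null_zero)
qed

lemma smul_smul: "smul c (smul d f) = smul (c * d) f" "smul 1 f = f"
proof -
  have "scal c (scal d f) = scal (c * d) f" "scal 1 f = f" for f :: "'a lin"
    by (rule poly_mapping_eqI, simp add: lookup_scal mult.assoc)+
  then show "smul c (smul d f) = smul (c * d) f" "smul 1 f = f"
    by (transfer, simp add: null_subset_bad null_zero)+
qed

lemma smul_zero [simp]: "smul c 0 = 0" "smul 0 f = 0"
  using smul_add(1)[of c 0 0] smul_add(2)[of 0 0 f] by simp_all

lemma smul_uminus: "smul c (- f) = - smul c f" "smul (- c) f = - smul c f"
  using smul_add(1)[of c f "- f"] smul_add(2)[of c "- c" f]
  by (simp_all add: eq_neg_iff_add_eq_0 add.commute)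

lemma smul_mult: "smul c f * g = smul c (f * g)" "f * smul c g = smul c (f * g)"
  "smul c f \<parallel> g = smul c (f \<parallel> g)" "f \<parallel> smul c g = smul c (f \<parallel> g)"
  by (transfer, simp add: vcomp_def hcomp_def bilinear_ext_scal_left bilinear_ext_scal_right
      null_subset_bad null_zero)+

lemma hc_assoc: "(f \<parallel> g) \<parallel> h = f \<parallel> g \<parallel> h"
proof -
  have "(f \<star> g) \<star> h - f \<star> g \<star> h \<in> bad" for f g h :: "'a lin"
  proof (induction f rule: poly_mapping_additive_induct)
    case zero
    then show ?case by (simp add: hcomp_def null_subset_bad null_zero)
  next
    case (add f f')
    then show ?case
      using bad_add[OF add] by (simp add: hcomp_def bilinear_ext_add_left algebra_simps)
  next
    case f: (single a x)
    show ?case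
    proof (induction g rule: poly_mapping_additive_induct)
      case zero
      then show ?case by (simp add: hcomp_def null_subset_bad null_zero)
    next
      case (add g g')
      then show ?case
        using bad_add[OF add]
        by (simp add: hcomp_def bilinear_ext_add_left bilinear_ext_add_right algebra_simps)
    next
      case g: (single b y)
      show ?case
      proof (induction h rule: poly_mapping_additive_induct)
        case zero
        then show ?case by (simp add: hcomp_def null_subset_bad null_zero)
      next
        case (add h h')
        then show ?case
          using bad_add[OF add] by (simp add: hcomp_def bilinear_ext_add_right algebra_simps)
      next
        case (single c z)
        have "gen (HComp (HComp a b) c) - gen (HComp a (HComp b c)) \<in> bad"
        proof (cases "wf_diagram (HComp (HComp a b) c)")
          case True
          then show ?thesis
            by (intro null_subset_bad null_rel rel.hassoc)
        next
          case False
          then have "\<not> wf_diagram (HComp a (HComp b c))"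
            by (auto simp: lwt_def)
          with False show ?thesis
            by (intro bad_diff ill_formed_bad) (auto simp: gen_def)
        qed
        from bad_scal[OF this, of "x * y * z"] show ?case
          by (simp add: hcomp_def bilinear_ext_single scal_diff gen_def scal_single mult.assoc)
      qed
    qed
  qed
  then show ?thesis
    by transfer
qed

section \<open>The pieces of the ring of cells with fixed boundary\<close>

definition hom :: "int \<Rightarrow> word \<Rightarrow> word \<Rightarrow> 'k::comm_ring_1 cell set" where
  "hom n V W = cell ` typed n V W"

lemma cell_in_hom: "f \<in> typed n V W \<Longrightarrow> cell f \<in> hom n V W"
  by (simp add: hom_def)

lemma hom_vcomp: "f \<in> hom n V W \<Longrightarrow> g \<in> hom n U V \<Longrightarrow> f * g \<in> hom n U W"
  by (auto simp: hom_def cell_hom(5)[symmetric] intro!: imageI typed_vcomp)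

lemma hom_hcomp:
  "f \<in> hom k V W \<Longrightarrow> g \<in> hom n V' W' \<Longrightarrow> k = n + wt V' \<Longrightarrow> V @ V' = A \<Longrightarrow> W @ W' = B
    \<Longrightarrow> f \<parallel> g \<in> hom n A B"
  by (auto simp: hom_def cell_hom(6)[symmetric] intro!: imageI typed_hcomp)

lemma hom_zero: "0 \<in> hom n V W"
  using cell_in_hom[OF typed_zero] by (simp add: cell_hom)

lemma hom_add: "f \<in> hom n V W \<Longrightarrow> g \<in> hom n V W \<Longrightarrow> f + g \<in> hom n V W"
  by (auto simp: hom_def cell_hom(2)[symmetric] intro!: imageI typed_add)

lemma hom_uminus: "f \<in> hom n V W \<Longrightarrow> - f \<in> hom n V W"
  by (auto simp: hom_def cell_hom(4)[symmetric] intro!: imageI typed_uminus)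

text \<open>A typed combination equals its own projection. Induction over projections of arbitrary
  combinations never leaves the class, because diagrams outside it are projected to zero.\<close>

lemma typed_induct [consumes 1, case_names zero single add]:
  assumes "f \<in> typed n V W"
    and "P 0" "\<And>d c. d \<in> typeset n V W \<Longrightarrow> P (Poly_Mapping.single d c)"
    and "\<And>f g. P f \<Longrightarrow> P g \<Longrightarrow> P (f + g)"
  shows "P f"
proof -
  have "P (part (typeset n V W) g)" for g
    by (induction g rule: poly_mapping_additive_induct) (auto intro: assms)
  then show ?thesis
    using part_typed[OF assms(1), of n V W] by metis
qed

lemma hom_induct [consumes 1, case_names zero single add]:
  assumes "f \<in> hom n V W"
    and "P 0" "\<And>d c. d \<in> typeset n V W \<Longrightarrow> P (smul c (cell (gen d)))"
    and "\<And>f g. P f \<Longrightarrow> P g \<Longrightarrow> P (f + g)"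
  shows "P f"
proof -
  obtain g where g: "g \<in> typed n V W" "f = cell g"
    using assms(1) by (auto simp: hom_def)
  from g(1) have "P (cell g)"
  proof (induction rule: typed_induct)
    case (single d c)
    then show ?case
      using assms(3)[OF single, of c]
      by (simp add: cell_hom(7)[symmetric] gen_def scal_single)
  qed (auto simp: cell_hom intro: assms)
  then show ?thesis
    by (simp add: g)
qed

definition cid :: "word \<Rightarrow> int \<Rightarrow> 'k::comm_ring_1 cell" where
  "cid W n = cell (idm W n)"

lemma hom_cid: "cid W n \<in> hom n W W"
  by (simp add: cid_def cell_in_hom typed_idm)

lemma vcomp_gen: "gen a \<circ>\<^sub>v gen b = gen (VComp a b)" "gen a \<star> gen b = gen (HComp a b)"
  by (simp_all add: vcomp_def hcomp_def gen_def bilinear_ext_single)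

lemma cid_left:
  fixes f :: "'k::comm_ring_1 cell"
  shows "f \<in> hom n V W \<Longrightarrow> cid W n * f = f"
proof (induction rule: hom_induct)
  case (single d c)
  then have "cell (idm W n \<circ>\<^sub>v gen d) = cell (gen d :: 'k lin)"
    unfolding vcomp_gen using cell_rel[OF rel.vunit_left[of d]] by (auto simp: typeset_def)
  then show ?case
    by (simp add: cell_hom cid_def smul_mult)
qed (simp_all add: distrib_left)

lemma cid_right:
  fixes f :: "'k::comm_ring_1 cell"
  shows "f \<in> hom n V W \<Longrightarrow> f * cid V n = f"
proof (induction rule: hom_induct)
  case (single d c)
  then have "cell (gen d \<circ>\<^sub>v idm V n) = cell (gen d :: 'k lin)"
    unfolding vcomp_gen using cell_rel[OF rel.vunit_right[of d]] by (auto simp: typeset_def)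
  then show ?case
    by (simp add: cell_hom cid_def smul_mult)
qed (simp_all add: distrib_right)

lemma cid_hc_left:
  fixes f :: "'k::comm_ring_1 cell"
  shows "f \<in> hom n V W \<Longrightarrow> k = n + wt V \<Longrightarrow> cid [] k \<parallel> f = f"
proof (induction rule: hom_induct)
  case (single d c)
  then have "cell (idm [] k \<star> gen d) = cell (gen d :: 'k lin)"
    unfolding vcomp_gen using cell_rel[OF rel.hunit_left[of d]] by (auto simp: typeset_def lwt_def)
  then show ?case
    by (simp add: cell_hom cid_def smul_mult)
qed (simp_all add: hc_add)

lemma cid_hc_right:
  fixes f :: "'k::comm_ring_1 cell"
  shows "f \<in> hom n V W \<Longrightarrow> f \<parallel> cid [] n = f"
proof (induction rule: hom_induct)
  case (single d c)
  then have "cell (gen d \<star> idm [] n) = cell (gen d :: 'k lin)"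
    unfolding vcomp_gen using cell_rel[OF rel.hunit_right[of d]] by (auto simp: typeset_def)
  then show ?case
    by (simp add: cell_hom cid_def smul_mult)
qed (simp_all add: hc_add)

lemma cid_hc_cid: "k = n + wt W \<Longrightarrow> cid V k \<parallel> cid W n = cid (V @ W) n"
  using cell_rel[OF rel.hident[of V n W]] by (simp add: cid_def vcomp_gen cell_hom(6)[symmetric])

text \<open>Multilinearity reduces this to four diagrams. The memberships fix where the words are
  cut: the left side by itself compares only concatenated words, while the axiom speaks about
  matching cuts.\<close>

lemma hc_interchange:
  fixes a b c d :: "'k::comm_ring_1 cell"
  assumes a: "a \<in> hom k V2 V3" and c: "c \<in> hom k V1 V2"
    and b: "b \<in> hom n W2 W3" and d: "d \<in> hom n W1 W2" and k: "k = n + wt W1"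
  shows "(a \<parallel> b) * (c \<parallel> d) = (a * c) \<parallel> (b * d)"
  using a
proof (induction rule: hom_induct)
  case A: (single da ca)
  show ?case
    using c
  proof (induction rule: hom_induct)
    case C: (single dc cc)
    show ?case
      using b
    proof (induction rule: hom_induct)
      case B: (single db cb)
      show ?case
        using d
      proof (induction rule: hom_induct)
        case D: (single dd cd)
        have "rel (gen (VComp (HComp da db) (HComp dc dd))) (gen (HComp (VComp da dc) (VComp db dd)) :: 'k lin)"
        proof (rule rel.interchange)
          show "wf_diagram (HComp (VComp da dc) (VComp db dd))"
            using A B C D k by (simp add: typeset_def lwt_def)
        qed
        then show ?case
          by (simp add: smul_mult smul_smul cell_rel cell_hom(5,6)[symmetric] vcomp_gen mult_ac)
      qed (simp_all add: hc_add algebra_simps)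
    qed (simp_all add: hc_add algebra_simps)
  qed (simp_all add: hc_add algebra_simps)
qed (simp_all add: hc_add algebra_simps)

text \<open>The way back from cells to 2-morphisms: the difference is typed and lies in
  \<open>bad\<close>, hence in \<open>null\<close>.\<close>

lemma cls_eq_of_cell_eq:
  assumes "f \<in> typed n V W" "g \<in> typed n V W" "cell f = cell g"
  shows "cls f = cls g"
  using bad_typed_null[OF _ typed_diff[OF assms(1,2)]] assms(3)
  by (simp add: cell_eq_iff mor.abs_eq_iff)

section \<open>The nilHecke relations\<close>

unbundle fps_syntax

text \<open>The sign (-1)^j, acting on a ring without unit in which the power itself cannot be
  formed.\<close>

definition alt :: "nat \<Rightarrow> 'u::group_add \<Rightarrow> 'u" where
  "alt j y = (if even j then y else - y)"

lemma alt_simps [simp]: "alt 0 y = y" "alt (Suc j) y = - alt j y"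
  by (simp_all add: alt_def)

lemma alt_zero [simp]: "alt j 0 = 0"
  by (simp add: alt_def)

lemma alt_mult: "alt j (y * z) = alt j y * (z::'u::ring)" "alt j (y * z) = y * alt j z"
  by (simp_all add: alt_def)

lemma alt_sum: "alt j (sum f A) = (\<Sum>i\<in>A. alt j (f i :: 'u::ab_group_add))"
  by (simp add: alt_def sum_negf)

text \<open>A reduced word of the longest element of the symmetric group on \<open>k\<close>
  letters, in the order chosen for \<open>nh_longest\<close>. Each step appends the descending cycle
  that brings in one more strand.\<close>

fun staircase_word :: "nat \<Rightarrow> nat list" where
  "staircase_word 0 = []"
| "staircase_word (Suc k) = staircase_word k @ rev [0..<k]"

lemma staircase_word_concat: "staircase_word a = concat (map (\<lambda>j. rev [0..<j]) [1..<a])"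
proof (induction a)
  case (Suc a)
  then show ?case by (cases a) simp_all
qed simp

lemma staircase_word_less: "i \<in> set (staircase_word k) \<Longrightarrow> Suc i < k"
  by (induction k) auto

lemma commute_fps_mult_nth:
  assumes "\<And>p. y * F $ p = F $ p * y" "\<And>p. y * K $ p = K $ p * (y::'u::ring)"
  shows "y * (F * K) $ p = (F * K) $ p * y"
proof -
  have "y * (F $ i * K $ j) = F $ i * K $ j * y" for i j
    using assms by (metis mult.assoc)
  then show ?thesis
    by (simp add: fps_mult_nth sum_distrib_left sum_distrib_right)
qed

lemma commute_fps_mult:
  assumes "\<And>p q. F $ p * K $ q = K $ q * (F $ p :: 'u::ring)"
  shows "F * K = K * F"
proof (rule fps_ext)
  fix n
  have "(F * K) $ n = (\<Sum>i=0..n. K $ (n - i) * F $ i)"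
    by (simp add: fps_mult_nth assms)
  also have "\<dots> = (\<Sum>i=0..n. K $ i * F $ (n - i))"
    by (rule sum.reindex_bij_witness[of _ "\<lambda>i. n - i" "\<lambda>i. n - i"]) auto
  finally show "(F * K) $ n = (K * F) $ n"
    by (simp add: fps_mult_nth)
qed

text \<open>The element \<open>e\<close> is the identity of \<open>b\<close> strands. The ambient
  ring of cells contains all boundaries at once and has no unit, so \<open>e\<close> is an
  idempotent that takes the place of 1 in the two dot slides \<open>S_X\<close> and
  \<open>X_S_slide\<close>.\<close>

locale nilhecke =
  fixes b :: nat and X S :: "nat \<Rightarrow> 'u::ring" and e :: 'u
  assumes e_idem: "e * e = e"
    and e_X: "i < b \<Longrightarrow> e * X i = X i" "i < b \<Longrightarrow> X i * e = X i"
    and e_S: "Suc i < b \<Longrightarrow> e * S i = S i" "Suc i < b \<Longrightarrow> S i * e = S i"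
    and X_X: "i < b \<Longrightarrow> j < b \<Longrightarrow> X i * X j = X j * X i"
    and X_S: "j < b \<Longrightarrow> Suc i < b \<Longrightarrow> j \<noteq> i \<Longrightarrow> j \<noteq> Suc i \<Longrightarrow> X j * S i = S i * X j"
    and S_S: "Suc i < j \<Longrightarrow> Suc j < b \<Longrightarrow> S i * S j = S j * S i"
    and S_braid: "Suc (Suc i) < b \<Longrightarrow> S i * S (Suc i) * S i = S (Suc i) * S i * S (Suc i)"
    and S_X: "Suc i < b \<Longrightarrow> S i * X i = X (Suc i) * S i + e"
    and X_S_slide: "Suc i < b \<Longrightarrow> X i * S i = S i * X (Suc i) + e"
    and S_nil: "Suc i < b \<Longrightarrow> S i * S i = 0"
begin

definition Sw :: "nat list \<Rightarrow> 'u" where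
  "Sw ws = foldr (\<lambda>i y. S i * y) ws e"

lemma Sw_simps [simp]: "Sw [] = e" "Sw (i # ws) = S i * Sw ws"
  by (simp_all add: Sw_def)

lemma e_Sw: "(\<And>i. i \<in> set ws \<Longrightarrow> Suc i < b) \<Longrightarrow> e * Sw ws = Sw ws"
  by (cases ws) (simp_all add: e_idem e_S mult.assoc[symmetric])

lemma Sw_e: "Sw ws * e = Sw ws"
  by (induction ws) (simp_all add: e_idem mult.assoc)

lemma Sw_append: "(\<And>i. i \<in> set vs \<Longrightarrow> Suc i < b) \<Longrightarrow> Sw (ws @ vs) = Sw ws * Sw vs"
  by (induction ws) (simp_all add: e_Sw mult.assoc)

lemma S_far: "Suc i < b \<Longrightarrow> Suc j < b \<Longrightarrow> Suc i < j \<or> Suc j < i \<Longrightarrow> S i * S j = S j * S i"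
  using S_S[of i j] S_S[of j i] by auto

lemma Sw_far:
  assumes "\<And>j. j \<in> set ws \<Longrightarrow> Suc j < b \<and> (Suc i < j \<or> Suc j < i)" "Suc i < b"
  shows "S i * Sw ws = Sw ws * S i"
  using assms(1)
proof (induction ws)
  case Nil
  then show ?case by (simp add: e_S assms)
next
  case (Cons j ws)
  then have "S i * S j = S j * S i"
    by (intro S_far assms(2)) auto
  moreover have "S i * Sw ws = Sw ws * S i"
    using Cons by simp
  ultimately show ?case
    by (simp add: mult.assoc[symmetric]) (simp add: mult.assoc)
qed

text \<open>Letters of the cycle above \<open>Suc i\<close> commute with \<open>S i\<close>. At the
  letters \<open>Suc i\<close>, \<open>i\<close> the braid relation applies, and the resulting
  \<open>S (Suc i)\<close> commutes with all lower letters of the cycle.\<close>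

lemma S_cycle:
  assumes "s \<le> i" "Suc i < s + j" "s + j < b"
  shows "S i * Sw (rev [s..<s + j]) = Sw (rev [s..<s + j]) * S (Suc i)"
  using assms
proof (induction j)
  case (Suc j)
  have w: "rev [s..<s + Suc j] = (s + j) # rev [s..<s + j]"
    by simp
  show ?case
  proof (cases "Suc i < s + j")
    case True
    have "S i * S (s + j) = S (s + j) * S i"
      using True Suc.prems by (intro S_far) auto
    moreover have "S i * Sw (rev [s..<s + j]) = Sw (rev [s..<s + j]) * S (Suc i)"
      using True Suc by auto
    ultimately show ?thesis
      unfolding w Sw_simps by (simp add: mult.assoc[symmetric]) (simp add: mult.assoc)
  next
    case False
    then have i: "s + j = Suc i"
      using Suc.prems by auto
    then obtain j' where j: "j = Suc j'" "i = s + j'"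
      using Suc.prems by (cases j) auto
    have w': "rev [s..<s + j] = i # rev [s..<i]"
      using j by simp
    have far: "S (Suc i) * Sw (rev [s..<i]) = Sw (rev [s..<i]) * S (Suc i)"
      using Suc.prems j by (intro Sw_far) auto
    have "S i * S (Suc i) * S i = S (Suc i) * S i * S (Suc i)"
      using Suc.prems j by (intro S_braid) auto
    then have "S i * S (Suc i) * S i * Sw (rev [s..<i]) = S (Suc i) * S i * (S (Suc i) * Sw (rev [s..<i]))"
      by (simp add: mult.assoc)
    then show ?thesis
      unfolding w i w' Sw_simps far using Suc.prems(1) by (simp add: mult.assoc)
  qed
qed auto

definition W :: "nat \<Rightarrow> 'u" where
  "W k = Sw (staircase_word k)"

lemma W_Suc: "k < b \<Longrightarrow> W (Suc k) = W k * Sw (rev [0..<k])"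
  unfolding W_def staircase_word.simps by (rule Sw_append) auto

text \<open>The last cycle ends in \<open>S 0\<close>, which squares to zero. A higher letter passes
  through that cycle, loses one in its index and is annihilated by the longest element on one strand
  fewer.\<close>

lemma W_S: "k \<le> b \<Longrightarrow> Suc i < k \<Longrightarrow> W k * S i = 0"
proof (induction k arbitrary: i)
  case (Suc k)
  show ?case
  proof (cases i)
    case 0
    have "rev [0..<k] = rev [1..<k] @ [0]"
      using Suc.prems by (simp add: upt_conv_Cons)
    moreover have "Sw (rev [1..<k] @ [0]) = Sw (rev [1..<k]) * Sw [0]"
      using Suc.prems by (intro Sw_append) auto
    ultimately have "Sw (rev [0..<k]) * S i = Sw (rev [1..<k]) * (S 0 * S 0)"
      using Suc.prems by (simp add: 0 mult.assoc e_S)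
    then show ?thesis
      using Suc.prems by (simp add: W_Suc S_nil mult.assoc)
  next
    case (Suc i')
    have "Sw (rev [0..<k]) * S (Suc i') = S i' * Sw (rev [0..<k])"
      using S_cycle[of 0 i' k] Suc.prems Suc by simp
    then show ?thesis
      using Suc.prems Suc.IH[of i'] Suc by (simp add: W_Suc mult.assoc) (simp add: mult.assoc[symmetric])
  qed
qed simp

text \<open>The longest element factored with the first strand as the special one, where the
  recursion of \<open>staircase_word\<close> singles out the last. The ascending run is carried
  through the descending cycle by repeated use of \<open>S_cycle\<close>. Reflection reads the
  strands from the other end and needs this second factorisation.\<close>

lemma Sw_shift_staircase:
  assumes "s + Suc k \<le> b"
  shows "Sw (map ((+) s) (staircase_word (Suc k))) =
    Sw (map ((+) (Suc s)) (staircase_word k)) * Sw [s..<s + k]"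
  using assms
proof (induction k)
  case 0
  then show ?case by (simp add: e_idem)
next
  case (Suc k)
  have r: "map ((+) t) (rev [0..<j]) = rev [t..<t + j]" for t j
    by (simp add: rev_map map_add_upt add.commute flip: map_add_upt)
  let ?C = "Sw (rev [s..<s + Suc k])"
  have up: "Sw [s..<s + d] * ?C = ?C * Sw [Suc s..<Suc s + d]" if "d \<le> k" for d
    using that
  proof (induction d)
    case 0
    have "e * ?C = ?C"
      using Suc.prems by (intro e_Sw) auto
    then show ?case
      by (simp only: add_0_right upt_rec[of s s] upt_rec[of "Suc s" "Suc s"] less_irrefl if_False
          Sw_simps Sw_e)
  next
    case (Suc d)
    have 1: "Sw ([s..<s + d] @ [s + d]) = Sw [s..<s + d] * S (s + d)"
      using Suc.prems \<open>s + Suc (Suc k) \<le> b\<close> by (subst Sw_append) (auto simp: e_S)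
    have 2: "Sw ([Suc s..<Suc s + d] @ [Suc (s + d)]) = Sw [Suc s..<Suc s + d] * S (Suc (s + d))"
      using Suc.prems \<open>s + Suc (Suc k) \<le> b\<close> by (subst Sw_append) (auto simp: e_S)
    have 3: "S (s + d) * ?C = ?C * S (Suc (s + d))"
      using Suc.prems \<open>s + Suc (Suc k) \<le> b\<close> by (intro S_cycle) auto
    have "Sw [s..<s + Suc d] * ?C = Sw [s..<s + d] * ?C * S (Suc (s + d))"
      using 1 3 by (simp add: mult.assoc)
    also have "\<dots> = ?C * Sw [Suc s..<Suc s + Suc d]"
      using Suc 2 by (simp add: mult.assoc)
    finally show ?case .
  qed
  have C: "?C = Sw (rev [Suc s..<Suc s + k]) * S s"
  proof -
    have "rev [s..<s + Suc k] = rev [Suc s..<Suc s + k] @ [s]"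
      by (simp add: upt_conv_Cons del: upt_Suc)
    moreover have "Sw (rev [Suc s..<Suc s + k] @ [s]) = Sw (rev [Suc s..<Suc s + k]) * Sw [s]"
      using Suc.prems by (intro Sw_append) auto
    ultimately show ?thesis
      using Suc.prems by (simp add: e_S del: upt_Suc)
  qed
  have "Sw (map ((+) s) (staircase_word (Suc (Suc k)))) =
      Sw (map ((+) s) (staircase_word (Suc k))) * ?C"
    unfolding staircase_word.simps(2)[of "Suc k"] map_append r
    using Suc.prems by (intro Sw_append) auto
  also have "\<dots> = Sw (map ((+) (Suc s)) (staircase_word k)) * ?C * Sw [Suc s..<Suc s + k]"
  proof -
    have "s + Suc k \<le> b"
      using Suc.prems by simp
    from Suc.IH[OF this] up[OF order.refl] show ?thesis
      by (simp only: mult.assoc)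
  qed
  also have "\<dots> = (Sw (map ((+) (Suc s)) (staircase_word k)) * Sw (rev [Suc s..<Suc s + k])) *
      (S s * Sw [Suc s..<Suc s + k])"
    by (simp only: C mult.assoc)
  also have "Sw (map ((+) (Suc s)) (staircase_word k)) * Sw (rev [Suc s..<Suc s + k]) =
      Sw (map ((+) (Suc s)) (staircase_word (Suc k)))"
    unfolding staircase_word.simps map_append r
    using Suc.prems by (intro Sw_append[symmetric]) auto
  also have "S s * Sw [Suc s..<Suc s + k] = Sw [s..<s + Suc k]"
    by (simp add: upt_conv_Cons del: upt_Suc)
  finally show ?case .
qed

lemma Sw_mirror_staircase:
  assumes "s + k \<le> b"
  shows "Sw (map (\<lambda>i. s + k - 2 - i) (staircase_word k)) = Sw (map ((+) s) (staircase_word k))"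
  using assms
proof (induction k arbitrary: s)
  case (Suc k)
  have r: "map (\<lambda>i. s + Suc k - 2 - i) (rev [0..<k]) = [s..<s + k]"
    by (rule nth_equalityI) (auto simp: rev_nth)
  have "map (\<lambda>i. s + Suc k - 2 - i) (staircase_word k) =
      map (\<lambda>i. Suc s + k - 2 - i) (staircase_word k)"
    by (rule map_cong) auto
  then have "Sw (map (\<lambda>i. s + Suc k - 2 - i) (staircase_word (Suc k))) =
      Sw (map (\<lambda>i. Suc s + k - 2 - i) (staircase_word k) @ [s..<s + k])"
    unfolding staircase_word.simps map_append r by (simp only:)
  also have "\<dots> = Sw (map (\<lambda>i. Suc s + k - 2 - i) (staircase_word k)) * Sw [s..<s + k]"
    using Suc.prems by (intro Sw_append) auto
  also have "Sw (map (\<lambda>i. Suc s + k - 2 - i) (staircase_word k)) = Sw (map ((+) (Suc s)) (staircase_word k))"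
    using Suc.prems by (intro Suc.IH) simp
  finally show ?case
    by (simp only: Sw_shift_staircase[OF Suc.prems])
qed simp

text \<open>Numbering the strands from the other end turns crossing \<open>i\<close> into crossing
  \<open>b - 2 - i\<close>. The renumbered word represents the same element, because the longest
  element is stable under this symmetry.\<close>

lemma W_mirror: "Sw (map (\<lambda>i. b - 2 - i) (staircase_word b)) = W b"
proof -
  have "map ((+) 0) ws = ws" for ws :: "nat list"
    by (induction ws) auto
  then show ?thesis
    using Sw_mirror_staircase[of 0 b] by (simp add: W_def)
qed

section \<open>Powers, complete and elementary polynomials in the nilHecke ring\<close>

primrec Xpow :: "nat \<Rightarrow> nat \<Rightarrow> 'u" where
  "Xpow i 0 = e"
| "Xpow i (Suc p) = X i * Xpow i p"

lemma e_Xpow: "i < b \<Longrightarrow> e * Xpow i p = Xpow i p" "Xpow i p * e = Xpow i p"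
proof -
  show "Xpow i p * e = Xpow i p"
    by (induction p) (simp_all add: e_idem mult.assoc)
  show "i < b \<Longrightarrow> e * Xpow i p = Xpow i p"
    by (cases p) (simp_all add: e_idem e_X mult.assoc[symmetric])
qed

lemma Xpow_commute:
  assumes "y * X i = X i * y" "y * e = e * y"
  shows "y * Xpow i p = Xpow i p * y"
proof (induction p)
  case (Suc p)
  have "y * (X i * Xpow i p) = X i * (y * Xpow i p)"
    using assms(1) by (metis mult.assoc)
  then show ?case
    by (simp add: Suc mult.assoc)
qed (simp add: assms)

text \<open>The divided difference of a power, written as a commutation rule: each dot that passes
  the crossing leaves one term, and together they form the complete polynomial of degree
  \<open>p - 1\<close> in the two variables.\<close>

lemma Xpow_S:
  assumes "Suc i < b"
  shows "Xpow (Suc i) p * S i = S i * Xpow i p - (\<Sum>u<p. Xpow i u * Xpow (Suc i) (p - 1 - u))"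
proof (induction p)
  case 0
  show ?case using assms by (simp add: e_S)
next
  case (Suc p)
  have XX: "X (Suc i) * Xpow i u = Xpow i u * X (Suc i)" for u
    using assms by (intro Xpow_commute) (simp_all add: X_X e_X)
  have "Xpow (Suc i) (Suc p) * S i = X (Suc i) * S i * Xpow i p
      - (\<Sum>u<p. Xpow i u * (X (Suc i) * Xpow (Suc i) (p - 1 - u)))"
    by (simp add: Suc mult.assoc right_diff_distrib sum_distrib_left)
      (simp add: mult.assoc[symmetric] XX)
  also have "X (Suc i) * S i * Xpow i p = S i * Xpow i (Suc p) - Xpow i p"
  proof -
    have "X (Suc i) * S i = S i * X i - e"
      using S_X[OF assms] by simp
    then show ?thesis
      using assms by (simp add: left_diff_distrib mult.assoc e_Xpow)
  qed
  also have "(\<Sum>u<p. Xpow i u * (X (Suc i) * Xpow (Suc i) (p - 1 - u))) =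
      (\<Sum>u<p. Xpow i u * Xpow (Suc i) (p - u))"
    by (rule sum.cong) (auto simp flip: Xpow.simps simp: Suc_diff_Suc)
  finally show ?case
    by (simp add: e_Xpow algebra_simps)
qed


text \<open>In a formal variable z, \<open>G i\<close> is the expansion of 1/(1 - X_i z), and
  \<open>L i\<close> is 1 - X_i z, both with \<open>e\<close> in place of 1.\<close>

definition G :: "nat \<Rightarrow> 'u fps" where
  "G i = Abs_fps (Xpow i)"

definition L :: "nat \<Rightarrow> 'u fps" where
  "L i = Abs_fps (\<lambda>p. if p = 0 then e else if p = 1 then - X i else 0)"

lemma G_nth [simp]: "G i $ p = Xpow i p"
  by (simp add: G_def)

lemma L_nth_0 [simp]: "L i $ 0 = e" and L_nth_1 [simp]: "L i $ Suc 0 = - X i"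
  and L_nth_2 [simp]: "L i $ Suc (Suc p) = 0"
  by (simp_all add: L_def)

lemma L_mult_nth: "(L i * F) $ 0 = e * F $ 0" "(L i * F) $ Suc p = e * F $ Suc p - X i * F $ p"
proof -
  have "(L i * F) $ Suc p = e * F $ Suc p + (\<Sum>q = 0..p. L i $ Suc q * F $ (p - q))"
    unfolding fps_mult_nth by (subst sum.atLeast0_atMost_Suc_shift) simp
  also have "(\<Sum>q = 0..p. L i $ Suc q * F $ (p - q)) = (\<Sum>q \<in> {0}. L i $ Suc q * F $ (p - q))"
    by (rule sum.mono_neutral_right) (auto simp: L_def)
  finally show "(L i * F) $ Suc p = e * F $ Suc p - X i * F $ p"
    by simp
qed (simp add: fps_mult_nth)

text \<open>Generating functions of the complete and of the signed elementary polynomials in the last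
  \<open>k\<close> variables.\<close>

primrec Hf :: "nat \<Rightarrow> 'u fps" where
  "Hf 0 = fps_const e"
| "Hf (Suc k) = G (b - Suc k) * Hf k"

primrec Ef :: "nat \<Rightarrow> 'u fps" where
  "Ef 0 = fps_const e"
| "Ef (Suc k) = L (b - Suc k) * Ef k"

lemma Hf_commute:
  assumes "k \<le> b" "\<And>i. b - k \<le> i \<Longrightarrow> i < b \<Longrightarrow> y * X i = X i * y" "y * e = e * y"
  shows "y * Hf k $ p = Hf k $ p * y"
  using assms(1,2)
proof (induction k arbitrary: p)
  case (Suc k)
  then show ?case
    unfolding Hf.simps by (intro commute_fps_mult_nth) (auto intro!: Xpow_commute simp: assms(3))
qed (simp add: assms(3))

lemma L_commute: "y * X i = X i * y \<Longrightarrow> y * e = e * y \<Longrightarrow> y * L i $ p = L i $ p * y"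
  by (simp add: L_def)

lemma Ef_commute:
  assumes "k \<le> b" "\<And>i. b - k \<le> i \<Longrightarrow> i < b \<Longrightarrow> y * X i = X i * y" "y * e = e * y"
  shows "y * Ef k $ p = Ef k $ p * y"
  using assms(1,2)
proof (induction k arbitrary: p)
  case (Suc k)
  then show ?case
    unfolding Ef.simps by (intro commute_fps_mult_nth L_commute) (auto simp: assms(3))
qed (simp add: assms(3))

lemma Hf_e: "k \<le> b \<Longrightarrow> Hf k $ p * e = Hf k $ p" "k \<le> b \<Longrightarrow> e * Hf k $ p = Hf k $ p"
proof -
  show *: "k \<le> b \<Longrightarrow> Hf k $ p * e = Hf k $ p"
    by (induction k arbitrary: p) (simp_all add: e_idem fps_mult_nth sum_distrib_right mult.assoc)
  show "k \<le> b \<Longrightarrow> e * Hf k $ p = Hf k $ p"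
    using Hf_commute[of k e p] * by (simp add: e_X)
qed

text \<open>The crossing commutes with all variables after \<open>Suc i\<close>. Moving it past the
  power of \<open>X (Suc i)\<close> brings it next to \<open>W b\<close>, where it vanishes by
  \<open>W_S\<close>. Only the correction of \<open>Xpow_S\<close> survives; convolved with
  \<open>Hf k\<close> it is a complete polynomial in one more variable and of one degree
  less.\<close>

lemma W_Hf_S:
  assumes "Suc k < b" and i: "i = b - Suc (Suc k)"
  shows "W b * Hf (Suc k) $ p * S i = (if p = 0 then 0 else - (W b * Hf (Suc (Suc k)) $ (p - 1)))"
proof -
  have i1: "b - Suc k = Suc i" and ib: "Suc i < b"
    using assms by auto
  have c: "Hf k $ q * S i = S i * Hf k $ q" for q
    by (rule Hf_commute[symmetric]) (use assms in \<open>auto simp: X_S e_S\<close>)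
  have "W b * Hf (Suc k) $ p * S i = (\<Sum>q=0..p. W b * (Xpow (Suc i) q * S i) * Hf k $ (p - q))"
    by (simp add: fps_mult_nth i1 sum_distrib_right sum_distrib_left mult.assoc c)
  also have "\<dots> = (\<Sum>q=0..p. - (W b * (\<Sum>u<q. Xpow i u * Xpow (Suc i) (q - 1 - u) * Hf k $ (p - q))))"
  proof (rule sum.cong[OF refl])
    fix q
    have "W b * (Xpow (Suc i) q * S i) = - (W b * (\<Sum>u<q. Xpow i u * Xpow (Suc i) (q - 1 - u)))"
      unfolding Xpow_S[OF ib] right_diff_distrib mult.assoc[symmetric, of "W b" "S i"]
        W_S[OF order.refl ib] by simp
    then show "W b * (Xpow (Suc i) q * S i) * Hf k $ (p - q) =
        - (W b * (\<Sum>u<q. Xpow i u * Xpow (Suc i) (q - 1 - u) * Hf k $ (p - q)))"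
      by (simp add: sum_distrib_right mult.assoc)
  qed
  also have "\<dots> = - (W b * (\<Sum>q=0..p. \<Sum>u<q. Xpow i u * Xpow (Suc i) (q - 1 - u) * Hf k $ (p - q)))"
    by (simp add: sum_negf sum_distrib_left)
  finally have 1: "W b * Hf (Suc k) $ p * S i =
      - (W b * (\<Sum>q=0..p. \<Sum>u<q. Xpow i u * Xpow (Suc i) (q - 1 - u) * Hf k $ (p - q)))" .
  show ?thesis
  proof (cases p)
    case (Suc p')
    have "(\<Sum>q=0..p. \<Sum>u<q. Xpow i u * Xpow (Suc i) (q - 1 - u) * Hf k $ (p - q)) =
        (\<Sum>u=0..p'. \<Sum>v=0..p'-u. Xpow i u * Xpow (Suc i) v * Hf k $ (p' - u - v))"
      unfolding sum.Sigma[OF finite_atLeastAtMost ballI[OF finite_lessThan]]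
        sum.Sigma[OF finite_atLeastAtMost ballI[OF finite_atLeastAtMost]]
      by (rule sum.reindex_bij_witness[of _ "\<lambda>(u, v). (Suc (u + v), u)" "\<lambda>(q, u). (u, q - 1 - u)"])
        (auto simp: Suc)
    also have "\<dots> = Hf (Suc (Suc k)) $ p'"
      by (simp add: fps_mult_nth i[symmetric] i1 sum_distrib_left mult.assoc)
    finally show ?thesis
      unfolding 1 by (simp add: Suc del: Hf.simps)
  next
    case 0
    then show ?thesis
      unfolding 1 by simp
  qed
qed

text \<open>Each letter of the descending cycle costs a sign and a degree and adjoins one variable.
  After \<open>d\<close> letters all \<open>b\<close> variables are present, and the value is zero
  if the degree has run out.\<close>

lemma W_Hf_cycle:
  assumes "d < b"
  shows "W b * Hf (b - d) $ p * Sw (rev [0..<d]) =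
    (if p < d then 0 else alt d (W b * Hf b $ (p - d)))"
  using assms
proof (induction d arbitrary: p)
  case 0
  then show ?case by (simp add: mult.assoc Hf_e)
next
  case (Suc d)
  have k: "b - Suc d = Suc (b - Suc (Suc d))" "b - d = Suc (Suc (b - Suc (Suc d)))"
    using Suc.prems by auto
  have "W b * Hf (b - Suc d) $ p * S d = (if p = 0 then 0 else - (W b * Hf (b - d) $ (p - 1)))"
    unfolding k using Suc.prems by (intro W_Hf_S) auto
  then show ?case
    using Suc.prems Suc.IH[of "p - 1"]
    by (cases p) (simp_all add: mult.assoc[symmetric])
qed

lemma W_Xpow_cycle:
  assumes "0 < b"
  shows "W b * Xpow (b - 1) p * Sw (rev [0..<b - 1]) =
    (if p < b - 1 then 0 else alt (b - 1) (W b * Hf b $ (p - (b - 1))))"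
proof -
  have "Hf (b - (b - 1)) $ p = Xpow (b - 1) p"
    using assms by (simp add: e_Xpow)
  then show ?thesis
    using W_Hf_cycle[of "b - 1" p] assms by simp
qed

lemma Ef_e: "k \<le> b \<Longrightarrow> Ef k $ p * e = Ef k $ p" "k \<le> b \<Longrightarrow> e * Ef k $ p = Ef k $ p"
proof -
  show *: "k \<le> b \<Longrightarrow> Ef k $ p * e = Ef k $ p"
    by (induction k arbitrary: p) (simp_all add: e_idem fps_mult_nth sum_distrib_right mult.assoc)
  show "k \<le> b \<Longrightarrow> e * Ef k $ p = Ef k $ p"
    using Ef_commute[of k e p] * by (simp add: e_X)
qed

text \<open>Only the factors of \<open>X i\<close> and \<open>X (Suc i)\<close> fail to commute with
  \<open>S i\<close>, but sum and product of these two variables do commute with it. The bound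
  \<open>b - i \<le> k\<close> says that both factors occur in \<open>Ef k\<close>.\<close>

lemma S_Ef:
  assumes i: "Suc i < b" and k: "b - i \<le> k" "k \<le> b"
  shows "S i * Ef k $ p = Ef k $ p * S i"
  using k
proof (induction k arbitrary: p)
  case (Suc k)
  show ?case
  proof (cases "b - i \<le> k")
    case True
    have c: "S i * X (b - Suc k) = X (b - Suc k) * S i"
      using X_S[of "b - Suc k" i] Suc.prems True i by auto
    show ?thesis
      unfolding Ef.simps
      using True Suc by (intro commute_fps_mult_nth L_commute c) (auto simp: e_S i)
  next
    case False
    then have bk: "b - Suc k = i"
      using Suc.prems i by auto
    then have "k \<noteq> 0"
      using i by (intro notI) simp
    then obtain k' where "k = Suc k'"
      using not0_implies_Suc by blast
    with bk i have k': "k = Suc k'" "b - Suc k' = Suc i"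
      using Suc.prems(2) by linarith+
    have c: "S i * Ef k' $ p = Ef k' $ p * S i" for p
      using Suc.prems k' by (intro Ef_commute) (auto simp: X_S e_S i)
    have d0: "S i * X i = X (Suc i) * S i + e" and d1: "X i * S i = S i * X (Suc i) + e"
      using S_X X_S_slide i by auto
    have XX: "X i * X (Suc i) = X (Suc i) * X i"
      using i by (simp add: X_X)
    have LL: "S i * (L i * L (Suc i)) $ p = (L i * L (Suc i)) $ p * S i" for p
    proof -
      consider "p = 0" | "p = 1" | "p = 2" | q where "p = Suc (Suc (Suc q))"
        by (metis One_nat_def Suc_1 not0_implies_Suc)
      then show ?thesis
      proof cases
        case 1
        then show ?thesis by (simp add: fps_mult_nth e_idem e_S i)
      next
        case 2
        have "S i * (X i + X (Suc i)) = (X i + X (Suc i)) * S i"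
          using d0 d1 by (simp add: algebra_simps)
        then show ?thesis
          using i by (simp add: 2 L_mult_nth e_X algebra_simps)
      next
        case 3
        have "S i * (X i * X (Suc i)) = X (Suc i) * (S i * X (Suc i)) + e * X (Suc i)"
          using d0 by (simp add: mult.assoc[symmetric] distrib_right)
        also have "S i * X (Suc i) = X i * S i - e"
          using d1 by simp
        also have "X (Suc i) * (X i * S i - e) + e * X (Suc i) = X i * X (Suc i) * S i"
          using i XX by (simp add: right_diff_distrib mult.assoc[symmetric] e_X)
        finally show ?thesis
          by (simp add: 3 numeral_2_eq_2 L_mult_nth mult.assoc)
      next
        case 4
        then show ?thesis by (simp add: L_mult_nth)
      qed
    qed
    have "Ef (Suc k) = (L i * L (Suc i)) * Ef k'"
      unfolding Ef.simps bk unfolding k'(1) Ef.simps k'(2) by (simp only: mult.assoc)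
    then show ?thesis
      by (simp only: commute_fps_mult_nth[OF LL c])
  qed
qed (use i in simp)

lemma Sw_Ef: "(\<And>i. i \<in> set ws \<Longrightarrow> Suc i < b) \<Longrightarrow> Sw ws * Ef b $ p = Ef b $ p * Sw ws"
proof (induction ws)
  case (Cons i ws)
  have "S i * Ef b $ p = Ef b $ p * S i"
    using Cons.prems by (intro S_Ef) auto
  then show ?case
    using Cons by (simp add: mult.assoc) (simp add: mult.assoc[symmetric])
qed (simp add: Ef_e)

lemma W_Ef: "W b * Ef b $ p = Ef b $ p * W b"
  unfolding W_def by (rule Sw_Ef) (auto dest: staircase_word_less)

text \<open>The formal part of moving a bubble across all strands. The series \<open>B t\<close>
  will be that of the bubbles with \<open>t\<close> strands on their right. Crossing one strand
  trades a factor \<open>G\<close> for a factor \<open>L\<close>, and factors of different strands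
  commute.\<close>

lemma Hf_eq_Ef:
  assumes "\<And>t. t < b \<Longrightarrow> G (b - Suc t) * B t = L (b - Suc t) * B (Suc t)" "t \<le> b"
  shows "Hf t * B 0 = Ef t * B t"
  using assms(2)
proof (induction t)
  case (Suc t)
  let ?i = "b - Suc t"
  have X: "X ?i * Ef t $ q = Ef t $ q * X ?i" for q
    using Suc.prems by (intro Ef_commute) (auto simp: X_X e_X)
  have ee: "e * Ef t $ q = Ef t $ q * e" for q
    using Ef_e[of t q] Suc.prems by simp
  have GE: "G ?i * Ef t = Ef t * G ?i"
    by (rule commute_fps_mult) (simp, rule Xpow_commute[symmetric]; simp add: X ee)
  have LE: "L ?i * Ef t = Ef t * L ?i"
    by (rule commute_fps_mult) (simp add: L_def X ee)
  have "Hf (Suc t) * B 0 = G ?i * (Hf t * B 0)"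
    by (simp add: mult.assoc)
  also have "\<dots> = Ef t * (G ?i * B t)"
    using Suc by (simp add: mult.assoc[symmetric] GE)
  also have "\<dots> = Ef (Suc t) * B (Suc t)"
    using Suc.prems assms(1)[of t] LE by (simp add: mult.assoc[symmetric])
  finally show ?case .
qed simp

text \<open>Built from the last variable backwards, like \<open>Hf\<close> and \<open>Ef\<close>, so
  that inductions on \<open>t\<close> run in parallel.\<close>

primrec mon :: "(nat \<Rightarrow> nat) \<Rightarrow> nat \<Rightarrow> 'u" where
  "mon k 0 = e"
| "mon k (Suc t) = Xpow (b - Suc t) (k (b - Suc t)) * mon k t"

lemma mon_e: "mon k t * e = mon k t"
  by (induction t) (simp_all add: e_idem mult.assoc)

lemma mon_cong: "(\<And>i. b - t \<le> i \<Longrightarrow> i < b \<Longrightarrow> k i = k' i) \<Longrightarrow> t \<le> b \<Longrightarrow> mon k t = mon k' t"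
  by (induction t) auto

lemma mon_commute:
  assumes "t \<le> b" "\<And>i. b - t \<le> i \<Longrightarrow> i < b \<Longrightarrow> y * X i = X i * y" "y * e = e * y"
  shows "y * mon k t = mon k t * y"
  using assms(1,2)
proof (induction t)
  case (Suc t)
  have "y * Xpow (b - Suc t) p = Xpow (b - Suc t) p * y" for p
    using Suc.prems assms(3) by (intro Xpow_commute) auto
  moreover have "y * mon k t = mon k t * y"
    using Suc by auto
  ultimately show ?case
    unfolding mon.simps by (metis mult.assoc)
qed (simp add: assms(3))

lemma mon_X:
  assumes "t \<le> b" "b - t \<le> i" "i < b"
  shows "mon k t * X i = mon (k(i := Suc (k i))) t"
  using assms
proof (induction t)
  case (Suc t)
  show ?case
  proof (cases "i = b - Suc t")
    case True
    have "mon k t * X i = X i * mon k t"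
      using Suc.prems by (intro mon_commute[symmetric]) (auto simp: X_X e_X)
    moreover have "X i * Xpow i p = Xpow i p * X i" for p
      using Suc.prems by (intro Xpow_commute) (auto simp: e_X)
    moreover have "mon (k(i := Suc (k i))) t = mon k t"
      using Suc.prems True by (intro mon_cong) auto
    moreover have "Xpow i (k i) * mon k t * X i = Xpow i (k i) * X i * mon k t"
      by (simp only: mult.assoc calculation(1))
    ultimately show ?thesis
      using True by (simp add: fun_upd_same del: fun_upd_apply)
  next
    case False
    then have "mon k t * X i = mon (k(i := Suc (k i))) t"
      using Suc by (auto simp del: fun_upd_apply)
    then show ?thesis
      using False by (simp add: mult.assoc fun_upd_other del: fun_upd_apply)
  qed
qed auto

text \<open>Each factor \<open>L i\<close> contributes either \<open>e\<close> or minus one extra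
  \<open>X i\<close>. The set \<open>T\<close> records the variables whose exponent is raised, and
  \<open>j\<close> of them give the sign.\<close>

lemma mon_Ef:
  assumes "t \<le> b"
  shows "mon k b * Ef t $ j =
    alt j (\<Sum>T | T \<subseteq> {b - t..<b} \<and> card T = j. mon (\<lambda>i. k i + of_bool (i \<in> T)) b)"
  using assms
proof (induction t arbitrary: k j)
  case 0
  have "{T. T \<subseteq> {b..<b} \<and> card T = j} = (if j = 0 then {{}} else {})"
    by auto
  then show ?case
    by (simp add: mon_e)
next
  case (Suc t)
  let ?i = "b - Suc t" and ?A = "{b - t..<b}"
  have A: "{?i..<b} = insert ?i ?A" "?i \<notin> ?A"
    using Suc.prems by auto
  show ?case
  proof (cases j)
    case 0
    have "{T. T \<subseteq> {?i..<b} \<and> card T = 0} = {{}}" "{T. T \<subseteq> ?A \<and> card T = 0} = {{}}"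
      by (auto dest: finite_subset)
    then show ?thesis
      using Suc Ef_e(2)[of t 0] by (simp add: 0 L_mult_nth)
  next
    case (Suc j')
    let ?f = "\<lambda>T. mon (\<lambda>i. k i + of_bool (i \<in> T)) b"
    have eq: "{T. T \<subseteq> {?i..<b} \<and> card T = Suc j'} =
        {T. T \<subseteq> ?A \<and> card T = Suc j'} \<union> insert ?i ` {T. T \<subseteq> ?A \<and> card T = j'}" (is "?L = ?R")
    proof
      show "?L \<subseteq> ?R"
      proof
        fix T assume T: "T \<in> ?L"
        show "T \<in> ?R"
        proof (cases "?i \<in> T")
          case True
          then have "T = insert ?i (T - {?i})" "T - {?i} \<subseteq> ?A" "card (T - {?i}) = j'"
            using T A by auto
          then show ?thesis by blast
        qed (use T A in auto)
      qed
      have "finite T \<and> ?i \<notin> T" if "T \<subseteq> ?A" for T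
        using that A(2) finite_subset[of T ?A] by blast
      then show "?R \<subseteq> ?L"
        unfolding A(1) by fastforce
    qed
    have "(\<Sum>T | T \<subseteq> {?i..<b} \<and> card T = Suc j'. ?f T) =
        (\<Sum>T | T \<subseteq> ?A \<and> card T = Suc j'. ?f T) + (\<Sum>T \<in> insert ?i ` {T. T \<subseteq> ?A \<and> card T = j'}. ?f T)"
      unfolding eq using A(2) by (intro sum.union_disjoint) auto
    also have "(\<Sum>T \<in> insert ?i ` {T. T \<subseteq> ?A \<and> card T = j'}. ?f T) =
        (\<Sum>T | T \<subseteq> ?A \<and> card T = j'. ?f (insert ?i T))"
    proof (rule sum.reindex_cong[OF _ refl refl])
      show "inj_on (insert ?i) {T. T \<subseteq> ?A \<and> card T = j'}"
      proof (rule inj_onI)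
        fix T T' assume *: "T \<in> {T. T \<subseteq> ?A \<and> card T = j'}" "T' \<in> {T. T \<subseteq> ?A \<and> card T = j'}"
          and eq: "insert ?i T = insert ?i T'"
        have "?i \<notin> T" "?i \<notin> T'"
          using * A(2) by blast+
        then show "T = T'"
          using eq by (metis insert_ident)
      qed
    qed
    also have "\<dots> = (\<Sum>T | T \<subseteq> ?A \<and> card T = j'.
        mon (\<lambda>i. (k(?i := Suc (k ?i))) i + of_bool (i \<in> T)) b)"
      using A(2) by (intro sum.cong refl mon_cong) auto
    finally have "alt j (\<Sum>T | T \<subseteq> {?i..<b} \<and> card T = j. ?f T) =
        mon k b * Ef t $ j - mon (k(?i := Suc (k ?i))) b * Ef t $ j'"
      using Suc.IH[of k "Suc j'"] Suc.IH[of "k(?i := Suc (k ?i))" j'] Suc.prems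
      by (simp add: Suc alt_def del: fun_upd_apply)
    also have "mon (k(?i := Suc (k ?i))) b = mon k b * X ?i"
      using Suc.prems by (intro mon_X[symmetric]) auto
    also have "mon k b * Ef t $ j - mon k b * X ?i * Ef t $ j' = mon k b * Ef (Suc t) $ j"
      using Suc.prems Ef_e(2)[of t j] by (simp add: Suc L_mult_nth right_diff_distrib mult.assoc)
    finally show ?thesis ..
  qed
qed

end

section \<open>Bubble slides\<close>

text \<open>The locale is instantiated twice: by the diagrams themselves and by their mirror images, in
  which left and right and the signs of all weights are exchanged. Clockwise and counterclockwise
  bubbles trade places, and so do the two curl relations and the two decompositions.\<close>

locale diagram_calculus =
  fixes hc :: "'u::ring \<Rightarrow> 'u \<Rightarrow> 'u"  (infixr "\<odot>" 75)
    and cid :: "word \<Rightarrow> int \<Rightarrow> 'u"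
    and hom :: "int \<Rightarrow> word \<Rightarrow> word \<Rightarrow> 'u set"
    and x cr cu cu' ca ca' :: "int \<Rightarrow> 'u"
    and c cc :: "int \<Rightarrow> int \<Rightarrow> 'u"
    and dts :: "int \<Rightarrow> nat \<Rightarrow> 'u"
  assumes hc_add: "(f + g) \<odot> h = f \<odot> h + g \<odot> h" "f \<odot> (g + h) = f \<odot> g + f \<odot> h"
    and hc_assoc: "(f \<odot> g) \<odot> h = f \<odot> g \<odot> h"
    and hom_zero: "0 \<in> hom n V W"
    and hom_add: "f \<in> hom n V W \<Longrightarrow> g \<in> hom n V W \<Longrightarrow> f + g \<in> hom n V W"
    and hom_uminus: "f \<in> hom n V W \<Longrightarrow> - f \<in> hom n V W"
    and hom_vcomp: "f \<in> hom n V W \<Longrightarrow> g \<in> hom n U V \<Longrightarrow> f * g \<in> hom n U W"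
    and hom_hcomp: "f \<in> hom k V W \<Longrightarrow> g \<in> hom n V' W' \<Longrightarrow> k = n + wt V' \<Longrightarrow> V @ V' = A
      \<Longrightarrow> W @ W' = B \<Longrightarrow> f \<odot> g \<in> hom n A B"
    and hom_cid: "cid W n \<in> hom n W W"
    and cid_left: "f \<in> hom n V W \<Longrightarrow> cid W n * f = f"
    and cid_right: "f \<in> hom n V W \<Longrightarrow> f * cid V n = f"
    and cid_hc_left: "f \<in> hom n V W \<Longrightarrow> k = n + wt V \<Longrightarrow> cid [] k \<odot> f = f"
    and cid_hc_right: "f \<in> hom n V W \<Longrightarrow> f \<odot> cid [] n = f"
    and cid_hc_cid: "k = n + wt W \<Longrightarrow> cid V k \<odot> cid W n = cid (V @ W) n"
    and hc_interchange: "a \<in> hom k V2 V3 \<Longrightarrow> d \<in> hom k V1 V2 \<Longrightarrow> b \<in> hom n W2 W3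
      \<Longrightarrow> e \<in> hom n W1 W2 \<Longrightarrow> k = n + wt W1 \<Longrightarrow> (a \<odot> b) * (d \<odot> e) = (a * d) \<odot> (b * e)"
    and hom_x: "x n \<in> hom n [\<E>] [\<E>]"
    and hom_cr: "cr n \<in> hom n [\<E>, \<E>] [\<E>, \<E>]"
    and hom_cu: "cu n \<in> hom n [] [\<F>, \<E>]" and hom_cu': "cu' n \<in> hom n [] [\<E>, \<F>]"
    and hom_ca: "ca n \<in> hom n [\<F>, \<E>] []" and hom_ca': "ca' n \<in> hom n [\<E>, \<F>] []"
    and hom_c: "c n r \<in> hom n [] []" and hom_cc: "cc n r \<in> hom n [] []"
    and dts_0: "dts n 0 = cid [\<E>] n" and dts_Suc: "dts n (Suc i) = x n * dts n i"
    and adj1: "(ca' (n + 2) \<odot> cid [\<E>] n) * (cid [\<E>] n \<odot> cu n) = cid [\<E>] n"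
    and adj2: "(cid [\<E>] n \<odot> ca n) * (cu' (n + 2) \<odot> cid [\<E>] n) = cid [\<E>] n"
    and cr_nil: "cr n * cr n = 0"
    and cr_braid: "(cr (n + 2) \<odot> cid [\<E>] n) * (cid [\<E>] (n + 4) \<odot> cr n) * (cr (n + 2) \<odot> cid [\<E>] n) =
      (cid [\<E>] (n + 4) \<odot> cr n) * (cr (n + 2) \<odot> cid [\<E>] n) * (cid [\<E>] (n + 4) \<odot> cr n)"
    and slide1: "cid [\<E>, \<E>] n = cr n * (x (n + 2) \<odot> cid [\<E>] n) - (cid [\<E>] (n + 2) \<odot> x n) * cr n"
    and slide2: "cid [\<E>, \<E>] n = (x (n + 2) \<odot> cid [\<E>] n) * cr n - cr n * (cid [\<E>] (n + 2) \<odot> x n)"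
    and c_neg: "r < 0 \<Longrightarrow> c n r = 0" and cc_neg: "r < 0 \<Longrightarrow> cc n r = 0"
    and c_zero: "c n 0 = cid [] n" and cc_zero: "cc n 0 = cid [] n"
    and c_real: "ca' n * (dts (n - 2) i \<odot> cid [\<F>] n) * cu' n = c n (int i - n + 1)"
    and cc_real: "ca n * (cid [\<F>] (n + 2) \<odot> dts n i) * cu n = cc n (int i + n + 1)"
    and curl_right: "(cid [\<E>] n \<odot> ca' n) * (cr (n - 2) \<odot> cid [\<F>] n) * (cid [\<E>] n \<odot> cu' n) =
      - (\<Sum>(f1, f2) | int f1 + int f2 = - n. dts n f1 \<odot> c n (int f2))"
    and curl_left: "(ca n \<odot> cid [\<E>] (n - 2)) * (cid [\<F>] (n + 2) \<odot> cr (n - 2)) * (cu n \<odot> cid [\<E>] (n - 2)) =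
      (\<Sum>(g1, g2) | int g1 + int g2 = n. cc n (int g2) \<odot> dts (n - 2) g1)"
    and decomp_FE: "cid [\<F>, \<E>] n =
      - (((cid [\<F>, \<E>] n \<odot> ca' n) * (cid [\<F>] (n + 2) \<odot> cr (n - 2) \<odot> cid [\<F>] n) * (cu n \<odot> cid [\<E>, \<F>] n))
        * ((ca n \<odot> cid [\<E>, \<F>] n) * (cid [\<F>] (n + 2) \<odot> cr (n - 2) \<odot> cid [\<F>] n) * (cid [\<F>, \<E>] n \<odot> cu' n)))
      + (\<Sum>(g1, g2, g3) | int g1 + int g2 + int g3 = - n - 1.
          (cid [\<F>] (n + 2) \<odot> dts n g1) * cu n * c n (int g2) * ca n * (cid [\<F>] (n + 2) \<odot> dts n g3))"
begin

lemma hom_diff: "f \<in> hom n V W \<Longrightarrow> g \<in> hom n V W \<Longrightarrow> f - g \<in> hom n V W"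
  using hom_add[OF _ hom_uminus] by fastforce

lemma hom_sum: "(\<And>i. i \<in> A \<Longrightarrow> f i \<in> hom n V W) \<Longrightarrow> sum f A \<in> hom n V W"
  by (induction A rule: infinite_finite_induct) (auto intro: hom_zero hom_add)

lemma hc_zero [simp]: "0 \<odot> h = 0" "h \<odot> 0 = 0"
  using hc_add(1)[of 0 0 h] hc_add(2)[of h 0 0] by simp_all

lemma hc_uminus: "(- f) \<odot> h = - (f \<odot> h)" "h \<odot> (- f) = - (h \<odot> f)"
  using hc_add(1)[of f "- f" h] hc_add(2)[of h f "- f"]
  by (simp_all add: eq_neg_iff_add_eq_0 add.commute)

lemma hc_diff: "(f - g) \<odot> h = f \<odot> h - g \<odot> h" "h \<odot> (f - g) = h \<odot> f - h \<odot> g"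
  using hc_add(1)[of f "- g" h] hc_add(2)[of h f "- g"] by (simp_all add: hc_uminus)

lemma hc_sum: "sum f A \<odot> h = (\<Sum>i\<in>A. f i \<odot> h)" "h \<odot> sum f A = (\<Sum>i\<in>A. h \<odot> f i)"
  by (induction A rule: infinite_finite_induct) (simp_all add: hc_add)

lemma hom_dts: "dts n k \<in> hom n [\<E>] [\<E>]"
  by (induction k) (auto simp: dts_0 dts_Suc intro: hom_cid hom_vcomp hom_x)

lemma dts_add: "dts n j * dts n k = dts n (j + k)"
  by (induction j) (simp_all add: dts_0 dts_Suc cid_left[OF hom_dts] mult.assoc)

lemma dts_1: "dts n (Suc 0) = x n"
  by (simp add: dts_0 dts_Suc cid_right[OF hom_x])

lemmas hom_intros = hom_vcomp hom_hcomp hom_cid hom_x hom_cr hom_cu hom_cu' hom_ca hom_ca' hom_c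
  hom_cc hom_dts hom_zero hom_uminus hom_add hom_diff hom_sum

lemma cid_hc_cid_hc: "k = n + wt W \<Longrightarrow> cid V k \<odot> cid W n \<odot> g = cid (V @ W) n \<odot> g"
  by (simp add: hc_assoc[symmetric] cid_hc_cid)

lemma cid_idem: "cid V n * cid V n = cid V n"
  by (rule cid_left[OF hom_cid])

section \<open>Whiskering, and sliding of pieces that do not touch\<close>

lemma whisker_left:
  assumes "f \<in> hom n V W" "g \<in> hom n U V" "k = n + wt U"
  shows "(cid A k \<odot> f) * (cid A k \<odot> g) = cid A k \<odot> (f * g)"
  using hc_interchange[OF hom_cid hom_cid assms] by (simp add: cid_idem)

lemma whisker_right:
  assumes "f \<in> hom k V W" "g \<in> hom k U V" "k = n + wt A"
  shows "(f \<odot> cid A n) * (g \<odot> cid A n) = (f * g) \<odot> cid A n"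
  using hc_interchange[OF assms(1,2) hom_cid hom_cid assms(3)] by (simp add: cid_idem)

lemma hc_split:
  assumes "f \<in> hom k V W" "g \<in> hom n V' W'" "k = n + wt V'"
  shows "(f \<odot> cid W' n) * (cid V k \<odot> g) = f \<odot> g" "(cid W k \<odot> g) * (f \<odot> cid V' n) = f \<odot> g"
  using hc_interchange[OF assms(1) hom_cid hom_cid assms(2,3)]
    hc_interchange[OF hom_cid assms(1,2) hom_cid assms(3)]
  by (simp_all add: cid_left[OF assms(1)] cid_left[OF assms(2)] cid_right[OF assms(1)]
      cid_right[OF assms(2)])

lemma cap_left_slide:
  assumes "f \<in> hom k V []" "g \<in> hom n V' W'" "k = n + wt V'"
  shows "(f \<odot> cid W' n) * (cid V k \<odot> g) = g * (f \<odot> cid V' n)"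
  using hc_split[OF assms] cid_hc_left[OF assms(2,3)] by simp

lemma cup_left_slide:
  assumes "f \<in> hom k [] W" "g \<in> hom n V' W'" "k = n + wt V'"
  shows "(cid W k \<odot> g) * (f \<odot> cid V' n) = (f \<odot> cid W' n) * g"
  using hc_split[OF assms] cid_hc_left[OF assms(2,3)] by simp

lemma cap_right_slide:
  assumes "f \<in> hom k V W" "g \<in> hom n V' []" "k = n + wt V'" "k = n"
  shows "(cid W k \<odot> g) * (f \<odot> cid V' n) = f * (cid V k \<odot> g)"
  using hc_split[OF assms(1-3)] cid_hc_right[of f k V W] assms by simp

lemma cup_right_slide:
  assumes "f \<in> hom n V W" "g \<in> hom n [] W'"
  shows "(f \<odot> cid W' n) * (cid V n \<odot> g) = (cid W n \<odot> g) * f"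
  using hc_split[OF assms] cid_hc_right[OF assms(1)] assms by simp

lemma sum_pairs:
  fixes K :: int and g :: "nat \<Rightarrow> nat \<Rightarrow> 'b::comm_monoid_add"
  shows "(\<Sum>(f1, f2) | int f1 + int f2 = K. g f1 f2) = (\<Sum>f<nat (K + 1). g (nat (K - int f)) f)"
  by (rule sum.reindex_bij_witness[of _ "\<lambda>f. (nat (K - int f), f)" snd]) auto

text \<open>\<open>slide1\<close> iterated: every dot that passes the crossing also leaves the two
  strands uncrossed, with the remaining dots distributed over both.\<close>

lemma slide_dots:
  "(cid [\<E>] (n + 2) \<odot> dts n q) * cr n =
    cr n * (dts (n + 2) q \<odot> cid [\<E>] n) - (\<Sum>i<q. dts (n + 2) i \<odot> dts n (q - 1 - i))"
proof (induction q)
  case 0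
  show ?case
    by (simp add: dts_0 cid_hc_cid cid_left[OF hom_cr] cid_right[OF hom_cr])
next
  case (Suc q)
  have *: "cid [\<E>] (n + 2) \<odot> dts n (Suc q) = (cid [\<E>] (n + 2) \<odot> x n) * (cid [\<E>] (n + 2) \<odot> dts n q)"
    unfolding dts_Suc by (rule whisker_left[symmetric, OF hom_x hom_dts]) simp
  have sl: "(cid [\<E>] (n + 2) \<odot> x n) * cr n = cr n * (x (n + 2) \<odot> cid [\<E>] n) - cid [\<E>, \<E>] n"
    using slide1[of n] by (simp add: algebra_simps)
  have hd: "dts (n + 2) q \<odot> cid [\<E>] n \<in> hom n [\<E>, \<E>] [\<E>, \<E>]"
    by (rule hom_intros refl | simp)+
  have 1: "(cid [\<E>] (n + 2) \<odot> x n) * (dts (n + 2) i \<odot> dts n j) = dts (n + 2) i \<odot> dts n (Suc j)" for i j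
  proof -
    have "(cid [\<E>] (n + 2) \<odot> x n) * (dts (n + 2) i \<odot> dts n j) =
        (cid [\<E>] (n + 2) * dts (n + 2) i) \<odot> (x n * dts n j)"
      by (rule hc_interchange[OF hom_cid hom_dts hom_x hom_dts]) simp
    then show ?thesis
      by (simp add: cid_left[OF hom_dts] dts_Suc)
  qed
  have "(cid [\<E>] (n + 2) \<odot> dts n (Suc q)) * cr n =
    (cid [\<E>] (n + 2) \<odot> x n) * cr n * (dts (n + 2) q \<odot> cid [\<E>] n)
      - (\<Sum>i<q. dts (n + 2) i \<odot> dts n (Suc (q - 1 - i)))"
    by (simp add: * mult.assoc Suc right_diff_distrib sum_distrib_left 1)
  also have "(\<Sum>i<q. dts (n + 2) i \<odot> dts n (Suc (q - 1 - i))) =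
     (\<Sum>i<Suc q. dts (n + 2) i \<odot> dts n (q - i)) - dts (n + 2) q \<odot> cid [\<E>] n"
    by (simp add: dts_0) (rule sum.cong; auto simp: Suc_diff_Suc)
  also have "(cid [\<E>] (n + 2) \<odot> x n) * cr n * (dts (n + 2) q \<odot> cid [\<E>] n) =
      cr n * (dts (n + 2) (Suc q) \<odot> cid [\<E>] n) - dts (n + 2) q \<odot> cid [\<E>] n"
    unfolding sl left_diff_distrib cid_left[OF hd] mult.assoc
    by (subst whisker_right[OF hom_x hom_dts]) (simp_all add: dts_Suc)
  finally show ?case
    by (simp del: sum.lessThan_Suc)
qed

lemma c_dots_closure:
  "(cid [\<E>] n \<odot> ca' n) * ((dts n i \<odot> dts (n - 2) j) \<odot> cid [\<F>] n) * (cid [\<E>] n \<odot> cu' n) =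
    dts n i \<odot> c n (int j - n + 1)"
proof -
  have h: "dts (n - 2) j \<odot> cid [\<F>] n \<in> hom n [\<E>, \<F>] [\<E>, \<F>]"
    by (rule hom_intros refl | simp)+
  have h': "(dts (n - 2) j \<odot> cid [\<F>] n) * cu' n \<in> hom n [] [\<E>, \<F>]"
    by (rule hom_vcomp[OF h hom_cu'])
  have "(dts n i \<odot> (dts (n - 2) j \<odot> cid [\<F>] n)) * (cid [\<E>] n \<odot> cu' n) =
      dts n i \<odot> ((dts (n - 2) j \<odot> cid [\<F>] n) * cu' n)"
    by (subst hc_interchange[OF hom_dts hom_cid h hom_cu']) (simp_all add: cid_right[OF hom_dts])
  moreover have "(cid [\<E>] n \<odot> ca' n) * (dts n i \<odot> ((dts (n - 2) j \<odot> cid [\<F>] n) * cu' n)) =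
      dts n i \<odot> (ca' n * ((dts (n - 2) j \<odot> cid [\<F>] n) * cu' n))"
    by (subst hc_interchange[OF hom_cid hom_dts hom_ca' h']) (simp_all add: cid_left[OF hom_dts])
  ultimately show ?thesis
    using c_real[of n j] by (simp add: mult.assoc hc_assoc)
qed

text \<open>After the dots have slid to the open strand, the main term is the plain curl with
  \<open>q\<close> more dots, whose bubbles have degree at most \<open>- n\<close>. The correction
  terms are uncrossed strands, and their closures are bubbles of degree above \<open>- n\<close>.
  The two ranges join to one sum over all degrees up to \<open>q - n\<close>.\<close>

lemma dotted_curl:
  "(cid [\<E>] n \<odot> ca' n) * (((cid [\<E>] n \<odot> dts (n - 2) q) * cr (n - 2)) \<odot> cid [\<F>] n) * (cid [\<E>] n \<odot> cu' n) =
    - (\<Sum>f<nat (int q - n + 1). dts n (nat (int q - n - int f)) \<odot> c n (int f))"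
proof -
  have h1: "dts n q \<odot> cid [\<E>] (n - 2) \<in> hom (n - 2) [\<E>, \<E>] [\<E>, \<E>]"
    by (rule hom_intros refl | simp)+
  have c1: "(cr (n - 2) * (dts n q \<odot> cid [\<E>] (n - 2))) \<odot> cid [\<F>] n =
      (cr (n - 2) \<odot> cid [\<F>] n) * (dts n q \<odot> cid [\<E>, \<F>] n)"
    using whisker_right[OF hom_cr h1, of n "[\<F>]"] by (simp add: hc_assoc cid_hc_cid)
  have c2: "(dts n q \<odot> cid [\<E>, \<F>] n) * (cid [\<E>] n \<odot> cu' n) = (cid [\<E>] n \<odot> cu' n) * dts n q"
    by (rule cup_right_slide[OF hom_dts hom_cu'])
  have c3: "(dts n j \<odot> c n r) * dts n q = dts n (j + q) \<odot> c n r" for j r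
  proof -
    have "(dts n j \<odot> c n r) * (dts n q \<odot> cid [] n) = (dts n j * dts n q) \<odot> (c n r * cid [] n)"
      by (rule hc_interchange[OF hom_dts hom_dts hom_c hom_cid]) simp
    then show ?thesis
      by (simp add: cid_hc_right[OF hom_dts] cid_right[OF hom_c] dts_add)
  qed
  have "(cid [\<E>] n \<odot> ca' n) * ((cr (n - 2) * (dts n q \<odot> cid [\<E>] (n - 2))) \<odot> cid [\<F>] n) * (cid [\<E>] n \<odot> cu' n) =
      ((cid [\<E>] n \<odot> ca' n) * (cr (n - 2) \<odot> cid [\<F>] n) * (cid [\<E>] n \<odot> cu' n)) * dts n q"
    by (simp only: c1 c2 mult.assoc)
  also have "\<dots> = - (\<Sum>f<nat (1 - n). dts n (nat (- n - int f) + q) \<odot> c n (int f))"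
    unfolding curl_right sum_pairs by (simp add: sum_distrib_right c3)
  finally have A: "(cid [\<E>] n \<odot> ca' n) * ((cr (n - 2) * (dts n q \<odot> cid [\<E>] (n - 2))) \<odot> cid [\<F>] n)
      * (cid [\<E>] n \<odot> cu' n) = - (\<Sum>f<nat (1 - n). dts n (nat (- n - int f) + q) \<odot> c n (int f))" .
  have B: "(cid [\<E>] n \<odot> ca' n) * ((\<Sum>i<q. dts n i \<odot> dts (n - 2) (q - 1 - i)) \<odot> cid [\<F>] n)
      * (cid [\<E>] n \<odot> cu' n) = (\<Sum>i<q. dts n i \<odot> c n (int (q - 1 - i) - n + 1))"
    by (simp add: hc_sum sum_distrib_left sum_distrib_right c_dots_closure)
  \<comment> \<open>The bubble has degree \<open>f = q - n - i\<close>. The bound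
    \<open>i < q\<close> becomes \<open>f > - n\<close>, and the terms with \<open>i > q - n\<close>
    vanish because their bubbles have negative degree.\<close>
  have C: "(\<Sum>i<q. dts n i \<odot> c n (int (q - 1 - i) - n + 1)) =
      (\<Sum>f = nat (1 - n)..<nat (int q - n + 1). dts n (nat (int q - n - int f)) \<odot> c n (int f))"
  proof (rule sum.mono_neutral_cong_right[of _ "{i. i < q \<and> int i \<le> int q - n}", THEN trans])
    show "\<forall>i \<in> {..<q} - {i. i < q \<and> int i \<le> int q - n}. dts n i \<odot> c n (int (q - 1 - i) - n + 1) = 0"
    proof
      fix i assume "i \<in> {..<q} - {i. i < q \<and> int i \<le> int q - n}"
      then have "int (q - 1 - i) - n + 1 < 0"
        by auto
      then show "dts n i \<odot> c n (int (q - 1 - i) - n + 1) = 0"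
        by (simp only: c_neg hc_zero)
    qed
    show "(\<Sum>i | i < q \<and> int i \<le> int q - n. dts n i \<odot> c n (int (q - 1 - i) - n + 1)) =
      (\<Sum>f = nat (1 - n)..<nat (int q - n + 1). dts n (nat (int q - n - int f)) \<odot> c n (int f))"
      by (rule sum.reindex_bij_witness[of _ "\<lambda>f. nat (int q - n - int f)" "\<lambda>i. nat (int q - n - int i)"])
        (auto simp: of_nat_diff nat_less_iff nat_le_iff algebra_simps)
  qed auto
  have D: "(\<Sum>f<nat (1 - n). dts n (nat (- n - int f) + q) \<odot> c n (int f)) =
      (\<Sum>f<nat (1 - n). dts n (nat (int q - n - int f)) \<odot> c n (int f))"
  proof (rule sum.cong)
    fix f assume "f \<in> {..<nat (1 - n)}"
    then have "nat (- n - int f) + q = nat (int q - n - int f)"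
      by (simp add: zless_nat_eq_int_zless)
    then show "dts n (nat (- n - int f) + q) \<odot> c n (int f) =
        dts n (nat (int q - n - int f)) \<odot> c n (int f)"
      by simp
  qed simp
  have "nat (1 - n) \<le> nat (int q - n + 1)"
    by simp
  then have S: "{..<nat (int q - n + 1)} = {..<nat (1 - n)} \<union> {nat (1 - n)..<nat (int q - n + 1)}"
    by auto
  have "(cid [\<E>] n \<odot> dts (n - 2) q) * cr (n - 2) =
      cr (n - 2) * (dts n q \<odot> cid [\<E>] (n - 2)) - (\<Sum>i<q. dts n i \<odot> dts (n - 2) (q - 1 - i))"
    using slide_dots[of "n - 2" q] by simp
  then have "(cid [\<E>] n \<odot> ca' n) * (((cid [\<E>] n \<odot> dts (n - 2) q) * cr (n - 2)) \<odot> cid [\<F>] n) * (cid [\<E>] n \<odot> cu' n)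
     = - (\<Sum>f<nat (1 - n). dts n (nat (int q - n - int f)) \<odot> c n (int f)) -
      (\<Sum>f = nat (1 - n)..<nat (int q - n + 1). dts n (nat (int q - n - int f)) \<odot> c n (int f))"
    by (simp only: hc_diff left_diff_distrib right_diff_distrib A B C D)
  then show ?thesis
    unfolding S by (subst sum.union_disjoint) auto
qed


lemma dts_times_bubble:
  "dts n i * (dts n j \<odot> c n r) = dts n (i + j) \<odot> c n r"
  "(dts n j \<odot> c n r) * dts n i = dts n (i + j) \<odot> c n r"
proof -
  have "(dts n i \<odot> cid [] n) * (dts n j \<odot> c n r) = (dts n i * dts n j) \<odot> (cid [] n * c n r)"
    by (rule hc_interchange[OF hom_dts hom_dts hom_cid hom_c]) simp
  then show "dts n i * (dts n j \<odot> c n r) = dts n (i + j) \<odot> c n r"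
    by (simp add: cid_hc_right[OF hom_dts] cid_left[OF hom_c] dts_add)
  have "(dts n j \<odot> c n r) * (dts n i \<odot> cid [] n) = (dts n j * dts n i) \<odot> (c n r * cid [] n)"
    by (rule hc_interchange[OF hom_dts hom_dts hom_c hom_cid]) simp
  then show "(dts n j \<odot> c n r) * dts n i = dts n (i + j) \<odot> c n r"
    by (simp add: cid_hc_right[OF hom_dts] cid_right[OF hom_c] dts_add add.commute)
qed

lemma hc_eq_vcomp:
  assumes "f \<in> hom n [] []" "g \<in> hom n [] []"
  shows "f \<odot> g = f * g" "f \<odot> g = g * f"
  using hc_split[OF assms] by (simp_all add: cid_hc_left[OF assms(2)] cid_hc_right[OF assms(1)])

lemma cc_dots_closure:
  "ca n * (cid [\<F>] (n + 2) \<odot> dts n p \<odot> c n r) * cu n = cc n (int p + n + 1) * c n r"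
proof -
  have h: "cid [\<F>] (n + 2) \<odot> dts n p \<in> hom n [\<F>, \<E>] [\<F>, \<E>]"
    by (rule hom_intros refl | simp)+
  have h2: "ca n * (cid [\<F>] (n + 2) \<odot> dts n p) \<in> hom n [\<F>, \<E>] []"
    by (rule hom_vcomp[OF hom_ca h])
  have "(ca n \<odot> cid [] n) * ((cid [\<F>] (n + 2) \<odot> dts n p) \<odot> c n r) =
      (ca n * (cid [\<F>] (n + 2) \<odot> dts n p)) \<odot> (cid [] n * c n r)"
    by (rule hc_interchange[OF hom_ca h hom_cid hom_c]) simp
  moreover have "((ca n * (cid [\<F>] (n + 2) \<odot> dts n p)) \<odot> c n r) * (cu n \<odot> cid [] n) =
      (ca n * (cid [\<F>] (n + 2) \<odot> dts n p) * cu n) \<odot> (c n r * cid [] n)"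
    by (rule hc_interchange[OF h2 hom_cu hom_c hom_cid]) simp
  ultimately show ?thesis
    by (simp add: cid_hc_right[OF hom_ca] cid_hc_right[OF hom_cu] cid_left[OF hom_c]
        cid_right[OF hom_c] cc_real hc_assoc hc_eq_vcomp(1)[OF hom_cc hom_c])
qed

lemma c_dots_closure':
  "ca' n * ((cc n r \<odot> dts (n - 2) p) \<odot> cid [\<F>] n) * cu' n = cc n r * c n (int p - n + 1)"
proof -
  have h: "dts (n - 2) p \<odot> cid [\<F>] n \<in> hom n [\<E>, \<F>] [\<E>, \<F>]"
    by (rule hom_intros refl | simp)+
  have h2: "ca' n * (dts (n - 2) p \<odot> cid [\<F>] n) \<in> hom n [\<E>, \<F>] []"
    by (rule hom_vcomp[OF hom_ca' h])
  have "(cid [] n \<odot> ca' n) * (cc n r \<odot> (dts (n - 2) p \<odot> cid [\<F>] n)) =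
      (cid [] n * cc n r) \<odot> (ca' n * (dts (n - 2) p \<odot> cid [\<F>] n))"
    by (rule hc_interchange[OF hom_cid hom_cc hom_ca' h]) simp
  moreover have "(cc n r \<odot> (ca' n * (dts (n - 2) p \<odot> cid [\<F>] n))) * (cid [] n \<odot> cu' n) =
      (cc n r * cid [] n) \<odot> (ca' n * (dts (n - 2) p \<odot> cid [\<F>] n) * cu' n)"
    by (rule hc_interchange[OF hom_cc hom_cid h2 hom_cu']) simp
  ultimately show ?thesis
    by (simp add: cid_hc_left[OF hom_ca'] cid_hc_left[OF hom_cu'] cid_left[OF hom_cc]
        cid_right[OF hom_cc] c_real hc_assoc hc_eq_vcomp(1)[OF hom_cc hom_c])
qed

text \<open>A figure eight, that is a crossing whose left strand is closed to the left and whose right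
  strand is closed to the right, is evaluated by resolving either of its two curls.\<close>

lemma figure_eight:
  fixes m :: nat
  shows "(\<Sum>g<nat (n + 1). cc n (int g) * c n (int (Suc m) - int g)) =
    - (\<Sum>f<nat (int m - n + 1). cc n (int (Suc m) - int f) * c n (int f))"
proof -
  let ?E = "cid [\<E>] n" and ?F = "cid [\<F>] n" and ?F2 = "cid [\<F>] (n + 2)" and ?E2 = "cid [\<E>] (n - 2)"
  define Y where "Y = (?E \<odot> dts (n - 2) m) * cr (n - 2)"
  define D where "D = (ca n \<odot> ca' n) * (?F2 \<odot> Y \<odot> ?F) * (cu n \<odot> cu' n)"
  have hY1: "?E \<odot> dts (n - 2) m \<in> hom (n - 2) [\<E>, \<E>] [\<E>, \<E>]"
    by (rule hom_intros refl | simp)+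
  have hY: "Y \<in> hom (n - 2) [\<E>, \<E>] [\<E>, \<E>]"
    unfolding Y_def by (rule hom_vcomp[OF hY1 hom_cr])
  have hYF: "Y \<odot> ?F \<in> hom n [\<E>, \<E>, \<F>] [\<E>, \<E>, \<F>]"
    by (rule hY hom_hcomp hom_cid refl | simp)+
  have hFY: "?F2 \<odot> Y \<in> hom (n - 2) [\<F>, \<E>, \<E>] [\<F>, \<E>, \<E>]"
    by (rule hY hom_hcomp hom_cid refl | simp)+
  have hEc: "?E \<odot> ca' n \<in> hom n [\<E>, \<E>, \<F>] [\<E>]" "?E \<odot> cu' n \<in> hom n [\<E>] [\<E>, \<E>, \<F>]"
    by (rule hom_intros refl | simp)+
  have hcE: "ca n \<odot> ?E2 \<in> hom (n - 2) [\<F>, \<E>, \<E>] [\<E>]" "cu n \<odot> ?E2 \<in> hom (n - 2) [\<E>] [\<F>, \<E>, \<E>]"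
    by (rule hom_intros refl | simp)+
  have p1: "ca n * (cid [\<F>, \<E>] n \<odot> ca' n) = ca n \<odot> ca' n"
    using hc_split(1)[OF hom_ca hom_ca', of n n] by (simp add: cid_hc_right[OF hom_ca])
  have p2: "(cid [\<F>, \<E>] n \<odot> cu' n) * cu n = cu n \<odot> cu' n"
    using hc_split(2)[OF hom_cu hom_cu', of n n] by (simp add: cid_hc_right[OF hom_cu])
  have p3: "?F2 \<odot> ((?E \<odot> ca' n) * (Y \<odot> ?F) * (?E \<odot> cu' n)) =
      (cid [\<F>, \<E>] n \<odot> ca' n) * (?F2 \<odot> Y \<odot> ?F) * (cid [\<F>, \<E>] n \<odot> cu' n)"
    using whisker_left[OF hEc(1) hYF, of "n + 2" "[\<F>]"]
      whisker_left[OF hom_vcomp[OF hEc(1) hYF] hEc(2), of "n + 2" "[\<F>]"]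
    by (simp add: cid_hc_cid_hc)
  \<comment> \<open>Closing the right loop first leaves dots and clockwise bubbles on the left
    strand, which the outer closure turns into counterclockwise bubbles.\<close>
  have D1: "D = ca n * (?F2 \<odot> ((?E \<odot> ca' n) * (Y \<odot> ?F) * (?E \<odot> cu' n))) * cu n"
    unfolding D_def p3 p1[symmetric] p2[symmetric] by (simp only: mult.assoc)
  have q1: "ca' n * (ca n \<odot> cid [\<E>, \<F>] n) = ca n \<odot> ca' n"
    using hc_split(2)[OF hom_ca hom_ca', of n n] by (simp add: cid_hc_left[OF hom_ca'])
  have q2: "(cu n \<odot> cid [\<E>, \<F>] n) * cu' n = cu n \<odot> cu' n"
    using hc_split(1)[OF hom_cu hom_cu', of n n] by (simp add: cid_hc_left[OF hom_cu'])
  have q3: "((ca n \<odot> ?E2) * (?F2 \<odot> Y) * (cu n \<odot> ?E2)) \<odot> ?F =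
      (ca n \<odot> cid [\<E>, \<F>] n) * (?F2 \<odot> Y \<odot> ?F) * (cu n \<odot> cid [\<E>, \<F>] n)"
    using whisker_right[OF hcE(1) hFY, of n "[\<F>]"]
      whisker_right[OF hom_vcomp[OF hcE(1) hFY] hcE(2), of n "[\<F>]"]
    by (simp add: hc_assoc cid_hc_cid)
  have D2: "D = ca' n * (((ca n \<odot> ?E2) * (?F2 \<odot> Y) * (cu n \<odot> ?E2)) \<odot> ?F) * cu' n"
    unfolding D_def q3 q1[symmetric] q2[symmetric] by (simp only: mult.assoc)
  have "D = - (\<Sum>f<nat (int m - n + 1). cc n (int (nat (int m - n - int f)) + n + 1) * c n (int f))"
    unfolding D1 Y_def dotted_curl
    by (simp add: hc_uminus hc_sum sum_distrib_left sum_distrib_right cc_dots_closure)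
  also have "\<dots> = - (\<Sum>f<nat (int m - n + 1). cc n (int (Suc m) - int f) * c n (int f))"
    by (intro arg_cong[where f = uminus] sum.cong refl)
      (auto simp: zless_nat_eq_int_zless intro!: arg_cong[where f = "\<lambda>z. cc n z * _"])
  finally have R: "D = \<dots>" .
  \<comment> \<open>In the other order the dots sit on the strand that the left curl leaves open, so
    they slide above the cap and the curl is undotted.\<close>
  have "(ca n \<odot> ?E2) * (?F2 \<odot> Y) =
      (ca n \<odot> ?E2) * (cid [\<F>, \<E>] n \<odot> dts (n - 2) m) * (?F2 \<odot> cr (n - 2))"
    using whisker_left[OF hY1 hom_cr, of "n + 2" "[\<F>]"]
    by (simp add: Y_def cid_hc_cid_hc mult.assoc)
  also have "(ca n \<odot> ?E2) * (cid [\<F>, \<E>] n \<odot> dts (n - 2) m) = dts (n - 2) m * (ca n \<odot> ?E2)"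
    by (rule cap_left_slide[OF hom_ca hom_dts]) simp
  finally have "(ca n \<odot> ?E2) * (?F2 \<odot> Y) * (cu n \<odot> ?E2) = dts (n - 2) m *
      (\<Sum>g<nat (n + 1). cc n (int g) \<odot> dts (n - 2) (nat (n - int g)))"
    using curl_left[of n] by (simp add: mult.assoc sum_pairs)
  also have "\<dots> = (\<Sum>g<nat (n + 1). cc n (int g) \<odot> dts (n - 2) (m + nat (n - int g)))"
    unfolding sum_distrib_left
  proof (rule sum.cong[OF refl])
    fix g
    have "(cid [] n \<odot> dts (n - 2) m) * (cc n (int g) \<odot> dts (n - 2) (nat (n - int g))) =
        (cid [] n * cc n (int g)) \<odot> (dts (n - 2) m * dts (n - 2) (nat (n - int g)))"
      by (rule hc_interchange[OF hom_cid hom_cc hom_dts hom_dts]) simp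
    then show "dts (n - 2) m * (cc n (int g) \<odot> dts (n - 2) (nat (n - int g))) =
        cc n (int g) \<odot> dts (n - 2) (m + nat (n - int g))"
      by (simp add: cid_hc_left[OF hom_dts] cid_left[OF hom_cc] dts_add)
  qed
  finally have "D = (\<Sum>g<nat (n + 1). cc n (int g) * c n (int (m + nat (n - int g)) - n + 1))"
    unfolding D2 by (simp add: hc_sum sum_distrib_left sum_distrib_right c_dots_closure' del: of_nat_add)
  also have "\<dots> = (\<Sum>g<nat (n + 1). cc n (int g) * c n (int (Suc m) - int g))"
    by (intro sum.cong refl)
      (auto simp: zless_nat_eq_int_zless intro!: arg_cong[where f = "\<lambda>z. cc n _ * c n z"])
  finally show ?thesis
    using R by simp
qed

text \<open>The two values of the figure eight cut the convolution at \<open>r = n\<close>: the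
  terms with \<open>r \<le> n\<close> come from the left curl and, with \<open>f = K - r\<close>,
  the terms with \<open>r > n\<close> from the right one. Bubbles of negative degree account for the
  different summation ranges.\<close>

lemma infinite_grassmannian:
  assumes "K > 0"
  shows "(\<Sum>r\<le>K. cc n (int r) * c n (int (K - r))) = 0"
proof -
  obtain m where K: "K = Suc m"
    using assms by (cases K) auto
  have 1: "(\<Sum>r\<in>{r. r \<le> K \<and> int r \<le> n}. cc n (int r) * c n (int (K - r))) =
      (\<Sum>g<nat (n + 1). cc n (int g) * c n (int (Suc m) - int g))"
  proof (rule sum.mono_neutral_cong_left)
    show "\<forall>g\<in>{..<nat (n + 1)} - {r. r \<le> K \<and> int r \<le> n}. cc n (int g) * c n (int (Suc m) - int g) = 0"
    proof
      fix g assume "g \<in> {..<nat (n + 1)} - {r. r \<le> K \<and> int r \<le> n}"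
      then have "int (Suc m) - int g < 0"
        by (auto simp: K)
      then show "cc n (int g) * c n (int (Suc m) - int g) = 0"
        by (simp only: c_neg mult_zero_right)
    qed
  qed (auto simp: K of_nat_diff)
  have 2: "(\<Sum>r\<in>{r. r \<le> K \<and> \<not> int r \<le> n}. cc n (int r) * c n (int (K - r))) =
      (\<Sum>f\<in>{f. f \<le> K \<and> int f \<le> int m - n}. cc n (int (Suc m) - int f) * c n (int f))"
    by (rule sum.reindex_bij_witness[of _ "\<lambda>f. K - f" "\<lambda>r. K - r"]) (auto simp: K of_nat_diff)
  also have "\<dots> = (\<Sum>f<nat (int m - n + 1). cc n (int (Suc m) - int f) * c n (int f))"
  proof (rule sum.mono_neutral_left)
    show "\<forall>f\<in>{..<nat (int m - n + 1)} - {f. f \<le> K \<and> int f \<le> int m - n}.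
        cc n (int (Suc m) - int f) * c n (int f) = 0"
    proof
      fix f assume "f \<in> {..<nat (int m - n + 1)} - {f. f \<le> K \<and> int f \<le> int m - n}"
      then have "int (Suc m) - int f < 0"
        by (auto simp: K)
      then show "cc n (int (Suc m) - int f) * c n (int f) = 0"
        by (simp only: cc_neg mult_zero_left)
    qed
  qed auto
  finally have 3: "(\<Sum>r | r \<le> K \<and> \<not> int r \<le> n. cc n (int r) * c n (int (K - r))) =
      (\<Sum>f<nat (int m - n + 1). cc n (int (Suc m) - int f) * c n (int f))" .
  have "{..K} = {r. r \<le> K \<and> int r \<le> n} \<union> {r. r \<le> K \<and> \<not> int r \<le> n}"
    by auto
  then have "(\<Sum>r\<le>K. cc n (int r) * c n (int (K - r))) =
    (\<Sum>r | r \<le> K \<and> int r \<le> n. cc n (int r) * c n (int (K - r))) +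
    (\<Sum>r | r \<le> K \<and> \<not> int r \<le> n. cc n (int r) * c n (int (K - r)))"
    by (simp only:) (rule sum.union_disjoint; auto)
  then show ?thesis
    by (simp only: 1 3 figure_eight left_minus)
qed

text \<open>A clockwise bubble with \<open>k\<close> dots to the left of a strand is moved to the right by
  decomposing \<open>\<F>\<E>\<close>, that is the left half of the strand and the facing half of the bubble.\<close>

lemma bubble_slide_real:
  fixes m :: int and r k :: nat
  assumes k: "int k = int r + m + 1"
  shows "c (m + 2) (int r) \<odot> cid [\<E>] m = (\<Sum>i\<le>r. \<Sum>f\<le>r - i. dts m (r - f) \<odot> c m (int f))"
proof -
  let ?E = "cid [\<E>] m" and ?F = "cid [\<F>] m" and ?F2 = "cid [\<F>] (m + 2)"
    and ?FE = "cid [\<F>, \<E>] m" and ?EF = "cid [\<E>, \<F>] m" and ?X = "\<lambda>i. dts m i"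
    and ?r = "cr (m - 2)"
  define P where "P = ca' (m + 2) \<odot> ?E"
  define Q where "Q = cu' (m + 2) \<odot> ?E"
  define s1 where "s1 = (?FE \<odot> ca' m) * (?F2 \<odot> ?r \<odot> ?F) * (cu m \<odot> ?EF)"
  define s2 where "s2 = (ca m \<odot> ?EF) * (?F2 \<odot> ?r \<odot> ?F) * (?FE \<odot> cu' m)"
  define t where "t g1 g2 g3 = (?F2 \<odot> ?X g1) * cu m * c m (int g2) * ca m * (?F2 \<odot> ?X g3)" for g1 g2 g3
  have hP: "P \<in> hom m [\<E>, \<F>, \<E>] [\<E>]" and hQ: "Q \<in> hom m [\<E>] [\<E>, \<F>, \<E>]"
    unfolding P_def Q_def by (rule hom_intros refl | simp)+
  have hFrF: "?F2 \<odot> ?r \<odot> ?F \<in> hom m [\<F>, \<E>, \<E>, \<F>] [\<F>, \<E>, \<E>, \<F>]"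
    and hrF: "?r \<odot> ?F \<in> hom m [\<E>, \<E>, \<F>] [\<E>, \<E>, \<F>]"
    and hFEca: "?FE \<odot> ca' m \<in> hom m [\<F>, \<E>, \<E>, \<F>] [\<F>, \<E>]"
    and hFEcu: "?FE \<odot> cu' m \<in> hom m [\<F>, \<E>] [\<F>, \<E>, \<E>, \<F>]"
    and hcuEF: "cu m \<odot> ?EF \<in> hom m [\<E>, \<F>] [\<F>, \<E>, \<E>, \<F>]"
    and hcaEF: "ca m \<odot> ?EF \<in> hom m [\<F>, \<E>, \<E>, \<F>] [\<E>, \<F>]"
    and hFX: "?F2 \<odot> ?X g \<in> hom m [\<F>, \<E>] [\<F>, \<E>]" for g
    by (rule hom_intros refl | simp)+
  have hs1: "s1 \<in> hom m [\<E>, \<F>] [\<F>, \<E>]" and hs2: "s2 \<in> hom m [\<F>, \<E>] [\<E>, \<F>]"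
    unfolding s1_def s2_def
    by (rule hom_vcomp[OF hom_vcomp[OF hFEca hFrF] hcuEF] hom_vcomp[OF hom_vcomp[OF hcaEF hFrF] hFEcu])+
  have ht: "t g1 g2 g3 \<in> hom m [\<F>, \<E>] [\<F>, \<E>]" for g1 g2 g3
    unfolding t_def by (rule hFX hom_vcomp hom_cu hom_ca hom_c)+

  \<comment> \<open>The cap in \<open>P\<close> and the cup in \<open>s1\<close> form a zigzag.
    Straightening it turns the sideways crossing into an upright one.\<close>
  have Ps1: "P * (?E \<odot> s1) = (?E \<odot> ca' m) * (?r \<odot> ?F)"
  proof -
    have 1: "?E \<odot> s1 = (cid [\<E>, \<F>, \<E>] m \<odot> ca' m) * (cid [\<E>, \<F>] (m + 2) \<odot> ?r \<odot> ?F) * (?E \<odot> cu m \<odot> ?EF)"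
      unfolding s1_def
      using whisker_left[OF hFEca hFrF, of m "[\<E>]"]
        whisker_left[OF hom_vcomp[OF hFEca hFrF] hcuEF, of m "[\<E>]"]
      by (simp add: cid_hc_cid_hc)
    have 2: "P * (cid [\<E>, \<F>, \<E>] m \<odot> ca' m) = (?E \<odot> ca' m) * (ca' (m + 2) \<odot> cid [\<E>, \<E>, \<F>] m)"
      using hc_split[OF hP hom_ca', of m] by (simp add: P_def hc_assoc cid_hc_cid cid_hc_right[OF hP[unfolded P_def]])
    have 3: "(ca' (m + 2) \<odot> cid [\<E>, \<E>, \<F>] m) * (cid [\<E>, \<F>] (m + 2) \<odot> ?r \<odot> ?F) =
        (?r \<odot> ?F) * (ca' (m + 2) \<odot> cid [\<E>, \<E>, \<F>] m)"
      by (rule cap_left_slide[OF hom_ca' hrF]) simp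
    have hE1: "?E \<odot> cu m \<in> hom m [\<E>] [\<E>, \<F>, \<E>]"
      by (rule hom_intros refl | simp)+
    have 4: "(ca' (m + 2) \<odot> cid [\<E>, \<E>, \<F>] m) * (?E \<odot> cu m \<odot> ?EF) = cid [\<E>, \<E>, \<F>] m"
      using whisker_right[OF hP hE1, of m "[\<E>, \<F>]"] adj1[of m]
      by (simp add: P_def hc_assoc cid_hc_cid)
    have "P * (?E \<odot> s1) = (?E \<odot> ca' m) * ((?r \<odot> ?F) *
        ((ca' (m + 2) \<odot> cid [\<E>, \<E>, \<F>] m) * (?E \<odot> cu m \<odot> ?EF)))"
      unfolding 1 by (simp only: mult.assoc[symmetric] 2) (simp only: mult.assoc 3[unfolded mult.assoc] 3)
    then show ?thesis
      by (simp only: 4 cid_right[OF hrF])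
  qed
  have s2Q: "(?E \<odot> s2) * Q = (?r \<odot> ?F) * (?E \<odot> cu' m)"
  proof -
    have 1: "?E \<odot> s2 = (?E \<odot> ca m \<odot> ?EF) * (cid [\<E>, \<F>] (m + 2) \<odot> ?r \<odot> ?F) * (cid [\<E>, \<F>, \<E>] m \<odot> cu' m)"
      unfolding s2_def
      using whisker_left[OF hcaEF hFrF, of m "[\<E>]"]
        whisker_left[OF hom_vcomp[OF hcaEF hFrF] hFEcu, of m "[\<E>]"]
      by (simp add: cid_hc_cid_hc)
    have 2: "(cid [\<E>, \<F>, \<E>] m \<odot> cu' m) * Q = (cu' (m + 2) \<odot> cid [\<E>, \<E>, \<F>] m) * (?E \<odot> cu' m)"
      using hc_split[OF hQ hom_cu', of m] by (simp add: Q_def hc_assoc cid_hc_cid cid_hc_right[OF hQ[unfolded Q_def]])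
    have 3: "(cid [\<E>, \<F>] (m + 2) \<odot> ?r \<odot> ?F) * (cu' (m + 2) \<odot> cid [\<E>, \<E>, \<F>] m) =
        (cu' (m + 2) \<odot> cid [\<E>, \<E>, \<F>] m) * (?r \<odot> ?F)"
      by (rule cup_left_slide[OF hom_cu' hrF]) simp
    have hE1: "?E \<odot> ca m \<in> hom m [\<E>, \<F>, \<E>] [\<E>]"
      by (rule hom_intros refl | simp)+
    have 4: "(?E \<odot> ca m \<odot> ?EF) * (cu' (m + 2) \<odot> cid [\<E>, \<E>, \<F>] m) = cid [\<E>, \<E>, \<F>] m"
      using whisker_right[OF hE1 hQ, of m "[\<E>, \<F>]"] adj2[of m]
      by (simp add: Q_def hc_assoc cid_hc_cid)
    have "(?E \<odot> s2) * Q = (?E \<odot> ca m \<odot> ?EF) * ((cid [\<E>, \<F>] (m + 2) \<odot> ?r \<odot> ?F) *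
        (cu' (m + 2) \<odot> cid [\<E>, \<E>, \<F>] m)) * (?E \<odot> cu' m)"
      unfolding 1 by (simp only: mult.assoc 2)
    also have "\<dots> = ((?E \<odot> ca m \<odot> ?EF) * (cu' (m + 2) \<odot> cid [\<E>, \<E>, \<F>] m)) * (?r \<odot> ?F) * (?E \<odot> cu' m)"
      by (simp only: 3 mult.assoc)
    finally show ?thesis
      by (simp only: 4 cid_left[OF hrF])
  qed

  have XS: "(?X k \<odot> ?FE) * (?E \<odot> s1) = (?E \<odot> s1) * (?X k \<odot> ?EF)"
    using hc_split[OF hom_dts hs1, of m] by simp
  have hXE: "?X i \<odot> cid [\<E>] (m - 2) \<in> hom (m - 2) [\<E>, \<E>] [\<E>, \<E>]"
    and hEX: "?E \<odot> dts (m - 2) i \<in> hom (m - 2) [\<E>, \<E>] [\<E>, \<E>]" for i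
    by (rule hom_intros refl | simp)+
  have XEF: "(?X i \<odot> cid [\<E>] (m - 2)) \<odot> ?F = ?X i \<odot> ?EF" for i
    by (simp add: hc_assoc cid_hc_cid)
  have "P * (?X k \<odot> ?FE) * (?E \<odot> (s1 * s2)) * Q = P * (?E \<odot> s1) * (?X k \<odot> ?EF) * ((?E \<odot> s2) * Q)"
    using XS by (simp add: whisker_left[OF hs1 hs2, symmetric] mult.assoc)
      (simp add: mult.assoc[symmetric])
  also have "\<dots> = (?E \<odot> ca' m) * ((?r * (?X k \<odot> cid [\<E>] (m - 2)) * ?r) \<odot> ?F) * (?E \<odot> cu' m)"
  proof -
    have "(?r * (?X k \<odot> cid [\<E>] (m - 2)) * ?r) \<odot> ?F = (?r \<odot> ?F) * (?X k \<odot> ?EF) * (?r \<odot> ?F)"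
      unfolding XEF[symmetric]
      using whisker_right[OF hom_cr hXE, of m "[\<F>]" k]
        whisker_right[OF hom_vcomp[OF hom_cr hXE] hom_cr, of m "[\<F>]" k] by simp
    then show ?thesis
      unfolding Ps1 s2Q by (simp only: mult.assoc)
  qed
  \<comment> \<open>The composite has become two upright crossings with \<open>k\<close> dots
    between them. Sliding the dots out makes the crossings meet, which gives zero; each correction
    term keeps one crossing with dots, and that is a dotted curl.\<close>
  also have "?r * (?X k \<odot> cid [\<E>] (m - 2)) * ?r =
      (\<Sum>i<k. (?X i \<odot> cid [\<E>] (m - 2)) * ((?E \<odot> dts (m - 2) (k - 1 - i)) * ?r))"
  proof -
    have "?r * (?X k \<odot> cid [\<E>] (m - 2)) =
        (?E \<odot> dts (m - 2) k) * ?r + (\<Sum>i<k. ?X i \<odot> dts (m - 2) (k - 1 - i))"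
      using slide_dots[of "m - 2" k] by (simp add: algebra_simps)
    moreover have "?X i \<odot> dts (m - 2) j = (?X i \<odot> cid [\<E>] (m - 2)) * (?E \<odot> dts (m - 2) j)" for i j
      using hc_split(1)[OF hom_dts hom_dts, of m "m - 2"] by simp
    ultimately show ?thesis
      by (simp only: distrib_right mult.assoc cr_nil mult_zero_right add_0_left sum_distrib_right)
  qed
  also have "(?E \<odot> ca' m) * ((\<Sum>i<k. (?X i \<odot> cid [\<E>] (m - 2)) * ((?E \<odot> dts (m - 2) (k - 1 - i)) * ?r)) \<odot> ?F)
        * (?E \<odot> cu' m) =
      (\<Sum>i<k. ?X i * ((?E \<odot> ca' m) * (((?E \<odot> dts (m - 2) (k - 1 - i)) * ?r) \<odot> ?F) * (?E \<odot> cu' m)))"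
    unfolding hc_sum sum_distrib_left sum_distrib_right
  proof (rule sum.cong[OF refl])
    fix i
    have "((?X i \<odot> cid [\<E>] (m - 2)) * ((?E \<odot> dts (m - 2) (k - 1 - i)) * ?r)) \<odot> ?F =
        (?X i \<odot> ?EF) * (((?E \<odot> dts (m - 2) (k - 1 - i)) * ?r) \<odot> ?F)"
      unfolding XEF[symmetric]
      by (rule whisker_right[symmetric, OF hXE hom_vcomp[OF hEX hom_cr]]) simp
    moreover have "(?E \<odot> ca' m) * (?X i \<odot> ?EF) = ?X i * (?E \<odot> ca' m)"
      by (rule cap_right_slide[OF hom_dts hom_ca']) auto
    ultimately show "(?E \<odot> ca' m) * (((?X i \<odot> cid [\<E>] (m - 2)) * ((?E \<odot> dts (m - 2) (k - 1 - i)) * ?r)) \<odot> ?F)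
        * (?E \<odot> cu' m) =
      ?X i * ((?E \<odot> ca' m) * (((?E \<odot> dts (m - 2) (k - 1 - i)) * ?r) \<odot> ?F) * (?E \<odot> cu' m))"
      by (simp only: mult.assoc[symmetric])
  qed
  also have "\<dots> = - (\<Sum>i<k. \<Sum>f<nat (int (k - 1 - i) - m + 1).
      ?X (i + nat (int (k - 1 - i) - m - int f)) \<odot> c m (int f))"
    unfolding dotted_curl by (simp add: sum_distrib_left dts_times_bubble sum_negf)
  also have "\<dots> = - (\<Sum>i<k. \<Sum>f | i + f \<le> r. ?X (r - f) \<odot> c m (int f))"
  proof (intro arg_cong[where f = uminus] sum.cong refl)
    fix i f assume i: "i \<in> {..<k}"
    show "{..<nat (int (k - 1 - i) - m + 1)} = {f. i + f \<le> r}"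
      using i k by (auto simp: zless_nat_eq_int_zless of_nat_diff)
    assume "f \<in> {f. i + f \<le> r}"
    then have "i + nat (int (k - 1 - i) - m - int f) = r - f"
      using i k by (simp add: of_nat_diff nat_add_distrib)
    then show "?X (i + nat (int (k - 1 - i) - m - int f)) \<odot> c m (int f) = ?X (r - f) \<odot> c m (int f)"
      by simp
  qed
  finally have T1: "P * (?X k \<odot> ?FE) * (?E \<odot> (s1 * s2)) * Q =
      - (\<Sum>i<k. \<Sum>f | i + f \<le> r. ?X (r - f) \<odot> c m (int f))" .

  \<comment> \<open>Cap and cup cut the picture and rejoin strand and bubble to a single strand. It
    collects the dots \<open>k\<close>, \<open>g1\<close> and \<open>g3\<close>, while the bubble of
    degree \<open>g2\<close> stays on its right.\<close>
  have T2: "P * (?X k \<odot> ?FE) * (?E \<odot> t g1 g2 g3) * Q = ?X (k + g1 + g3) \<odot> c m (int g2)" for g1 g2 g3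
  proof -
    have w: "?E \<odot> t g1 g2 g3 = (?E \<odot> ?F2 \<odot> ?X g1) * (?E \<odot> cu m) * (?E \<odot> c m (int g2)) * (?E \<odot> ca m)
        * (?E \<odot> ?F2 \<odot> ?X g3)"
      unfolding t_def
      by (subst whisker_left, (rule hFX hom_vcomp hom_cu hom_ca hom_c | simp)+)+
    have 1: "P * (?E \<odot> ?F2 \<odot> ?X g1) = ?X g1 * P"
      unfolding P_def using cap_left_slide[OF hom_ca' hom_dts, of "m + 2" m g1]
      by (simp add: cid_hc_cid_hc)
    have 2: "(?E \<odot> ?F2 \<odot> ?X g3) * Q = Q * ?X g3"
      unfolding Q_def using cup_left_slide[OF hom_cu' hom_dts, of "m + 2" m g3]
      by (simp add: cid_hc_cid_hc)
    have 3: "(?X k \<odot> ?FE) * (?E \<odot> cu m) = (?E \<odot> cu m) * ?X k"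
      by (rule cup_right_slide[OF hom_dts hom_cu])
    have 4: "(?X k \<odot> ?FE) * (?E \<odot> ?F2 \<odot> ?X g1) = (?E \<odot> ?F2 \<odot> ?X g1) * (?X k \<odot> ?FE)"
      using hc_split[OF hom_dts hFX, of m] by simp
    have 5: "P * (?E \<odot> cu m) = ?E" "(?E \<odot> ca m) * Q = ?E"
      unfolding P_def Q_def using adj1[of m] adj2[of m] by simp_all
    have "P * (?X k \<odot> ?FE) * (?E \<odot> t g1 g2 g3) * Q =
      P * ((?X k \<odot> ?FE) * (?E \<odot> ?F2 \<odot> ?X g1)) * (?E \<odot> cu m) * (?E \<odot> c m (int g2)) * (?E \<odot> ca m)
        * ((?E \<odot> ?F2 \<odot> ?X g3) * Q)"
      unfolding w by (simp only: mult.assoc)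
    also have "\<dots> = (P * (?E \<odot> ?F2 \<odot> ?X g1)) * ((?X k \<odot> ?FE) * (?E \<odot> cu m)) * (?E \<odot> c m (int g2))
        * ((?E \<odot> ca m) * Q) * ?X g3"
      unfolding 4 2 by (simp only: mult.assoc)
    also have "\<dots> = ?X g1 * (P * (?E \<odot> cu m)) * ?X k * (?E \<odot> c m (int g2)) * ((?E \<odot> ca m) * Q) * ?X g3"
      unfolding 1 3 by (simp only: mult.assoc)
    also have "\<dots> = ?X g1 * ?X k * (?E \<odot> c m (int g2)) * ?X g3"
      unfolding 5 mult.assoc cid_left[OF hom_dts] by simp
    also have "\<dots> = ?X (k + g1 + g3) \<odot> c m (int g2)"
      using dts_times_bubble(1)[where n = m and i = "g1 + k" and j = 0 and r = "int g2"]
        dts_times_bubble(2)[where n = m and j = "g1 + k" and i = g3 and r = "int g2"]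
      by (simp add: dts_add dts_0 add_ac)
    finally show ?thesis .
  qed

  have "c (m + 2) (int r) \<odot> ?E = (ca' (m + 2) * (?X k \<odot> ?F2) * cu' (m + 2)) \<odot> ?E"
    using c_real[of "m + 2" k] k by simp
  also have "\<dots> = P * (?X k \<odot> ?FE) * Q"
  proof -
    have h: "?X k \<odot> ?F2 \<in> hom (m + 2) [\<E>, \<F>] [\<E>, \<F>]"
      by (rule hom_intros refl | simp)+
    show ?thesis
      unfolding P_def Q_def
      using whisker_right[OF hom_vcomp[OF hom_ca' h] hom_cu', of m "[\<E>]"]
        whisker_right[OF hom_ca' h, of m "[\<E>]"]
      by (simp add: hc_assoc cid_hc_cid)
  qed
  also have "\<dots> = P * (?X k \<odot> ?FE) * (?E \<odot> ?FE) * Q"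
  proof -
    have "(?E \<odot> ?FE) * Q = Q"
      using cid_left[OF hQ] by (simp add: cid_hc_cid)
    then show ?thesis
      by (simp only: mult.assoc)
  qed
  also have "?E \<odot> ?FE =
      ?E \<odot> (- (s1 * s2) + (\<Sum>(g1, g2, g3) | int g1 + int g2 + int g3 = - m - 1. t g1 g2 g3))"
    unfolding s1_def s2_def t_def by (rule arg_cong[OF decomp_FE])
  also have "P * (?X k \<odot> ?FE) *
      (?E \<odot> (- (s1 * s2) + (\<Sum>(g1, g2, g3) | int g1 + int g2 + int g3 = - m - 1. t g1 g2 g3))) * Q =
     (\<Sum>i<k. \<Sum>f | i + f \<le> r. ?X (r - f) \<odot> c m (int f)) +
     (\<Sum>(g1, g2, g3) | int g1 + int g2 + int g3 = - m - 1. ?X (k + g1 + g3) \<odot> c m (int g2))"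
    by (simp only: hc_add hc_uminus distrib_left distrib_right T1 hc_sum sum_distrib_left
        sum_distrib_right case_prod_unfold T2 mult_minus_left mult_minus_right minus_minus)
  \<comment> \<open>The triple contributes to the row \<open>i = k + g1\<close>, with
    \<open>f = g2\<close>. So these are exactly the rows \<open>i \<ge> k\<close>, and the curl
    terms have supplied the rows \<open>i < k\<close>.\<close>
  also have "(\<Sum>(g1, g2, g3) | int g1 + int g2 + int g3 = - m - 1. ?X (k + g1 + g3) \<odot> c m (int g2)) =
     (\<Sum>(i, f) | k \<le> i \<and> i + f \<le> r. ?X (r - f) \<odot> c m (int f))"
  proof -
    have "k + g1 + g3 = r - g2" "k + g1 + g2 \<le> r" "r - (k + g1) - g2 = g3"
      if "int g1 + int g2 + int g3 = - m - 1" for g1 g2 g3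
    proof -
      have "int r = int (k + g1 + g2 + g3)"
        using k that by simp
      then have "r = k + g1 + g2 + g3"
        by (simp only: of_nat_eq_iff)
      then show "k + g1 + g3 = r - g2" "k + g1 + g2 \<le> r" "r - (k + g1) - g2 = g3"
        by simp_all
    qed
    moreover have "int (i - k) + int f + int (r - i - f) = - m - 1" if "k \<le> i" "i + f \<le> r" for i f
      using k that by (simp add: of_nat_diff)
    ultimately show ?thesis
      by (intro sum.reindex_bij_witness[of _ "\<lambda>(i, f). (i - k, f, r - i - f)" "\<lambda>(g1, g2, g3). (k + g1, g2)"])
        auto
  qed
  also have "(\<Sum>i<k. \<Sum>f | i + f \<le> r. ?X (r - f) \<odot> c m (int f)) =
     (\<Sum>(i, f) | i < k \<and> i + f \<le> r. ?X (r - f) \<odot> c m (int f))"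
  proof -
    have fin: "finite {f. i + f \<le> r}" for i
      by (rule finite_subset[of _ "{..r}"]) auto
    show ?thesis
      by (subst sum.Sigma) (auto simp: fin intro!: sum.cong)
  qed
  also have "\<dots> + (\<Sum>(i, f) | k \<le> i \<and> i + f \<le> r. ?X (r - f) \<odot> c m (int f)) =
     (\<Sum>(i, f) \<in> (SIGMA i:{..r}. {..r - i}). ?X (r - f) \<odot> c m (int f))"
  proof -
    have "(SIGMA i:{..r}. {..r - i}) = {(i, f). i < k \<and> i + f \<le> r} \<union> {(i, f). k \<le> i \<and> i + f \<le> r}"
      by auto
    moreover have "finite {(i, f). i < k \<and> i + f \<le> r}" "finite {(i, f). k \<le> i \<and> i + f \<le> r}"
      by (rule finite_subset[of _ "{..r} \<times> {..r}"]; auto)+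
    ultimately show ?thesis
      by (simp only:) (rule sum.union_disjoint[symmetric]; auto)
  qed
  finally show ?thesis
    by (simp add: sum.Sigma)
qed

end

text \<open>\<open>cc_slide\<close> concerns real counterclockwise bubbles, \<open>j\<close> being
  their number of dots. Inside the mirror image it is \<open>bubble_slide_real\<close>, so each of
  the two instances supplies it to the other; this is why it is an axiom of a second locale.\<close>

locale bubble_slides = diagram_calculus +
  assumes cc_slide: "int j = int r - m - 1 \<Longrightarrow> cid [\<E>] m \<odot> cc m (int r) =
    (\<Sum>i\<le>r. \<Sum>f\<le>r - i. cc (m + 2) (int f) \<odot> dts m (r - f))"
begin

lemma endo_commute: "f \<in> hom n [] [] \<Longrightarrow> g \<in> hom n [] [] \<Longrightarrow> f * g = g * f"
  using hc_eq_vcomp by metis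

lemma left_bubble_dts:
  assumes "z \<in> hom (m + 2) [] []"
  shows "(z \<odot> cid [\<E>] m) * dts m i = z \<odot> dts m i" "dts m i * (z \<odot> cid [\<E>] m) = z \<odot> dts m i"
  using hc_split[OF assms hom_dts, of m i] cid_hc_left[OF hom_dts, of "m + 2" m i] by simp_all

lemma right_bubble_dts: "dts m i * (cid [\<E>] m \<odot> c m r) = dts m i \<odot> c m r"
  using dts_times_bubble(1)[where n = m and i = i and j = 0 and r = r] by (simp add: dts_0)

text \<open>For \<open>m \<ge> -1\<close> the clockwise bubbles in question are real. Otherwise the
  counterclockwise bubbles in the region of weight \<open>m\<close> are real in every degree, and
  their slide reads \<open>U = G * (G * A)\<close> as an identity of series. The Grassmannian
  relation makes \<open>B\<close> inverse to \<open>A\<close> and \<open>V\<close> inverse to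
  \<open>U\<close>, so that inverting the slide gives \<open>B = G * (G * V)\<close>.\<close>

lemma bubble_slide:
  "c (m + 2) (int r) \<odot> cid [\<E>] m = (\<Sum>i\<le>r. \<Sum>f\<le>r - i. dts m (r - f) \<odot> c m (int f))"
proof (cases "m \<ge> -1")
  case True
  then have "int (nat (int r + m + 1)) = int r + m + 1"
    by simp
  then show ?thesis
    by (rule bubble_slide_real)
next
  case False
  let ?e = "cid [\<E>] m"
  define G where "G = Abs_fps (dts m)"
  define A where "A = Abs_fps (\<lambda>f. cc (m + 2) (int f) \<odot> ?e)"
  define B where "B = Abs_fps (\<lambda>f. c (m + 2) (int f) \<odot> ?e)"
  define U where "U = Abs_fps (\<lambda>f. ?e \<odot> cc m (int f))"
  define V where "V = Abs_fps (\<lambda>f. ?e \<odot> c m (int f))"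
  have hB: "c (m + 2) z \<odot> ?e \<in> hom m [\<E>] [\<E>]" and hV: "?e \<odot> c m z \<in> hom m [\<E>] [\<E>]" for z
    by (rule hom_intros refl | simp)+
  have GG: "(G * (G * F)) $ r = (\<Sum>i\<le>r. \<Sum>f\<le>r - i. dts m (r - f) * F $ f)" for F r
  proof -
    have "(\<Sum>j=0..r - i. dts m i * (dts m j * F $ (r - i - j))) = (\<Sum>f\<le>r - i. dts m (r - f) * F $ f)"
      if "i \<le> r" for i
      using that by (intro sum.reindex_bij_witness[of _ "\<lambda>f. r - i - f" "\<lambda>j. r - i - j"])
        (auto simp: mult.assoc[symmetric] dts_add intro!: arg_cong[where f = "\<lambda>j. dts m j * _"])
    then show ?thesis
      by (simp add: fps_mult_nth G_def sum_distrib_left atLeast0AtMost)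
  qed
  have U: "U = G * (G * A)"
  proof (rule fps_ext)
    fix r
    have "int (nat (int r - m - 1)) = int r - m - 1"
      using False by simp
    from cc_slide[OF this] show "U $ r = (G * (G * A)) $ r"
      by (simp add: GG U_def A_def left_bubble_dts(2)[OF hom_cc])
  qed
  have delta: "(\<Sum>i=0..k. cc n (int i) * c n (int (k - i))) = (if k = 0 then cid [] n else 0)" for n k
    using infinite_grassmannian[of k n] by (auto simp: atLeast0AtMost cc_zero c_zero cid_idem)
  have AB: "A * B = fps_const ?e"
  proof (rule fps_ext)
    fix k
    have "(A * B) $ k = (\<Sum>i=0..k. (cc (m + 2) (int i) * c (m + 2) (int (k - i))) \<odot> ?e)"
      unfolding fps_mult_nth A_def B_def fps_nth_Abs_fps
      by (intro sum.cong refl whisker_right[OF hom_cc hom_c]) simp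
    then show "(A * B) $ k = fps_const ?e $ k"
      by (simp only: hc_sum[symmetric] delta) (simp add: cid_hc_cid)
  qed
  have UV: "U * V = fps_const ?e"
  proof (rule fps_ext)
    fix k
    have "(U * V) $ k = (\<Sum>i=0..k. ?e \<odot> (cc m (int i) * c m (int (k - i))))"
      unfolding fps_mult_nth U_def V_def fps_nth_Abs_fps
      by (intro sum.cong refl whisker_left[OF hom_cc hom_c]) simp
    then show "(U * V) $ k = fps_const ?e $ k"
      by (simp only: hc_sum[symmetric] delta) (simp add: cid_hc_cid)
  qed
  have BA: "B * A = A * B"
  proof (rule commute_fps_mult)
    fix p q
    have "(c (m + 2) (int p) \<odot> ?e) * (cc (m + 2) (int q) \<odot> ?e) =
        (c (m + 2) (int p) * cc (m + 2) (int q)) \<odot> ?e"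
      by (rule whisker_right[OF hom_c hom_cc]) simp
    also have "\<dots> = (cc (m + 2) (int q) * c (m + 2) (int p)) \<odot> ?e"
      by (simp only: endo_commute[OF hom_c hom_cc])
    also have "\<dots> = (cc (m + 2) (int q) \<odot> ?e) * (c (m + 2) (int p) \<odot> ?e)"
      by (rule whisker_right[OF hom_cc hom_c, symmetric]) simp
    finally show "B $ p * A $ q = A $ q * B $ p"
      by (simp add: A_def B_def)
  qed
  have BG: "B * G = G * B"
    by (rule commute_fps_mult) (simp add: B_def G_def left_bubble_dts[OF hom_c])
  have Be: "B * fps_const ?e = B"
    by (rule fps_ext) (simp add: B_def cid_right[OF hB])
  have eV: "fps_const ?e * V = V"
    by (rule fps_ext) (simp add: V_def cid_left[OF hV])
  have "B = B * (G * (G * A)) * V"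
    using Be UV U by (simp add: mult.assoc)
  also have "\<dots> = G * (G * (B * A)) * V"
    by (simp only: mult.assoc[symmetric] BG) (simp only: mult.assoc BG mult.assoc[symmetric, of B G])
  also have "\<dots> = G * (G * V)"
    by (simp only: BA AB eV mult.assoc)
  finally have "B $ r = (G * (G * V)) $ r"
    by simp
  then show ?thesis
    unfolding GG by (simp add: B_def V_def right_bubble_dts)
qed

text \<open>The slide with one of its two factors \<open>G\<close> moved to the other side. The row
  \<open>i = 0\<close> of the double sum is the single sum here, and the remaining rows are a dot
  times the slide in degree \<open>r - 1\<close>.\<close>

lemma bubble_slide_cancel:
  "(\<Sum>p=0..r. dts m p \<odot> c m (int (r - p))) =
    c (m + 2) (int r) \<odot> cid [\<E>] m - (if r = 0 then 0 else c (m + 2) (int (r - 1)) \<odot> x m)"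
proof -
  have "(\<Sum>p=0..r. dts m p \<odot> c m (int (r - p))) = (\<Sum>f\<le>r. dts m (r - f) \<odot> c m (int f))"
    by (rule sum.reindex_bij_witness[of _ "\<lambda>f. r - f" "\<lambda>p. r - p"]) auto
  also have "\<dots> = c (m + 2) (int r) \<odot> cid [\<E>] m -
      (if r = 0 then 0 else c (m + 2) (int (r - 1)) \<odot> x m)"
  proof (cases r)
    case 0
    then show ?thesis
      using bubble_slide[of m 0] by simp
  next
    case (Suc s)
    have "c (m + 2) (int s) \<odot> x m = dts m 1 * (c (m + 2) (int s) \<odot> cid [\<E>] m)"
      using left_bubble_dts(2)[OF hom_c, of m 1] by (simp add: dts_1)
    also have "\<dots> = (\<Sum>i\<le>s. \<Sum>f\<le>s - i. dts m (Suc s - f) \<odot> c m (int f))"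
      unfolding bubble_slide sum_distrib_left
      by (intro sum.cong refl) (simp add: dts_times_bubble Suc_diff_le)
    also have "\<dots> = (\<Sum>i\<in>{1..Suc s}. \<Sum>f\<le>Suc s - i. dts m (Suc s - f) \<odot> c m (int f))"
      by (rule sum.reindex_bij_witness[of _ "\<lambda>i. i - 1" Suc]) auto
    finally have 1: "c (m + 2) (int s) \<odot> x m =
        (\<Sum>i\<in>{1..Suc s}. \<Sum>f\<le>Suc s - i. dts m (Suc s - f) \<odot> c m (int f))" .
    have "{..Suc s} = insert 0 {1..Suc s}"
      by auto
    then have "c (m + 2) (int r) \<odot> cid [\<E>] m =
       (\<Sum>f\<le>Suc s. dts m (Suc s - f) \<odot> c m (int f)) + c (m + 2) (int s) \<odot> x m"
      unfolding bubble_slide 1 Suc by (simp del: sum.atMost_Suc sum.cl_ivl_Suc)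
    then show ?thesis
      by (simp add: Suc del: sum.atMost_Suc)
  qed
  finally show ?thesis .
qed

end

context bubble_slides
begin

subsection \<open>The action of the nilHecke ring\<close>

definition emb :: "nat \<Rightarrow> nat \<Rightarrow> nat \<Rightarrow> int \<Rightarrow> 'a \<Rightarrow> 'a" where
  "emb w i j n f = cid (replicate i \<E>) (n + 2 * (int w + int j)) \<odot> f \<odot> cid (replicate j \<E>) n"

lemma hom_emb:
  assumes "f \<in> hom (n + 2 * int j) (replicate w \<E>) (replicate w \<E>)" "b = i + w + j"
  shows "emb w i j n f \<in> hom n (replicate b \<E>) (replicate b \<E>)"
  unfolding emb_def
  by (rule hom_hcomp[OF hom_cid hom_hcomp[OF assms(1) hom_cid _ refl refl]])
    (simp_all add: assms(2) replicate_add[symmetric] algebra_simps)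

lemma emb_mult:
  assumes "f \<in> hom (n + 2 * int j) (replicate w \<E>) (replicate w \<E>)"
    and "g \<in> hom (n + 2 * int j) (replicate w \<E>) (replicate w \<E>)"
  shows "emb w i j n f * emb w i j n g = emb w i j n (f * g)"
proof -
  have h: "k \<odot> cid (replicate j \<E>) n \<in> hom n (replicate w \<E> @ replicate j \<E>) (replicate w \<E> @ replicate j \<E>)"
    if "k \<in> hom (n + 2 * int j) (replicate w \<E>) (replicate w \<E>)" for k
    by (rule hom_hcomp[OF that hom_cid _ refl refl]) simp
  show ?thesis
    unfolding emb_def
    by (subst whisker_left[OF h[OF assms(1)] h[OF assms(2)]])
      (simp_all add: algebra_simps whisker_right[OF assms])
qed

lemma emb_cid: "b = i + w + j \<Longrightarrow> emb w i j n (cid (replicate w \<E>) (n + 2 * int j)) = cid (replicate b \<E>) n"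
  unfolding emb_def by (simp add: cid_hc_cid replicate_add[symmetric] algebra_simps)

lemma emb_linear: "emb w i j n (f + g) = emb w i j n f + emb w i j n g"
  "emb w i j n (f - g) = emb w i j n f - emb w i j n g" "emb w i j n 0 = 0"
  by (simp_all add: emb_def hc_add hc_diff)

text \<open>Interchange for operations that share no strand; \<open>d\<close> is the number of idle
  strands between them.\<close>

lemma emb_far:
  assumes f: "f \<in> hom (n + 2 * int (d + v + j)) (replicate w \<E>) (replicate w \<E>)"
    and g: "g \<in> hom (n + 2 * int j) (replicate v \<E>) (replicate v \<E>)"
  shows "emb w i (d + v + j) n f * emb v (i + w + d) j n g =
    emb v (i + w + d) j n g * emb w i (d + v + j) n f"
proof -
  let ?k = "n + 2 * int (d + v + j)" and ?l = "n + 2 * (int w + int (d + v + j))"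
  let ?W = "replicate (d + v + j) \<E>"
  have g': "emb v d j n g \<in> hom n ?W ?W"
    by (rule hom_emb[OF g refl])
  have 1: "emb v (i + w + d) j n g = cid (replicate i \<E>) ?l \<odot> (cid (replicate w \<E>) ?k \<odot> emb v d j n g)"
    unfolding emb_def by (simp add: cid_hc_cid_hc replicate_add[symmetric] algebra_simps)
  have 2: "emb w i (d + v + j) n f = cid (replicate i \<E>) ?l \<odot> (f \<odot> cid ?W n)"
    by (simp add: emb_def)
  have h1: "f \<odot> cid ?W n \<in> hom n (replicate w \<E> @ ?W) (replicate w \<E> @ ?W)"
    by (rule hom_hcomp[OF f hom_cid _ refl refl]) simp
  have h2: "cid (replicate w \<E>) ?k \<odot> emb v d j n g \<in> hom n (replicate w \<E> @ ?W) (replicate w \<E> @ ?W)"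
    by (rule hom_hcomp[OF hom_cid g' _ refl refl]) simp
  have "(f \<odot> cid ?W n) * (cid (replicate w \<E>) ?k \<odot> emb v d j n g) =
      (cid (replicate w \<E>) ?k \<odot> emb v d j n g) * (f \<odot> cid ?W n)"
    using hc_split[OF f g'] by simp
  then show ?thesis
    unfolding 1 2 using whisker_left[OF h1 h2, of ?l "replicate i \<E>"]
      whisker_left[OF h2 h1, of ?l "replicate i \<E>"]
    by (simp add: algebra_simps)
qed

definition Xs :: "int \<Rightarrow> nat \<Rightarrow> nat \<Rightarrow> 'a" where
  "Xs n b i = emb 1 i (b - i - 1) n (x (n + 2 * int (b - i - 1)))"

definition Ss :: "int \<Rightarrow> nat \<Rightarrow> nat \<Rightarrow> 'a" where
  "Ss n b i = emb 2 i (b - i - 2) n (cr (n + 2 * int (b - i - 2)))"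

lemma hom_x': "x n \<in> hom n (replicate 1 \<E>) (replicate 1 \<E>)"
  and hom_cr': "cr n \<in> hom n (replicate 2 \<E>) (replicate 2 \<E>)"
  using hom_x hom_cr by (simp_all add: numeral_2_eq_2)

lemma hom_Xs: "i < b \<Longrightarrow> Xs n b i \<in> hom n (replicate b \<E>) (replicate b \<E>)"
  unfolding Xs_def by (rule hom_emb[OF hom_x']) simp

lemma hom_Ss: "Suc i < b \<Longrightarrow> Ss n b i \<in> hom n (replicate b \<E>) (replicate b \<E>)"
  unfolding Ss_def by (rule hom_emb[OF hom_cr']) simp

lemma Xs_emb_2:
  assumes "b = i + 2 + j"
  shows "Xs n b i = emb 2 i j n (x (n + 2 * int j + 2) \<odot> cid [\<E>] (n + 2 * int j))"
    "Xs n b (Suc i) = emb 2 i j n (cid [\<E>] (n + 2 * int j + 2) \<odot> x (n + 2 * int j))"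
  unfolding Xs_def emb_def assms
  by (simp_all add: hc_assoc cid_hc_cid cid_hc_cid_hc replicate_append_same algebra_simps)

lemma Ss_emb_3:
  assumes "b = i + 3 + j"
  shows "Ss n b i = emb 3 i j n (cr (n + 2 * int j + 2) \<odot> cid [\<E>] (n + 2 * int j))"
    "Ss n b (Suc i) = emb 3 i j n (cid [\<E>] (n + 2 * int j + 4) \<odot> cr (n + 2 * int j))"
proof -
  have "b - i - 2 = Suc j" "b - Suc i - 2 = j"
    using assms by auto
  then show "Ss n b i = emb 3 i j n (cr (n + 2 * int j + 2) \<odot> cid [\<E>] (n + 2 * int j))"
    "Ss n b (Suc i) = emb 3 i j n (cid [\<E>] (n + 2 * int j + 4) \<odot> cr (n + 2 * int j))"
    unfolding Ss_def emb_def
    by (simp_all add: hc_assoc cid_hc_cid cid_hc_cid_hc replicate_append_same algebra_simps)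
qed

lemma nilhecke_strands: "nilhecke b (Xs n b) (Ss n b) (cid (replicate b \<E>) n)"
proof
  let ?e = "cid (replicate b \<E>) n"
  show "?e * ?e = ?e"
    by (rule cid_idem)
  show "?e * Xs n b i = Xs n b i" "Xs n b i * ?e = Xs n b i" if "i < b" for i
    using cid_left[OF hom_Xs[OF that]] cid_right[OF hom_Xs[OF that]] by auto
  show "?e * Ss n b i = Ss n b i" "Ss n b i * ?e = Ss n b i" if "Suc i < b" for i
    using cid_left[OF hom_Ss[OF that]] cid_right[OF hom_Ss[OF that]] by auto
  have XX: "Xs n b i * Xs n b j = Xs n b j * Xs n b i" if "i < j" "j < b" for i j
  proof -
    have e: "b - i - 1 = (j - i - 1) + 1 + (b - j - 1)" "j = i + 1 + (j - i - 1)"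
      using that by auto
    show ?thesis
      unfolding Xs_def using emb_far[where n = n and d = "j - i - 1" and j = "b - j - 1" and i = i and w = 1 and v = 1,
          OF hom_x' hom_x'] e by metis
  qed
  show "Xs n b i * Xs n b j = Xs n b j * Xs n b i" if "i < b" "j < b" for i j
    using XX[of i j] XX[of j i] that by (metis linorder_neqE_nat)
  show "Ss n b i * Ss n b j = Ss n b j * Ss n b i" if "Suc i < j" "Suc j < b" for i j
  proof -
    have e: "b - i - 2 = (j - i - 2) + 2 + (b - j - 2)" "j = i + 2 + (j - i - 2)"
      using that by auto
    show ?thesis
      unfolding Ss_def using emb_far[where n = n and d = "j - i - 2" and j = "b - j - 2" and i = i and w = 2 and v = 2,
          OF hom_cr' hom_cr'] e by metis
  qed
  show "Xs n b j * Ss n b i = Ss n b i * Xs n b j"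
    if "j < b" "Suc i < b" "j \<noteq> i" "j \<noteq> Suc i" for i j
  proof (cases "j < i")
    case True
    have e: "b - j - 1 = (i - j - 1) + 2 + (b - i - 2)" "i = j + 1 + (i - j - 1)"
      using that True by auto
    show ?thesis
      unfolding Ss_def Xs_def using emb_far[where n = n and d = "i - j - 1" and j = "b - i - 2" and i = j and w = 1 and v = 2,
          OF hom_x' hom_cr'] e by metis
  next
    case False
    then have e: "b - i - 2 = (j - i - 2) + 1 + (b - j - 1)" "j = i + 2 + (j - i - 2)"
      using that by auto
    show ?thesis
      unfolding Ss_def Xs_def using emb_far[where n = n and d = "j - i - 2" and j = "b - j - 1" and i = i and w = 2 and v = 1,
          OF hom_cr' hom_x'] e by metis
  qed
  have two: "\<exists>j. b = i + 2 + j" if "Suc i < b" for i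
    using that by (intro exI[of _ "b - i - 2"]) simp
  have hx: "x (k + 2) \<odot> cid [\<E>] k \<in> hom k (replicate 2 \<E>) (replicate 2 \<E>)"
    "cid [\<E>] (k + 2) \<odot> x k \<in> hom k (replicate 2 \<E>) (replicate 2 \<E>)" for k
    by (rule hom_intros | simp add: numeral_2_eq_2)+
  show "Ss n b i * Ss n b i = 0" if "Suc i < b" for i
    unfolding Ss_def by (simp add: emb_mult[OF hom_cr' hom_cr'] cr_nil emb_linear)
  show "Ss n b i * Xs n b i = Xs n b (Suc i) * Ss n b i + ?e"
    "Xs n b i * Ss n b i = Ss n b i * Xs n b (Suc i) + ?e" if i: "Suc i < b" for i
  proof -
    obtain j where j: "b = i + 2 + j"
      using two[OF i] by blast
    have S: "Ss n b i = emb 2 i j n (cr (n + 2 * int j))"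
      by (simp add: Ss_def j)
    have e: "?e = emb 2 i j n (cid [\<E>, \<E>] (n + 2 * int j))"
      using emb_cid[OF j, of n] by (simp add: numeral_2_eq_2)
    have "Ss n b i * Xs n b i - Xs n b (Suc i) * Ss n b i = ?e"
      unfolding S Xs_emb_2[OF j] emb_mult[OF hom_cr' hx(1)] emb_mult[OF hx(2) hom_cr']
        emb_linear(2)[symmetric] e slide1[symmetric] ..
    then show "Ss n b i * Xs n b i = Xs n b (Suc i) * Ss n b i + ?e"
      by (simp add: algebra_simps)
    have "Xs n b i * Ss n b i - Ss n b i * Xs n b (Suc i) = ?e"
      unfolding S Xs_emb_2[OF j] emb_mult[OF hom_cr' hx(2)] emb_mult[OF hx(1) hom_cr']
        emb_linear(2)[symmetric] e slide2[symmetric] ..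
    then show "Xs n b i * Ss n b i = Ss n b i * Xs n b (Suc i) + ?e"
      by (simp add: algebra_simps)
  qed
  show "Ss n b i * Ss n b (Suc i) * Ss n b i = Ss n b (Suc i) * Ss n b i * Ss n b (Suc i)"
    if i: "Suc (Suc i) < b" for i
  proof -
    obtain j where j: "b = i + 3 + j"
      using i by (metis add.commute add_Suc_right less_iff_Suc_add numeral_3_eq_3 add_Suc plus_nat.add_0)
    have h: "cr (k + 2) \<odot> cid [\<E>] k \<in> hom k (replicate 3 \<E>) (replicate 3 \<E>)"
      "cid [\<E>] (k + 4) \<odot> cr k \<in> hom k (replicate 3 \<E>) (replicate 3 \<E>)" for k
      by (rule hom_intros | simp add: numeral_3_eq_3)+
    have hh: "f * g \<in> hom k V V" if "f \<in> hom k V V" "g \<in> hom k V V" for f g k V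
      by (rule hom_vcomp[OF that])
    show ?thesis
      unfolding Ss_emb_3[OF j] emb_mult[OF h(1) h(2)] emb_mult[OF h(2) h(1)]
        emb_mult[OF hh[OF h(1) h(2)] h(1)] emb_mult[OF hh[OF h(2) h(1)] h(2)] cr_braid ..
  qed
qed

end

sublocale bubble_slides \<subseteq> NH: nilhecke b "Xs n b" "Ss n b" "cid (replicate b \<E>) n" for n b
  by (rule nilhecke_strands)

context bubble_slides
begin

declare replicate_Suc [simp del]

abbreviation RE :: "nat \<Rightarrow> word" where "RE b \<equiv> replicate b \<E>"
abbreviation RF :: "nat \<Rightarrow> word" where "RF b \<equiv> replicate b \<F>"

lemma hom_Xpow: "i < b \<Longrightarrow> NH.Xpow n b i p \<in> hom n (RE b) (RE b)"
  by (induction p) (auto intro: hom_vcomp hom_cid hom_Xs)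

lemma hom_mon: "t \<le> b \<Longrightarrow> NH.mon b n k t \<in> hom n (RE b) (RE b)"
  by (induction t) (simp_all add: hom_cid hom_vcomp[OF hom_Xpow])

lemma hom_Sw: "(\<And>i. i \<in> set ws \<Longrightarrow> Suc i < b) \<Longrightarrow> NH.Sw n b ws \<in> hom n (RE b) (RE b)"
  by (induction ws) (auto intro: hom_vcomp hom_cid hom_Ss)

lemma hom_W: "NH.W n b b \<in> hom n (RE b) (RE b)"
  unfolding NH.W_def by (rule hom_Sw) (auto dest: staircase_word_less)

section \<open>Splitting off the last strand\<close>

lemma Xs_level: "i < b \<Longrightarrow> Xs n (Suc b) i = Xs (n + 2) b i \<odot> cid [\<E>] n"
proof -
  assume "i < b"
  then obtain j where j: "b = Suc (i + j)"
    using less_iff_Suc_add by auto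
  show ?thesis
    unfolding Xs_def emb_def j
    by (simp add: hc_assoc cid_hc_cid cid_hc_cid_hc replicate_append_same replicate_Suc algebra_simps)
qed

lemma Ss_level: "Suc i < b \<Longrightarrow> Ss n (Suc b) i = Ss (n + 2) b i \<odot> cid [\<E>] n"
proof -
  assume "Suc i < b"
  then obtain j where j: "b = Suc (Suc (i + j))"
    using less_iff_Suc_add by auto
  show ?thesis
    unfolding Ss_def emb_def j
    by (simp add: hc_assoc cid_hc_cid cid_hc_cid_hc replicate_append_same replicate_Suc algebra_simps)
qed

lemma cid_level: "cid (RE (Suc b)) n = cid (RE b) (n + 2) \<odot> cid [\<E>] n"
  by (simp add: cid_hc_cid replicate_append_same replicate_Suc)

lemma Xpow_level: "i < b \<Longrightarrow> NH.Xpow n (Suc b) i p = NH.Xpow (n + 2) b i p \<odot> cid [\<E>] n"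
  by (induction p) (simp_all add: cid_level[symmetric] Xs_level
      whisker_right[OF hom_Xs hom_Xpow])

lemma Sw_level: "(\<And>i. i \<in> set ws \<Longrightarrow> Suc i < b) \<Longrightarrow>
    NH.Sw n (Suc b) ws = NH.Sw (n + 2) b ws \<odot> cid [\<E>] n"
  by (induction ws) (simp_all add: cid_level[symmetric] Ss_level
      whisker_right[OF hom_Ss hom_Sw])

lemma Xs_last: "Xs n (Suc b) b = cid (RE b) (n + 2) \<odot> x n"
  by (simp add: Xs_def emb_def cid_hc_right[OF hom_x])

lemma Xpow_last: "NH.Xpow n (Suc b) b p = cid (RE b) (n + 2) \<odot> dts n p"
  by (induction p) (simp_all add: dts_0 dts_Suc Xs_last cid_level[symmetric]
      whisker_left[OF hom_x hom_dts])

lemma hom_last: "cid (RE b) (n + 2) \<odot> dts n p \<in> hom n (RE (Suc b)) (RE (Suc b))"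
  using hom_Xpow[of b "Suc b" n p] by (simp only: Xpow_last lessI)

lemma mon_level:
  "t \<le> b \<Longrightarrow> NH.mon (Suc b) n k (Suc t) =
    (NH.mon b (n + 2) k t \<odot> cid [\<E>] n) * (cid (RE b) (n + 2) \<odot> dts n (k b))"
proof (induction t)
  case 0
  then show ?case
    using cid_left[OF hom_last] cid_right[OF hom_last]
    by (simp add: Xpow_last cid_level[symmetric])
next
  case (Suc t)
  have "NH.mon (Suc b) n k (Suc (Suc t)) =
      (NH.Xpow (n + 2) b (b - Suc t) (k (b - Suc t)) \<odot> cid [\<E>] n) *
      ((NH.mon b (n + 2) k t \<odot> cid [\<E>] n) * (cid (RE b) (n + 2) \<odot> dts n (k b)))"
    using Suc by (subst NH.mon.simps(2)) (simp add: Xpow_level del: NH.mon.simps)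
  also have "\<dots> = ((NH.Xpow (n + 2) b (b - Suc t) (k (b - Suc t)) \<odot> cid [\<E>] n) *
      (NH.mon b (n + 2) k t \<odot> cid [\<E>] n)) * (cid (RE b) (n + 2) \<odot> dts n (k b))"
    by (simp only: mult.assoc)
  also have "(NH.Xpow (n + 2) b (b - Suc t) (k (b - Suc t)) \<odot> cid [\<E>] n) *
      (NH.mon b (n + 2) k t \<odot> cid [\<E>] n) = NH.mon b (n + 2) k (Suc t) \<odot> cid [\<E>] n"
    using Suc.prems by (subst whisker_right[OF hom_Xpow hom_mon]) auto
  finally show ?case .
qed

text \<open>\<open>bubble_slide_cancel\<close> on one strand, with the idle strands added on both
  sides. It is stated in exactly the form that \<open>Hf_eq_Ef\<close> asks for.\<close>

lemma bubble_strands: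
  assumes "t < b"
  shows "NH.G m b (b - Suc t) *
      Abs_fps (\<lambda>f. cid (RE (b - t)) (m + 2 * int t) \<odot> c (m + 2 * int t) (int f) \<odot> cid (RE t) m) =
    NH.L m b (b - Suc t) *
      Abs_fps (\<lambda>f. cid (RE (b - Suc t)) (m + 2 * int (Suc t)) \<odot> c (m + 2 * int (Suc t)) (int f)
        \<odot> cid (RE (Suc t)) m)"
proof (rule fps_ext)
  fix N :: nat
  let ?i = "b - Suc t" and ?l = "m + 2 * int t"
  obtain i where i: "b = Suc (i + t)"
    using assms less_iff_Suc_add by (metis add.commute)
  then have bt: "b - t = Suc i" "b - Suc t = i"
    by auto
  have hE: "f \<in> hom ?l (RE (Suc 0)) (RE (Suc 0))" if "f \<in> hom ?l [\<E>] [\<E>]" for f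
    using that by (simp add: replicate_Suc)
  have Xp: "NH.Xpow m b i p = emb (Suc 0) i t m (dts ?l p)" for p
  proof (induction p)
    case 0
    have "emb (Suc 0) i t m (cid [\<E>] ?l) = cid (RE b) m"
      using emb_cid[of b i "Suc 0" t m] i by (simp add: replicate_Suc[of 0])
    then show ?case
      unfolding NH.Xpow.simps dts_0 by simp
  next
    case (Suc p)
    have "Xs m b i = emb (Suc 0) i t m (x ?l)"
      by (simp add: Xs_def i)
    then show ?case
      using Suc emb_mult[OF hE[OF hom_x] hE[OF hom_dts], of i p] by (simp add: dts_Suc)
  qed
  have hEc: "cid [\<E>] ?l \<odot> c ?l z \<in> hom ?l [\<E>] [\<E>]" for z
    by (rule hom_intros refl | simp)+
  have hcE: "c (?l + 2) z \<odot> cid [\<E>] ?l \<in> hom ?l [\<E>] [\<E>]" for z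
    by (rule hom_intros refl | simp)+
  have B0: "cid (RE (b - t)) ?l \<odot> c ?l z \<odot> cid (RE t) m = emb (Suc 0) i t m (cid [\<E>] ?l \<odot> c ?l z)" for z
    unfolding emb_def bt
    by (simp add: hc_assoc cid_hc_cid_hc replicate_append_same replicate_Suc algebra_simps)
  have B1: "cid (RE i) (m + 2 * int (Suc t)) \<odot> c (m + 2 * int (Suc t)) z \<odot> cid (RE (Suc t)) m =
      emb (Suc 0) i t m (c (?l + 2) z \<odot> cid [\<E>] ?l)" for z
    unfolding emb_def by (simp add: hc_assoc cid_hc_cid replicate_Suc algebra_simps)
  have e1: "cid (RE b) m * emb (Suc 0) i t m f = emb (Suc 0) i t m f" if "f \<in> hom ?l [\<E>] [\<E>]" for f
    by (rule cid_left[OF hom_emb[OF hE[OF that]]]) (simp add: i)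
  have sum: "(\<Sum>p=0..N. emb (Suc 0) i t m (f p)) = emb (Suc 0) i t m (\<Sum>p=0..N. f p)" for f
    unfolding emb_def by (simp add: hc_sum)
  have "(NH.G m b ?i * Abs_fps (\<lambda>f. cid (RE (b - t)) ?l \<odot> c ?l (int f) \<odot> cid (RE t) m)) $ N =
      (\<Sum>p=0..N. emb (Suc 0) i t m (dts ?l p \<odot> c ?l (int (N - p))))"
    unfolding fps_mult_nth NH.G_nth fps_nth_Abs_fps B0 unfolding bt Xp
    by (simp only: emb_mult[OF hE[OF hom_dts] hE[OF hEc]] right_bubble_dts)
  also have "\<dots> = emb (Suc 0) i t m (c (?l + 2) (int N) \<odot> cid [\<E>] ?l -
      (if N = 0 then 0 else c (?l + 2) (int (N - 1)) \<odot> x ?l))"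
    unfolding sum bubble_slide_cancel ..
  also have "\<dots> = (NH.L m b ?i *
      Abs_fps (\<lambda>f. cid (RE (b - Suc t)) (m + 2 * int (Suc t)) \<odot> c (m + 2 * int (Suc t)) (int f)
        \<odot> cid (RE (Suc t)) m)) $ N"
  proof (cases N)
    case 0
    show ?thesis
      unfolding 0 NH.L_mult_nth fps_nth_Abs_fps bt B1 by (simp add: e1[OF hcE])
  next
    case (Suc M)
    have Xs: "Xs m b i = emb (Suc 0) i t m (dts ?l 1)"
      using Xp[of 1] cid_right[OF hom_Xs[of i b m]] by (simp add: i)
    have "Xs m b i * emb (Suc 0) i t m (c (?l + 2) (int M) \<odot> cid [\<E>] ?l) =
        emb (Suc 0) i t m (c (?l + 2) (int M) \<odot> x ?l)"
      unfolding Xs emb_mult[OF hE[OF hom_dts] hE[OF hcE]] left_bubble_dts(2)[OF hom_c]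
      by (simp add: dts_1)
    then show ?thesis
      unfolding Suc NH.L_mult_nth fps_nth_Abs_fps bt B1 by (simp add: e1[OF hcE] emb_linear)
  qed
  finally show "(NH.G m b ?i *
      Abs_fps (\<lambda>f. cid (RE (b - t)) ?l \<odot> c ?l (int f) \<odot> cid (RE t) m)) $ N = \<dots>" .
qed

text \<open>Moving the bubbles from the right of all strands to the left turns complete polynomials
  into signed elementary ones. This matters because elementary polynomials raise each exponent by at
  most one.\<close>

lemma bubble_all_strands:
  "(\<Sum>f=0..P. NH.Hf b m b $ f * (cid (RE b) m \<odot> c m (int (P - f)))) =
   (\<Sum>j=0..P. NH.Ef b m b $ j * (c (m + 2 * int b) (int (P - j)) \<odot> cid (RE b) m))"
proof -
  define B where "B t = Abs_fps (\<lambda>f. cid (RE (b - t)) (m + 2 * int t) \<odot> c (m + 2 * int t) (int f)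
    \<odot> cid (RE t) m)" for t
  have h: "cid (RE b) m \<odot> c m z \<in> hom m (RE b) (RE b)" "c (m + 2 * int b) z \<odot> cid (RE b) m \<in> hom m (RE b) (RE b)" for z
    by (rule hom_hcomp[OF hom_cid hom_c] hom_hcomp[OF hom_c hom_cid]; simp)+
  have "NH.Hf b m b * B 0 = NH.Ef b m b * B b"
    unfolding B_def by (rule NH.Hf_eq_Ef[OF bubble_strands order.refl])
  then have "(NH.Hf b m b * B 0) $ P = (NH.Ef b m b * B b) $ P"
    by simp
  then show ?thesis
    unfolding fps_mult_nth B_def fps_nth_Abs_fps
    using cid_hc_right[OF h(1)] cid_hc_left[OF h(2)] by (simp add: hc_assoc)
qed

subsection \<open>Closing the strands\<close>

text \<open>\<open>ncap'\<close> rebuilt from the data of the locale, so that its mirror instance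
  yields \<open>ncap\<close>.\<close>

fun nca' :: "nat \<Rightarrow> int \<Rightarrow> 'a" where
  "nca' 0 n = cid [] n"
| "nca' (Suc a) n = ca' n * (cid [\<E>] (n - 2) \<odot> nca' a (n - 2) \<odot> cid [\<F>] n)"

fun ncu' :: "nat \<Rightarrow> int \<Rightarrow> 'a" where
  "ncu' 0 n = cid [] n"
| "ncu' (Suc a) n = (cid [\<E>] (n - 2) \<odot> ncu' a (n - 2) \<odot> cid [\<F>] n) * cu' n"

lemma hom_nca': "nca' a n \<in> hom n (RE a @ RF a) []"
proof (induction a arbitrary: n)
  case (Suc a)
  show ?case
    unfolding nca'.simps
    by (rule hom_vcomp[OF hom_ca'] hom_hcomp[OF hom_cid] hom_hcomp[OF Suc hom_cid] refl
      | simp add: replicate_append_same replicate_Suc)+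
qed (simp add: hom_cid)

lemma hom_ncu': "ncu' a n \<in> hom n [] (RE a @ RF a)"
proof (induction a arbitrary: n)
  case (Suc a)
  show ?case
    unfolding ncu'.simps
    by (rule hom_vcomp[OF _ hom_cu'] hom_hcomp[OF hom_cid] hom_hcomp[OF Suc hom_cid] refl
      | simp add: replicate_append_same replicate_Suc)+
qed (simp add: hom_cid)

lemma hom_inner:
  "cid (RE a) (n - 2 * int a) \<odot> ca' (n - 2 * int a) \<odot> cid (RF a) n \<in>
    hom n (RE (Suc a) @ RF (Suc a)) (RE a @ RF a)"
  "cid (RE a) (n - 2 * int a) \<odot> cu' (n - 2 * int a) \<odot> cid (RF a) n \<in>
    hom n (RE a @ RF a) (RE (Suc a) @ RF (Suc a))"
  by (rule hom_hcomp[OF hom_cid] hom_hcomp[OF hom_ca' hom_cid] hom_hcomp[OF hom_cu' hom_cid] refl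
    | simp add: replicate_append_same replicate_Suc)+

lemma whisker_both:
  assumes "f \<in> hom k V W" "g \<in> hom k U V" "k = n + wt B" "l = k + wt U"
  shows "cid A l \<odot> (f * g) \<odot> cid B n = (cid A l \<odot> f \<odot> cid B n) * (cid A l \<odot> g \<odot> cid B n)"
proof -
  have "f \<odot> cid B n \<in> hom n (V @ B) (W @ B)" "g \<odot> cid B n \<in> hom n (U @ B) (V @ B)"
    using assms by (auto intro!: hom_hcomp hom_cid)
  then show ?thesis
    using whisker_right[OF assms(1-3)] whisker_left[of "f \<odot> cid B n" n "V @ B" "W @ B" "g \<odot> cid B n" "U @ B" l A]
    using assms(3,4) by simp
qed

text \<open>The definition adds an outermost cap, which belongs to the first strand. Strands are
  closed beginning with the last one, whose cap is innermost, so a recursion from the inside is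
  required.\<close>

lemma nca'_inner: "nca' (Suc a) n = nca' a n * (cid (RE a) (n - 2 * int a) \<odot> ca' (n - 2 * int a) \<odot> cid (RF a) n)"
proof (induction a arbitrary: n)
  case 0
  have "cid [\<E>] (n - 2) \<odot> cid [] (n - 2) \<odot> cid [\<F>] n = cid [\<E>, \<F>] n"
    by (simp add: cid_hc_cid)
  then show ?case
    using cid_left[OF hom_ca'] cid_right[OF hom_ca']
    by (simp add: cid_hc_left[OF hom_ca'] cid_hc_right[OF hom_ca'])
next
  case (Suc a)
  have eq: "n - 2 - 2 * int a = n - 2 * int (Suc a)"
    by simp
  have "nca' (Suc (Suc a)) n = ca' n * (cid [\<E>] (n - 2) \<odot>
      (nca' a (n - 2) * (cid (RE a) (n - 2 - 2 * int a) \<odot> ca' (n - 2 - 2 * int a) \<odot> cid (RF a) (n - 2)))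
      \<odot> cid [\<F>] n)"
    by (simp only: nca'.simps(2)[of "Suc a"] Suc)
  also have "\<dots> = nca' (Suc a) n * (cid [\<E>] (n - 2) \<odot>
      (cid (RE a) (n - 2 - 2 * int a) \<odot> ca' (n - 2 - 2 * int a) \<odot> cid (RF a) (n - 2)) \<odot> cid [\<F>] n)"
    by (subst whisker_both[OF hom_nca' hom_inner(1)]) (simp_all add: mult.assoc)
  also have "cid [\<E>] (n - 2) \<odot>
      (cid (RE a) (n - 2 - 2 * int a) \<odot> ca' (n - 2 - 2 * int a) \<odot> cid (RF a) (n - 2)) \<odot> cid [\<F>] n =
      cid (RE (Suc a)) (n - 2 * int (Suc a)) \<odot> ca' (n - 2 * int (Suc a)) \<odot> cid (RF (Suc a)) n"
    by (simp add: hc_assoc cid_hc_cid cid_hc_cid_hc replicate_append_same replicate_Suc eq[simplified] algebra_simps)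
  finally show ?case .
qed

lemma ncu'_inner: "ncu' (Suc a) n = (cid (RE a) (n - 2 * int a) \<odot> cu' (n - 2 * int a) \<odot> cid (RF a) n) * ncu' a n"
proof (induction a arbitrary: n)
  case 0
  have "cid [\<E>] (n - 2) \<odot> cid [] (n - 2) \<odot> cid [\<F>] n = cid [\<E>, \<F>] n"
    by (simp add: cid_hc_cid)
  then show ?case
    using cid_left[OF hom_cu'] cid_right[OF hom_cu']
    by (simp add: cid_hc_left[OF hom_cu'] cid_hc_right[OF hom_cu'])
next
  case (Suc a)
  have eq: "n - 2 - 2 * int a = n - 2 * int (Suc a)"
    by simp
  have "ncu' (Suc (Suc a)) n = (cid [\<E>] (n - 2) \<odot>
      ((cid (RE a) (n - 2 - 2 * int a) \<odot> cu' (n - 2 - 2 * int a) \<odot> cid (RF a) (n - 2)) * ncu' a (n - 2))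
      \<odot> cid [\<F>] n) * cu' n"
    by (simp only: ncu'.simps(2)[of "Suc a"] Suc)
  also have "\<dots> = (cid [\<E>] (n - 2) \<odot>
      (cid (RE a) (n - 2 - 2 * int a) \<odot> cu' (n - 2 - 2 * int a) \<odot> cid (RF a) (n - 2)) \<odot> cid [\<F>] n)
      * ncu' (Suc a) n"
    by (subst whisker_both[OF hom_inner(2) hom_ncu']) (simp_all add: mult.assoc)
  also have "cid [\<E>] (n - 2) \<odot>
      (cid (RE a) (n - 2 - 2 * int a) \<odot> cu' (n - 2 - 2 * int a) \<odot> cid (RF a) (n - 2)) \<odot> cid [\<F>] n =
      cid (RE (Suc a)) (n - 2 * int (Suc a)) \<odot> cu' (n - 2 * int (Suc a)) \<odot> cid (RF (Suc a)) n"
    by (simp add: hc_assoc cid_hc_cid cid_hc_cid_hc replicate_append_same replicate_Suc eq[simplified] algebra_simps)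
  finally show ?case .
qed

end

context bubble_slides
begin

definition closure :: "nat \<Rightarrow> int \<Rightarrow> 'a \<Rightarrow> 'a" where
  "closure b n f = nca' b n * (f \<odot> cid (RF b) n) * ncu' b n"

lemma closure_linear:
  "closure b n (f - g) = closure b n f - closure b n g" "closure b n 0 = 0"
  "closure b n (f + g) = closure b n f + closure b n g"
  "closure b n (sum h A) = (\<Sum>i\<in>A. closure b n (h i))"
  "closure b n (alt j f) = alt j (closure b n f)"
  by (simp_all add: closure_def hc_diff hc_add hc_sum hc_uminus alt_def algebra_simps sum_distrib_left
      sum_distrib_right)

text \<open>The partial trace: only the last strand is closed, to the right, and \<open>b\<close>
  strands stay open.\<close>

definition ptr :: "nat \<Rightarrow> int \<Rightarrow> 'a \<Rightarrow> 'a" where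
  "ptr b m f = (cid (RE b) m \<odot> ca' m) * (f \<odot> cid [\<F>] m) * (cid (RE b) m \<odot> cu' m)"

lemma hom_ptr_ends:
  "cid (RE b) m \<odot> ca' m \<in> hom m (RE b @ [\<E>, \<F>]) (RE b)"
  "cid (RE b) m \<odot> cu' m \<in> hom m (RE b) (RE b @ [\<E>, \<F>])"
  by (rule hom_hcomp[OF hom_cid hom_ca'] hom_hcomp[OF hom_cid hom_cu'] refl | simp)+

lemma closure_Suc:
  assumes f: "f \<in> hom (m - 2) (RE (Suc b)) (RE (Suc b))" and m: "m = n - 2 * int b"
  shows "closure (Suc b) n f = closure b n (ptr b m f)"
proof -
  have fF: "f \<odot> cid [\<F>] m \<in> hom m (RE b @ [\<E>, \<F>]) (RE b @ [\<E>, \<F>])"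
    by (rule hom_hcomp[OF f hom_cid]) (simp_all add: replicate_Suc replicate_append_same[symmetric] flip: append_Cons)
  have mF: "m = n + wt (RF b)"
    by (simp add: m)
  have "ptr b m f \<odot> cid (RF b) n = ((cid (RE b) m \<odot> ca' m) \<odot> cid (RF b) n) *
      ((f \<odot> cid [\<F>] m) \<odot> cid (RF b) n) * ((cid (RE b) m \<odot> cu' m) \<odot> cid (RF b) n)"
    unfolding ptr_def
    by (simp add: whisker_right[OF hom_ptr_ends(1) fF mF, symmetric]
        whisker_right[OF hom_vcomp[OF hom_ptr_ends(1) fF] hom_ptr_ends(2) mF, symmetric])
  moreover have "(f \<odot> cid [\<F>] m) \<odot> cid (RF b) n = f \<odot> cid (RF (Suc b)) n"
    by (simp add: hc_assoc cid_hc_cid mF replicate_Suc)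
  ultimately show ?thesis
    unfolding closure_def nca'_inner ncu'_inner by (simp add: hc_assoc m mult.assoc)
qed

text \<open>Operations on the first \<open>b\<close> strands slide past the cap and the cup of the
  last one, so the partial trace is linear over them from both sides.\<close>

lemma ptr_mult:
  assumes f: "f \<in> hom m (RE b) (RE b)" and h: "h \<in> hom m (RE b) (RE b)"
    and g: "g \<in> hom (m - 2) (RE (Suc b)) (RE (Suc b))"
  shows "ptr b m ((f \<odot> cid [\<E>] (m - 2)) * g * (h \<odot> cid [\<E>] (m - 2))) = f * ptr b m g * h"
proof -
  have w: "k \<odot> cid [\<E>] (m - 2) \<in> hom (m - 2) (RE (Suc b)) (RE (Suc b))" if "k \<in> hom m (RE b) (RE b)" for k
    by (rule hom_hcomp[OF that hom_cid]) (simp_all add: replicate_Suc replicate_append_same)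
  have e: "(k \<odot> cid [\<E>] (m - 2)) \<odot> cid [\<F>] m = k \<odot> cid [\<E>, \<F>] m" for k
    by (simp add: hc_assoc cid_hc_cid)
  have "((f \<odot> cid [\<E>] (m - 2)) * g * (h \<odot> cid [\<E>] (m - 2))) \<odot> cid [\<F>] m =
      (f \<odot> cid [\<E>, \<F>] m) * (g \<odot> cid [\<F>] m) * (h \<odot> cid [\<E>, \<F>] m)"
    unfolding e[symmetric]
    using whisker_right[OF w[OF f] g, of m "[\<F>]"]
      whisker_right[OF hom_vcomp[OF w[OF f] g] w[OF h], of m "[\<F>]"] by simp
  moreover have "(cid (RE b) m \<odot> ca' m) * (f \<odot> cid [\<E>, \<F>] m) = f * (cid (RE b) m \<odot> ca' m)"
    by (rule cap_right_slide[OF f hom_ca']) auto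
  moreover have "(h \<odot> cid [\<E>, \<F>] m) * (cid (RE b) m \<odot> cu' m) = (cid (RE b) m \<odot> cu' m) * h"
    by (rule cup_right_slide[OF h hom_cu'])
  ultimately show ?thesis
    unfolding ptr_def by (simp only: mult.assoc) (simp only: mult.assoc[symmetric])
qed

text \<open>The region to the left of the strands is the outer region of the closed diagram. A
  bubble there passes down beside the nested cups and separates from the rest.\<close>

lemma closure_bubble:
  assumes g: "g \<in> hom (n - 2 * int b) (RE b) (RE b)"
  shows "closure b n (g * (c n r \<odot> cid (RE b) (n - 2 * int b))) = closure b n g * c n r"
proof -
  let ?m = "n - 2 * int b"
  have cE: "c n r \<odot> cid (RE b) ?m \<in> hom ?m (RE b) (RE b)"
    by (rule hom_hcomp[OF hom_c hom_cid]) simp_all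
  have "(g * (c n r \<odot> cid (RE b) ?m)) \<odot> cid (RF b) n =
      (g \<odot> cid (RF b) n) * ((c n r \<odot> cid (RE b) ?m) \<odot> cid (RF b) n)"
    by (rule whisker_right[symmetric, OF g cE]) simp
  moreover have "((c n r \<odot> cid (RE b) ?m) \<odot> cid (RF b) n) * ncu' b n = ncu' b n * c n r"
    using hc_split[OF hom_c[of n r] hom_ncu'[of b n]] cid_hc_left[OF hom_ncu'[of b n], of n]
      cid_hc_right[OF hom_c[of n r]]
    by (simp add: hc_assoc cid_hc_cid)
  ultimately show ?thesis
    by (simp add: closure_def mult.assoc)
qed

lemma ptr_crossing:
  "ptr (Suc b) m (NH.Xpow (m - 2) (Suc (Suc b)) (Suc b) q * Ss (m - 2) (Suc (Suc b)) b) =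
    - (\<Sum>f<nat (int q - m + 1). NH.Xpow m (Suc b) b (nat (int q - m - int f)) *
        (cid (RE (Suc b)) m \<odot> c m (int f)))"
proof -
  let ?R = "cid (RE b) (m + 2)" and ?E = "cid [\<E>] m"
  have hX: "?E \<odot> dts (m - 2) q \<in> hom (m - 2) [\<E>, \<E>] [\<E>, \<E>]"
    by (rule hom_intros refl | simp)+
  have hY: "(?E \<odot> dts (m - 2) q) * cr (m - 2) \<in> hom (m - 2) [\<E>, \<E>] [\<E>, \<E>]"
    by (rule hom_vcomp[OF hX hom_cr])
  have hYF: "((?E \<odot> dts (m - 2) q) * cr (m - 2)) \<odot> cid [\<F>] m \<in> hom m [\<E>, \<E>, \<F>] [\<E>, \<E>, \<F>]"
    by (rule hom_hcomp[OF hY hom_cid]) simp_all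
  have hE: "?E \<odot> ca' m \<in> hom m [\<E>, \<E>, \<F>] [\<E>]" "?E \<odot> cu' m \<in> hom m [\<E>] [\<E>, \<E>, \<F>]"
    by (rule hom_intros refl | simp)+
  have X: "NH.Xpow (m - 2) (Suc (Suc b)) (Suc b) q = ?R \<odot> (?E \<odot> dts (m - 2) q)"
    using Xpow_last[of "m - 2" "Suc b" q]
    by (simp add: cid_hc_cid_hc replicate_append_same replicate_Suc)
  have S: "Ss (m - 2) (Suc (Suc b)) b = ?R \<odot> cr (m - 2)"
    using cid_hc_right[OF hom_cr, of "m - 2"] by (simp add: Ss_def emb_def add.commute)
  have "NH.Xpow (m - 2) (Suc (Suc b)) (Suc b) q * Ss (m - 2) (Suc (Suc b)) b =
      ?R \<odot> ((?E \<odot> dts (m - 2) q) * cr (m - 2))"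
    unfolding X S by (rule whisker_left[OF hX hom_cr]) simp
  moreover have R: "cid (RE (Suc b)) m \<odot> z = ?R \<odot> (?E \<odot> z)" for z
    by (simp add: cid_hc_cid_hc replicate_append_same replicate_Suc)
  ultimately have "ptr (Suc b) m (NH.Xpow (m - 2) (Suc (Suc b)) (Suc b) q * Ss (m - 2) (Suc (Suc b)) b) =
      (?R \<odot> (?E \<odot> ca' m)) * (?R \<odot> (((?E \<odot> dts (m - 2) q) * cr (m - 2)) \<odot> cid [\<F>] m)) * (?R \<odot> (?E \<odot> cu' m))"
    by (simp add: ptr_def hc_assoc)
  also have "\<dots> = ?R \<odot> ((?E \<odot> ca' m) * (((?E \<odot> dts (m - 2) q) * cr (m - 2)) \<odot> cid [\<F>] m) * (?E \<odot> cu' m))"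
    using whisker_left[OF hE(1) hYF, of "m + 2" "RE b"]
      whisker_left[OF hom_vcomp[OF hE(1) hYF] hE(2), of "m + 2" "RE b"] by simp
  also have "\<dots> = - (\<Sum>f<nat (int q - m + 1). ?R \<odot> (dts m (nat (int q - m - int f)) \<odot> c m (int f)))"
    unfolding dotted_curl by (simp add: hc_uminus hc_sum)
  also have "(\<Sum>f<nat (int q - m + 1). ?R \<odot> (dts m (nat (int q - m - int f)) \<odot> c m (int f))) =
    (\<Sum>f<nat (int q - m + 1). NH.Xpow m (Suc b) b (nat (int q - m - int f)) * (cid (RE (Suc b)) m \<odot> c m (int f)))"
  proof (rule sum.cong[OF refl])
    fix f
    have "cid (RE b) (m + 2) \<odot> dts m p \<in> hom m (RE (Suc b)) (RE (Suc b))" for p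
      by (rule hom_last)
    from hc_split(1)[OF this hom_c, of m _ "int f"]
    show "?R \<odot> (dts m (nat (int q - m - int f)) \<odot> c m (int f)) =
        NH.Xpow m (Suc b) b (nat (int q - m - int f)) * (cid (RE (Suc b)) m \<odot> c m (int f))"
      using cid_hc_right[OF hom_last] by (simp add: Xpow_last hc_assoc)
  qed
  finally show ?thesis .
qed

definition closure_mon :: "nat \<Rightarrow> int \<Rightarrow> (nat \<Rightarrow> nat) \<Rightarrow> 'a" where
  "closure_mon b n k = closure b n (NH.mon b (n - 2 * int b) k b * NH.W (n - 2 * int b) b b)"

lemma closure_mon_0: "closure_mon 0 n k = cid [] n"
proof -
  have "NH.mon 0 m k 0 = cid (RE 0) m" "NH.W m 0 0 = cid (RE 0) m" for m
    by (simp_all only: NH.mon.simps NH.W_def staircase_word.simps NH.Sw_simps)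
  then show ?thesis
    unfolding closure_mon_def closure_def by (simp add: cid_idem cid_hc_cid)
qed

lemma closure_mon_1: "closure_mon (Suc 0) n k = c n (int (k 0) - n + 1)"
proof -
  have "NH.mon (Suc 0) (n - 2) k (Suc 0) * NH.W (n - 2) (Suc 0) (Suc 0) = dts (n - 2) (k 0)"
  proof -
    have *: "staircase_word (Suc 0) = []" "Suc 0 - Suc 0 = 0"
      by simp_all
    have R: "RE (Suc 0) = [\<E>]"
      by (simp add: replicate_Suc)
    have X: "NH.Xpow (n - 2) (Suc 0) 0 (k 0) = dts (n - 2) (k 0)"
      using Xpow_last[of "n - 2" 0 "k 0"] by (simp add: cid_hc_left[OF hom_dts])
    show ?thesis
      unfolding NH.mon.simps NH.W_def * NH.Sw_simps X unfolding R
      by (simp only: cid_right[OF hom_dts])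
  qed
  moreover have "nca' (Suc 0) n = ca' n" "ncu' (Suc 0) n = cu' n"
    using cid_right[OF hom_ca'] cid_left[OF hom_cu'] by (simp_all add: cid_hc_cid)
  ultimately show ?thesis
    using c_real[of n "k 0"] by (simp add: closure_mon_def closure_def replicate_Suc)
qed

text \<open>In the word of \<open>NH.W\<close> on \<open>Suc b\<close> strands, one crossing meets
  the last strand, between the longest element \<open>W\<close> on \<open>b\<close> strands and a
  cycle \<open>C\<close>. Its partial trace is a dotted curl: powers of the last remaining variable
  with bubbles on the right. Squeezed between \<open>W\<close> and \<open>C\<close>, the powers
  become complete polynomials in all variables. Moving the bubbles to the left turns these into
  signed elementary polynomials, which commute with \<open>W\<close> and raise the exponents on a
  set \<open>T\<close>; the bubbles then leave the closure.\<close>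

lemma closure_mon_Suc:
  "closure_mon (Suc b) n k = alt b (\<Sum>j\<le>b. alt j
    ((\<Sum>T | T \<subseteq> {..<b} \<and> card T = j. closure_mon b n (\<lambda>i. k i + of_bool (i \<in> T))) *
      c n (int (k b) - n + 1 + int b - int j)))"
proof (cases b)
  \<comment> \<open>With no strand left over there is no crossing to resolve, and the closure is a
    single bubble.\<close>
  case 0
  have "{T. T = {} \<and> card T = 0} = {{} :: nat set}"
    by auto
  then show ?thesis
    by (simp add: 0 closure_mon_1 closure_mon_0 cid_left[OF hom_c])
next
  case (Suc b')
  define m where "m = n - 2 * int b"
  define M where "M = NH.mon b m k b"
  define W where "W = NH.W m b b"
  define C where "C = NH.Sw m b (rev [0..<b'])"
  define q where "q = k b"
  have n': "n - 2 * int (Suc b) = m - 2"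
    by (simp add: m_def)
  have hM: "M \<in> hom m (RE b) (RE b)" and hW: "W \<in> hom m (RE b) (RE b)" and hC: "C \<in> hom m (RE b) (RE b)"
    unfolding M_def W_def C_def by (rule hom_mon hom_W hom_Sw order.refl; auto simp: Suc)+
  define Y where "Y = NH.Xpow (m - 2) (Suc b) b q * Ss (m - 2) (Suc b) b'"
  have hY: "Y \<in> hom (m - 2) (RE (Suc b)) (RE (Suc b))"
    unfolding Y_def by (rule hom_vcomp[OF hom_Xpow hom_Ss]) (simp_all add: Suc)
  have level: "NH.W (m - 2) (Suc b) (Suc b) = (W \<odot> cid [\<E>] (m - 2)) * (Ss (m - 2) (Suc b) b' * (C \<odot> cid [\<E>] (m - 2)))"
  proof -
    have "NH.W (m - 2) (Suc b) (Suc b) = NH.W (m - 2) (Suc b) b * NH.Sw (m - 2) (Suc b) (rev [0..<b])"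
      by (rule NH.W_Suc) simp
    moreover have "NH.W (m - 2) (Suc b) b = W \<odot> cid [\<E>] (m - 2)"
      unfolding NH.W_def W_def by (subst Sw_level) (auto dest: staircase_word_less)
    moreover have "NH.Sw (m - 2) (Suc b) (rev [0..<b']) = C \<odot> cid [\<E>] (m - 2)"
      unfolding C_def by (subst Sw_level) (auto simp: Suc)
    ultimately show ?thesis
      by (simp add: Suc)
  qed
  \<comment> \<open>The dots of the last strand have to pass \<open>W\<close> to reach the crossing
    that will become the curl.\<close>
  have XW: "NH.Xpow (m - 2) (Suc b) b q * (W \<odot> cid [\<E>] (m - 2)) = (W \<odot> cid [\<E>] (m - 2)) * NH.Xpow (m - 2) (Suc b) b q"
    unfolding Xpow_last using hc_split[OF hW hom_dts, of "m - 2" q] by simp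
  have "NH.mon (Suc b) (m - 2) k (Suc b) = (M \<odot> cid [\<E>] (m - 2)) * NH.Xpow (m - 2) (Suc b) b q"
    using mon_level[of b b "m - 2" k] by (simp add: Xpow_last M_def q_def)
  then have "NH.mon (Suc b) (m - 2) k (Suc b) * NH.W (m - 2) (Suc b) (Suc b) =
      (M \<odot> cid [\<E>] (m - 2)) * (NH.Xpow (m - 2) (Suc b) b q * (W \<odot> cid [\<E>] (m - 2))) *
        (Ss (m - 2) (Suc b) b' * (C \<odot> cid [\<E>] (m - 2)))"
    by (simp only: level mult.assoc)
  also have "\<dots> = ((M \<odot> cid [\<E>] (m - 2)) * (W \<odot> cid [\<E>] (m - 2))) * Y * (C \<odot> cid [\<E>] (m - 2))"
    by (simp only: XW Y_def mult.assoc)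
  also have "(M \<odot> cid [\<E>] (m - 2)) * (W \<odot> cid [\<E>] (m - 2)) = (M * W) \<odot> cid [\<E>] (m - 2)"
    by (rule whisker_right[OF hM hW]) simp
  finally have eq: "NH.mon (Suc b) (m - 2) k (Suc b) * NH.W (m - 2) (Suc b) (Suc b) =
      ((M * W) \<odot> cid [\<E>] (m - 2)) * Y * (C \<odot> cid [\<E>] (m - 2))" .
  have wE: "z \<odot> cid [\<E>] (m - 2) \<in> hom (m - 2) (RE (Suc b)) (RE (Suc b))" if "z \<in> hom m (RE b) (RE b)" for z
    by (rule hom_hcomp[OF that hom_cid]) (simp_all add: replicate_Suc replicate_append_same)
  have "closure_mon (Suc b) n k = closure b n (ptr b m (((M * W) \<odot> cid [\<E>] (m - 2)) * Y * (C \<odot> cid [\<E>] (m - 2))))"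
    unfolding closure_mon_def n' eq
    by (rule closure_Suc[OF hom_vcomp[OF hom_vcomp[OF wE[OF hom_vcomp[OF hM hW]] hY] wE[OF hC]] m_def])
  also have "ptr b m (((M * W) \<odot> cid [\<E>] (m - 2)) * Y * (C \<odot> cid [\<E>] (m - 2))) = M * W * ptr b m Y * C"
    by (rule ptr_mult[OF hom_vcomp[OF hM hW] hC hY])
  also have "ptr b m Y = - (\<Sum>f<nat (int q - m + 1). NH.Xpow m b b' (nat (int q - m - int f)) *
        (cid (RE b) m \<odot> c m (int f)))"
    using ptr_crossing[of b' m q] by (simp add: Y_def Suc)
  finally have 1: "closure_mon (Suc b) n k = closure b n (M * W * (- (\<Sum>f<nat (int q - m + 1).
      NH.Xpow m b b' (nat (int q - m - int f)) * (cid (RE b) m \<odot> c m (int f)))) * C)" .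
  define V where "V f = cid (RE b) m \<odot> c m (int f)" for f
  have VC: "V f * C = C * V f" for f
    unfolding V_def using hc_split[OF hC hom_c[of m "int f"]] cid_hc_right[OF hC] by simp
  have summand: "W * (NH.Xpow m b b' p * V f) * C = (if p < b' then 0 else alt b' (W * NH.Hf b m b $ (p - b'))) * V f" for p f
  proof -
    have "W * (NH.Xpow m b b' p * V f) * C = W * NH.Xpow m b b' p * C * V f"
      by (simp only: mult.assoc VC)
    then show ?thesis
      using NH.W_Xpow_cycle[of b m p] by (simp add: W_def C_def Suc)
  qed
  \<comment> \<open>The cycle \<open>C\<close> lowers the degree by \<open>b'\<close>. What remains
    to be shared between polynomial and bubble is \<open>q - m - b'\<close>, here expressed by the
    weight \<open>n\<close> of the outer region.\<close>
  define K where "K = int q - n + 1 + int b"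
  have Km: "int q - m - int b' = K"
    by (simp add: K_def m_def Suc)
  have "W * (\<Sum>f<nat (int q - m + 1). NH.Xpow m b b' (nat (int q - m - int f)) * V f) * C =
      (\<Sum>f<nat (int q - m + 1). (if nat (int q - m - int f) < b' then 0
        else alt b' (W * NH.Hf b m b $ (nat (int q - m - int f) - b'))) * V f)"
    by (simp add: sum_distrib_left sum_distrib_right summand)
  also have "\<dots> = (\<Sum>f\<in>{f. int f \<le> K}. alt b' (W * NH.Hf b m b $ (nat (K - int f))) * V f)"
  proof (rule sum.mono_neutral_cong_right)
    show "\<forall>f\<in>{..<nat (int q - m + 1)} - {f. int f \<le> K}. (if nat (int q - m - int f) < b' then 0
        else alt b' (W * NH.Hf b m b $ (nat (int q - m - int f) - b'))) * V f = 0"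
    proof
      fix f assume f: "f \<in> {..<nat (int q - m + 1)} - {f. int f \<le> K}"
      then have "nat (int q - m - int f) < b'"
        using Km by auto
      then show "(if nat (int q - m - int f) < b' then 0
        else alt b' (W * NH.Hf b m b $ (nat (int q - m - int f) - b'))) * V f = 0"
        by simp
    qed
    fix f assume "f \<in> {f. int f \<le> K}"
    then have "\<not> nat (int q - m - int f) < b'" "nat (int q - m - int f) - b' = nat (K - int f)"
      using Km by auto
    then show "(if nat (int q - m - int f) < b' then 0
        else alt b' (W * NH.Hf b m b $ (nat (int q - m - int f) - b'))) * V f =
        alt b' (W * NH.Hf b m b $ (nat (K - int f))) * V f"
      by simp
  qed (use Km in auto)
  also have "\<dots> = alt b' (W * (\<Sum>f | int f \<le> K. NH.Hf b m b $ (nat (K - int f)) * V f))"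
    by (simp add: alt_mult(1)[symmetric] alt_sum sum_distrib_left mult.assoc)
  also have "(\<Sum>f | int f \<le> K. NH.Hf b m b $ (nat (K - int f)) * V f) =
      (\<Sum>j | int j \<le> K. NH.Ef b m b $ j * (c n (K - int j) \<odot> cid (RE b) m))"
  proof (cases "K < 0")
    case True
    then have "{f. int f \<le> K} = {}"
      by auto
    then show ?thesis by simp
  next
    case False
    define P where "P = nat K"
    have P: "{f. int f \<le> K} = {0..P}" "K = int P"
      using False by (auto simp: P_def)
    have "(\<Sum>f=0..P. NH.Hf b m b $ (nat (K - int f)) * V f) =
        (\<Sum>f=0..P. NH.Hf b m b $ f * (cid (RE b) m \<odot> c m (int (P - f))))"
      by (rule sum.reindex_bij_witness[of _ "\<lambda>f. P - f" "\<lambda>f. P - f"])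
        (auto simp: P(2) V_def of_nat_diff nat_diff_distrib)
    then show ?thesis
      unfolding P(1) bubble_all_strands by (simp add: P(2) m_def of_nat_diff)
  qed
  finally have 2: "W * (\<Sum>f<nat (int q - m + 1). NH.Xpow m b b' (nat (int q - m - int f)) * V f) * C =
      alt b' (W * (\<Sum>j | int j \<le> K. NH.Ef b m b $ j * (c n (K - int j) \<odot> cid (RE b) m)))" .
  have "M * W * (- (\<Sum>f<nat (int q - m + 1). NH.Xpow m b b' (nat (int q - m - int f)) * V f)) * C =
      alt b (M * (W * (\<Sum>j | int j \<le> K. NH.Ef b m b $ j * (c n (K - int j) \<odot> cid (RE b) m))))"
    using 2 by (simp add: mult.assoc Suc alt_mult(2))
  also have "W * (\<Sum>j | int j \<le> K. NH.Ef b m b $ j * (c n (K - int j) \<odot> cid (RE b) m)) =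
      (\<Sum>j | int j \<le> K. NH.Ef b m b $ j * W * (c n (K - int j) \<odot> cid (RE b) m))"
    by (simp only: sum_distrib_left mult.assoc[symmetric] W_def NH.W_Ef)
  also have "M * \<dots> = (\<Sum>j | int j \<le> K. alt j (\<Sum>T | T \<subseteq> {..<b} \<and> card T = j.
      (NH.mon b m (\<lambda>i. k i + of_bool (i \<in> T)) b * W) * (c n (K - int j) \<odot> cid (RE b) m)))"
  proof -
    have "M * (NH.Ef b m b $ j * W * z) = alt j (\<Sum>T | T \<subseteq> {..<b} \<and> card T = j.
      (NH.mon b m (\<lambda>i. k i + of_bool (i \<in> T)) b * W) * z)" for j z
    proof -
      have "M * NH.Ef b m b $ j = alt j (\<Sum>T | T \<subseteq> {..<b} \<and> card T = j.
          NH.mon b m (\<lambda>i. k i + of_bool (i \<in> T)) b)"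
        unfolding M_def using NH.mon_Ef[of b b m k j] by (simp add: atLeast0LessThan)
      then have "M * NH.Ef b m b $ j * W * z = alt j ((\<Sum>T | T \<subseteq> {..<b} \<and> card T = j.
          NH.mon b m (\<lambda>i. k i + of_bool (i \<in> T)) b) * W * z)"
        by (simp only: alt_mult)
      then show ?thesis
        by (simp only: mult.assoc sum_distrib_right)
    qed
    then show ?thesis
      by (simp only: sum_distrib_left)
  qed
  finally have 3: "M * W * (- (\<Sum>f<nat (int q - m + 1). NH.Xpow m b b' (nat (int q - m - int f)) * V f)) * C =
      alt b (\<Sum>j | int j \<le> K. alt j (\<Sum>T | T \<subseteq> {..<b} \<and> card T = j.
      (NH.mon b m (\<lambda>i. k i + of_bool (i \<in> T)) b * W) * (c n (K - int j) \<odot> cid (RE b) m)))" .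
  have "closure b n (NH.mon b m k' b * W * (c n r \<odot> cid (RE b) m)) = closure_mon b n k' * c n r" for k' r
    using closure_bubble[OF hom_vcomp[OF hom_mon[OF order.refl] hW[unfolded m_def]]]
    by (simp add: closure_mon_def W_def m_def)
  then have "closure_mon (Suc b) n k = alt b (\<Sum>j | int j \<le> K. alt j (\<Sum>T | T \<subseteq> {..<b} \<and> card T = j.
      closure_mon b n (\<lambda>i. k i + of_bool (i \<in> T)) * c n (K - int j)))"
    unfolding 1[folded V_def] 3 by (simp only: closure_linear)
  also have "\<dots> = alt b (\<Sum>j | int j \<le> K. alt j ((\<Sum>T | T \<subseteq> {..<b} \<and> card T = j.
      closure_mon b n (\<lambda>i. k i + of_bool (i \<in> T))) * c n (K - int j)))"
    by (simp only: sum_distrib_right)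
  \<comment> \<open>For \<open>j > b\<close> there is no subset \<open>T\<close>, and for
    \<open>j > K\<close> the bubble has negative degree. So both ranges of summation give the same
    value.\<close>
  also have "\<dots> = alt b (\<Sum>j\<le>b. alt j ((\<Sum>T | T \<subseteq> {..<b} \<and> card T = j.
      closure_mon b n (\<lambda>i. k i + of_bool (i \<in> T))) * c n (K - int j)))"
    (is "alt b (\<Sum>j | int j \<le> K. ?g j) = alt b (\<Sum>j\<le>b. ?g j)")
  proof -
    have "?g j = 0" if "b < j" for j
    proof -
      have card: "card T \<le> b" if "T \<subseteq> {..<b}" for T
        using card_mono[OF finite_lessThan that] by simp
      have "\<not> (T \<subseteq> {..<b} \<and> card T = j)" for T
        using card[of T] \<open>b < j\<close> by auto
      then have "{T. T \<subseteq> {..<b} \<and> card T = j} = {}"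
        by (simp only: simp_thms Collect_empty_eq)
      then show ?thesis
        by (simp only: sum.empty mult_zero_left alt_zero)
    qed
    moreover have "?g j = 0" if "K < int j" for j
      using that by (simp add: c_neg)
    moreover have "finite {j. int j \<le> K}"
      by (rule finite_subset[of _ "{..nat K}"]) auto
    ultimately have "sum ?g {j. int j \<le> K} = sum ?g {..b}"
      by (intro sum.mono_neutral_cong) (auto simp: not_le)
    then show ?thesis
      by (simp only:)
  qed
  finally show ?thesis
    by (simp only: K_def q_def)
qed

end

section \<open>Determinants\<close>

text \<open>Orbits are removed one at a time. At a fixed point antisymmetry yields only that twice
  the value is zero, hence the separate assumption on fixed points.\<close>

lemma sum_sign_reversing_involution:
  fixes f :: "'a \<Rightarrow> 'b::ab_group_add"
  assumes "finite A" "\<And>x. x \<in> A \<Longrightarrow> g x \<in> A" "\<And>x. x \<in> A \<Longrightarrow> g (g x) = x"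
    and "\<And>x. x \<in> A \<Longrightarrow> f (g x) = - f x" "\<And>x. x \<in> A \<Longrightarrow> g x = x \<Longrightarrow> f x = 0"
  shows "sum f A = 0"
  using assms
proof (induction "card A" arbitrary: A rule: less_induct)
  case less
  show ?case
  proof (cases "A = {}")
    case False
    then obtain x where x: "x \<in> A"
      by blast
    let ?B = "A - {x, g x}"
    have "sum f ?B = 0"
    proof (rule less.hyps)
      show "card ?B < card A"
        using x less.prems(1) by (intro psubset_card_mono) auto
      show "g y \<in> ?B" if "y \<in> ?B" for y
        using that less.prems(2,3) x by (metis Diff_iff insert_iff singletonD)
    qed (use less.prems in auto)
    moreover have "sum f A = sum f {x, g x} + sum f ?B"
      using x less.prems(1,2) by (subst sum.subset_diff[of "{x, g x}"]) auto
    moreover have "sum f {x, g x} = 0"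
      using less.prems(4,5)[OF x] by (cases "g x = x") auto
    ultimately show ?thesis
      by simp
  qed simp
qed

text \<open>Matrices are functions on all pairs of naturals. Renumbering rows or columns is then
  mere composition, and the row with index \<open>a\<close>, just outside the matrix, can serve as a
  boundary value.\<close>

definition ldet :: "nat \<Rightarrow> (nat \<Rightarrow> nat \<Rightarrow> 'r::comm_ring_1) \<Rightarrow> 'r" where
  "ldet a M = (\<Sum>p | p permutes {..<a}. of_int (sign p) * (\<Prod>i<a. M i (p i)))"

lemma ldet_cong: "(\<And>i j. i < a \<Longrightarrow> j < a \<Longrightarrow> M i j = M' i j) \<Longrightarrow> ldet a M = ldet a M'"
  unfolding ldet_def
  by (intro sum.cong refl arg_cong2[of _ _ _ _ "(*)"] prod.cong)
    (auto dest: permutes_in_image)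

lemma permutes_permutation: "p permutes {..<a::nat} \<Longrightarrow> permutation p"
  by (metis finite_lessThan permutation_permutes)

lemma ldet_transpose: "ldet a (\<lambda>i j. M j i) = ldet a M"
proof -
  have "ldet a (\<lambda>i j. M j i) = (\<Sum>p | p permutes {..<a}. of_int (sign (inv_into UNIV p)) * (\<Prod>i<a. M (inv_into UNIV p i) i))"
    unfolding ldet_def by (rule sum_permutations_inverse)
  also have "\<dots> = ldet a M"
    unfolding ldet_def
  proof (rule sum.cong[OF refl])
    fix p assume "p \<in> {p. p permutes {..<a}}"
    then have p: "p permutes {..<a}"
      by simp
    have "(\<Prod>i<a. M (inv_into UNIV p i) i) = (\<Prod>i<a. M i (p i))"
      by (rule prod.reindex_bij_witness[of _ p "inv_into UNIV p"])
        (use p in \<open>auto simp: permutes_inverses dest: permutes_in_image permutes_in_image[OF permutes_inv]\<close>)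
    then show "of_int (sign (inv_into UNIV p)) * (\<Prod>i<a. M (inv_into UNIV p i) i) = of_int (sign p) * (\<Prod>i<a. M i (p i))"
      by (simp add: sign_inverse[OF permutes_permutation[OF p]])
  qed
  finally show ?thesis .
qed

lemma ldet_permute_cols:
  fixes M :: "nat \<Rightarrow> nat \<Rightarrow> 'b::comm_ring_1"
  assumes q: "q permutes {..<a}"
  shows "ldet a (\<lambda>i j. M i (q j)) = of_int (sign q) * ldet a M"
proof -
  have "of_int (sign q) * ldet a M =
      of_int (sign q) * (\<Sum>p | p permutes {..<a}. of_int (sign (q \<circ> p)) * (\<Prod>i<a. M i ((q \<circ> p) i)))"
    unfolding ldet_def by (subst setum_permutations_compose_left[OF q]) rule
  also have "\<dots> = (\<Sum>p | p permutes {..<a}. of_int (sign p) * (\<Prod>i<a. M i (q (p i))))"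
    unfolding sum_distrib_left
  proof (rule sum.cong[OF refl])
    fix p assume "p \<in> {p. p permutes {..<a}}"
    then have "sign q * sign (q \<circ> p) = sign p"
      by (simp add: sign_compose[OF permutes_permutation[OF q] permutes_permutation] mult.assoc[symmetric])
    then have "of_int (sign q) * of_int (sign (q \<circ> p)) = (of_int (sign p) :: 'b)"
      by (simp flip: of_int_mult)
    then show "of_int (sign q) * (of_int (sign (q \<circ> p)) * (\<Prod>i<a. M i ((q \<circ> p) i))) =
        of_int (sign p) * (\<Prod>i<a. M i (q (p i)))"
      by (simp add: mult.assoc[symmetric])
  qed
  finally show ?thesis
    by (simp add: ldet_def)
qed

lemma ldet_swap_cols:
  assumes "u < a" "v < a" "u \<noteq> v"
  shows "ldet a (\<lambda>i j. M i (transpose u v j)) = - ldet a M"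
  using ldet_permute_cols[OF permutes_swap_id[of u "{..<a}" v], of M] assms by (simp add: sign_swap_id)

lemma ldet_swap_rows:
  assumes "u < a" "v < a" "u \<noteq> v"
  shows "ldet a (\<lambda>i. M (transpose u v i)) = - ldet a M"
  using ldet_swap_cols[OF assms, of "\<lambda>i j. M j i"] ldet_transpose[of a M]
    ldet_transpose[of a "\<lambda>i. M (transpose u v i)"] by simp

text \<open>Composition with the transposition of \<open>u\<close> and \<open>v\<close> pairs each
  permutation with another one of opposite term. A permutation is never its own partner, so the
  argument also holds with 2-torsion.\<close>

lemma ldet_equal_cols:
  assumes uv: "u < a" "v < a" "u \<noteq> v" and M: "\<And>i. i < a \<Longrightarrow> M i u = M i v"
  shows "ldet a M = 0"
  unfolding ldet_def
proof (rule sum_sign_reversing_involution[where g = "\<lambda>p. transpose u v \<circ> p"])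
  fix p assume "p \<in> {p. p permutes {..<a}}"
  then have p: "p permutes {..<a}"
    by simp
  show "transpose u v \<circ> p \<in> {p. p permutes {..<a}}"
    using permutes_compose[OF p permutes_swap_id[of u "{..<a}" v]] uv by simp
  show "transpose u v \<circ> (transpose u v \<circ> p) = p"
    by (simp add: fun_eq_iff)
  have "M i (transpose u v (p i)) = M i (p i)" if "i < a" for i
    using M[OF that] by (auto simp: transpose_def)
  then show "of_int (sign (transpose u v \<circ> p)) * (\<Prod>i<a. M i ((transpose u v \<circ> p) i)) =
      - (of_int (sign p) * (\<Prod>i<a. M i (p i)))"
    using uv by (simp add: sign_compose[OF permutation_swap_id permutes_permutation[OF p]] sign_swap_id)
  assume "transpose u v \<circ> p = p"
  then have "transpose u v (p (inv_into UNIV p u)) = p (inv_into UNIV p u)"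
    by (metis comp_apply)
  then show "of_int (sign p) * (\<Prod>i<a. M i (p i)) = 0"
    using uv p by (simp add: permutes_inverses)
qed (simp add: finite_permutations)

lemma ldet_equal_rows:
  assumes "u < a" "v < a" "u \<noteq> v" "\<And>j. j < a \<Longrightarrow> M u j = M v j"
  shows "ldet a M = 0"
  using ldet_equal_cols[OF assms(1-3), of "\<lambda>i j. M j i"] assms(4) ldet_transpose[of a M] by simp

lemma ldet_zero_row:
  assumes "u < a" "\<And>j. j < a \<Longrightarrow> M u j = 0"
  shows "ldet a M = 0"
  unfolding ldet_def
proof (rule sum.neutral, rule ballI)
  fix p assume "p \<in> {p. p permutes {..<a}}"
  then have "M u (p u) = 0"
    using assms permutes_in_image[of p "{..<a}" u] by auto
  then show "of_int (sign p) * (\<Prod>i<a. M i (p i)) = 0"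
    using assms(1) by (simp add: prod_zero[of _ "\<lambda>i. M i (p i)"] bexI[of _ u])
qed

section \<open>Multilinear expansion and row operations\<close>

lemma ldet_expand_rows:
  assumes "\<And>i. i < a \<Longrightarrow> finite (J i)"
  shows "ldet a (\<lambda>i t. \<Sum>j\<in>J i. w i j * M i j t) =
    (\<Sum>j \<in> PiE {..<a} J. (\<Prod>i<a. w i (j i)) * ldet a (\<lambda>i. M i (j i)))"
proof -
  have "ldet a (\<lambda>i t. \<Sum>j\<in>J i. w i j * M i j t) = (\<Sum>p | p permutes {..<a}. of_int (sign p) *
      (\<Sum>j \<in> PiE {..<a} J. \<Prod>i<a. w i (j i) * M i (j i) (p i)))"
    unfolding ldet_def by (subst prod_sum_PiE) (use assms in auto)
  also have "\<dots> = (\<Sum>p | p permutes {..<a}. \<Sum>j \<in> PiE {..<a} J. (\<Prod>i<a. w i (j i)) *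
      (of_int (sign p) * (\<Prod>i<a. M i (j i) (p i))))"
    by (simp add: sum_distrib_left prod.distrib mult_ac)
  also have "\<dots> = (\<Sum>j \<in> PiE {..<a} J. (\<Prod>i<a. w i (j i)) * ldet a (\<lambda>i. M i (j i)))"
    unfolding ldet_def by (subst sum.swap) (simp add: sum_distrib_left)
  finally show ?thesis .
qed

text \<open>Row \<open>u\<close> is written as a sum of two terms and every other row as a sum of
  one. Choosing the second term in row \<open>u\<close> repeats row \<open>v\<close>.\<close>

lemma ldet_add_row:
  assumes "u < a" "v < a" "u \<noteq> v"
  shows "ldet a (M(u := (\<lambda>t. M u t + x * M v t))) = ldet a M"
proof -
  let ?J = "\<lambda>i. if i = u then {..<2::nat} else {..<1}"
  let ?w = "\<lambda>i j. if i = u \<and> j = 1 then x else 1"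
  let ?N = "\<lambda>i j. if i = u \<and> j = 1 then M v else M i"
  have "M(u := (\<lambda>t. M u t + x * M v t)) = (\<lambda>i t. \<Sum>j\<in>?J i. ?w i j * ?N i j t)"
    by (auto simp: fun_eq_iff numeral_2_eq_2)
  then have "ldet a (M(u := (\<lambda>t. M u t + x * M v t))) =
      (\<Sum>j \<in> PiE {..<a} ?J. (\<Prod>i<a. ?w i (j i)) * ldet a (\<lambda>i. ?N i (j i)))"
    by (simp only:) (rule ldet_expand_rows, simp)
  also have "\<dots> = (\<Sum>j \<in> {restrict (\<lambda>_. 0::nat) {..<a}}. (\<Prod>i<a. ?w i (j i)) * ldet a (\<lambda>i. ?N i (j i)))"
  proof (rule sum.mono_neutral_right)
    show "\<forall>j \<in> PiE {..<a} ?J - {restrict (\<lambda>_. 0::nat) {..<a}}. (\<Prod>i<a. ?w i (j i)) * ldet a (\<lambda>i. ?N i (j i)) = 0"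
    proof
      fix j assume j: "j \<in> PiE {..<a} ?J - {restrict (\<lambda>_. 0::nat) {..<a}}"
      have "j u = 1"
      proof (rule ccontr)
        assume "j u \<noteq> 1"
        moreover have "j i \<in> ?J i" if "i < a" for i
          using j that by (auto simp: PiE_iff)
        ultimately have "j i = 0" if "i < a" for i
          using that assms(1) by (fastforce split: if_splits)
        then have "j = restrict (\<lambda>_. 0::nat) {..<a}"
          using j by (intro extensionalityI[of _ "{..<a}"]) (auto simp: PiE_def)
        with j show False by simp
      qed
      moreover have "j v \<in> ?J v"
        using j assms(2) by (auto simp: PiE_iff)
      then have "j v = 0"
        using assms(3) by simp
      ultimately have "ldet a (\<lambda>i. ?N i (j i)) = 0"
        using assms by (intro ldet_equal_rows[of u a v]) auto
      then show "(\<Prod>i<a. ?w i (j i)) * ldet a (\<lambda>i. ?N i (j i)) = 0"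
        by simp
    qed
  qed (auto intro!: finite_PiE)
  also have "\<dots> = ldet a M"
    by (simp cong: ldet_cong)
  finally show ?thesis .
qed

text \<open>The rows are changed from the top downwards, so that the row being added is always still
  the original one. The last row receives a multiple of the row outside the matrix, which
  vanishes.\<close>

lemma ldet_add_next_row:
  assumes "\<And>t. t < a \<Longrightarrow> M a t = 0"
  shows "ldet a (\<lambda>i t. M i t + x i * M (Suc i) t) = ldet a M"
proof -
  have "ldet a (\<lambda>i. if i < k then (\<lambda>t. M i t + x i * M (Suc i) t) else M i) = ldet a M" if "k \<le> a" for k
    using that
  proof (induction k)
    case (Suc k)
    let ?M = "\<lambda>i. if i < k then (\<lambda>t. M i t + x i * M (Suc i) t) else M i"
    show ?case
    proof (cases "Suc k < a")
      case True
      have "(\<lambda>i. if i < Suc k then (\<lambda>t. M i t + x i * M (Suc i) t) else M i) =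
          ?M(k := (\<lambda>t. ?M k t + x k * ?M (Suc k) t))"
        by (auto simp: fun_eq_iff less_Suc_eq)
      then show ?thesis
        using ldet_add_row[of k a "Suc k" ?M "x k"] True Suc by simp
    next
      case False
      then have "Suc k = a"
        using Suc.prems by simp
      then have "ldet a (\<lambda>i. if i < Suc k then (\<lambda>t. M i t + x i * M (Suc i) t) else M i) = ldet a ?M"
        using assms by (intro ldet_cong) (auto simp: less_Suc_eq)
      then show ?thesis
        using Suc by simp
    qed
  qed simp
  from this[of a] show ?thesis
    by (simp cong: ldet_cong)
qed

text \<open>A permutation sending \<open>b\<close> to \<open>c\<close> is
  \<open>transpose b c\<close> after a permutation fixing \<open>b\<close>. In the resulting minor
  column \<open>b\<close> stands in the place of column \<open>c\<close>, out of its natural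
  order.\<close>

lemma ldet_Suc_swap:
  "ldet (Suc b) M = M b b * ldet b M - (\<Sum>c<b. M b c * ldet b (\<lambda>i t. M i (if t = c then b else t)))"
proof -
  have ins: "{..<Suc b} = insert b {..<b}"
    by auto
  have "ldet (Suc b) M = (\<Sum>c\<in>insert b {..<b}. \<Sum>q | q permutes {..<b}.
      of_int (sign (transpose b c \<circ> q)) * (\<Prod>i<Suc b. M i ((transpose b c \<circ> q) i)))"
    unfolding ldet_def ins by (rule sum_over_permutations_insert) auto
  also have "\<dots> = (\<Sum>c\<in>insert b {..<b}. (if c = b then 1 else -1) * M b c *
      ldet b (\<lambda>i t. M i (if t = c then b else t)))"
  proof (rule sum.cong[OF refl])
    fix c assume c: "c \<in> insert b {..<b}"
    have "of_int (sign (transpose b c \<circ> q)) * (\<Prod>i<Suc b. M i ((transpose b c \<circ> q) i)) =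
        (if c = b then 1 else -1) * M b c * (of_int (sign q) * (\<Prod>i<b. M i (if q i = c then b else q i)))"
      if q: "q permutes {..<b}" for q
    proof -
      have "q b = b"
        using q by (simp add: permutes_def)
      moreover have "transpose b c (q i) = (if q i = c then b else q i)" if "i < b" for i
        using permutes_in_image[OF q, of i] that by (auto simp: transpose_def)
      ultimately have "(\<Prod>i<Suc b. M i ((transpose b c \<circ> q) i)) =
          (\<Prod>i<b. M i (if q i = c then b else q i)) * M b c"
        by simp
      moreover have "sign (transpose b c \<circ> q) = (if c = b then 1 else -1) * sign q"
        by (simp add: sign_compose[OF permutation_swap_id permutes_permutation[OF q]] sign_swap_id)
      ultimately show ?thesis
        by simp
    qed
    then show "(\<Sum>q | q permutes {..<b}.
      of_int (sign (transpose b c \<circ> q)) * (\<Prod>i<Suc b. M i ((transpose b c \<circ> q) i))) =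
      (if c = b then 1 else -1) * M b c * ldet b (\<lambda>i t. M i (if t = c then b else t))"
      unfolding ldet_def sum_distrib_left by (intro sum.cong) auto
  qed
  also have "\<dots> = M b b * ldet b (\<lambda>i t. M i (if t = b then b else t)) -
      (\<Sum>c<b. M b c * ldet b (\<lambda>i t. M i (if t = c then b else t)))"
    by (simp add: sum_negf)
  also have "ldet b (\<lambda>i t. M i (if t = b then b else t)) = ldet b M"
    by (rule ldet_cong) auto
  finally show ?thesis .
qed

text \<open>Column \<open>b\<close>, which stands at position \<open>c\<close>, is moved
  \<open>d\<close> places to the right by exchanges of neighbours, one sign each.\<close>

lemma ldet_cycle_cols:
  assumes "c + d < b"
  shows "ldet b (\<lambda>i t. M i (if t = c then b else t)) =
    (- 1) ^ d * ldet b (\<lambda>i t. M i (if t = c + d then b else if c \<le> t \<and> t < c + d then Suc t else t))"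
  using assms
proof (induction d)
  case 0
  show ?case by (simp, rule ldet_cong) auto
next
  case (Suc d)
  let ?f = "\<lambda>d t. if t = c + d then b else if c \<le> t \<and> t < c + d then Suc t else t"
  have "ldet b (\<lambda>i t. M i (?f (Suc d) t)) = ldet b (\<lambda>i t. M i (?f d (transpose (c + d) (Suc (c + d)) t)))"
    by (rule ldet_cong) (auto simp: transpose_def)
  also have "\<dots> = - ldet b (\<lambda>i t. M i (?f d t))"
    using Suc.prems by (intro ldet_swap_cols) auto
  finally show ?case
    using Suc by simp
qed

text \<open>The deleted column is counted from the right end, so that \<open>j\<close> agrees with
  the degree of the elementary polynomial in \<open>closure_mon_Suc\<close>.\<close>

lemma laplace_last_row:
  "ldet (Suc b) M = (\<Sum>j\<le>b. (- 1) ^ j * M b (b - j) * ldet b (\<lambda>i t. M i (if t < b - j then t else Suc t)))"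
proof -
  have c: "ldet b (\<lambda>i t. M i (if t = c then b else t)) =
      (- 1) ^ (b - 1 - c) * ldet b (\<lambda>i t. M i (if t < c then t else Suc t))" if "c < b" for c
  proof -
    have "ldet b (\<lambda>i t. M i (if t = c + (b - 1 - c) then b
        else if c \<le> t \<and> t < c + (b - 1 - c) then Suc t else t)) =
        ldet b (\<lambda>i t. M i (if t < c then t else Suc t))"
      using that by (intro ldet_cong) (auto intro!: arg_cong[of _ _ "M _"])
    then show ?thesis
      using ldet_cycle_cols[of c "b - 1 - c" b M] that by simp
  qed
  have "{..b} = insert 0 {1..b}"
    by auto
  then have "(\<Sum>j\<le>b. (- 1) ^ j * M b (b - j) * ldet b (\<lambda>i t. M i (if t < b - j then t else Suc t))) =
      M b b * ldet b (\<lambda>i t. M i (if t < b then t else Suc t)) +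
      (\<Sum>j=1..b. (- 1) ^ j * M b (b - j) * ldet b (\<lambda>i t. M i (if t < b - j then t else Suc t)))"
    by simp
  also have "ldet b (\<lambda>i t. M i (if t < b then t else Suc t)) = ldet b M"
    by (rule ldet_cong) auto
  also have "(\<Sum>j=1..b. (- 1) ^ j * M b (b - j) * ldet b (\<lambda>i t. M i (if t < b - j then t else Suc t))) =
      (\<Sum>c<b. - (M b c * ldet b (\<lambda>i t. M i (if t = c then b else t))))"
  proof (rule sum.reindex_bij_witness[of _ "\<lambda>c. b - c" "\<lambda>j. b - j"])
    fix j assume j: "j \<in> {1..b}"
    then obtain j' where j': "j = Suc j'"
      by (cases j) auto
    have "b - 1 - (b - j) = j'"
      using j j' by simp
    then show "- (M b (b - j) * ldet b (\<lambda>i t. M i (if t = b - j then b else t))) =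
        (- 1) ^ j * M b (b - j) * ldet b (\<lambda>i t. M i (if t < b - j then t else Suc t))"
      using c[of "b - j"] j j' by (simp add: mult_ac)
  qed auto
  finally show ?thesis
    unfolding ldet_Suc_swap by (simp add: sum_negf)
qed

lemma ldet_cycle_rows:
  assumes "d < a"
  shows "ldet a (\<lambda>i. if i = d then M 0 else if i < d then M (Suc i) else M i) = (- 1) ^ d * ldet a M"
  using assms
proof (induction d)
  case 0
  have "(\<lambda>i. if i = 0 then M 0 else if i < 0 then M (Suc i) else M i) = M"
    by auto
  then show ?case by simp
next
  case (Suc d)
  let ?f = "\<lambda>d i. if i = d then M 0 else if i < d then M (Suc i) else M i"
  have "?f (Suc d) = (\<lambda>i. ?f d (transpose d (Suc d) i))"
    by (auto simp: transpose_def fun_eq_iff)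
  then have "ldet a (?f (Suc d)) = - ldet a (?f d)"
    using ldet_swap_rows[of d a "Suc d" "?f d"] Suc.prems by simp
  then show ?case
    using Suc by simp
qed

text \<open>Expanding along the last row reverses the rows of all minors at once, by induction. It
  remains to move the first row to the bottom, which costs (-1)^a.\<close>

lemma ldet_reverse_rows: "ldet a (\<lambda>i. M (a - 1 - i)) = (- 1) ^ (a * (a - 1) div 2) * ldet a M"
proof (induction a arbitrary: M)
  case 0
  show ?case by (simp, rule ldet_cong) auto
next
  case (Suc a)
  let ?C = "\<lambda>i. if i = a then M 0 else if i < a then M (Suc i) else M i"
  have minor: "ldet a (\<lambda>i t. M (a - i) (f t)) = (- 1) ^ (a * (a - 1) div 2) * ldet a (\<lambda>i t. M (Suc i) (f t))" for f
  proof -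
    have "ldet a (\<lambda>i t. M (a - i) (f t)) = ldet a (\<lambda>i t. M (Suc (a - 1 - i)) (f t))"
      by (rule ldet_cong) (auto simp: Suc_diff_Suc)
    then show ?thesis
      using Suc.IH[of "\<lambda>i t. M (Suc i) (f t)"] by simp
  qed
  have minor': "ldet a (\<lambda>i t. ?C i (f t)) = ldet a (\<lambda>i t. M (Suc i) (f t))" for f
    by (rule ldet_cong) auto
  have "ldet (Suc a) (\<lambda>i. M (Suc a - 1 - i)) = (- 1) ^ (a * (a - 1) div 2) * ldet (Suc a) ?C"
    unfolding laplace_last_row minor' by (simp add: minor sum_distrib_left mult_ac)
  also have "\<dots> = (- 1) ^ (a * (a - 1) div 2 + a) * ldet (Suc a) M"
    by (subst ldet_cycle_rows) (simp_all add: power_add mult.assoc)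
  also have "a * (a - 1) div 2 + a = Suc a * (Suc a - 1) div 2"
    by (cases a) auto
  finally show ?case .
qed

lemma ldet_shift_rows:
  fixes h :: "int \<Rightarrow> 'r::comm_ring_1"
  assumes "j \<le> b"
  shows "(\<Sum>T | T \<subseteq> {..<b} \<and> card T = j. ldet b (\<lambda>i t. h (k i + of_bool (i \<in> T) + int t))) =
    ldet b (\<lambda>i t. h (k i + int (if t < b - j then t else Suc t)))"
proof -
  let ?S = "{T. T \<subseteq> {..<b} \<and> card T = j}"
  have fin: "finite ?S"
    by (rule finite_subset[of _ "Pow {..<b}"]) auto
  have "(\<Sum>T\<in>?S. ldet b (\<lambda>i t. h (k i + of_bool (i \<in> T) + int t))) =
      (\<Sum>p | p permutes {..<b}. \<Sum>T\<in>?S. of_int (sign p) * (\<Prod>i<b. h (k i + of_bool (i \<in> T) + int (p i))))"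
    unfolding ldet_def by (rule sum.swap)
  also have "\<dots> = (\<Sum>p | p permutes {..<b}. \<Sum>C\<in>?S. of_int (sign p) * (\<Prod>i<b. h (k i + int (p i) + of_bool (p i \<in> C))))"
  proof (rule sum.cong[OF refl])
    fix p assume "p \<in> {p. p permutes {..<b}}"
    then have p: "p permutes {..<b}"
      by simp
    have ii: "inv_into UNIV p ` p ` T = T" "p ` inv_into UNIV p ` T = T" for T
      using p by (auto simp: image_image permutes_inverses)
    have c: "card (p ` T) = card T" "card (inv_into UNIV p ` T) = card T" for T
      using permutes_inj[OF p] permutes_inj[OF permutes_inv[OF p]]
      by (auto intro!: card_image inj_on_subset[of _ UNIV])
    have s: "p ` T \<subseteq> {..<b} \<longleftrightarrow> T \<subseteq> {..<b}" "inv_into UNIV p ` T \<subseteq> {..<b} \<longleftrightarrow> T \<subseteq> {..<b}" for T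
      using permutes_in_image[OF p] permutes_in_image[OF permutes_inv[OF p]] by auto
    show "(\<Sum>T\<in>?S. of_int (sign p) * (\<Prod>i<b. h (k i + of_bool (i \<in> T) + int (p i)))) =
        (\<Sum>C\<in>?S. of_int (sign p) * (\<Prod>i<b. h (k i + int (p i) + of_bool (p i \<in> C))))"
    proof (rule sum.reindex_bij_witness[of _ "\<lambda>C. inv_into UNIV p ` C" "\<lambda>T. p ` T"])
      fix T assume "T \<in> ?S"
      have "p i \<in> p ` T \<longleftrightarrow> i \<in> T" for i
        using permutes_inj[OF p] by (simp add: inj_image_mem_iff)
      then show "of_int (sign p) * (\<Prod>i<b. h (k i + int (p i) + of_bool (p i \<in> p ` T))) =
          of_int (sign p) * (\<Prod>i<b. h (k i + of_bool (i \<in> T) + int (p i)))"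
        by (simp add: add_ac)
    qed (auto simp: ii c s)
  qed
  also have "\<dots> = (\<Sum>C\<in>?S. ldet b (\<lambda>i t. h (k i + int t + of_bool (t \<in> C))))"
    unfolding ldet_def by (rule sum.swap)
  also have "\<dots> = (\<Sum>C\<in>{{b - j..<b}}. ldet b (\<lambda>i t. h (k i + int t + of_bool (t \<in> C))))"
  proof (rule sum.mono_neutral_right[OF fin])
    show "{{b - j..<b}} \<subseteq> ?S"
      using assms by auto
    show "\<forall>C\<in>?S - {{b - j..<b}}. ldet b (\<lambda>i t. h (k i + int t + of_bool (t \<in> C))) = 0"
    proof
      fix C assume C: "C \<in> ?S - {{b - j..<b}}"
      text \<open>A set of columns that is not closed upwards moves one column onto its neighbour.\<close>
      have "\<exists>t. t \<in> C \<and> Suc t < b \<and> Suc t \<notin> C"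
      proof (rule ccontr)
        assume "\<nexists>t. t \<in> C \<and> Suc t < b \<and> Suc t \<notin> C"
        then have up: "t \<in> C \<Longrightarrow> Suc t < b \<Longrightarrow> Suc t \<in> C" for t
          by blast
        have up': "t \<in> C \<Longrightarrow> t \<le> u \<Longrightarrow> u < b \<Longrightarrow> u \<in> C" for t u
          by (induction u) (use up in \<open>auto simp: le_Suc_eq\<close>)
        show False
        proof (cases "C = {}")
          case True
          then show ?thesis using C by auto
        next
          case False
          have fC: "finite C"
            using C finite_subset[of C "{..<b}"] by auto
          have 1: "C = {Min C..<b}"
            using up'[OF Min_in[OF fC False]] Min_le[OF fC] C by auto
          have 2: "card C = b - Min C"
            by (subst 1) (rule card_atLeastLessThan)
          have 3: "Min C < b"
            using Min_in[OF fC False] C by auto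
          have "card C = j" "C \<noteq> {b - j..<b}"
            using C by auto
          then show ?thesis
            using 1 2 3 by (metis diff_diff_cancel less_imp_le_nat)
        qed
      qed
      then obtain t where t: "t \<in> C" "Suc t < b" "Suc t \<notin> C"
        by blast
      then show "ldet b (\<lambda>i t. h (k i + int t + of_bool (t \<in> C))) = 0"
        by (intro ldet_equal_cols[of t b "Suc t"]) (auto simp: add_ac)
    qed
  qed
  also have "\<dots> = ldet b (\<lambda>i t. h (k i + int (if t < b - j then t else Suc t)))"
    by simp (rule ldet_cong, auto simp: add_ac)
  finally show ?thesis .
qed

section \<open>Symmetric functions as a ring type\<close>

text \<open>Formal power series as a type of their own, so that the ring structure becomes a class
  instance. The carrier of \<open>Lambda\<close> will be a subset of it.\<close>

typedef 'k mps = "UNIV :: (nat multiset \<Rightarrow> 'k) set" morphisms coef Mps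
  by simp

setup_lifting type_definition_mps

lemma finite_submultisets: "finite {p. p \<subseteq># m}"
proof (induction m)
  case (add x m)
  have "{p. p \<subseteq># add_mset x m} \<subseteq> {p. p \<subseteq># m} \<union> add_mset x ` {p. p \<subseteq># m}"
  proof
    fix p assume p: "p \<in> {p. p \<subseteq># add_mset x m}"
    show "p \<in> {p. p \<subseteq># m} \<union> add_mset x ` {p. p \<subseteq># m}"
    proof (cases "x \<in># p")
      case True
      then obtain q where "p = add_mset x q"
        by (metis insert_DiffM)
      with p show ?thesis by auto
    next
      case False
      have "p \<subseteq># m"
      proof (rule mset_subset_eqI)
        fix a
        show "count p a \<le> count m a"
          using p False mset_subset_eq_count[of p "add_mset x m" a]
          by (cases "a = x") (auto simp: not_in_iff)
      qed
      then show ?thesis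
        by simp
    qed
  qed
  then show ?case
    using add finite_subset by blast
qed simp

lemma submultiset_sum: "q \<subseteq># m \<Longrightarrow> r \<subseteq># m - q \<Longrightarrow> q + r \<subseteq># (m :: 'a multiset)"
proof (rule mset_subset_eqI)
  fix a assume "q \<subseteq># m" "r \<subseteq># m - q"
  then show "count (q + r) a \<le> count m a"
    using mset_subset_eq_count[of q m a] mset_subset_eq_count[of r "m - q" a] by simp
qed

lemma submultiset_diff: "p \<subseteq># m \<Longrightarrow> q \<subseteq># p \<Longrightarrow> p - q \<subseteq># m - (q :: 'a multiset)"
proof (rule mset_subset_eqI)
  fix a assume "p \<subseteq># m"
  then show "count (p - q) a \<le> count (m - q) a"
    using mset_subset_eq_count[of p m a] by simp
qed

lemma multiset_diff_diff: "p \<subseteq># m \<Longrightarrow> m - (m - p) = (p :: 'a multiset)"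
  by (rule multiset_eqI) (simp add: mset_subset_eq_count)

instantiation mps :: (comm_ring_1) comm_ring_1
begin

lift_definition zero_mps :: "'a mps" is "\<lambda>_. 0" .
lift_definition one_mps :: "'a mps" is "\<lambda>m. if m = {#} then 1 else 0" .
lift_definition plus_mps :: "'a mps \<Rightarrow> 'a mps \<Rightarrow> 'a mps" is "\<lambda>f g m. f m + g m" .
lift_definition minus_mps :: "'a mps \<Rightarrow> 'a mps \<Rightarrow> 'a mps" is "\<lambda>f g m. f m - g m" .
lift_definition uminus_mps :: "'a mps \<Rightarrow> 'a mps" is "\<lambda>f m. - f m" .
lift_definition times_mps :: "'a mps \<Rightarrow> 'a mps \<Rightarrow> 'a mps" is
  "\<lambda>f g m. \<Sum>p | p \<subseteq># m. f p * g (m - p)" .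

instance
proof
  fix f g h :: "'a mps"
  show "f * g * h = f * (g * h)"
  proof transfer
    fix f g h :: "nat multiset \<Rightarrow> 'a"
    have "(\<Sum>p | p \<subseteq># m. (\<Sum>q | q \<subseteq># p. f q * g (p - q)) * h (m - p)) =
        (\<Sum>q | q \<subseteq># m. f q * (\<Sum>r | r \<subseteq># m - q. g r * h (m - q - r)))" for m
      unfolding sum_distrib_left sum_distrib_right
        sum.Sigma[OF finite_submultisets ballI[OF finite_submultisets]]
      by (rule sum.reindex_bij_witness[of _ "\<lambda>(q, r). (q + r, q)" "\<lambda>(p, q). (q, p - q)"])
        (auto simp: submultiset_sum submultiset_diff mult.assoc subset_mset.add_diff_inverse
          intro: subset_mset.order_trans)
    then show "(\<lambda>m. \<Sum>p | p \<subseteq># m. (\<Sum>q | q \<subseteq># p. f q * g (p - q)) * h (m - p)) =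
        (\<lambda>m. \<Sum>q | q \<subseteq># m. f q * (\<Sum>r | r \<subseteq># m - q. g r * h (m - q - r)))"
      by blast
  qed
  show "f * g = g * f"
  proof transfer
    fix f g :: "nat multiset \<Rightarrow> 'a"
    have "(\<Sum>p | p \<subseteq># m. f p * g (m - p)) = (\<Sum>p | p \<subseteq># m. g p * f (m - p))" for m
      by (rule sum.reindex_bij_witness[of _ "\<lambda>p. m - p" "\<lambda>p. m - p"])
        (auto simp: multiset_diff_diff mult.commute)
    then show "(\<lambda>m. \<Sum>p | p \<subseteq># m. f p * g (m - p)) = (\<lambda>m. \<Sum>p | p \<subseteq># m. g p * f (m - p))"
      by blast
  qed
  show "1 * f = f"
  proof transfer
    fix f :: "nat multiset \<Rightarrow> 'a"
    have "(\<Sum>p | p \<subseteq># m. (if p = {#} then 1 else 0) * f (m - p)) =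
        (\<Sum>p \<in> {{#}}. (if p = {#} then 1 else 0) * f (m - p))" for m
      by (rule sum.mono_neutral_right[OF finite_submultisets]) auto
    then show "(\<lambda>m. \<Sum>p | p \<subseteq># m. (if p = {#} then 1 else 0) * f (m - p)) = f"
      by simp
  qed
  show "(f + g) * h = f * h + g * h"
    by transfer (simp add: sum.distrib distrib_right)
  show "(0 :: 'a mps) \<noteq> 1"
    by transfer (metis zero_neq_one)
qed (transfer, simp add: fun_eq_iff algebra_simps)+

end

lemmas coef_simps [simp] = zero_mps.rep_eq one_mps.rep_eq plus_mps.rep_eq minus_mps.rep_eq
  uminus_mps.rep_eq Mps_inverse[OF UNIV_I]

lemma mps_eqI: "(\<And>m. coef f m = coef g m) \<Longrightarrow> f = g"
  by (simp add: coef_inject[symmetric] fun_eq_iff)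

lemma coef_sum: "coef (sum f A) m = (\<Sum>i\<in>A. coef (f i) m)"
  by (induction A rule: infinite_finite_induct) simp_all

definition xv :: "nat \<Rightarrow> 'k::comm_ring_1 mps" where
  "xv i = Mps (\<lambda>m. if m = {#i#} then 1 else 0)"

lemma coef_xv_mult: "coef (xv i * f) m = (if i \<in># m then coef f (m - {#i#}) else 0)"
proof -
  have "coef (xv i * f) m = (\<Sum>p | p \<subseteq># m. (if p = {#i#} then coef f (m - {#i#}) else 0))"
    unfolding times_mps.rep_eq by (rule sum.cong) (auto simp: xv_def)
  then show ?thesis
    by (simp add: finite_submultisets)
qed

lemma coef_prod_xv:
  assumes "finite S"
  shows "coef (\<Prod>c\<in>S. xv (T c)) m = (if image_mset T (mset_set S) = m then 1 else 0)"
  using assms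
proof (induction S arbitrary: m)
  case (insert c S)
  then show ?case
    by (auto simp: coef_xv_mult) 
qed simp

text \<open>Sets all variables from index \<open>N\<close> on to zero. A monomial involves finitely
  many variables, so each coefficient is visible after a suitable truncation.\<close>

definition rho :: "nat \<Rightarrow> 'k::comm_ring_1 mps \<Rightarrow> 'k mps" where
  "rho N f = Mps (\<lambda>m. if set_mset m \<subseteq> {..<N} then coef f m else 0)"

lemma rho_hom: "rho N (f + g) = rho N f + rho N g" "rho N (f * g) = rho N f * rho N g"
  "rho N 0 = 0" "rho N 1 = 1" "rho N (- f) = - rho N f"
proof -
  show "rho N (f * g) = rho N f * rho N g"
  proof (rule mps_eqI)
    fix m
    show "coef (rho N (f * g)) m = coef (rho N f * rho N g) m"
    proof (cases "set_mset m \<subseteq> {..<N}")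
      case True
      have "set_mset p \<subseteq> {..<N} \<and> set_mset (m - p) \<subseteq> {..<N}" if "p \<subseteq># m" for p
        using that True set_mset_mono[of p m] set_mset_mono[of "m - p" m] by auto
      then show ?thesis
        using True by (simp add: rho_def times_mps.rep_eq)
    next
      case False
      have "\<not> (set_mset p \<subseteq> {..<N} \<and> set_mset (m - p) \<subseteq> {..<N})" if "p \<subseteq># m" for p
        using that False by (metis Un_least set_mset_union subset_mset.add_diff_inverse)
      then show ?thesis
        using False by (auto simp: rho_def times_mps.rep_eq intro!: sum.neutral)
    qed
  qed
qed (rule mps_eqI, simp add: rho_def; fail)+

lemma rho_sum: "rho N (sum f A) = (\<Sum>i\<in>A. rho N (f i))"
  by (induction A rule: infinite_finite_induct) (simp_all add: rho_hom)

lemma rho_prod: "rho N (prod f A) = (\<Prod>i\<in>A. rho N (f i))"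
  by (induction A rule: infinite_finite_induct) (simp_all add: rho_hom)

lemma rho_ldet: "rho N (ldet a M) = ldet a (\<lambda>i j. rho N (M i j))"
proof -
  have "rho N (of_int (sign p) * x) = of_int (sign p) * rho N x" for p :: "nat \<Rightarrow> nat" and x :: "'a mps"
    by (cases p rule: sign_cases) (simp_all add: rho_hom)
  then show ?thesis
    by (simp add: ldet_def rho_sum rho_prod)
qed

section \<open>Tableaux\<close>

definition tableaux :: "(nat \<times> nat) set \<Rightarrow> nat \<Rightarrow> (nat \<times> nat \<Rightarrow> nat) set" where
  "tableaux S N = {T \<in> extensional S.
     (\<forall>i j j'. (i, j) \<in> S \<and> (i, j') \<in> S \<and> j < j' \<longrightarrow> T (i, j) \<le> T (i, j')) \<and>
     (\<forall>i i' j. (i, j) \<in> S \<and> (i', j) \<in> S \<and> i < i' \<longrightarrow> T (i, j) < T (i', j)) \<and>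
     (\<forall>c\<in>S. T c < N)}"

definition order_ideal :: "(nat \<times> nat) set \<Rightarrow> bool" where
  "order_ideal S \<longleftrightarrow> (\<forall>i j i' j'. (i, j) \<in> S \<and> i' \<le> i \<and> j' \<le> j \<longrightarrow> (i', j') \<in> S)"

text \<open>Cells are pairs of row and column, so \<open>S - R\<close> is a horizontal strip: no
  column contains two of its cells.\<close>

definition strips :: "(nat \<times> nat) set \<Rightarrow> (nat \<times> nat) set set" where
  "strips S = {R. R \<subseteq> S \<and> order_ideal R \<and>
     (\<forall>i i' j. (i, j) \<in> S - R \<and> (i', j) \<in> S - R \<longrightarrow> i = i')}"

lemma finite_tableaux: "finite S \<Longrightarrow> finite (tableaux S N)"
  by (rule finite_subset[OF _ finite_PiE[of S "\<lambda>_. {..<N}"]]) (auto simp: tableaux_def PiE_def)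

lemma finite_strips: "finite S \<Longrightarrow> finite (strips S)"
  by (rule finite_subset[of _ "Pow S"]) (auto simp: strips_def)

definition fill_strip :: "(nat \<times> nat) set \<Rightarrow> (nat \<times> nat) set \<Rightarrow> nat \<Rightarrow> (nat \<times> nat \<Rightarrow> nat) \<Rightarrow> nat \<times> nat \<Rightarrow> nat" where
  "fill_strip S R N T = (\<lambda>c. if c \<in> R then T c else if c \<in> S then N else undefined)"

text \<open>The branching rule. The entries below \<open>N\<close> fill an order ideal, and
  strictness in columns makes the cells with the largest entry \<open>N\<close> a horizontal strip;
  \<open>fill_strip\<close> puts them back.\<close>

lemma sum_tableaux_Suc:
  assumes fin: "finite S" and S: "order_ideal S"
  shows "(\<Sum>T\<in>tableaux S (Suc N). F T) = (\<Sum>R\<in>strips S. \<Sum>T\<in>tableaux R N. F (fill_strip S R N T))"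
proof -
  have finR: "finite R" if "R \<in> strips S" for R
    using that fin by (auto simp: strips_def intro: finite_subset)
  have ideal: "(i', j') \<in> R" if "order_ideal R" "(i, j) \<in> R" "i' \<le> i" "j' \<le> j" for R i j i' j'
    using that unfolding order_ideal_def by blast
  have sigma: "(\<Sum>R\<in>strips S. \<Sum>T\<in>tableaux R N. F (fill_strip S R N T)) =
      (\<Sum>(R, T)\<in>(SIGMA R:strips S. tableaux R N). F (fill_strip S R N T))"
    by (rule sum.Sigma) (auto intro: finite_strips fin finite_tableaux finR)
  show ?thesis
    unfolding sigma
  proof (rule sum.reindex_bij_witness[of _ "\<lambda>(R, T). fill_strip S R N T"
        "\<lambda>T. ({c \<in> S. T c < N}, restrict T {c \<in> S. T c < N})"])
    fix T assume T: "T \<in> tableaux S (Suc N)"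
    have row: "T (i, j) \<le> T (i, j')" if "(i, j) \<in> S" "(i, j') \<in> S" "j \<le> j'" for i j j'
      using T that unfolding tableaux_def by (cases "j = j'") auto
    have col: "T (i, j) < T (i', j)" if "(i, j) \<in> S" "(i', j) \<in> S" "i < i'" for i i' j
      using T that unfolding tableaux_def by auto
    have bound: "T c < Suc N" if "c \<in> S" for c
      using T that by (auto simp: tableaux_def)
    have ext: "T c = undefined" if "c \<notin> S" for c
      using T that extensional_arb[of T S c] unfolding tableaux_def by blast
    let ?R = "{c \<in> S. T c < N}"
    have "order_ideal ?R"
      unfolding order_ideal_def
    proof (intro allI impI)
      fix i j i' j' assume *: "(i, j) \<in> ?R \<and> i' \<le> i \<and> j' \<le> j"
      then have m: "(i', j') \<in> S" "(i', j) \<in> S"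
        using ideal[OF S] by auto
      then have "T (i', j') \<le> T (i', j)"
        using row * by auto
      also have "T (i', j) \<le> T (i, j)"
        using * m col[of i' j i] by (cases "i' = i") auto
      finally show "(i', j') \<in> ?R"
        using * m by auto
    qed
    moreover have "i = i'" if "(i, j) \<in> S - ?R" "(i', j) \<in> S - ?R" for i i' j
    proof -
      have "T (i, j) = N" "T (i', j) = N"
        using that bound[of "(i, j)"] bound[of "(i', j)"] by auto
      then show ?thesis
        using that col[of i j i'] col[of i' j i] by (metis DiffD1 less_irrefl linorder_neqE_nat)
    qed
    ultimately have "?R \<in> strips S"
      by (auto simp: strips_def)
    moreover have "restrict T ?R \<in> tableaux ?R N"
      using row col by (auto simp: tableaux_def)
    ultimately show "(?R, restrict T ?R) \<in> (SIGMA R:strips S. tableaux R N)"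
      by auto
    show *: "(case (?R, restrict T ?R) of (R, T) \<Rightarrow> fill_strip S R N T) = T"
      using bound ext by (fastforce simp: fill_strip_def fun_eq_iff less_Suc_eq)
    show "(case (?R, restrict T ?R) of (R, T) \<Rightarrow> F (fill_strip S R N T)) = F T"
      using * by simp
  next
    fix z assume "z \<in> (SIGMA R:strips S. tableaux R N)"
    then obtain R T where z: "z = (R, T)" "R \<in> strips S" "T \<in> tableaux R N"
      by auto
    then have R: "R \<subseteq> S" "order_ideal R" "\<And>i i' j. (i, j) \<in> S - R \<Longrightarrow> (i', j) \<in> S - R \<Longrightarrow> i = i'"
      by (auto simp: strips_def)
    have row: "T (i, j) \<le> T (i, j')" if "(i, j) \<in> R" "(i, j') \<in> R" "j < j'" for i j j'
      using z(3) that unfolding tableaux_def by auto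
    have col: "T (i, j) < T (i', j)" if "(i, j) \<in> R" "(i', j) \<in> R" "i < i'" for i i' j
      using z(3) that unfolding tableaux_def by auto
    have bound: "T c < N" if "c \<in> R" for c
      using z(3) that by (auto simp: tableaux_def)
    let ?T = "fill_strip S R N T"
    have "?T (i, j) \<le> ?T (i, j')" if "(i, j) \<in> S" "(i, j') \<in> S" "j < j'" for i j j'
      using that row[of i j j'] bound[of "(i, j)"] ideal[OF R(2), of i j' i j] by (auto simp: fill_strip_def)
    moreover have "?T (i, j) < ?T (i', j)" if "(i, j) \<in> S" "(i', j) \<in> S" "i < i'" for i i' j
      using that col[of i j i'] bound[of "(i, j)"] ideal[OF R(2), of i' j i j] R(3)[of i j i']
      by (auto simp: fill_strip_def)
    moreover have "?T c < Suc N" if "c \<in> S" for c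
      using bound[of c] by (auto simp: fill_strip_def that intro: less_SucI)
    moreover have "?T \<in> extensional S"
      using R(1) by (auto simp: fill_strip_def extensional_def)
    ultimately show "(case z of (R, T) \<Rightarrow> fill_strip S R N T) \<in> tableaux S (Suc N)"
      by (auto simp: z tableaux_def)
    have "{c \<in> S. ?T c < N} = R"
      using R(1) bound by (auto simp: fill_strip_def)
    moreover have "restrict ?T R = T"
      using z(3) by (auto simp: fill_strip_def tableaux_def extensional_def fun_eq_iff)
    ultimately show "({c \<in> S. (case z of (R, T) \<Rightarrow> fill_strip S R N T) c < N},
        restrict (case z of (R, T) \<Rightarrow> fill_strip S R N T) {c \<in> S. (case z of (R, T) \<Rightarrow> fill_strip S R N T) c < N}) = z"
      by (simp add: z)
  qed
qed

definition schur_poly :: "nat \<Rightarrow> (nat \<times> nat) set \<Rightarrow> 'k::comm_ring_1 mps" where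
  "schur_poly N S = (\<Sum>T\<in>tableaux S N. \<Prod>c\<in>S. xv (T c))"

lemma schur_poly_0: "schur_poly 0 S = (if S = {} then 1 else 0)"
proof -
  have "tableaux {} 0 = {\<lambda>_. undefined}" "S \<noteq> {} \<Longrightarrow> tableaux S 0 = {}"
    by (auto simp: tableaux_def extensional_def)
  then show ?thesis
    by (auto simp: schur_poly_def)
qed

lemma schur_poly_Suc:
  assumes "finite S" "order_ideal S"
  shows "schur_poly (Suc N) S = (\<Sum>R\<in>strips S. xv N ^ card (S - R) * schur_poly N R)"
  unfolding schur_poly_def sum_tableaux_Suc[OF assms] sum_distrib_left
proof (intro sum.cong refl)
  fix R T assume "R \<in> strips S"
  then have R: "R \<subseteq> S"
    by (auto simp: strips_def)
  then have "(\<Prod>c\<in>S. xv (fill_strip S R N T c)) =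
      (\<Prod>c\<in>S - R. xv (fill_strip S R N T c)) * (\<Prod>c\<in>R. xv (fill_strip S R N T c))"
    using assms(1) by (rule prod.subset_diff)
  also have "(\<Prod>c\<in>S - R. xv (fill_strip S R N T c)) = (\<Prod>c\<in>S - R. xv N)"
    by (rule prod.cong) (auto simp: fill_strip_def)
  also have "(\<Prod>c\<in>R. xv (fill_strip S R N T c)) = (\<Prod>c\<in>R. xv (T c))"
    by (rule prod.cong) (auto simp: fill_strip_def)
  finally show "(\<Prod>c\<in>S. xv (fill_strip S R N T c)) = xv N ^ card (S - R) * (\<Prod>c\<in>R. xv (T c))"
    by simp
qed

lemma coef_schur_poly:
  assumes "finite S"
  shows "coef (schur_poly N S) m = of_nat (card {T \<in> tableaux S N. image_mset T (mset_set S) = m})"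
  using finite_tableaux[OF assms, of N]
  by (simp add: schur_poly_def coef_sum coef_prod_xv[OF assms] sum.If_cases Int_def
      flip: sum.inter_filter)

lemma finite_cells: "finite (cells \<alpha>)"
  by (simp add: cells_def)

text \<open>A tableau of weight \<open>m\<close> has entries from \<open>m\<close> only, so the
  bound \<open>N\<close> excludes none of them.\<close>

lemma schur_eq_schur_poly:
  assumes "set_mset m \<subseteq> {..<N}"
  shows "schur \<alpha> m = coef (schur_poly N (cells \<alpha>)) m"
proof -
  have "{T \<in> ssyt \<alpha>. image_mset T (mset_set (cells \<alpha>)) = m} =
      {T \<in> tableaux (cells \<alpha>) N. image_mset T (mset_set (cells \<alpha>)) = m}"
  proof -
    have "T c < N" if "image_mset T (mset_set (cells \<alpha>)) = m" "c \<in> cells \<alpha>" for T c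
    proof -
      have "T c \<in># image_mset T (mset_set (cells \<alpha>))"
        using that(2) finite_cells[of \<alpha>] by simp
      then show ?thesis
        using that(1) assms by auto
    qed
    then show ?thesis
      by (auto simp: ssyt_def tableaux_def)
  qed
  then show ?thesis
    by (simp add: schur_def coef_schur_poly[OF finite_cells])
qed

section \<open>The Jacobi--Trudi formulas\<close>

definition shape :: "(nat \<Rightarrow> nat) \<Rightarrow> nat \<Rightarrow> (nat \<times> nat) set" where
  "shape l a = (SIGMA i:{..<a}. {..<l i})"

text \<open>The transposed diagram: \<open>l i\<close> is now the length of column \<open>i\<close>,
  as is suitable for a conjugate partition given by the original parts.\<close>

definition tshape :: "(nat \<Rightarrow> nat) \<Rightarrow> nat \<Rightarrow> (nat \<times> nat) set" where
  "tshape l a = {(j, i). i < a \<and> j < l i}"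

lemma finite_shape: "finite (shape l a)" "finite (tshape l a)"
proof -
  show f: "finite (shape l a)"
    by (simp add: shape_def)
  have "tshape l a = prod.swap ` shape l a"
    by (auto simp: shape_def tshape_def)
  then show "finite (tshape l a)"
    using f by simp
qed

lemma initial_segment:
  fixes A :: "nat set"
  assumes "finite A" "\<And>i j. i \<in> A \<Longrightarrow> j \<le> i \<Longrightarrow> j \<in> A"
  shows "A = {..<card A}"
proof (cases "A = {}")
  case False
  have *: "A = {..Max A}"
    using assms(2)[OF Max_in[OF assms(1) False]] Max_ge[OF assms(1)] by blast
  have "card A = Suc (Max A)"
    by (subst *) (rule card_atMost)
  then show ?thesis
    using * by (simp only: lessThan_Suc_atMost)
qed simp

lemma order_ideal_shape:
  assumes "antimono l"
  shows "order_ideal (shape l a)" "order_ideal (tshape l a)"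
proof -
  have "l i \<le> l i'" if "i' \<le> i" for i i'
    using assms that by (rule antimonoD)
  then show "order_ideal (shape l a)" "order_ideal (tshape l a)"
    unfolding order_ideal_def shape_def tshape_def
    by (auto intro: le_less_trans less_le_trans)
qed

lemma card_diff_shape:
  assumes "\<And>i. i < a \<Longrightarrow> m i \<le> l i"
  shows "card (shape l a - shape m a) = (\<Sum>i<a. l i - m i)"
proof -
  have "shape l a - shape m a = (SIGMA i:{..<a}. {m i..<l i})"
    by (auto simp: shape_def)
  then show ?thesis
    by simp
qed

lemma card_diff_tshape:
  assumes "\<And>i. i < a \<Longrightarrow> m i \<le> l i"
  shows "card (tshape l a - tshape m a) = (\<Sum>i<a. l i - m i)"
proof -
  have "tshape l a - tshape m a = prod.swap ` (shape l a - shape m a)"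
    by (auto simp: shape_def tshape_def)
  then show ?thesis
    using card_diff_shape[OF assms] by (simp add: card_image)
qed

text \<open>Restricted to extensional functions, so that \<open>m\<close> can be recovered from its
  diagram and sums over strips can be reindexed.\<close>

definition interlacing :: "(nat \<Rightarrow> nat) \<Rightarrow> nat \<Rightarrow> (nat \<Rightarrow> nat) set" where
  "interlacing l a = PiE {..<a} (\<lambda>i. {l (Suc i)..l i})"

lemma inj_shape: "inj_on (\<lambda>m. shape m a) (extensional {..<a})"
proof (rule inj_onI)
  fix m m' assume *: "m \<in> extensional {..<a}" "m' \<in> extensional {..<a}" "shape m a = shape m' a"
  show "m = m'"
  proof (rule extensionalityI[OF *(1,2)])
    fix i assume "i \<in> {..<a}"
    then have "j < m i \<longleftrightarrow> j < m' i" for j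
      using *(3) by (auto simp: shape_def set_eq_iff)
    then show "m i = m' i"
      by (metis less_irrefl linorder_neqE_nat)
  qed
qed

text \<open>If row \<open>i\<close> of the smaller diagram ended before row \<open>Suc i\<close> of
  the larger one, the column at that place would contain two removed cells, one in each of these
  rows. For the last row the lower bound is \<open>l a = 0\<close>.\<close>

lemma strips_shape:
  assumes l: "antimono l" "l a = 0"
  shows "strips (shape l a) = (\<lambda>m. shape m a) ` interlacing l a"
proof (intro equalityI subsetI)
  fix R assume "R \<in> strips (shape l a)"
  then have R: "R \<subseteq> shape l a" "order_ideal R"
    "\<And>i i' j. (i, j) \<in> shape l a - R \<Longrightarrow> (i', j) \<in> shape l a - R \<Longrightarrow> i = i'"
    by (auto simp: strips_def)
  define m where "m = restrict (\<lambda>i. card {j. (i, j) \<in> R}) {..<a}"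
  have row: "{j. (i, j) \<in> R} = {..<m i}" if "i < a" for i
  proof -
    have "finite {j. (i, j) \<in> R}"
      by (rule finite_subset[of _ "{..<l i}"]) (use R(1) in \<open>auto simp: shape_def\<close>)
    then show ?thesis
      using that R(2) initial_segment[of "{j. (i, j) \<in> R}"] by (auto simp: m_def order_ideal_def)
  qed
  have "(i, j) \<in> R \<longleftrightarrow> (i, j) \<in> shape m a" for i j
  proof (cases "i < a")
    case True
    then have "j \<in> {j. (i, j) \<in> R} \<longleftrightarrow> j \<in> {..<m i}"
      using row by simp
    then show ?thesis
      using True by (simp add: shape_def)
  qed (use R(1) in \<open>auto simp: shape_def\<close>)
  then have Rm: "R = shape m a"
    by auto
  have "m i \<in> {l (Suc i)..l i}" if i: "i < a" for i
  proof -
    have "m i \<le> l i"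
    proof (rule ccontr)
      assume "\<not> m i \<le> l i"
      then have "(i, l i) \<in> R"
        using i by (auto simp: Rm shape_def)
      then show False
        using R(1) by (auto simp: shape_def)
    qed
    moreover have "l (Suc i) \<le> m i"
    proof (rule ccontr)
      assume n: "\<not> l (Suc i) \<le> m i"
      have "Suc i < a"
        using n l antimonoD[OF l(1), of a "Suc i"] by (metis le_zero_eq not_le zero_le)
      moreover have "l (Suc i) \<le> l i"
        using antimonoD[OF l(1)] by simp
      ultimately have "(i, m i) \<in> shape l a" "(Suc i, m i) \<in> shape l a"
        using n i by (auto simp: shape_def)
      moreover have "(i, m i) \<notin> R"
        by (simp add: Rm shape_def)
      moreover from this have "(Suc i, m i) \<notin> R"
        using R(2) unfolding order_ideal_def by (metis le_refl le_SucI)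
      ultimately show False
        using R(3)[of i "m i" "Suc i"] by simp
    qed
    ultimately show ?thesis
      by simp
  qed
  then have "m \<in> interlacing l a"
    by (auto simp: interlacing_def m_def)
  then show "R \<in> (\<lambda>m. shape m a) ` interlacing l a"
    using Rm by blast
next
  fix R assume "R \<in> (\<lambda>m. shape m a) ` interlacing l a"
  then obtain m where mem: "m \<in> interlacing l a" and R: "R = shape m a"
    by blast
  have "l (Suc i) \<le> m i \<and> m i \<le> l i" if "i < a" for i
    using mem that by (auto simp: interlacing_def PiE_iff)
  then have m: "i < a \<Longrightarrow> l (Suc i) \<le> m i" "i < a \<Longrightarrow> m i \<le> l i" "R = shape m a" for i
    using R by auto
  have ml: "l i' \<le> m i" if "i < i'" "i < a" for i i'
    using m(1)[of i] antimonoD[OF l(1), of "Suc i" i'] that by auto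
  show "R \<in> strips (shape l a)"
    unfolding strips_def
  proof (intro CollectI conjI allI impI)
    show "R \<subseteq> shape l a"
      using m(2) by (fastforce simp: m(3) shape_def)
    show "order_ideal R"
      unfolding order_ideal_def m(3)
    proof (intro allI impI)
      fix i j i' j' assume *: "(i, j) \<in> shape m a \<and> i' \<le> i \<and> j' \<le> j"
      then have i: "i < a" "j < m i"
        by (auto simp: shape_def)
      have "m i \<le> m i'"
        using * ml[of i' i] m(2)[OF i(1)] i(1) by (cases "i' = i") auto
      then show "(i', j') \<in> shape m a"
        using * i by (auto simp: shape_def)
    qed
    have "\<not> i < i'" if "(i, j) \<in> shape l a - R" "(i', j) \<in> shape l a - R" for i i' j
      using that ml[of i i'] by (auto simp: m(3) shape_def)
    then show "i = i'" if "(i, j) \<in> shape l a - R \<and> (i', j) \<in> shape l a - R" for i i' j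
      using that by (metis linorder_neqE_nat)
  qed
qed

text \<open>Indexed by integers, so that the entries of negative degree in the Jacobi--Trudi
  matrices are zero by definition.\<close>

definition hs :: "int \<Rightarrow> 'k::comm_ring_1 mps" where
  "hs r = Mps (\<lambda>m. if int (size m) = r then 1 else 0)"

definition es :: "int \<Rightarrow> 'k::comm_ring_1 mps" where
  "es r = Mps (\<lambda>m. if int (size m) = r \<and> (\<forall>i. count m i \<le> 1) then 1 else 0)"

lemma hs_neg: "r < 0 \<Longrightarrow> hs r = 0" and es_neg: "r < 0 \<Longrightarrow> es r = 0"
  by (rule mps_eqI, simp add: hs_def es_def)+

lemma rho_0: "rho 0 (hs r) = (if r = 0 then 1 else 0)" "rho 0 (es r) = (if r = 0 then 1 else 0)"
  by (rule mps_eqI, auto simp: rho_def hs_def es_def)+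

lemma rho_hs_Suc: "rho (Suc N) (hs r) = rho N (hs r) + xv N * rho (Suc N) (hs (r - 1))"
proof (rule mps_eqI)
  fix m
  show "coef (rho (Suc N) (hs r)) m = coef (rho N (hs r) + xv N * rho (Suc N) (hs (r - 1))) m"
  proof (cases "N \<in># m")
    case True
    then obtain m' where "m = add_mset N m'"
      by (metis insert_DiffM)
    then show ?thesis
      by (auto simp: rho_def hs_def coef_xv_mult)
  next
    case False
    then have "set_mset m \<subseteq> {..<Suc N} \<longleftrightarrow> set_mset m \<subseteq> {..<N}"
      by (auto simp: less_Suc_eq)
    then show ?thesis
      using False by (simp add: rho_def hs_def coef_xv_mult)
  qed
qed

lemma rho_es_Suc: "rho (Suc N) (es r) = rho N (es r) + xv N * rho N (es (r - 1))"
proof (rule mps_eqI)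
  fix m
  show "coef (rho (Suc N) (es r)) m = coef (rho N (es r) + xv N * rho N (es (r - 1))) m"
  proof (cases "N \<in># m")
    case True
    then obtain m' where m: "m = add_mset N m'"
      by (metis insert_DiffM)
    have "(\<forall>i. count m i \<le> 1) \<longleftrightarrow> N \<notin># m' \<and> (\<forall>i. count m' i \<le> 1)"
    proof
      assume *: "\<forall>i. count m i \<le> 1"
      then have "count m' i \<le> 1" for i
        using m by (metis count_add_mset le_SucI not_less_eq_eq le_trans nat_le_linear One_nat_def)
      moreover have "N \<notin># m'"
        using *[rule_format, of N] m by (simp add: not_in_iff)
      ultimately show "N \<notin># m' \<and> (\<forall>i. count m' i \<le> 1)"
        by blast
    next
      assume "N \<notin># m' \<and> (\<forall>i. count m' i \<le> 1)"
      then show "\<forall>i. count m i \<le> 1"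
        using m by (simp add: not_in_iff)
    qed
    moreover have "set_mset m' \<subseteq> {..<N} \<longleftrightarrow> set_mset m' \<subseteq> {..<Suc N} \<and> N \<notin># m'"
      by (auto simp: less_Suc_eq)
    ultimately show ?thesis
      using m by (auto simp: rho_def es_def coef_xv_mult)
  next
    case False
    then have "set_mset m \<subseteq> {..<Suc N} \<longleftrightarrow> set_mset m \<subseteq> {..<N}"
      by (auto simp: less_Suc_eq)
    then show ?thesis
      using False by (simp add: rho_def es_def coef_xv_mult)
  qed
qed

text \<open>The recursion in the last variable, unrolled \<open>Suc d\<close> times. The left side
  is the row operation performed in \<open>jacobi_trudi_rho\<close>.\<close>

lemma rho_hs_telescope:
  "rho (Suc N) (hs r :: 'k::comm_ring_1 mps) - xv N ^ Suc d * rho (Suc N) (hs (r - int d - 1)) =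
    (\<Sum>j\<le>d. xv N ^ j * rho N (hs (r - int j)))"
proof (induction d)
  case 0
  then show ?case
    by (subst rho_hs_Suc[of N r]) simp
next
  case (Suc d)
  have "rho (Suc N) (hs (r - int d - 1) :: 'k mps) = rho N (hs (r - int (Suc d))) +
      xv N * rho (Suc N) (hs (r - int (Suc d) - 1))"
    by (subst rho_hs_Suc) (simp add: algebra_simps)
  then show ?case
    using Suc by (simp add: algebra_simps)
qed

lemma ldet_identity: "ldet a (\<lambda>i j. if i = j then 1 else 0) = (1 :: 'r::comm_ring_1)"
proof -
  have "ldet a (\<lambda>i j. if i = j then 1 else 0 :: 'r) =
      (\<Sum>p\<in>{id}. of_int (sign p) * (\<Prod>i<a. if i = p i then 1 else 0))"
    unfolding ldet_def
  proof (rule sum.mono_neutral_right)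
    show "\<forall>p\<in>{p. p permutes {..<a}} - {id}. of_int (sign p) * (\<Prod>i<a. if i = p i then 1 else 0 :: 'r) = 0"
    proof
      fix p assume p: "p \<in> {p. p permutes {..<a}} - {id}"
      then obtain i where "p i \<noteq> i"
        by (auto simp: fun_eq_iff)
      then have "i < a" "(if i = p i then 1 else 0 :: 'r) = 0"
        using p by (auto simp: permutes_def)
      then have "(\<Prod>i<a. if i = p i then 1 else 0 :: 'r) = 0"
        by (intro prod_zero bexI[of _ i]) auto
      then show "of_int (sign p) * (\<Prod>i<a. if i = p i then 1 else 0 :: 'r) = 0"
        by simp
    qed
  qed (auto simp: finite_permutations permutes_id)
  then show ?thesis
    by simp
qed

text \<open>Without variables only degree zero survives. The empty partition gives the identity
  matrix, and any other partition gives a first row of positive degrees, that is of zeros.\<close>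

lemma ldet_rho_0:
  assumes g: "\<And>r. g r = (if r = 0 then 1 else 0 :: 'r::comm_ring_1)" and l: "antimono l" "l a = 0"
  shows "ldet a (\<lambda>i t. g (int (l i) - int i + int t)) = (if \<forall>i<a. l i = 0 then 1 else 0)"
proof (cases "\<forall>i<a. l i = 0")
  case True
  then have "ldet a (\<lambda>i t. g (int (l i) - int i + int t)) = ldet a (\<lambda>i j. if i = j then 1 else 0)"
    by (intro ldet_cong) (auto simp: g)
  then show ?thesis
    using True by (simp add: ldet_identity)
next
  case False
  then obtain i where i: "i < a" "l i > 0"
    by auto
  then have "l 0 > 0"
    using antimonoD[OF l(1), of 0 i] by simp
  then have "ldet a (\<lambda>i t. g (int (l i) - int i + int t)) = 0"
    using i(1) by (intro ldet_zero_row[of 0]) (auto simp: g)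
  then show ?thesis
    using False by simp
qed

lemma antimono_extend:
  "(\<And>i. Suc i < a \<Longrightarrow> m (Suc i) \<le> m i) \<Longrightarrow> antimono (\<lambda>i. if i < a then m i else (0::nat))"
  by (auto simp: antimono_iff_le_Suc)

lemma interlacing_extend:
  assumes "m \<in> interlacing l a"
  shows "antimono (\<lambda>i. if i < a then m i else (0::nat))"
proof (rule antimono_extend)
  fix i assume "Suc i < a"
  moreover have "m j \<in> {l (Suc j)..l j}" if "j < a" for j
    using assms that by (auto simp: interlacing_def PiE_iff)
  ultimately have "m (Suc i) \<le> l (Suc i)" "l (Suc i) \<le> m i"
    by (metis atLeastAtMost_iff) (metis Suc_lessD \<open>Suc i < a\<close> \<open>\<And>j. j < a \<Longrightarrow> m j \<in> {l (Suc j)..l j}\<close> atLeastAtMost_iff)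
  then show "m (Suc i) \<le> m i"
    by simp
qed

text \<open>Induction on the number of variables. Subtracting from row \<open>i\<close> the next row
  times x_N to the power l_i - l_(i+1) + 1 telescopes it to a sum over the integers from
  \<open>l (Suc i)\<close> to \<open>l i\<close>. Expanding all rows sums over interlacing
  partitions, weighted by the size of the removed strip, as the branching rule does.\<close>

lemma jacobi_trudi_rho:
  assumes "antimono l" "l a = 0"
  shows "ldet a (\<lambda>i t. rho N (hs (int (l i) - int i + int t))) = schur_poly N (shape l a)"
  using assms
proof (induction N arbitrary: l)
  case 0
  have "shape l a = {} \<longleftrightarrow> (\<forall>i<a. l i = 0)"
    by (auto simp: shape_def)
  then show ?case
    using ldet_rho_0[of "\<lambda>r. rho 0 (hs r)", OF rho_0(1) 0] by (simp add: schur_poly_0)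
next
  case (Suc N)
  define H where "H i t = rho (Suc N) (hs (int (l i) - int i + int t) :: 'a mps)" for i t
  let ?h = "\<lambda>r. rho N (hs r) :: 'a mps"
  \<comment> \<open>Because \<open>l a = 0\<close>, the row outside the matrix has the negative
    degrees \<open>t - a\<close>.\<close>
  have "H a t = 0" if "t < a" for t
    using that Suc.prems(2) by (simp add: H_def hs_neg rho_hom)
  then have "ldet a H = ldet a (\<lambda>i t. H i t + - (xv N ^ Suc (l i - l (Suc i))) * H (Suc i) t)"
    by (rule ldet_add_next_row[symmetric])
  also have "\<dots> = ldet a (\<lambda>i t. \<Sum>k\<in>{l (Suc i)..l i}. xv N ^ (l i - k) * ?h (int k - int i + int t))"
  proof (rule ldet_cong)
    fix i t
    have le: "l (Suc i) \<le> l i"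
      using antimonoD[OF Suc.prems(1)] by simp
    have "H i t + - (xv N ^ Suc (l i - l (Suc i))) * H (Suc i) t =
        (\<Sum>j\<le>l i - l (Suc i). xv N ^ j * ?h (int (l i) - int i + int t - int j))"
      using rho_hs_telescope[of N "int (l i) - int i + int t" "l i - l (Suc i)"] le
      by (simp add: H_def of_nat_diff algebra_simps)
    also have "\<dots> = (\<Sum>k\<in>{l (Suc i)..l i}. xv N ^ (l i - k) * ?h (int k - int i + int t))"
      by (rule sum.reindex_bij_witness[of _ "\<lambda>k. l i - k" "\<lambda>j. l i - j"])
        (use le in \<open>auto simp: of_nat_diff algebra_simps\<close>)
    finally show "H i t + - (xv N ^ Suc (l i - l (Suc i))) * H (Suc i) t =
        (\<Sum>k\<in>{l (Suc i)..l i}. xv N ^ (l i - k) * ?h (int k - int i + int t))" .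
  qed
  also have "\<dots> = (\<Sum>m\<in>interlacing l a. (\<Prod>i<a. xv N ^ (l i - m i)) *
      ldet a (\<lambda>i t. ?h (int (m i) - int i + int t)))"
    unfolding interlacing_def by (rule ldet_expand_rows) simp
  also have "\<dots> = (\<Sum>m\<in>interlacing l a. xv N ^ card (shape l a - shape m a) * schur_poly N (shape m a))"
  proof (rule sum.cong[OF refl])
    fix m assume m: "m \<in> interlacing l a"
    let ?m = "\<lambda>i. if i < a then m i else 0"
    have "ldet a (\<lambda>i t. ?h (int (m i) - int i + int t)) = ldet a (\<lambda>i t. ?h (int (?m i) - int i + int t))"
      by (rule ldet_cong) simp
    also have "\<dots> = schur_poly N (shape ?m a)"
      by (rule Suc.IH[OF interlacing_extend[OF m]]) simp
    also have "shape ?m a = shape m a"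
      by (auto simp: shape_def)
    finally show "(\<Prod>i<a. xv N ^ (l i - m i)) * ldet a (\<lambda>i t. ?h (int (m i) - int i + int t)) =
        xv N ^ card (shape l a - shape m a) * schur_poly N (shape m a)"
      using m by (subst card_diff_shape) (auto simp: power_sum interlacing_def PiE_iff)
  qed
  also have "\<dots> = schur_poly (Suc N) (shape l a)"
    unfolding schur_poly_Suc[OF finite_shape(1) order_ideal_shape(1)[OF Suc.prems(1)]]
      strips_shape[OF Suc.prems]
    by (subst sum.reindex)
      (auto intro!: inj_on_subset[OF inj_shape] simp: interlacing_def PiE_def)
  finally have "ldet a H = schur_poly (Suc N) (shape l a)" .
  moreover have "ldet a H = ldet a (\<lambda>i t. rho (Suc N) (hs (int (l i) - int i + int t)))"
    by (rule ldet_cong) (simp add: H_def)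
  ultimately show ?case
    by simp
qed

lemma finite_set_bound: "\<exists>N. set_mset m \<subseteq> {..<N::nat}"
  using finite_nat_set_iff_bounded[of "set_mset m"] by auto

text \<open>The coefficient of a fixed monomial is read off after truncation to finitely many
  variables that contain it.\<close>

theorem jacobi_trudi:
  assumes "\<alpha> \<in> partitions_atmost a"
  shows "Mps (schur \<alpha>) = ldet a (\<lambda>i t. hs (int (\<alpha> ! i) - int i + int t))"
proof (rule mps_eqI)
  fix m :: "nat multiset"
  obtain N where N: "set_mset m \<subseteq> {..<N}"
    using finite_set_bound by blast
  let ?l = "\<lambda>i. if i < a then \<alpha> ! i else 0"
  have a: "length \<alpha> = a" and s: "sorted_wrt (\<ge>) \<alpha>"
    using assms by (auto simp: partitions_atmost_def)
  have "antimono ?l"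
    by (rule antimono_extend) (use s a in \<open>auto simp: sorted_wrt_iff_nth_less\<close>)
  then have "ldet a (\<lambda>i t. rho N (hs (int (?l i) - int i + int t))) = (schur_poly N (shape ?l a) :: 'a mps)"
    by (rule jacobi_trudi_rho) simp
  moreover have "shape ?l a = cells \<alpha>"
    by (auto simp: shape_def cells_def a)
  moreover have "ldet a (\<lambda>i t. rho N (hs (int (?l i) - int i + int t))) =
      rho N (ldet a (\<lambda>i t. hs (int (\<alpha> ! i) - int i + int t)) :: 'a mps)"
    unfolding rho_ldet by (rule ldet_cong) simp
  ultimately have "coef (rho N (ldet a (\<lambda>i t. hs (int (\<alpha> ! i) - int i + int t)))) m = (schur \<alpha> m :: 'a)"
    by (simp add: schur_eq_schur_poly[OF N])
  then show "coef (Mps (schur \<alpha>)) m = (coef (ldet a (\<lambda>i t. hs (int (\<alpha> ! i) - int i + int t))) m :: 'a)"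
    using N by (simp add: rho_def)
qed

section \<open>Transposed diagrams and the dual formula\<close>

lemma inj_tshape: "inj_on (\<lambda>k. tshape (\<lambda>i. nat (k i)) a) {k \<in> extensional {..<a}. \<forall>i<a. 0 \<le> k i}"
proof (rule inj_onI)
  fix k k' :: "nat \<Rightarrow> int"
  assume *: "k \<in> {k \<in> extensional {..<a}. \<forall>i<a. 0 \<le> k i}" "k' \<in> {k \<in> extensional {..<a}. \<forall>i<a. 0 \<le> k i}"
    "tshape (\<lambda>i. nat (k i)) a = tshape (\<lambda>i. nat (k' i)) a"
  show "k = k'"
  proof (rule extensionalityI[of k "{..<a}" k'])
    fix i assume i: "i \<in> {..<a}"
    then have "j < nat (k i) \<longleftrightarrow> j < nat (k' i)" for j
      using *(3) by (auto simp: tshape_def set_eq_iff)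
    then have "nat (k i) = nat (k' i)"
      by (metis less_irrefl linorder_neqE_nat)
    then show "k i = k' i"
      using * i by (simp add: eq_nat_nat_iff)
  qed (use * in auto)
qed

text \<open>A horizontal strip takes at most one cell from each column of the transposed diagram.
  The column lengths are integers because the determinant expansion also offers -1 where
  \<open>l i = 0\<close>; that choice is excluded by positivity.\<close>

lemma strips_tshape:
  assumes l: "antimono l"
  shows "strips (tshape l a) = (\<lambda>k. tshape (\<lambda>i. nat (k i)) a) `
    {k \<in> PiE {..<a} (\<lambda>i. {int (l i) - 1, int (l i)}). (\<forall>i<a. 0 \<le> k i) \<and> (\<forall>i. Suc i < a \<longrightarrow> k (Suc i) \<le> k i)}"
    (is "_ = _ ` ?V")
proof (intro equalityI subsetI)
  fix R assume "R \<in> strips (tshape l a)"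
  then have R: "R \<subseteq> tshape l a" "order_ideal R"
    "\<And>i i' j. (i, j) \<in> tshape l a - R \<Longrightarrow> (i', j) \<in> tshape l a - R \<Longrightarrow> i = i'"
    by (auto simp: strips_def)
  define k where "k = restrict (\<lambda>i. int (card {j. (j, i) \<in> R})) {..<a}"
  have fin: "finite {j. (j, i) \<in> R}" for i
    by (rule finite_subset[of _ "{..<l i}"]) (use R(1) in \<open>auto simp: tshape_def\<close>)
  have col: "{j. (j, i) \<in> R} = {..<nat (k i)}" if "i < a" for i
    using that fin[of i] R(2) initial_segment[of "{j. (j, i) \<in> R}"] by (auto simp: k_def order_ideal_def)
  have "(j, i) \<in> R \<longleftrightarrow> (j, i) \<in> tshape (\<lambda>i. nat (k i)) a" for i j
  proof (cases "i < a")
    case True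
    then have "j \<in> {j. (j, i) \<in> R} \<longleftrightarrow> j \<in> {..<nat (k i)}"
      using col by simp
    then show ?thesis
      using True by (simp add: tshape_def)
  qed (use R(1) in \<open>auto simp: tshape_def\<close>)
  then have Rk: "R = tshape (\<lambda>i. nat (k i)) a"
    by auto
  have "k \<in> ?V"
  proof (intro CollectI conjI allI impI PiE_I)
    show pos: "0 \<le> k i" if "i < a" for i
      using that by (simp add: k_def)
    show "k i \<in> {int (l i) - 1, int (l i)}" if "i \<in> {..<a}" for i
    proof -
      have i: "i < a"
        using that by simp
      have 1: "nat (k i) \<le> l i"
      proof (rule ccontr)
        assume "\<not> nat (k i) \<le> l i"
        then have "(l i, i) \<in> R"
          using i by (auto simp: Rk tshape_def)
        then show False
          using R(1) by (auto simp: tshape_def)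
      qed
      have 2: "l i \<le> Suc (nat (k i))"
      proof (rule ccontr)
        assume "\<not> l i \<le> Suc (nat (k i))"
        then have "(nat (k i), i) \<in> tshape l a - R" "(Suc (nat (k i)), i) \<in> tshape l a - R"
          using i by (auto simp: Rk tshape_def)
        then show False
          using R(3) by (metis n_not_Suc_n)
      qed
      show ?thesis
        using 1 2 pos[OF i] by (auto simp: nat_le_iff)
    qed
    show "k i = undefined" if "i \<notin> {..<a}" for i
      using that by (auto simp: k_def)
    show "k (Suc i) \<le> k i" if i: "Suc i < a" for i
    proof -
      have "{j. (j, Suc i) \<in> R} \<subseteq> {j. (j, i) \<in> R}"
        using R(2) unfolding order_ideal_def by (auto, metis le_refl le_SucI)
      then show ?thesis
        using i card_mono[OF fin] by (simp add: k_def)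
    qed
  qed
  then show "R \<in> (\<lambda>k. tshape (\<lambda>i. nat (k i)) a) ` ?V"
    using Rk by blast
next
  fix R assume "R \<in> (\<lambda>k. tshape (\<lambda>i. nat (k i)) a) ` ?V"
  then obtain k where mem: "k \<in> ?V" and R: "R = tshape (\<lambda>i. nat (k i)) a"
    by blast
  have k: "i < a \<Longrightarrow> k i = int (l i) - 1 \<or> k i = int (l i)" "i < a \<Longrightarrow> 0 \<le> k i"
    "Suc i < a \<Longrightarrow> k (Suc i) \<le> k i" for i
    using mem by (auto simp: PiE_iff)
  have anti: "antimono (\<lambda>i. if i < a then nat (k i) else 0)"
    by (rule antimono_extend) (use k(3) in \<open>auto intro: nat_mono\<close>)
  have R': "R = tshape (\<lambda>i. if i < a then nat (k i) else 0) a"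
    by (auto simp: R tshape_def)
  show "R \<in> strips (tshape l a)"
    unfolding strips_def
  proof (intro CollectI conjI allI impI)
    show "R \<subseteq> tshape l a"
      using k(1) by (fastforce simp: R tshape_def)
    show "order_ideal R"
      unfolding R' by (rule order_ideal_shape(2)[OF anti])
    show "j = j'" if "(j, i) \<in> tshape l a - R \<and> (j', i) \<in> tshape l a - R" for j j' i
      using that k(1)[of i] by (auto simp: R tshape_def)
  qed
qed

text \<open>A variable occurs at most once in a monomial of an elementary function, so each row has
  just two terms. Choices that are not partitions contribute zero: an ascent makes two neighbouring
  rows equal, and without ascents a negative entry forces a negative last entry, so that the last
  row vanishes.\<close>

lemma dual_jacobi_trudi_rho:
  assumes "antimono l" "l a = 0"
  shows "ldet a (\<lambda>i t. rho N (es (int (l i) - int i + int t))) = schur_poly N (tshape l a)"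
  using assms
proof (induction N arbitrary: l)
  case 0
  have "tshape l a = {} \<longleftrightarrow> (\<forall>i<a. l i = 0)"
    by (auto simp: tshape_def)
  then show ?case
    using ldet_rho_0[of "\<lambda>r. rho 0 (es r)", OF rho_0(2) 0] by (simp add: schur_poly_0)
next
  case (Suc N)
  let ?e = "\<lambda>r. rho N (es r) :: 'a mps"
  let ?K = "\<lambda>i. {int (l i) - 1, int (l i)}"
  let ?V = "{k \<in> PiE {..<a} ?K. (\<forall>i<a. 0 \<le> k i) \<and> (\<forall>i. Suc i < a \<longrightarrow> k (Suc i) \<le> k i)}"
  let ?t = "\<lambda>k. (\<Prod>i<a. xv N ^ nat (int (l i) - k i)) * ldet a (\<lambda>i t. ?e (k i - int i + int t))"
  have "ldet a (\<lambda>i t. rho (Suc N) (es (int (l i) - int i + int t))) =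
      ldet a (\<lambda>i t. \<Sum>k\<in>?K i. xv N ^ nat (int (l i) - k) * ?e (k - int i + int t))"
    by (rule ldet_cong) (simp add: rho_es_Suc algebra_simps)
  also have "\<dots> = (\<Sum>k\<in>PiE {..<a} ?K. ?t k)"
    by (rule ldet_expand_rows) simp
  also have "\<dots> = (\<Sum>k\<in>?V. ?t k)"
  proof (rule sum.mono_neutral_right)
    show "\<forall>k\<in>PiE {..<a} ?K - ?V. ?t k = 0"
    proof
      fix k assume k: "k \<in> PiE {..<a} ?K - ?V"
      have kK: "k i = int (l i) - 1 \<or> k i = int (l i)" if "i < a" for i
        using k that by (auto simp: PiE_iff)
      have "ldet a (\<lambda>i t. ?e (k i - int i + int t)) = 0"
      proof (cases "\<forall>i. Suc i < a \<longrightarrow> k (Suc i) \<le> k i")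
        case False
        then obtain i where i: "Suc i < a" "k i < k (Suc i)"
          by (auto simp: not_le)
        have "l (Suc i) \<le> l i"
          using antimonoD[OF Suc.prems(1)] by simp
        then have "k (Suc i) = k i + 1"
          using kK[of i] kK[of "Suc i"] i by auto
        then show ?thesis
          using i by (intro ldet_equal_rows[of i a "Suc i"]) auto
      next
        case True
        then obtain i where i: "i < a" "k i < 0"
          using k by (auto simp: not_le)
        have mono: "k (i + d) \<le> k i" if "i + d < a" for d
          using that
        proof (induction d)
          case (Suc d)
          then show ?case
            using True[rule_format, of "i + d"] by auto
        qed simp
        have "k (a - 1) < 0"
          using mono[of "a - 1 - i"] i by simp
        then have "?e (k (a - 1) - int (a - 1) + int t) = 0" if "t < a" for t
          using that by (simp add: es_neg rho_hom of_nat_diff)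
        then show ?thesis
          using i(1) by (intro ldet_zero_row[of "a - 1"]) auto
      qed
      then show "?t k = 0"
        by simp
    qed
  qed (auto intro!: finite_PiE)
  also have "\<dots> = (\<Sum>k\<in>?V. xv N ^ card (tshape l a - tshape (\<lambda>i. nat (k i)) a) *
      schur_poly N (tshape (\<lambda>i. nat (k i)) a))"
  proof (rule sum.cong[OF refl])
    fix k assume "k \<in> ?V"
    then have k: "\<And>i. i < a \<Longrightarrow> k i = int (l i) - 1 \<or> k i = int (l i)" "\<And>i. i < a \<Longrightarrow> 0 \<le> k i"
      "\<And>i. Suc i < a \<Longrightarrow> k (Suc i) \<le> k i"
      by (auto simp: PiE_iff)
    let ?m = "\<lambda>i. if i < a then nat (k i) else 0"
    have "ldet a (\<lambda>i t. ?e (k i - int i + int t)) = ldet a (\<lambda>i t. ?e (int (?m i) - int i + int t))"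
      by (rule ldet_cong) (simp add: k(2))
    also have "\<dots> = schur_poly N (tshape ?m a)"
      by (rule Suc.IH) (auto intro!: antimono_extend nat_mono k(3))
    also have "tshape ?m a = tshape (\<lambda>i. nat (k i)) a"
      by (auto simp: tshape_def)
    finally have 1: "ldet a (\<lambda>i t. ?e (k i - int i + int t)) = schur_poly N (tshape (\<lambda>i. nat (k i)) a)" .
    have 2: "card (tshape l a - tshape (\<lambda>i. nat (k i)) a) = (\<Sum>i<a. l i - nat (k i))"
      by (rule card_diff_tshape) (use k(1) in fastforce)
    have 3: "(\<Prod>i<a. xv N ^ nat (int (l i) - k i)) = (\<Prod>i<a. xv N ^ (l i - nat (k i)) :: 'a mps)"
      by (rule prod.cong) (use k(2) in \<open>auto simp: nat_diff_distrib'\<close>)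
    show "?t k = xv N ^ card (tshape l a - tshape (\<lambda>i. nat (k i)) a) * schur_poly N (tshape (\<lambda>i. nat (k i)) a)"
      unfolding 1 2 3 by (simp add: power_sum)
  qed
  also have "\<dots> = schur_poly (Suc N) (tshape l a)"
    unfolding schur_poly_Suc[OF finite_shape(2) order_ideal_shape(2)[OF Suc.prems(1)]]
      strips_tshape[OF Suc.prems(1)]
    by (subst sum.reindex) (auto intro!: inj_on_subset[OF inj_tshape] simp: PiE_def)
  finally show ?case .
qed

text \<open>The parts exceeding \<open>j\<close> form an initial segment because
  \<open>\<beta>\<close> decreases, so comparing an index with their number is the same as testing
  its part.\<close>

lemma cells_conjugate:
  assumes "\<beta> \<in> partitions_atmost a"
  shows "cells (conjugate \<beta>) = tshape (\<lambda>i. if i < a then \<beta> ! i else 0) a"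
proof -
  have a: "length \<beta> = a" and s: "sorted_wrt (\<ge>) \<beta>"
    using assms by (auto simp: partitions_atmost_def)
  have init: "i < card {i'. i' < a \<and> j < \<beta> ! i'} \<longleftrightarrow> i < a \<and> j < \<beta> ! i" for i j
  proof -
    have "{i'. i' < a \<and> j < \<beta> ! i'} = {..<card {i'. i' < a \<and> j < \<beta> ! i'}}"
    proof (rule initial_segment)
      fix i i' assume "i \<in> {i'. i' < a \<and> j < \<beta> ! i'}" "i' \<le> i"
      moreover from this have "\<beta> ! i \<le> \<beta> ! i'"
        using s a by (cases "i' = i") (auto simp: sorted_wrt_iff_nth_less)
      ultimately show "i' \<in> {i'. i' < a \<and> j < \<beta> ! i'}"
        by simp
    qed simp
    then show ?thesis
      by blast
  qed
  have "j < Max (insert 0 (set \<beta>))" if "i < a" "j < \<beta> ! i" for i j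
  proof -
    have "\<beta> ! i \<le> Max (insert 0 (set \<beta>))"
      using that a by (intro Max_ge) auto
    then show ?thesis
      using that by simp
  qed
  then have "(j, i) \<in> cells (conjugate \<beta>) \<longleftrightarrow> i < a \<and> j < \<beta> ! i" for i j
    unfolding cells_def conjugate_def a using init[of i j] by auto
  then show ?thesis
    by (auto simp: tshape_def)
qed

theorem dual_jacobi_trudi:
  assumes "\<beta> \<in> partitions_atmost a"
  shows "Mps (schur (conjugate \<beta>)) = ldet a (\<lambda>i t. es (int (\<beta> ! i) - int i + int t))"
proof (rule mps_eqI)
  fix m :: "nat multiset"
  obtain N where N: "set_mset m \<subseteq> {..<N}"
    using finite_set_bound by blast
  let ?l = "\<lambda>i. if i < a then \<beta> ! i else 0"
  have a: "length \<beta> = a" and s: "sorted_wrt (\<ge>) \<beta>"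
    using assms by (auto simp: partitions_atmost_def)
  have "antimono ?l"
    by (rule antimono_extend) (use s a in \<open>auto simp: sorted_wrt_iff_nth_less\<close>)
  then have "ldet a (\<lambda>i t. rho N (es (int (?l i) - int i + int t))) = (schur_poly N (tshape ?l a) :: 'a mps)"
    by (rule dual_jacobi_trudi_rho) simp
  moreover have "ldet a (\<lambda>i t. rho N (es (int (?l i) - int i + int t))) =
      rho N (ldet a (\<lambda>i t. es (int (\<beta> ! i) - int i + int t)) :: 'a mps)"
    unfolding rho_ldet by (rule ldet_cong) simp
  ultimately have "coef (rho N (ldet a (\<lambda>i t. es (int (\<beta> ! i) - int i + int t)))) m =
      (schur (conjugate \<beta>) m :: 'a)"
    by (simp add: schur_eq_schur_poly[OF N] cells_conjugate[OF assms])
  then show "coef (Mps (schur (conjugate \<beta>))) m =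
      (coef (ldet a (\<lambda>i t. es (int (\<beta> ! i) - int i + int t))) m :: 'a)"
    using N by (simp add: rho_def)
qed

section \<open>Straightening Schur polynomials against an alternating functional\<close>

text \<open>The sum runs over the interlacing partitions of one part less, with the lost weight as an
  additional last entry. If some weight is lost, that last entry lies in the range of exactly one of
  the other entries, and exchanging the two reverses signs.\<close>

lemma alternating_interlacing:
  fixes A :: "(nat \<Rightarrow> nat) \<Rightarrow> 'b::ab_group_add" and a b c :: nat and r l :: "nat \<Rightarrow> nat"
  assumes b: "b < a"
    and swap: "\<And>k i j. i < a \<Longrightarrow> j < a \<Longrightarrow> i \<noteq> j \<Longrightarrow> A (k \<circ> transpose i j) = - A k"
    and eq: "\<And>k i j. i < a \<Longrightarrow> j < a \<Longrightarrow> i \<noteq> j \<Longrightarrow> k i = k j \<Longrightarrow> A k = 0"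
    and l: "antimono l"
  defines "d \<equiv> \<lambda>m. l b + (\<Sum>i<b. l i - m i)"
    and "K \<equiv> \<lambda>m i. if i < b then m i + (b - i) + c else if i = b then l b + (\<Sum>i<b. l i - m i) + c else r i"
  shows "(\<Sum>m\<in>interlacing l b. A (K m)) =
    A (\<lambda>i. if i < b then l i + (b - i) + c else if i = b then l b + c else r i)"
proof -
  define l0 where "l0 = restrict l {..<b}"
  have anti: "i \<le> j \<Longrightarrow> l j \<le> l i" for i j
    using antimonoD[OF l] .
  have bounds: "l (Suc i) \<le> m i \<and> m i \<le> l i" if "m \<in> interlacing l b" "i < b" for m i
    using that by (auto simp: interlacing_def PiE_iff)
  have l0: "l0 \<in> interlacing l b"
    using anti by (auto simp: l0_def interlacing_def)
  have tele: "(\<Sum>i<t. l i - l (Suc i)) = l 0 - l t" for t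
  proof (induction t)
    case (Suc t)
    then show ?case
      using anti[of 0 t] anti[of t "Suc t"] by simp
  qed simp
  have d_le: "d m \<le> l 0" if "m \<in> interlacing l b" for m
  proof -
    have "(\<Sum>i<b. l i - m i) \<le> (\<Sum>i<b. l i - l (Suc i))"
      using bounds[OF that] by (intro sum_mono diff_le_mono2) auto
    then show ?thesis
      using anti[of 0 b] by (simp add: d_def tele)
  qed
  \<comment> \<open>The shifted entry \<open>m q + (b - q)\<close> ranges from
    \<open>l (Suc q) + (b - q)\<close> to \<open>l q + (b - q)\<close>. These intervals are disjoint
    and adjacent for successive \<open>q\<close>, and \<open>p m\<close> is the index of the one
    that contains the lost weight \<open>d m\<close>. The map \<open>g\<close> exchanges that entry
    with the lost weight.\<close>
  define p where "p m = (LEAST q. l (Suc q) + (b - Suc q) < d m)" for m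
  define g where "g m = m(p m := d m - (b - p m))" for m
  have p: "p m < b" "l (Suc (p m)) + (b - Suc (p m)) < d m" "d m \<le> l (p m) + (b - p m)"
    if m: "m \<in> interlacing l b - {l0}" for m
  proof -
    obtain i where i: "i < b" "m i \<noteq> l i"
    proof -
      have "m \<in> extensional {..<b}" "l0 \<in> extensional {..<b}" "m \<noteq> l0"
        using m by (auto simp: interlacing_def l0_def PiE_def)
      then obtain i where "i \<in> {..<b}" "m i \<noteq> l0 i"
        using extensionalityI by blast
      then show ?thesis
        using that by (simp add: l0_def)
    qed
    have "0 < l i - m i"
      using bounds[of m i] m i by simp
    also have "l i - m i \<le> (\<Sum>i<b. l i - m i)"
      using i by (intro member_le_sum) auto
    finally have pos: "l (Suc (b - 1)) + (b - Suc (b - 1)) < d m"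
      using i by (simp add: d_def)
    show 2: "l (Suc (p m)) + (b - Suc (p m)) < d m"
      unfolding p_def using pos by (rule LeastI)
    have "p m \<le> b - 1"
      unfolding p_def using pos by (rule Least_le)
    then show "p m < b"
      using i by simp
    show "d m \<le> l (p m) + (b - p m)"
    proof (cases "p m")
      case 0
      then show ?thesis
        using d_le[of m] m by simp
    next
      case (Suc q)
      then have "\<not> l (Suc q) + (b - Suc q) < d m"
        using not_less_Least[of q "\<lambda>q. l (Suc q) + (b - Suc q) < d m"] by (simp add: p_def)
      then show ?thesis
        using Suc by simp
    qed
  qed
  have step: "g m \<in> interlacing l b" "d (g m) = m (p m) + (b - p m)" "p (g m) = p m"
    if m: "m \<in> interlacing l b - {l0}" for m
  proof -
    note pm = p[OF m]
    have gp: "l (Suc (p m)) \<le> d m - (b - p m) \<and> d m - (b - p m) \<le> l (p m)" "b - p m \<le> d m"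
      using pm by auto
    show gi: "g m \<in> interlacing l b"
      unfolding g_def interlacing_def
      using m gp(1) pm(1) by (auto simp: interlacing_def PiE_iff extensional_def)
    have bm: "m (p m) \<le> l (p m)" "l (Suc (p m)) \<le> m (p m)"
      using bounds[of m "p m"] m pm(1) by auto
    have ins: "{..<b} = insert (p m) ({..<b} - {p m})"
      using pm(1) by auto
    have rest: "(\<Sum>i\<in>{..<b} - {p m}. l i - g m i) = (\<Sum>i\<in>{..<b} - {p m}. l i - m i)"
      by (rule sum.cong) (auto simp: g_def)
    have s: "(\<Sum>i<b. l i - k i) = l (p m) - k (p m) + (\<Sum>i\<in>{..<b} - {p m}. l i - k i)" for k
      by (subst ins) (simp add: sum.insert_remove)
    have 1: "d m = l b + (l (p m) - m (p m)) + (\<Sum>i\<in>{..<b} - {p m}. l i - m i)"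
      by (simp add: d_def s[of m])
    have 2: "d (g m) = l b + (l (p m) - (d m - (b - p m))) + (\<Sum>i\<in>{..<b} - {p m}. l i - m i)"
      by (simp add: d_def s[of "g m"] rest) (simp add: g_def d_def)
    \<comment> \<open>Subtraction on naturals is truncated; the listed bounds make every difference
      exact.\<close>
    have ar: "D = lb + (lp - mp) + s \<Longrightarrow> D' = lb + (lp - (D - e)) + s \<Longrightarrow> mp \<le> lp \<Longrightarrow> e \<le> D
        \<Longrightarrow> D - e \<le> lp \<Longrightarrow> D' = mp + e" for D D' lb lp mp s e :: nat
      by linarith
    show dg: "d (g m) = m (p m) + (b - p m)"
      by (rule ar[OF 1 2 bm(1) gp(2) conjunct2[OF gp(1)]])
    show "p (g m) = p m"
      unfolding p_def[of "g m"]
    proof (rule Least_equality)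
      show "l (Suc (p m)) + (b - Suc (p m)) < d (g m)"
        using dg bm pm(1) by simp
      fix q assume q: "l (Suc q) + (b - Suc q) < d (g m)"
      show "p m \<le> q"
      proof (rule ccontr)
        assume "\<not> p m \<le> q"
        then have "l (p m) \<le> l (Suc q)" "b - p m \<le> b - Suc q"
          using anti[of "Suc q" "p m"] by auto
        then show False
          using q dg bm by simp
      qed
    qed
  qed
  have gK: "K (g m) = K m \<circ> transpose (p m) b" if m: "m \<in> interlacing l b - {l0}" for m
  proof
    fix i
    have "K m b = d m + c" "K (g m) b = m (p m) + (b - p m) + c" "K m (p m) = m (p m) + (b - p m) + c"
      using step(2)[OF m] p(1)[OF m] by (auto simp: K_def d_def)
    moreover have "K (g m) (p m) = d m + c"
      using p[OF m] by (simp add: K_def g_def)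
    moreover have "K (g m) i = K m i" if "i \<noteq> p m" "i \<noteq> b"
      using that by (simp add: K_def g_def)
    ultimately show "K (g m) i = (K m \<circ> transpose (p m) b) i"
      by (cases "i = p m"; cases "i = b") (auto simp: transpose_def)
  qed
  have fin: "finite (interlacing l b)"
    unfolding interlacing_def by (rule finite_PiE) auto
  have "(\<Sum>m\<in>interlacing l b - {l0}. A (K m)) = 0"
  proof (rule sum_sign_reversing_involution[where g = g])
    fix m assume m: "m \<in> interlacing l b - {l0}"
    have pb: "p m < a" "p m \<noteq> b"
      using p(1)[OF m] b by auto
    have "d l0 = l b"
      by (simp add: d_def l0_def)
    \<comment> \<open>Losing nothing gives the value \<open>l b\<close>. The exchanged weight is
      larger, so the involution never reaches \<open>l0\<close>.\<close>
    moreover have "l b < d (g m)"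
    proof -
      have "l b \<le> l (Suc (p m))"
        using p(1)[OF m] by (intro anti) simp
      also have "\<dots> \<le> m (p m)"
        using bounds[of m "p m"] m p(1)[OF m] by simp
      finally show ?thesis
        using step(2)[OF m] p(1)[OF m] by simp
    qed
    ultimately show gm: "g m \<in> interlacing l b - {l0}"
      using step(1)[OF m] by auto
    have "g (g m) = m(p m := d (g m) - (b - p m))"
      unfolding g_def[of "g m"] step(3)[OF m] by (simp add: g_def)
    then show "g (g m) = m"
      using step(2)[OF m] by simp
    show "A (K (g m)) = - A (K m)"
      unfolding gK[OF m] by (rule swap[OF pb(1) b pb(2)])
    assume "g m = m"
    then have "K m = K m \<circ> transpose (p m) b"
      using gK[OF m] by simp
    then have "K m (p m) = K m b"
      by (metis comp_apply transpose_apply_first)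
    then show "A (K m) = 0"
      by (rule eq[OF pb(1) b pb(2)])
  qed (use fin in auto)
  then have "(\<Sum>m\<in>interlacing l b. A (K m)) = A (K l0)"
    using sum.remove[OF fin l0, of "\<lambda>m. A (K m)"] by simp
  also have "K l0 = (\<lambda>i. if i < b then l i + (b - i) + c else if i = b then l b + c else r i)"
    by (auto simp: K_def l0_def fun_eq_iff)
  finally show ?thesis .
qed

text \<open>The first column would contain \<open>Suc b\<close> strictly increasing entries below
  \<open>b\<close>.\<close>

lemma tableaux_few_entries:
  assumes "\<And>i. i \<le> b \<Longrightarrow> m i > 0"
  shows "tableaux (shape m (Suc b)) b = {}"
proof (rule ccontr)
  assume "tableaux (shape m (Suc b)) b \<noteq> {}"
  then obtain T where T: "T \<in> tableaux (shape m (Suc b)) b"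
    by blast
  have mem: "(i, 0) \<in> shape m (Suc b)" if "i \<le> b" for i
    using assms that by (simp add: shape_def)
  have step: "T (i, 0) < T (Suc i, 0)" if "Suc i \<le> b" for i
    using T mem[of i] mem[OF that] that unfolding tableaux_def by auto
  have "i \<le> T (i, 0)" if "i \<le> b" for i
    using that
  proof (induction i)
    case (Suc i)
    then show ?case
      using step[of i] by simp
  qed simp
  moreover have "T (b, 0) < b"
    using T mem[of b] unfolding tableaux_def by blast
  ultimately show False
    using not_le by blast
qed

text \<open>The identity of a Schur polynomial times the Vandermonde with a single alternant, in a
  form dual to it: tested on any alternating \<open>A\<close>. Removing the largest entry by the
  branching rule, the remaining ones are straightened by induction and the choice of the strip by
  \<open>alternating_interlacing\<close>. The exponents already treated are frozen in
  \<open>r\<close>, and \<open>c\<close> is a common shift of the others.\<close>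

lemma alternating_schur:
  fixes A :: "(nat \<Rightarrow> nat) \<Rightarrow> 'b::ab_group_add" and a b c :: nat and r l :: "nat \<Rightarrow> nat"
  assumes "b \<le> a"
    and swap: "\<And>k i j. i < a \<Longrightarrow> j < a \<Longrightarrow> i \<noteq> j \<Longrightarrow> A (k \<circ> transpose i j) = - A k"
    and eq: "\<And>k i j. i < a \<Longrightarrow> j < a \<Longrightarrow> i \<noteq> j \<Longrightarrow> k i = k j \<Longrightarrow> A k = 0"
    and "antimono l" "l b = 0"
  shows "(\<Sum>T\<in>tableaux (shape l b) b.
      A (\<lambda>i. if i < b then card {x \<in> shape l b. T x = i} + (b - 1 - i) + c else r i)) =
    A (\<lambda>i. if i < b then l i + (b - 1 - i) + c else r i)"
  using assms(1,4,5)
proof (induction b arbitrary: l c r)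
  case 0
  have "tableaux (shape l 0) 0 = {\<lambda>_. undefined}"
    by (auto simp: tableaux_def shape_def)
  then show ?case
    by simp
next
  case (Suc b)
  let ?S = "shape l (Suc b)"
  define K where "K T = (\<lambda>i. if i < Suc b then card {x \<in> ?S. T x = i} + (Suc b - 1 - i) + c else r i)" for T
  let ?F = "\<lambda>m. \<Sum>T\<in>tableaux (shape m (Suc b)) b. A (K (fill_strip ?S (shape m (Suc b)) b T))"
  let ?d = "\<lambda>m. l b + (\<Sum>i<b. l i - m i) + c"
  let ?H = "\<lambda>m i. if i < b then m i + (b - i) + c else if i = b then ?d m else r i"
  let ?I = "interlacing l (Suc b)"
  have bounds: "l (Suc i) \<le> m i \<and> m i \<le> l i" if "m \<in> ?I" "i < Suc b" for m i
    using that by (auto simp: interlacing_def PiE_iff)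
  have finI: "finite ?I"
    unfolding interlacing_def by (rule finite_PiE) auto
  \<comment> \<open>If the part with index \<open>b\<close> is positive, all \<open>Suc b\<close>
    rows are nonempty and \<open>b\<close> different entries cannot fill them.\<close>
  have zero: "?F m = 0" if m: "m \<in> ?I - {m \<in> ?I. m b = 0}" for m
  proof -
    have "m i > 0" if "i \<le> b" for i
    proof (cases "i = b")
      case False
      have "0 < m b" "m b \<le> l b" "l b \<le> l (Suc i)" "l (Suc i) \<le> m i"
        using m bounds[of m b] bounds[of m i] that False antimonoD[OF Suc.prems(2), of "Suc i" b] by auto
      then show ?thesis
        by linarith
    qed (use m in auto)
    then show ?thesis
      by (simp add: tableaux_few_entries)
  qed
  have F: "?F m = A (?H m)" if m: "m \<in> ?I" "m b = 0" for m
  proof -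
    define m' where "m' = (\<lambda>i. if i < b then m i else 0)"
    have R: "shape m (Suc b) = shape m' b"
      using m(2) by (auto simp: shape_def m'_def less_Suc_eq)
    have "antimono m'"
    proof -
      have "m' = (\<lambda>i. if i < Suc b then m i else 0)"
        using m(2) by (auto simp: m'_def fun_eq_iff less_Suc_eq)
      then show ?thesis
        using interlacing_extend[OF m(1)] by simp
    qed
    moreover have "m' b = 0"
      by (simp add: m'_def)
    ultimately have IH: "(\<Sum>T\<in>tableaux (shape m' b) b.
        A (\<lambda>i. if i < b then card {x \<in> shape m' b. T x = i} + (b - 1 - i) + Suc c
          else if i = b then ?d m else r i)) =
      A (\<lambda>i. if i < b then m' i + (b - 1 - i) + Suc c else if i = b then ?d m else r i)"
      using Suc.prems(1) by (intro Suc.IH) auto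
    have sub: "shape m' b \<subseteq> ?S"
      using bounds[OF m(1)] by (auto simp: shape_def m'_def less_le_trans)
    have "K (fill_strip ?S (shape m' b) b T) =
        (\<lambda>i. if i < b then card {x \<in> shape m' b. T x = i} + (b - 1 - i) + Suc c
          else if i = b then ?d m else r i)" if T: "T \<in> tableaux (shape m' b) b" for T
    proof
      fix i
      have Tb: "T x < b" if "x \<in> shape m' b" for x
        using T that unfolding tableaux_def by blast
      have "{x \<in> ?S. fill_strip ?S (shape m' b) b T x = i} = {x \<in> shape m' b. T x = i}" if "i < b"
        using sub that by (auto simp: fill_strip_def)
      moreover have "card {x \<in> ?S. fill_strip ?S (shape m' b) b T x = b} = l b + (\<Sum>i<b. l i - m i)"
      proof -
        have "{x \<in> ?S. fill_strip ?S (shape m' b) b T x = b} = ?S - shape m (Suc b)"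
          using Tb unfolding R by (auto simp: fill_strip_def)
        moreover have "card (?S - shape m (Suc b)) = (\<Sum>i<Suc b. l i - m i)"
          by (rule card_diff_shape) (use bounds[OF m(1)] in blast)
        ultimately show ?thesis
          using m(2) by simp
      qed
      ultimately show "K (fill_strip ?S (shape m' b) b T) i =
        (if i < b then card {x \<in> shape m' b. T x = i} + (b - 1 - i) + Suc c
          else if i = b then ?d m else r i)"
        by (auto simp: K_def)
    qed
    then have "?F m = (\<Sum>T\<in>tableaux (shape m' b) b.
        A (\<lambda>i. if i < b then card {x \<in> shape m' b. T x = i} + (b - 1 - i) + Suc c
          else if i = b then ?d m else r i))"
      unfolding R by (intro sum.cong) auto
    also have "\<dots> = A (?H m)"
      unfolding IH by (rule arg_cong[of _ _ A]) (auto simp: m'_def fun_eq_iff)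
    finally show ?thesis .
  qed
  have "(\<Sum>T\<in>tableaux ?S (Suc b). A (K T)) = (\<Sum>R\<in>strips ?S. \<Sum>T\<in>tableaux R b. A (K (fill_strip ?S R b T)))"
    by (rule sum_tableaux_Suc[OF finite_shape(1) order_ideal_shape(1)[OF Suc.prems(2)]])
  also have "\<dots> = (\<Sum>m\<in>?I. ?F m)"
    unfolding strips_shape[OF Suc.prems(2,3)]
    by (subst sum.reindex) (auto intro!: inj_on_subset[OF inj_shape] simp: interlacing_def PiE_def)
  also have "\<dots> = (\<Sum>m\<in>{m \<in> ?I. m b = 0}. ?F m)"
    by (rule sum.mono_neutral_right) (use finI zero in auto)
  also have "\<dots> = (\<Sum>m\<in>{m \<in> ?I. m b = 0}. A (?H m))"
    using F by (intro sum.cong) auto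
  also have "\<dots> = (\<Sum>m\<in>interlacing l b. A (?H m))"
  proof (rule sum.reindex_bij_witness[of _ "\<lambda>m. m(b := 0)" "\<lambda>m. restrict m {..<b}"])
    fix m assume "m \<in> {m \<in> ?I. m b = 0}"
    then have m: "m \<in> extensional {..<Suc b}" "m b = 0" "m \<in> ?I"
      by (auto simp: interlacing_def PiE_def)
    show "(restrict m {..<b})(b := 0) = m"
      using m by (auto simp: fun_eq_iff extensional_def)
    show "restrict m {..<b} \<in> interlacing l b"
      using bounds[OF m(3)] by (auto simp: interlacing_def)
    show "A (?H (restrict m {..<b})) = A (?H m)"
      by (rule arg_cong[of _ _ A]) (auto simp: fun_eq_iff)
  next
    fix m assume m: "m \<in> interlacing l b"
    show "restrict (m(b := 0)) {..<b} = m"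
      using m by (auto simp: fun_eq_iff interlacing_def PiE_def extensional_def)
    show "m(b := 0) \<in> {m \<in> ?I. m b = 0}"
      using m Suc.prems(3) by (auto simp: interlacing_def PiE_iff extensional_def less_Suc_eq)
  qed
  also have "\<dots> = A (\<lambda>i. if i < b then l i + (b - i) + c else if i = b then l b + c else r i)"
  proof (rule alternating_interlacing[where A = A and a = a])
    show "b < a" "antimono l"
      using Suc.prems by auto
    fix k :: "nat \<Rightarrow> nat" and i j assume ij: "i < a" "j < a" "i \<noteq> j"
    show "A (k \<circ> transpose i j) = - A k"
      using ij by (rule swap)
    assume "k i = k j"
    with ij show "A k = 0"
      by (rule eq)
  qed
  also have "(\<lambda>i. if i < b then l i + (b - i) + c else if i = b then l b + c else r i) =
      (\<lambda>i. if i < Suc b then l i + (Suc b - 1 - i) + c else r i)"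
    by (auto simp: fun_eq_iff less_Suc_eq)
  finally show ?case
    by (simp only: K_def)
qed

section \<open>The two instances\<close>

lemma cw_real: "cw n (int i - n + 1) = cw_dots n i" and ccw_real: "ccw n (int i + n + 1) = ccw_dots n i"
  by (simp_all add: cw_def ccw_def)

lemma diagram_calculus_cell:
  "diagram_calculus (\<parallel>) cid hom (\<lambda>n. cell (dot n)) (\<lambda>n. cell (cross n)) (\<lambda>n. cell (cup n)) (\<lambda>n. cell (cup' n))
     (\<lambda>n. cell (cap n)) (\<lambda>n. cell (cap' n)) (\<lambda>n r. cell (cw n r)) (\<lambda>n r. cell (ccw n r))
     (\<lambda>n i. cell (dots n i))"
proof
  fix n k :: int and V W U V' W' A B V1 V2 V3 W1 W2 W3 :: word and f g h a b d e :: "'a cell" and r :: int and i :: nat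
  show "(f + g) \<parallel> h = f \<parallel> h + g \<parallel> h" "h \<parallel> (f + g) = h \<parallel> f + h \<parallel> g" "(f \<parallel> g) \<parallel> h = f \<parallel> g \<parallel> h"
    by (simp_all add: hc_add hc_assoc)
  show "(0 :: 'a cell) \<in> hom n V W" by (rule hom_zero)
  show "f \<in> hom n V W \<Longrightarrow> g \<in> hom n V W \<Longrightarrow> f + g \<in> hom n V W" by (rule hom_add)
  show "f \<in> hom n V W \<Longrightarrow> - f \<in> hom n V W" by (rule hom_uminus)
  show "f \<in> hom n V W \<Longrightarrow> g \<in> hom n U V \<Longrightarrow> f * g \<in> hom n U W" by (rule hom_vcomp)
  show "f \<in> hom k V W \<Longrightarrow> g \<in> hom n V' W' \<Longrightarrow> k = n + wt V' \<Longrightarrow> V @ V' = A \<Longrightarrow> W @ W' = B \<Longrightarrow> f \<parallel> g \<in> hom n A B"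
    by (rule hom_hcomp)
  show "(cid W n :: 'a cell) \<in> hom n W W" by (rule hom_cid)
  show "f \<in> hom n V W \<Longrightarrow> cid W n * f = f" by (rule cid_left)
  show "f \<in> hom n V W \<Longrightarrow> f * cid V n = f" by (rule cid_right)
  show "f \<in> hom n V W \<Longrightarrow> k = n + wt V \<Longrightarrow> cid [] k \<parallel> f = f" by (rule cid_hc_left)
  show "f \<in> hom n V W \<Longrightarrow> f \<parallel> cid [] n = f" by (rule cid_hc_right)
  show "k = n + wt W \<Longrightarrow> cid V k \<parallel> cid W n = (cid (V @ W) n :: 'a cell)" by (rule cid_hc_cid)
  show "a \<in> hom k V2 V3 \<Longrightarrow> d \<in> hom k V1 V2 \<Longrightarrow> b \<in> hom n W2 W3 \<Longrightarrow> e \<in> hom n W1 W2 \<Longrightarrow>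
      k = n + wt W1 \<Longrightarrow> (a \<parallel> b) * (d \<parallel> e) = (a * d) \<parallel> (b * e)" by (rule hc_interchange)
  show "(cell (dot n) :: 'a cell) \<in> hom n [\<E>] [\<E>]" "(cell (cross n) :: 'a cell) \<in> hom n [\<E>, \<E>] [\<E>, \<E>]"
    "(cell (cup n) :: 'a cell) \<in> hom n [] [\<F>, \<E>]" "(cell (cup' n) :: 'a cell) \<in> hom n [] [\<E>, \<F>]"
    "(cell (cap n) :: 'a cell) \<in> hom n [\<F>, \<E>] []" "(cell (cap' n) :: 'a cell) \<in> hom n [\<E>, \<F>] []"
    "(cell (cw n r) :: 'a cell) \<in> hom n [] []" "(cell (ccw n r) :: 'a cell) \<in> hom n [] []"
    by (rule cell_in_hom typed_gens typed_ccw_cw)+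
  show "(cell (dots n 0) :: 'a cell) = cid [\<E>] n" "(cell (dots n (Suc i)) :: 'a cell) = cell (dot n) * cell (dots n i)"
    by (simp_all add: dots_def vlist_def cid_def cell_hom)
  show "r < 0 \<Longrightarrow> (cell (cw n r) :: 'a cell) = 0" "r < 0 \<Longrightarrow> (cell (ccw n r) :: 'a cell) = 0"
    using cell_rel[OF rel.cw_neg] cell_rel[OF rel.ccw_neg] by (simp_all add: cell_hom)
  show "(cell (cw n 0) :: 'a cell) = cid [] n" "(cell (ccw n 0) :: 'a cell) = cid [] n"
    using cell_rel[OF rel.cw_zero] cell_rel[OF rel.ccw_zero] by (simp_all add: cid_def)
  show "cell (cap' n) * (cell (dots (n - 2) i) \<parallel> cid [\<F>] n) * cell (cup' n) = (cell (cw n (int i - n + 1)) :: 'a cell)"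
    "cell (cap n) * (cid [\<F>] (n + 2) \<parallel> cell (dots n i)) * cell (cup n) = (cell (ccw n (int i + n + 1)) :: 'a cell)"
    unfolding cw_real ccw_real by (simp_all add: cw_dots_def ccw_dots_def cell_hom cid_def mult.assoc)
  note R = cell_hom cell_sum cid_def mult.assoc case_prod_unfold sideways_def sideways'_def
  show "(cell (cap' (n + 2)) \<parallel> cid [\<E>] n) * (cid [\<E>] n \<parallel> cell (cup n)) = (cid [\<E>] n :: 'a cell)"
    using cell_rel[OF rel.adj1[of n]] by (simp add: R)
  show "(cid [\<E>] n \<parallel> cell (cap n)) * (cell (cup' (n + 2)) \<parallel> cid [\<E>] n) = (cid [\<E>] n :: 'a cell)"
    using cell_rel[OF rel.adj2[of n]] by (simp add: R)
  show "cell (cross n) * cell (cross n) = (0 :: 'a cell)"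
    using cell_rel[OF rel.nil[of n]] by (simp add: R)
  show "(cell (cross (n + 2)) \<parallel> cid [\<E>] n) * (cid [\<E>] (n + 4) \<parallel> cell (cross n)) * (cell (cross (n + 2)) \<parallel> cid [\<E>] n) =
      (cid [\<E>] (n + 4) \<parallel> cell (cross n)) * (cell (cross (n + 2)) \<parallel> cid [\<E>] n) * (cid [\<E>] (n + 4) \<parallel> cell (cross n) :: 'a cell)"
    using cell_rel[OF rel.braid[of n]] by (simp add: R)
  show "(cid [\<E>, \<E>] n :: 'a cell) =
      cell (cross n) * (cell (dot (n + 2)) \<parallel> cid [\<E>] n) - (cid [\<E>] (n + 2) \<parallel> cell (dot n)) * cell (cross n)"
    using cell_rel[OF rel.slide1[of n]] by (simp add: R)
  show "(cid [\<E>, \<E>] n :: 'a cell) =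
      (cell (dot (n + 2)) \<parallel> cid [\<E>] n) * cell (cross n) - cell (cross n) * (cid [\<E>] (n + 2) \<parallel> cell (dot n))"
    using cell_rel[OF rel.slide2[of n]] by (simp add: R)
  show "(cid [\<E>] n \<parallel> cell (cap' n)) * (cell (cross (n - 2)) \<parallel> cid [\<F>] n) * (cid [\<E>] n \<parallel> cell (cup' n)) =
      - (\<Sum>(f1, f2) | int f1 + int f2 = - n. cell (dots n f1) \<parallel> (cell (cw n (int f2)) :: 'a cell))"
    using cell_rel[OF rel.curl_right[of n]] by (simp add: R)
  show "(cell (cap n) \<parallel> cid [\<E>] (n - 2)) * (cid [\<F>] (n + 2) \<parallel> cell (cross (n - 2))) * (cell (cup n) \<parallel> cid [\<E>] (n - 2)) =
      (\<Sum>(g1, g2) | int g1 + int g2 = n. cell (ccw n (int g2)) \<parallel> (cell (dots (n - 2) g1) :: 'a cell))"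
    using cell_rel[OF rel.curl_left[of n]] by (simp add: R)
  show "(cid [\<F>, \<E>] n :: 'a cell) =
      - (((cid [\<F>, \<E>] n \<parallel> cell (cap' n)) * (cid [\<F>] (n + 2) \<parallel> cell (cross (n - 2)) \<parallel> cid [\<F>] n) * (cell (cup n) \<parallel> cid [\<E>, \<F>] n))
        * ((cell (cap n) \<parallel> cid [\<E>, \<F>] n) * (cid [\<F>] (n + 2) \<parallel> cell (cross (n - 2)) \<parallel> cid [\<F>] n) * (cid [\<F>, \<E>] n \<parallel> cell (cup' n))))
      + (\<Sum>(g1, g2, g3) | int g1 + int g2 + int g3 = - n - 1.
          (cid [\<F>] (n + 2) \<parallel> cell (dots n g1)) * cell (cup n) * cell (cw n (int g2)) * cell (cap n) * (cid [\<F>] (n + 2) \<parallel> cell (dots n g3)))"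
    using cell_rel[OF rel.decomp_FE[of n]] by (simp add: R)
qed

text \<open>Well-formed diagrams preserve weight, so between words of different weight there is only
  zero.\<close>

lemma hom_eq_0:
  fixes f :: "'k::comm_ring_1 cell"
  shows "f \<in> hom n V W \<Longrightarrow> wt V \<noteq> wt W \<Longrightarrow> f = 0"
proof (induction rule: hom_induct)
  case (single d c)
  then show ?case
    using wf_diagram_wt[of d] by (auto simp: typeset_def)
qed auto

definition mhc :: "'k::comm_ring_1 cell \<Rightarrow> 'k cell \<Rightarrow> 'k cell" where
  "mhc f g = g \<parallel> f"

text \<open>After reflection in a vertical axis the left region, of weight \<open>n + wt W\<close>,
  is on the right. Negating the weights restores the rule that \<open>\<E>\<close> raises the weight
  from right to left.\<close>

definition mcid :: "word \<Rightarrow> int \<Rightarrow> 'k::comm_ring_1 cell" where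
  "mcid W n = cid (rev W) (- (n + wt W))"

definition mhom :: "int \<Rightarrow> word \<Rightarrow> word \<Rightarrow> 'k::comm_ring_1 cell set" where
  "mhom n V W = hom (- (n + wt V)) (rev V) (rev W)"

text \<open>The sign of the crossing is forced by the nilHecke relations, which the reflection would
  otherwise violate.\<close>

lemma diagram_calculus_mirror:
  "diagram_calculus mhc mcid mhom (\<lambda>n. cell (dot (- n - 2))) (\<lambda>n. - cell (cross (- n - 4)))
     (\<lambda>n. cell (cup' (- n))) (\<lambda>n. cell (cup (- n))) (\<lambda>n. cell (cap' (- n))) (\<lambda>n. cell (cap (- n)))
     (\<lambda>n r. cell (ccw (- n) r)) (\<lambda>n r. cell (cw (- n) r)) (\<lambda>n i. cell (dots (- n - 2) i))"
proof
  fix n k :: int and V W U V' W' A B V1 V2 V3 W1 W2 W3 :: word and f g h a b d e :: "'a cell" and r :: int and i :: nat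
  show "mhc (f + g) h = mhc f h + mhc g h" "mhc h (f + g) = mhc h f + mhc h g"
    "mhc (mhc f g) h = mhc f (mhc g h)"
    by (simp_all add: mhc_def hc_add hc_assoc)
  show "(0 :: 'a cell) \<in> mhom n V W" unfolding mhom_def by (rule hom_zero)
  show "f \<in> mhom n V W \<Longrightarrow> g \<in> mhom n V W \<Longrightarrow> f + g \<in> mhom n V W" unfolding mhom_def by (rule hom_add)
  show "f \<in> mhom n V W \<Longrightarrow> - f \<in> mhom n V W" unfolding mhom_def by (rule hom_uminus)
  \<comment> \<open>\<open>mhom\<close> computes the reflected weight from the source word.
    Composition also refers to the intermediate word, whose weight agrees unless the morphism is
    zero.\<close>
  have wtD: "f = 0 \<or> wt V = wt W" if "f \<in> mhom n V W" for f :: "'a cell" and n V W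
    using hom_eq_0[OF that[unfolded mhom_def]] by auto
  show "f * g \<in> mhom n U W" if "f \<in> mhom n V W" "g \<in> mhom n U V"
    using wtD[OF that(2)] that by (auto simp: mhom_def hom_zero intro: hom_vcomp)
  show "mhc f g \<in> mhom n A B"
    if "f \<in> mhom k V W" "g \<in> mhom n V' W'" "k = n + wt V'" "V @ V' = A" "W @ W' = B"
  proof -
    have *: "- (n + wt A) = - (k + wt V)"
      using that by auto
    show ?thesis
      unfolding mhom_def mhc_def *
      by (rule hom_hcomp[OF that(2,1)[unfolded mhom_def]]) (use that(3-5) in auto)
  qed
  show "(mcid W n :: 'a cell) \<in> mhom n W W" unfolding mhom_def mcid_def by (rule hom_cid)
  show "mcid W n * f = f" if "f \<in> mhom n V W"
    using wtD[OF that] that by (auto simp: mhom_def mcid_def intro: cid_left)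
  show "f * mcid V n = f" if "f \<in> mhom n V W"
    using that unfolding mhom_def mcid_def by (rule cid_right)
  show "f \<in> mhom n V W \<Longrightarrow> k = n + wt V \<Longrightarrow> mhc (mcid [] k) f = f"
    using cid_hc_right unfolding mhc_def mcid_def mhom_def by fastforce
  show "mhc f (mcid [] n) = f" if "f \<in> mhom n V W"
    using cid_hc_left[OF that[unfolded mhom_def], of "- n"] by (simp add: mhc_def mcid_def)
  show "k = n + wt W \<Longrightarrow> mhc (mcid V k) (mcid W n) = (mcid (V @ W) n :: 'a cell)"
    by (simp add: mhc_def mcid_def cid_hc_cid algebra_simps)
  show "mhc a b * mhc d e = mhc (a * d) (b * e)"
    if "a \<in> mhom k V2 V3" "d \<in> mhom k V1 V2" "b \<in> mhom n W2 W3" "e \<in> mhom n W1 W2" "k = n + wt W1"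
  proof (cases "d = 0 \<or> e = 0")
    case True
    have "(0 :: 'a cell) \<parallel> y = 0" "y \<parallel> (0 :: 'a cell) = 0" for y
      using hc_zero by auto
    with True show ?thesis
      by (auto simp: mhc_def)
  next
    case False
    then have "wt V1 = wt V2" "wt W1 = wt W2"
      using wtD that(2,4) by blast+
    then show ?thesis
      using that unfolding mhc_def mhom_def by (intro hc_interchange) auto
  qed
  show "(cell (dot (- n - 2)) :: 'a cell) \<in> mhom n [\<E>] [\<E>]" "(- cell (cross (- n - 4)) :: 'a cell) \<in> mhom n [\<E>, \<E>] [\<E>, \<E>]"
    "(cell (cup' (- n)) :: 'a cell) \<in> mhom n [] [\<F>, \<E>]" "(cell (cup (- n)) :: 'a cell) \<in> mhom n [] [\<E>, \<F>]"
    "(cell (cap' (- n)) :: 'a cell) \<in> mhom n [\<F>, \<E>] []" "(cell (cap (- n)) :: 'a cell) \<in> mhom n [\<E>, \<F>] []"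
    "(cell (ccw (- n) r) :: 'a cell) \<in> mhom n [] []" "(cell (cw (- n) r) :: 'a cell) \<in> mhom n [] []"
    using cell_in_hom[OF typed_gens(1), of "- n - 2"] hom_uminus[OF cell_in_hom[OF typed_gens(3), of "- n - 4"]]
      cell_in_hom[OF typed_gens(5), of "- n"] cell_in_hom[OF typed_gens(6), of "- n"]
      cell_in_hom[OF typed_gens(7), of "- n"] cell_in_hom[OF typed_gens(8), of "- n"]
      cell_in_hom[OF typed_ccw_cw(1), of "- n"] cell_in_hom[OF typed_ccw_cw(2), of "- n"]
    by (simp_all add: mhom_def)
  interpret D: diagram_calculus "(\<parallel>)" cid hom "\<lambda>n. cell (dot n)" "\<lambda>n. cell (cross n)" "\<lambda>n. cell (cup n)" "\<lambda>n. cell (cup' n)"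
     "\<lambda>n. cell (cap n)" "\<lambda>n. cell (cap' n)" "\<lambda>n r. cell (cw n r)" "\<lambda>n r. cell (ccw n r)"
     "\<lambda>n i. cell (dots n i) :: 'a cell"
    by (rule diagram_calculus_cell)
  show "(cell (dots (- n - 2) 0) :: 'a cell) = mcid [\<E>] n"
    "(cell (dots (- n - 2) (Suc i)) :: 'a cell) = cell (dot (- n - 2)) * cell (dots (- n - 2) i)"
    by (simp_all add: D.dts_0 D.dts_Suc mcid_def)
  show "r < 0 \<Longrightarrow> (cell (ccw (- n) r) :: 'a cell) = 0" "r < 0 \<Longrightarrow> (cell (cw (- n) r) :: 'a cell) = 0"
    by (rule D.cc_neg D.c_neg, assumption)+
  show "(cell (ccw (- n) 0) :: 'a cell) = mcid [] n" "(cell (cw (- n) 0) :: 'a cell) = mcid [] n"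
    by (simp_all add: D.c_zero D.cc_zero mcid_def)
  note M = mhc_def mcid_def hc_uminus
  show "cell (cap (- n)) * mhc (cell (dots (- (n - 2) - 2) i)) (mcid [\<F>] n) * cell (cup (- n)) =
      (cell (ccw (- n) (int i - n + 1)) :: 'a cell)"
    using D.cc_real[of "- n" i] by (simp add: M)
  show "cell (cap' (- n)) * mhc (mcid [\<F>] (n + 2)) (cell (dots (- n - 2) i)) * cell (cup' (- n)) =
      (cell (cw (- n) (int i + n + 1)) :: 'a cell)"
    using D.c_real[of "- n" i] by (simp add: M)
  show "mhc (cell (cap (- (n + 2)))) (mcid [\<E>] n) * mhc (mcid [\<E>] n) (cell (cup' (- n))) = (mcid [\<E>] n :: 'a cell)"
    using D.adj2[of "- n - 2"] by (simp add: M algebra_simps)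
  show "mhc (mcid [\<E>] n) (cell (cap' (- n))) * mhc (cell (cup (- (n + 2)))) (mcid [\<E>] n) = (mcid [\<E>] n :: 'a cell)"
    using D.adj1[of "- n - 2"] by (simp add: M algebra_simps)
  show "- cell (cross (- n - 4)) * - cell (cross (- n - 4)) = (0 :: 'a cell)"
    by (simp add: D.cr_nil)
  show "mhc (- cell (cross (- (n + 2) - 4))) (mcid [\<E>] n) * mhc (mcid [\<E>] (n + 4)) (- cell (cross (- n - 4))) *
      mhc (- cell (cross (- (n + 2) - 4))) (mcid [\<E>] n) =
      mhc (mcid [\<E>] (n + 4)) (- cell (cross (- n - 4))) * mhc (- cell (cross (- (n + 2) - 4))) (mcid [\<E>] n) *
      (mhc (mcid [\<E>] (n + 4)) (- cell (cross (- n - 4))) :: 'a cell)"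
    using D.cr_braid[of "- n - 6"] by (simp add: M algebra_simps)
  \<comment> \<open>Reflection exchanges the two dot slides up to sign, which the sign of the
    reflected crossing corrects.\<close>
  show "(mcid [\<E>, \<E>] n :: 'a cell) = - cell (cross (- n - 4)) * mhc (cell (dot (- (n + 2) - 2))) (mcid [\<E>] n) -
      mhc (mcid [\<E>] (n + 2)) (cell (dot (- n - 2))) * - cell (cross (- n - 4))"
    using D.slide2[of "- n - 4"] by (simp add: M algebra_simps)
  show "(mcid [\<E>, \<E>] n :: 'a cell) = mhc (cell (dot (- (n + 2) - 2))) (mcid [\<E>] n) * - cell (cross (- n - 4)) -
      - cell (cross (- n - 4)) * mhc (mcid [\<E>] (n + 2)) (cell (dot (- n - 2)))"
    using D.slide1[of "- n - 4"] by (simp add: M algebra_simps)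
  show "mhc (mcid [\<E>] n) (cell (cap (- n))) * mhc (- cell (cross (- (n - 2) - 4))) (mcid [\<F>] n) * mhc (mcid [\<E>] n) (cell (cup (- n))) =
      - (\<Sum>(f1, f2) | int f1 + int f2 = - n. mhc (cell (dots (- n - 2) f1)) (cell (ccw (- n) (int f2)) :: 'a cell))"
    using D.curl_left[of "- n"] by (simp add: M algebra_simps)
  show "mhc (cell (cap' (- n))) (mcid [\<E>] (n - 2)) * mhc (mcid [\<F>] (n + 2)) (- cell (cross (- (n - 2) - 4))) *
        mhc (cell (cup' (- n))) (mcid [\<E>] (n - 2)) =
      (\<Sum>(g1, g2) | int g1 + int g2 = n. mhc (cell (cw (- n) (int g2))) (cell (dots (- (n - 2) - 2) g1) :: 'a cell))"
    using D.curl_right[of "- n"] by (simp add: M algebra_simps)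
  show "(mcid [\<F>, \<E>] n :: 'a cell) =
      - (mhc (mcid [\<F>, \<E>] n) (cell (cap (- n))) * mhc (mcid [\<F>] (n + 2)) (mhc (- cell (cross (- (n - 2) - 4))) (mcid [\<F>] n))
          * mhc (cell (cup' (- n))) (mcid [\<E>, \<F>] n)
        * (mhc (cell (cap' (- n))) (mcid [\<E>, \<F>] n) * mhc (mcid [\<F>] (n + 2)) (mhc (- cell (cross (- (n - 2) - 4))) (mcid [\<F>] n))
          * mhc (mcid [\<F>, \<E>] n) (cell (cup (- n)))))
      + (\<Sum>(g1, g2, g3) | int g1 + int g2 + int g3 = - n - 1.
          mhc (mcid [\<F>] (n + 2)) (cell (dots (- n - 2) g1)) * cell (cup' (- n)) * cell (ccw (- n) (int g2)) * cell (cap' (- n))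
            * mhc (mcid [\<F>] (n + 2)) (cell (dots (- n - 2) g3)))"
    using cell_rel[OF rel.decomp_EF[of "- n"]]
    by (simp add: M hc_assoc cell_hom cell_sum mult.assoc case_prod_unfold sideways_def sideways'_def cid_def[symmetric] algebra_simps)
qed

text \<open>The counterclockwise slide at weight \<open>m\<close> is the clockwise slide of the
  mirror image at weight \<open>- m - 2\<close>; the number of dots \<open>j\<close> is the
  same.\<close>

lemma bubble_slides_cell:
  "bubble_slides (\<parallel>) cid hom (\<lambda>n. cell (dot n)) (\<lambda>n. cell (cross n)) (\<lambda>n. cell (cup n)) (\<lambda>n. cell (cup' n))
     (\<lambda>n. cell (cap n)) (\<lambda>n. cell (cap' n)) (\<lambda>n r. cell (cw n r)) (\<lambda>n r. cell (ccw n r))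
     (\<lambda>n i. cell (dots n i))"
proof (rule bubble_slides.intro[OF diagram_calculus_cell], rule bubble_slides_axioms.intro)
  fix j r :: nat and m :: int assume j: "int j = int r - m - 1"
  show "cid [\<E>] m \<parallel> cell (ccw m (int r)) =
      (\<Sum>i\<le>r. \<Sum>f\<le>r - i. cell (ccw (m + 2) (int f)) \<parallel> (cell (dots m (r - f)) :: 'a cell))"
    using diagram_calculus.bubble_slide_real[OF diagram_calculus_mirror, of j r "- m - 2"] j
    by (simp add: mhc_def mcid_def add.commute)
qed

lemma bubble_slides_mirror:
  "bubble_slides mhc mcid mhom (\<lambda>n. cell (dot (- n - 2))) (\<lambda>n. - cell (cross (- n - 4)))
     (\<lambda>n. cell (cup' (- n))) (\<lambda>n. cell (cup (- n))) (\<lambda>n. cell (cap' (- n))) (\<lambda>n. cell (cap (- n)))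
     (\<lambda>n r. cell (ccw (- n) r)) (\<lambda>n r. cell (cw (- n) r)) (\<lambda>n i. cell (dots (- n - 2) i))"
proof (rule bubble_slides.intro[OF diagram_calculus_mirror], rule bubble_slides_axioms.intro)
  fix j r :: nat and m :: int assume j: "int j = int r - m - 1"
  show "mhc (mcid [\<E>] m) (cell (cw (- m) (int r))) =
      (\<Sum>i\<le>r. \<Sum>f\<le>r - i. mhc (cell (cw (- (m + 2)) (int f))) (cell (dots (- m - 2) (r - f)) :: 'a cell))"
    using diagram_calculus.bubble_slide_real[OF diagram_calculus_cell, of j r "- m - 2"] j
    by (simp add: mhc_def mcid_def)
qed

section \<open>Closures as determinants\<close>

text \<open>The given isomorphism is meaningful on symmetric functions only, so it is treated as a
  homomorphism on a subset \<open>S\<close> of a ring type. Its target has no unit; the image of 1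
  is therefore specified at each use.\<close>

locale subring_map =
  fixes S :: "'r::comm_ring_1 set" and \<Phi> :: "'r \<Rightarrow> 'u::ring"
  assumes one: "1 \<in> S" and add: "p \<in> S \<Longrightarrow> q \<in> S \<Longrightarrow> p + q \<in> S"
    and uminus: "p \<in> S \<Longrightarrow> - p \<in> S" and mult: "p \<in> S \<Longrightarrow> q \<in> S \<Longrightarrow> p * q \<in> S"
    and map_add: "p \<in> S \<Longrightarrow> q \<in> S \<Longrightarrow> \<Phi> (p + q) = \<Phi> p + \<Phi> q"
    and map_mult: "p \<in> S \<Longrightarrow> q \<in> S \<Longrightarrow> \<Phi> (p * q) = \<Phi> p * \<Phi> q"
begin

lemma zero: "0 \<in> S"
  using add[OF one uminus[OF one]] by simp

lemma map_zero: "\<Phi> 0 = 0"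
  using map_add[OF zero zero] by simp

lemma map_uminus: "p \<in> S \<Longrightarrow> \<Phi> (- p) = - \<Phi> p"
  using map_add[of p "- p"] uminus map_zero by (simp add: eq_neg_iff_add_eq_0 add.commute)

lemma sum_mem: "(\<And>i. i \<in> A \<Longrightarrow> f i \<in> S) \<Longrightarrow> sum f A \<in> S"
  by (induction A rule: infinite_finite_induct) (auto simp: zero add)

lemma prod_mem: "(\<And>i. i \<in> A \<Longrightarrow> f i \<in> S) \<Longrightarrow> prod f A \<in> S"
  by (induction A rule: infinite_finite_induct) (auto simp: one mult)

lemma map_sum: "(\<And>i. i \<in> A \<Longrightarrow> f i \<in> S) \<Longrightarrow> \<Phi> (sum f A) = (\<Sum>i\<in>A. \<Phi> (f i))"
  by (induction A rule: infinite_finite_induct) (auto simp: map_zero map_add sum_mem)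

lemma sign_mem: "p \<in> S \<Longrightarrow> (- 1) ^ j * p \<in> S"
  by (cases "even j") (auto simp: uminus)

lemma map_sign: "p \<in> S \<Longrightarrow> \<Phi> ((- 1) ^ j * p) = alt j (\<Phi> p)"
  by (cases "even j") (auto simp: alt_def map_uminus)

lemma ldet_mem: "(\<And>i t. i < a \<Longrightarrow> t < a \<Longrightarrow> M i t \<in> S) \<Longrightarrow> ldet a M \<in> S"
  unfolding ldet_def
proof (rule sum_mem)
  fix p assume M: "\<And>i t. i < a \<Longrightarrow> t < a \<Longrightarrow> M i t \<in> S" and p: "p \<in> {p. p permutes {..<a}}"
  have "(\<Prod>i<a. M i (p i)) \<in> S"
    using p permutes_in_image[of p "{..<a}"] by (intro prod_mem M) auto
  then show "of_int (sign p) * (\<Prod>i<a. M i (p i)) \<in> S"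
    by (auto simp: sign_def uminus)
qed

end

lemma triangular_Suc: "Suc b * (Suc b - 1) div 2 = b + b * (b - 1) div 2"
  by (cases b) (simp_all add: algebra_simps)

text \<open>In \<open>closure_mon_Suc\<close>, the sum over raised exponents is by
  \<open>ldet_shift_rows\<close> the minor without column \<open>b - j\<close>, and the bubble is
  the corresponding entry of the last row. The step to \<open>Suc b\<close> contributes the sign
  (-1)^b.\<close>

lemma (in bubble_slides) closure_mon_det:
  assumes "subring_map S \<Phi>" and one: "\<Phi> 1 = cid [] n"
    and g: "\<And>r. g r \<in> S" "\<And>r. \<Phi> (g r) = c n r"
  shows "closure_mon b n k = \<Phi> ((- 1) ^ (b * (b - 1) div 2) * ldet b (\<lambda>i t. g (int (k i) - n + 1 + int t)))"
proof (induction b arbitrary: k)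
  case 0
  have "ldet 0 M = 1" for M :: "nat \<Rightarrow> nat \<Rightarrow> 'b"
    by (simp add: ldet_def)
  then show ?case
    by (simp add: closure_mon_0 one)
next
  case (Suc b)
  interpret subring_map S \<Phi> by fact
  let ?s = "(- 1) ^ (b * (b - 1) div 2) :: 'b"
  let ?D = "\<lambda>j. ldet b (\<lambda>i t. g (int (k i) - n + 1 + int (if t < b - j then t else Suc t)))"
  have mem: "ldet b (\<lambda>i t. g (K i t)) \<in> S" for K
    by (rule ldet_mem) (rule g)
  have 1: "(\<Sum>T | T \<subseteq> {..<b} \<and> card T = j. closure_mon b n (\<lambda>i. k i + of_bool (i \<in> T))) = \<Phi> (?s * ?D j)"
    if "j \<le> b" for j
  proof -
    have "?D j = (\<Sum>T | T \<subseteq> {..<b} \<and> card T = j.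
        ldet b (\<lambda>i t. g (int (k i + of_bool (i \<in> T)) - n + 1 + int t)))"
      using ldet_shift_rows[OF that, of g "\<lambda>i. int (k i) - n + 1"] by (simp add: algebra_simps)
    then show ?thesis
      unfolding Suc.IH by (simp add: sum_distrib_left map_sum sign_mem mem)
  qed
  have "closure_mon (Suc b) n k = alt b (\<Sum>j\<le>b. alt j (\<Phi> (?s * ?D j) * \<Phi> (g (int (k b) - n + 1 + int (b - j)))))"
    unfolding closure_mon_Suc by (rule arg_cong[of _ _ "alt b"], rule sum.cong) (auto simp: 1 g of_nat_diff algebra_simps)
  also have "\<dots> = \<Phi> ((- 1) ^ b * (\<Sum>j\<le>b. (- 1) ^ j * (?s * ?D j * g (int (k b) - n + 1 + int (b - j)))))"
    by (simp add: map_sign map_sum map_mult sign_mem mem g mult sum_mem)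
  also have "(- 1) ^ b * (\<Sum>j\<le>b. (- 1) ^ j * (?s * ?D j * g (int (k b) - n + 1 + int (b - j)))) =
      (- 1) ^ b * ?s * ldet (Suc b) (\<lambda>i t. g (int (k i) - n + 1 + int t))"
    unfolding laplace_last_row by (simp add: sum_distrib_left mult_ac)
  finally show ?case
    unfolding triangular_Suc by (simp add: power_add)
qed

section \<open>Monomials as ordered products of dots\<close>

context nilhecke
begin

lemma e_mon: "t \<le> b \<Longrightarrow> e * mon k t = mon k t"
  by (induction t) (simp_all add: e_idem e_Xpow flip: mult.assoc)

lemma X_mon: "i < b \<Longrightarrow> t \<le> b \<Longrightarrow> X i * mon k t = mon k t * X i"
proof (induction t)
  case (Suc t)
  let ?j = "b - Suc t"
  have "X i * Xpow ?j p = Xpow ?j p * X i" for p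
    using Suc.prems by (intro Xpow_commute X_X) (simp_all add: e_X)
  then have "X i * (Xpow ?j (k ?j) * mon k t) = Xpow ?j (k ?j) * (X i * mon k t)"
    by (metis mult.assoc)
  then show ?case
    using Suc by (simp add: mult.assoc)
qed (simp add: e_X)

lemma Xpow_mon: "i < b \<Longrightarrow> t \<le> b \<Longrightarrow> Xpow i p * mon k t = mon k t * Xpow i p"
  by (rule Xpow_commute[symmetric]) (simp_all add: X_mon e_mon mon_e)

lemma Xpow_add: "i < b \<Longrightarrow> Xpow i p * Xpow i q = Xpow i (p + q)"
  by (induction p) (simp_all add: e_Xpow mult.assoc)

lemma mon_mult: "t \<le> b \<Longrightarrow> mon k t * mon k' t = mon (\<lambda>i. k i + k' i) t"
proof (induction t)
  case (Suc t)
  let ?j = "b - Suc t"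
  have "Xpow ?j (k ?j) * mon k t * (Xpow ?j (k' ?j) * mon k' t) =
      Xpow ?j (k ?j) * (mon k t * Xpow ?j (k' ?j)) * mon k' t"
    by (simp add: mult.assoc)
  also have "\<dots> = Xpow ?j (k ?j) * Xpow ?j (k' ?j) * (mon k t * mon k' t)"
    using Suc.prems by (simp add: mult.assoc flip: Xpow_mon)
  finally show ?case
    using Suc by (simp add: Xpow_add)
qed (simp add: e_idem)

lemma foldr_Xpow:
  "set is \<subseteq> {..<b} \<Longrightarrow> foldr (*) (concat (map (\<lambda>i. replicate (k i) (X i)) is)) e =
    foldr (\<lambda>i y. Xpow i (k i) * y) is e"
proof (induction "is")
  case (Cons i js)
  have "e * foldr (\<lambda>i y. Xpow i (k i) * y) js e = foldr (\<lambda>i y. Xpow i (k i) * y) js e"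
    using Cons.prems by (cases js) (simp_all add: e_idem e_Xpow flip: mult.assoc)
  moreover have "((*) (X i) ^^ p) y = Xpow i p * y" if "e * y = y" for p y
    using that by (induction p) (simp_all add: mult.assoc)
  ultimately show ?case
    using Cons by simp
qed simp

text \<open>Both orders are required: the dots are listed by strands from the left, which is the
  reverse order for the reflected numbering.\<close>

lemma foldr_mon:
  "foldr (*) (concat (map (\<lambda>i. replicate (k i) (X i)) [0..<b])) e = mon k b"
  "foldr (*) (concat (map (\<lambda>i. replicate (k i) (X i)) (rev [0..<b]))) e = mon k b"
proof -
  let ?f = "\<lambda>i y. Xpow i (k i) * y"
  have *: "foldr ?f [b - t..<b] e = mon k t" if "t \<le> b" for t
    using that
  proof (induction t)
    case (Suc t)
    have "[b - Suc t..<b] = (b - Suc t) # [b - t..<b]"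
      using Suc.prems by (subst upt_conv_Cons) (auto simp: Suc_diff_Suc)
    then show ?case
      using Suc by simp
  qed simp
  have f: "foldr ?f [0..<b] e = mon k b"
    using *[of b] by simp
  then show "foldr (*) (concat (map (\<lambda>i. replicate (k i) (X i)) [0..<b])) e = mon k b"
    by (subst foldr_Xpow) auto
  have XX: "Xpow i p * Xpow j q = Xpow j q * Xpow i p" if "i < b" "j < b" for i j p q
  proof (rule Xpow_commute)
    show "Xpow i p * e = e * Xpow i p"
      using that by (simp add: e_Xpow)
    show "Xpow i p * X j = X j * Xpow i p"
      using that by (intro Xpow_commute[symmetric] X_X) (simp_all add: e_X)
  qed
  have "?f i \<circ> ?f j = ?f j \<circ> ?f i" if "i \<in> set [0..<b]" "j \<in> set [0..<b]" for i j
    using XX[of i j] that by (simp add: fun_eq_iff flip: mult.assoc)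
  then have "foldr ?f [0..<b] = fold ?f [0..<b]"
    by (rule foldr_fold)
  then show "foldr (*) (concat (map (\<lambda>i. replicate (k i) (X i)) (rev [0..<b]))) e = mon k b"
    using f by (subst foldr_Xpow) (auto simp: foldr_conv_fold)
qed

end

section \<open>Thick bubbles as closures\<close>

interpretation R: bubble_slides "(\<parallel>)" cid hom "\<lambda>n. cell (dot n)" "\<lambda>n. cell (cross n)" "\<lambda>n. cell (cup n)"
  "\<lambda>n. cell (cup' n)" "\<lambda>n. cell (cap n)" "\<lambda>n. cell (cap' n)" "\<lambda>n r. cell (cw n r)" "\<lambda>n r. cell (ccw n r)"
  "\<lambda>n i. cell (dots n i)"
  by (rule bubble_slides_cell)

interpretation M: bubble_slides mhc mcid mhom "\<lambda>n. cell (dot (- n - 2))" "\<lambda>n. - cell (cross (- n - 4))"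
  "\<lambda>n. cell (cup' (- n))" "\<lambda>n. cell (cup (- n))" "\<lambda>n. cell (cap' (- n))" "\<lambda>n. cell (cap (- n))"
  "\<lambda>n r. cell (ccw (- n) r)" "\<lambda>n r. cell (cw (- n) r)" "\<lambda>n i. cell (dots (- n - 2) i)"
  by (rule bubble_slides_mirror)

lemma cell_vlist: "cell (vlist f fs) = foldr (*) (map cell fs) (cell f)"
  unfolding vlist_def by (induction fs) (simp_all add: cell_hom)

text \<open>One diagram read in both calculi. The reflected reading numbers the strands from the
  right, and its weight \<open>- n - 2 * int a\<close> is the negative of the weight on the
  left.\<close>

lemma cell_nh_dot:
  assumes "i < a"
  shows "cell (nh_dot n a i) = R.Xs n a i"
    "cell (nh_dot n a i) = M.Xs (- n - 2 * int a) a (a - 1 - i)"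
proof -
  obtain j where j: "a = Suc (i + j)"
    using assms less_iff_Suc_add by auto
  show "cell (nh_dot n a i) = R.Xs n a i"
    unfolding nh_dot_def R.Xs_def R.emb_def j by (simp add: cell_hom cid_def algebra_simps)
  show "cell (nh_dot n a i) = M.Xs (- n - 2 * int a) a (a - 1 - i)"
    unfolding nh_dot_def M.Xs_def M.emb_def j
    by (simp add: cell_hom cid_def mhc_def mcid_def hc_assoc algebra_simps)
qed

lemma cell_nh_cross:
  assumes "Suc i < a"
  shows "cell (nh_cross n a i) = R.Ss n a i"
    "cell (nh_cross n a i) = - M.Ss (- n - 2 * int a) a (a - 2 - i)"
proof -
  obtain j where j: "a = Suc (Suc (i + j))"
    using assms less_iff_Suc_add by auto
  show "cell (nh_cross n a i) = R.Ss n a i"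
    unfolding nh_cross_def R.Ss_def R.emb_def j by (simp add: cell_hom cid_def algebra_simps)
  show "cell (nh_cross n a i) = - M.Ss (- n - 2 * int a) a (a - 2 - i)"
    unfolding nh_cross_def M.Ss_def M.emb_def j
    by (simp add: cell_hom cid_def mhc_def mcid_def hc_assoc hc_uminus algebra_simps)
qed

lemma cell_nh_monomial:
  "cell (nh_monomial n a m) = R.NH.mon a n (count m) a"
  "cell (nh_monomial n a m) = M.NH.mon a (- n - 2 * int a) (\<lambda>i. count m (a - 1 - i)) a"
proof -
  have e: "cell (nh_monomial n a m) =
      foldr (*) (concat (map (\<lambda>i. replicate (count m i) (cell (nh_dot n a i))) [0..<a])) (cid (replicate a \<E>) n)"
    unfolding nh_monomial_def cell_vlist by (simp add: map_concat comp_def cid_def)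
  have e1: "map (\<lambda>i. replicate (count m i) (cell (nh_dot n a i))) [0..<a] =
      map (\<lambda>i. replicate (count m i) (R.Xs n a i)) [0..<a]"
    by (simp add: cell_nh_dot(1))
  show "cell (nh_monomial n a m) = R.NH.mon a n (count m) a"
    unfolding e e1 by (rule R.NH.foldr_mon)
  have r: "rev [0..<a] = map (\<lambda>i. a - 1 - i) [0..<a]"
    by (rule nth_equalityI) (simp_all add: rev_nth)
  have e2: "map (\<lambda>i. replicate (count m i) (cell (nh_dot n a i))) [0..<a] =
      map (\<lambda>i. replicate (count m (a - 1 - i)) (M.Xs (- n - 2 * int a) a i)) (rev [0..<a])"
    unfolding r by (simp add: cell_nh_dot(2))
  have mc: "cid (replicate a \<E>) n = mcid (replicate a \<E>) (- n - 2 * int a)"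
    by (simp add: mcid_def)
  show "cell (nh_monomial n a m) = M.NH.mon a (- n - 2 * int a) (\<lambda>i. count m (a - 1 - i)) a"
    unfolding e e2 mc by (rule M.NH.foldr_mon)
qed

lemma length_staircase_word: "length (staircase_word a) = a * (a - 1) div 2"
proof (induction a)
  case (Suc a)
  then show ?case
    unfolding triangular_Suc by simp
qed simp

text \<open>In the reflected reading every crossing carries a sign, \<open>a * (a - 1) div 2\<close>
  in number. The reversed numbering is absorbed by \<open>W_mirror\<close>.\<close>

lemma cell_nh_longest:
  "cell (nh_longest n a) = R.NH.W n a a"
  "cell (nh_longest n a) = alt (a * (a - 1) div 2) (M.NH.W (- n - 2 * int a) a a)"
proof -
  have e: "cell (nh_longest n a) = foldr (*) (map (\<lambda>i. cell (nh_cross n a i)) (staircase_word a)) (cid (replicate a \<E>) n)"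
    unfolding nh_longest_def cell_vlist staircase_word_concat by (simp add: comp_def cid_def)
  have 1: "foldr (*) (map (\<lambda>i. cell (nh_cross n a i)) ws) (cid (replicate a \<E>) n) = R.NH.Sw n a ws"
    if "\<And>i. i \<in> set ws \<Longrightarrow> Suc i < a" for ws
    using that by (induction ws) (simp_all add: cell_nh_cross(1))
  have mc: "mcid (replicate a \<E>) (- n - 2 * int a) = cid (replicate a \<E>) n"
    by (simp add: mcid_def)
  have 2: "foldr (*) (map (\<lambda>i. cell (nh_cross n a i)) ws) (mcid (replicate a \<E>) (- n - 2 * int a)) =
      alt (length ws) (M.NH.Sw (- n - 2 * int a) a (map (\<lambda>i. a - 2 - i) ws))"
    if "\<And>i. i \<in> set ws \<Longrightarrow> Suc i < a" for ws
    using that by (induction ws) (simp_all add: cell_nh_cross(2) alt_mult(2))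
  show "cell (nh_longest n a) = R.NH.W n a a"
    unfolding e R.NH.W_def by (rule 1) (rule staircase_word_less)
  show "cell (nh_longest n a) = alt (a * (a - 1) div 2) (M.NH.W (- n - 2 * int a) a a)"
    unfolding e mc[symmetric] M.NH.W_mirror[symmetric] length_staircase_word[symmetric] by (rule 2) (rule staircase_word_less)
qed

lemma count_staircase: "i < a \<Longrightarrow> count (\<Sum>i<a. replicate_mset (a - 1 - i) i) i = a - 1 - i"
  by (simp add: count_sum)

lemma cell_nested:
  "cell (ncap' a n) = (R.nca' a n :: 'k::comm_ring_1 cell)" "cell (ncup' a n) = (R.ncu' a n :: 'k cell)"
  "cell (ncap a n) = (M.nca' a (- n) :: 'k cell)" "cell (ncup a n) = (M.ncu' a (- n) :: 'k cell)"
proof -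
  show "cell (ncap' a n) = (R.nca' a n :: 'k cell)" "cell (ncup' a n) = (R.ncu' a n :: 'k cell)"
    by (induction a arbitrary: n) (simp_all add: cell_hom cid_def)
  show "cell (ncap a n) = (M.nca' a (- n) :: 'k cell)"
  proof (induction a arbitrary: n)
    case (Suc a)
    have IH: "M.nca' a (- n - 2) = (cell (ncap a (n + 2)) :: 'k cell)"
      using Suc[of "n + 2", symmetric] by simp
    show ?case
      unfolding M.nca'.simps IH by (simp add: cell_hom cid_def mhc_def mcid_def hc_assoc add.commute)
  qed (simp add: cid_def mcid_def)
  show "cell (ncup a n) = (M.ncu' a (- n) :: 'k cell)"
  proof (induction a arbitrary: n)
    case (Suc a)
    have IH: "M.ncu' a (- n - 2) = (cell (ncup a (n + 2)) :: 'k cell)"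
      using Suc[of "n + 2", symmetric] by simp
    show ?case
      unfolding M.ncu'.simps IH by (simp add: cell_hom cid_def mhc_def mcid_def hc_assoc add.commute)
  qed (simp add: cid_def mcid_def)
qed

lemma count_image_mset_set:
  "finite A \<Longrightarrow> count (image_mset f (mset_set A)) i = card {x \<in> A. f x = i}"
proof (induction A rule: finite_induct)
  case (insert x A)
  have "{y \<in> insert x A. f y = i} = (if f x = i then insert x {y \<in> A. f y = i} else {y \<in> A. f y = i})"
    by auto
  then show ?case
    using insert by simp
qed simp

lemma smul_card: "finite A \<Longrightarrow> smul (of_nat (card A)) y = (\<Sum>i\<in>A. y)"
  by (induction A rule: finite_induct) (simp_all add: smul_add smul_smul)

text \<open>Grouping the tableaux by weight recovers the coefficients. A number of tableaux may
  vanish in \<open>'k\<close>, so the weights that occur and the support of the Schur function can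
  differ, but only by zero terms.\<close>

lemma smul_schur_sum:
  fixes Y :: "nat multiset \<Rightarrow> 'k::comm_ring_1 cell"
  shows "(\<Sum>m | set_mset m \<subseteq> {..<a} \<and> schur \<gamma> m \<noteq> (0 :: 'k). smul (schur \<gamma> m) (Y m)) =
    (\<Sum>T\<in>tableaux (cells \<gamma>) a. Y (image_mset T (mset_set (cells \<gamma>))))"
proof -
  let ?S = "cells \<gamma>"
  let ?h = "\<lambda>T. image_mset T (mset_set ?S)"
  let ?B = "tableaux ?S a"
  have fin: "finite ?B"
    by (rule finite_tableaux[OF finite_cells])
  have sub: "set_mset (?h T) \<subseteq> {..<a}" if "T \<in> ?B" for T
  proof -
    have "\<forall>x\<in>?S. T x < a"
      using that unfolding tableaux_def by blast
    then show ?thesis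
      using finite_cells[of \<gamma>] by auto
  qed
  have schur: "schur \<gamma> m = (of_nat (card {T \<in> ?B. ?h T = m}) :: 'k)" if "set_mset m \<subseteq> {..<a}" for m
    by (simp add: schur_eq_schur_poly[OF that] coef_schur_poly[OF finite_cells])
  have "(\<Sum>T\<in>?B. Y (?h T)) = (\<Sum>m\<in>?h ` ?B. \<Sum>T\<in>{T \<in> ?B. ?h T = m}. Y (?h T))"
    by (rule sum.image_gen[OF fin])
  also have "\<dots> = (\<Sum>m\<in>?h ` ?B. smul (schur \<gamma> m) (Y m))"
  proof (rule sum.cong[OF refl])
    fix m assume "m \<in> ?h ` ?B"
    then have "set_mset m \<subseteq> {..<a}"
      using sub by blast
    then show "(\<Sum>T\<in>{T \<in> ?B. ?h T = m}. Y (?h T)) = smul (schur \<gamma> m) (Y m)"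
      using fin by (simp add: schur smul_card)
  qed
  also have "\<dots> = (\<Sum>m | set_mset m \<subseteq> {..<a} \<and> schur \<gamma> m \<noteq> (0 :: 'k). smul (schur \<gamma> m) (Y m))"
  proof (rule sum.mono_neutral_right)
    have *: "{T \<in> ?B. ?h T = m} \<noteq> {}" if "set_mset m \<subseteq> {..<a}" "schur \<gamma> m \<noteq> (0 :: 'k)" for m
      using that schur[OF that(1)] by (metis card.empty of_nat_0)
    then show "{m. set_mset m \<subseteq> {..<a} \<and> schur \<gamma> m \<noteq> (0 :: 'k)} \<subseteq> ?h ` ?B"
      by blast
    show "\<forall>m\<in>?h ` ?B - {m. set_mset m \<subseteq> {..<a} \<and> schur \<gamma> m \<noteq> (0 :: 'k)}. smul (schur \<gamma> m) (Y m) = 0"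
    proof
      fix m assume m: "m \<in> ?h ` ?B - {m. set_mset m \<subseteq> {..<a} \<and> schur \<gamma> m \<noteq> (0 :: 'k)}"
      then have "set_mset m \<subseteq> {..<a}"
        using sub by blast
      then have "schur \<gamma> m = (0 :: 'k)"
        using m by blast
      then show "smul (schur \<gamma> m) (Y m) = 0"
        by simp
    qed
  qed (use fin in simp)
  finally show ?thesis
    by simp
qed

text \<open>The weight of a tableau gives the exponents of a monomial of the Schur polynomial, and
  the idempotent adds the staircase \<open>a - 1 - i\<close>.\<close>

lemma cell_thick_cw_real:
  assumes "int (\<alpha> ! (a - 1)) \<ge> int a - n"
  defines "\<gamma> \<equiv> add_all \<alpha> (n - int a)"
  shows "(cell (thick_cw n a \<alpha>) :: 'k::comm_ring_1 cell) = (\<Sum>T\<in>tableaux (cells \<gamma>) a.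
    R.closure_mon a n (\<lambda>i. card {x \<in> cells \<gamma>. T x = i} + (a - 1 - i)))"
proof -
  let ?m = "n - 2 * int a"
  let ?K = "\<lambda>m i. count m i + (a - 1 - i)"
  have mon: "(cell (nh_monomial ?m a m) :: 'k cell) * cell (nh_idem ?m a) = R.NH.mon a ?m (?K m) a * R.NH.W ?m a a" for m :: "nat multiset"
  proof -
    have *: "R.NH.mon a ?m (\<lambda>i. count m i + count (\<Sum>i<a. replicate_mset (a - 1 - i) i) i) a = R.NH.mon a ?m (?K m) a"
      by (rule R.NH.mon_cong) (simp_all only: count_staircase order_refl)
    show ?thesis
      unfolding nh_idem_def cell_hom cell_nh_monomial(1) cell_nh_longest(1) mult.assoc[symmetric]
        R.NH.mon_mult[OF order_refl] * ..
  qed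
  have "cell (thick_cw n a \<alpha>) = (R.closure a n (cell (nh_poly ?m a (schur \<gamma>)) * cell (nh_idem ?m a)) :: 'k cell)"
    using assms(1) by (simp add: thick_cw_def \<gamma>_def R.closure_def cell_hom cell_nested mult.assoc cid_def)
  also have "\<dots> = (\<Sum>m | set_mset m \<subseteq> {..<a} \<and> schur \<gamma> m \<noteq> (0 :: 'k). smul (schur \<gamma> m) (R.closure_mon a n (?K m)))"
    unfolding nh_poly_def cell_sum cell_hom sum_distrib_right smul_mult mon R.closure_linear(4)
    by (simp add: R.closure_def smul_mult R.closure_mon_def)
  also have "\<dots> = (\<Sum>T\<in>tableaux (cells \<gamma>) a. R.closure_mon a n (?K (image_mset T (mset_set (cells \<gamma>)))))"
    by (rule smul_schur_sum)
  finally show ?thesis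
    by (simp add: count_image_mset_set[OF finite_cells])
qed

text \<open>As for the clockwise bubble, but read in the mirror image: exponents appear in reversed
  order, and the crossings of the idempotent contribute the sign.\<close>

lemma cell_thick_ccw_real:
  assumes "int (\<beta> ! (a - 1)) \<ge> n + int a"
  defines "\<gamma> \<equiv> add_all \<beta> (- (n + int a))"
  shows "(cell (thick_ccw n a \<beta>) :: 'k::comm_ring_1 cell) = (\<Sum>T\<in>tableaux (cells \<gamma>) a. alt (a * (a - 1) div 2)
    (M.closure_mon a (- n) (\<lambda>i. card {x \<in> cells \<gamma>. T x = a - 1 - i} + (a - 1 - (a - 1 - i)))))"
proof -
  let ?m = "- n - 2 * int a"
  let ?K = "\<lambda>m i. count m (a - 1 - i) + (a - 1 - (a - 1 - i))"
  let ?j = "a * (a - 1) div 2"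
  have mon: "(cell (nh_monomial n a m) :: 'k cell) * cell (nh_idem n a) = alt ?j (M.NH.mon a ?m (?K m) a * M.NH.W ?m a a)" for m :: "nat multiset"
  proof -
    have *: "M.NH.mon a ?m (\<lambda>i. count m (a - 1 - i) + count (\<Sum>i<a. replicate_mset (a - 1 - i) i) (a - 1 - i)) a =
        M.NH.mon a ?m (?K m) a"
    proof (rule M.NH.mon_cong)
      fix i assume "i < a"
      then have "a - 1 - i < a"
        by simp
      then show "count m (a - 1 - i) + count (\<Sum>i<a. replicate_mset (a - 1 - i) i) (a - 1 - i) = ?K m i"
        by (simp only: count_staircase)
    qed simp
    show ?thesis
      unfolding nh_idem_def cell_hom cell_nh_monomial(2) cell_nh_longest(2) alt_mult(2)[symmetric] mult.assoc[symmetric]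
        M.NH.mon_mult[OF order_refl] * ..
  qed
  have "cell (thick_ccw n a \<beta>) = (M.closure a (- n) (cell (nh_poly n a (schur \<gamma>)) * cell (nh_idem n a)) :: 'k cell)"
    using assms(1) by (simp add: thick_ccw_def \<gamma>_def M.closure_def cell_hom cell_nested mult.assoc cid_def
        mhc_def mcid_def add.commute)
  also have "\<dots> = (\<Sum>m | set_mset m \<subseteq> {..<a} \<and> schur \<gamma> m \<noteq> (0 :: 'k).
      smul (schur \<gamma> m) (alt ?j (M.closure_mon a (- n) (?K m))))"
    unfolding nh_poly_def cell_sum cell_hom sum_distrib_right smul_mult mon M.closure_linear(4)
      M.closure_mon_def M.closure_linear(5)[symmetric]
    by (simp only: M.closure_def smul_mult mhc_def)
  also have "\<dots> = (\<Sum>T\<in>tableaux (cells \<gamma>) a.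
      alt ?j (M.closure_mon a (- n) (?K (image_mset T (mset_set (cells \<gamma>))))))"
    by (rule smul_schur_sum)
  finally show ?thesis
    by (simp only: count_image_mset_set[OF finite_cells])
qed

section \<open>Symmetric functions and endomorphisms\<close>

lift_definition of_mor :: "'k::comm_ring_1 mor \<Rightarrow> 'k cell" is "\<lambda>f. f"
  by (rule null_subset_bad)

lemma of_mor_hom:
  "of_mor (x + y) = of_mor x + of_mor y" "of_mor (mor_vcomp x y) = of_mor x * of_mor y"
  by (transfer, simp add: null_subset_bad null_zero)+

section \<open>The subring of symmetric functions and its two families of generators\<close>

definition sym_funs :: "'k::comm_ring_1 mps set" where
  "sym_funs = {f. coef f \<in> carrier Lambda}"

lemma sym_funs_iff: "f \<in> sym_funs \<longleftrightarrow>
    (\<forall>\<sigma> m. bij \<sigma> \<longrightarrow> coef f (image_mset \<sigma> m) = coef f m) \<and> (\<exists>N. \<forall>m. coef f m \<noteq> 0 \<longrightarrow> size m \<le> N)"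
  by (auto simp: sym_funs_def Lambda_def)

lemma sym_funs_mult:
  assumes "f \<in> sym_funs" "g \<in> sym_funs"
  shows "f * g \<in> sym_funs"
  unfolding sym_funs_iff
proof (intro conjI allI impI)
  fix \<sigma> :: "nat \<Rightarrow> nat" and m assume \<sigma>: "bij \<sigma>"
  define \<sigma>' where "\<sigma>' = inv_into UNIV \<sigma>"
  have "\<sigma>' \<circ> \<sigma> = id" "\<sigma> \<circ> \<sigma>' = id"
    using \<sigma> by (auto simp: \<sigma>'_def bij_def surj_iff)
  then have inv_image: "image_mset \<sigma>' (image_mset \<sigma> p) = p" "image_mset \<sigma> (image_mset \<sigma>' p) = p" for p
    by (simp_all add: multiset.map_comp)
  show "coef (f * g) (image_mset \<sigma> m) = coef (f * g) m"
    unfolding times_mps.rep_eq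
  proof (rule sum.reindex_bij_witness[of _ "image_mset \<sigma>" "image_mset \<sigma>'"])
    fix p assume "p \<in> {p. p \<subseteq># image_mset \<sigma> m}"
    then have p: "p \<subseteq># image_mset \<sigma> m"
      by simp
    show "image_mset \<sigma> (image_mset \<sigma>' p) = p"
      by (rule inv_image)
    show "image_mset \<sigma>' p \<in> {p. p \<subseteq># m}"
      using image_mset_subseteq_mono[OF p, of "\<sigma>'"] by (simp add: inv_image)
    then have "image_mset \<sigma> (m - image_mset \<sigma>' p) = image_mset \<sigma> m - p"
      by (simp add: image_mset_Diff inv_image)
    moreover have "coef f (image_mset \<sigma> (image_mset \<sigma>' p)) = coef f (image_mset \<sigma>' p)"
      "coef g (image_mset \<sigma> (m - image_mset \<sigma>' p)) = coef g (m - image_mset \<sigma>' p)"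
      using assms \<sigma> by (simp_all only: sym_funs_iff)
    ultimately show "coef f (image_mset \<sigma>' p) * coef g (m - image_mset \<sigma>' p) =
        coef f p * coef g (image_mset \<sigma> m - p)"
      by (simp only: inv_image)
  next
    fix p assume "p \<in> {p. p \<subseteq># m}"
    then show "image_mset \<sigma> p \<in> {p. p \<subseteq># image_mset \<sigma> m}"
      by (simp add: image_mset_subseteq_mono)
  qed (rule inv_image)
next
  obtain N M where N: "\<forall>m. coef f m \<noteq> 0 \<longrightarrow> size m \<le> N" "\<forall>m. coef g m \<noteq> 0 \<longrightarrow> size m \<le> M"
    using assms unfolding sym_funs_iff by blast
  show "\<exists>N. \<forall>m. coef (f * g) m \<noteq> 0 \<longrightarrow> size m \<le> N"
  proof (intro exI[of _ "N + M"] allI impI)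
    fix m assume "coef (f * g) m \<noteq> 0"
    then obtain p where p: "p \<subseteq># m" "coef f p * coef g (m - p) \<noteq> 0"
      unfolding times_mps.rep_eq by (metis (mono_tags, lifting) mem_Collect_eq sum.not_neutral_contains_not_neutral)
    then have "coef f p \<noteq> 0" "coef g (m - p) \<noteq> 0"
      by auto
    then have "size p \<le> N" "size (m - p) \<le> M"
      using N by blast+
    then show "size m \<le> N + M"
      using p(1) size_mset_mono[OF p(1)] by (simp add: size_Diff_submset)
  qed
qed

lemma sym_funs_simple: "1 \<in> sym_funs" "f \<in> sym_funs \<Longrightarrow> - f \<in> sym_funs" "hs r \<in> sym_funs"
  "f \<in> sym_funs \<Longrightarrow> g \<in> sym_funs \<Longrightarrow> f + g \<in> sym_funs"
proof -
  show "1 \<in> sym_funs" "f \<in> sym_funs \<Longrightarrow> - f \<in> sym_funs"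
    by (auto simp: sym_funs_iff)
  show "hs r \<in> sym_funs"
    unfolding sym_funs_iff by (auto simp: hs_def intro!: exI[of _ "nat r"])
  assume f: "f \<in> sym_funs" and g: "g \<in> sym_funs"
  then obtain N M where N: "\<forall>m. coef f m \<noteq> 0 \<longrightarrow> size m \<le> N" "\<forall>m. coef g m \<noteq> 0 \<longrightarrow> size m \<le> M"
    unfolding sym_funs_iff by blast
  have "\<forall>m. coef (f + g) m \<noteq> 0 \<longrightarrow> size m \<le> max N M"
  proof (intro allI impI)
    fix m assume "coef (f + g) m \<noteq> 0"
    then have "coef f m \<noteq> 0 \<or> coef g m \<noteq> 0"
      by auto
    then show "size m \<le> max N M"
      using N by (meson le_max_iff_disj)
  qed
  then show "f + g \<in> sym_funs"
    using f g unfolding sym_funs_iff by auto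
qed

definition sgn_es :: "int \<Rightarrow> 'k::comm_ring_1 mps" where
  "sgn_es r = (- 1) ^ nat r * es r"

lemma rho_zero: "rho N 0 = 0" and rho_uminus: "rho N (- f) = - rho N f"
  by (rule mps_eqI, simp add: rho_def)+

text \<open>Adjoining a variable multiplies the series of signed elementary functions by 1 - x_N z
  and the series of complete functions by its inverse. Their product is unchanged, and without
  variables it is 1.\<close>

lemma rho_sgn_es_hs:
  "K > 0 \<Longrightarrow> (\<Sum>r\<le>K. (- 1) ^ r * rho N (es (int r)) * rho N (hs (int K - int r))) = 0"
proof (induction N arbitrary: K)
  case 0
  have "(- 1) ^ r * rho 0 (es (int r)) * rho 0 (hs (int K - int r)) = (0 :: 'a mps)" for r
    using 0 by (simp add: rho_0)
  then show ?case
    by simp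
next
  case (Suc N)
  let ?E = "\<lambda>r. rho N (es r) :: 'a mps" and ?H = "\<lambda>r. rho (Suc N) (hs r) :: 'a mps"
  let ?g = "\<lambda>r. (- 1) ^ r * ?E (int r) * ?H (int K - int r - 1)"
  have H: "?H z - xv N * ?H (z - 1) = rho N (hs z)" for z
    by (subst rho_hs_Suc) simp
  obtain L where L: "K = Suc L"
    using Suc.prems gr0_implies_Suc by blast
  have "(\<Sum>r\<le>K. (- 1) ^ r * rho (Suc N) (es (int r)) * ?H (int K - int r)) =
      (\<Sum>r\<le>K. (- 1) ^ r * ?E (int r) * ?H (int K - int r)) + xv N * (\<Sum>r\<le>K. (- 1) ^ r * ?E (int r - 1) * ?H (int K - int r))"
    by (simp add: rho_es_Suc sum_distrib_left sum.distrib algebra_simps)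
  also have "(\<Sum>r\<le>K. (- 1) ^ r * ?E (int r - 1) * ?H (int K - int r)) = - (\<Sum>r\<le>L. ?g r)"
    unfolding L sum.atMost_Suc_shift by (simp add: es_neg rho_zero sum_negf algebra_simps)
  also have "(\<Sum>r\<le>L. ?g r) = (\<Sum>r\<le>K. ?g r)"
    unfolding L by (simp add: hs_neg rho_zero)
  also have "(\<Sum>r\<le>K. (- 1) ^ r * ?E (int r) * ?H (int K - int r)) + xv N * - (\<Sum>r\<le>K. ?g r) =
      (\<Sum>r\<le>K. (- 1) ^ r * ?E (int r) * (?H (int K - int r) - xv N * ?H (int K - int r - 1)))"
    by (simp add: sum_distrib_left right_diff_distrib sum_subtractf mult_ac diff_right_commute)
  also have "\<dots> = (\<Sum>r\<le>K. (- 1) ^ r * ?E (int r) * rho N (hs (int K - int r)))"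
    by (simp only: H)
  finally show ?case
    using Suc by simp
qed

lemma sgn_es_hs:
  assumes "K > 0"
  shows "(\<Sum>r\<le>K. sgn_es (int r) * hs (int (K - r))) = 0"
proof (rule mps_eqI)
  fix m :: "nat multiset"
  obtain N where N: "set_mset m \<subseteq> {..<N}"
    using finite_set_bound by blast
  let ?f = "\<Sum>r\<le>K. sgn_es (int r) * hs (int (K - r)) :: 'a mps"
  have sg: "rho N ((- 1) ^ r * f) = (- 1) ^ r * rho N f" for r and f :: "'a mps"
    by (cases "even r") (auto simp: rho_uminus)
  have sgr: "rho N (sgn_es (int r)) = ((- 1) ^ r * rho N (es (int r)) :: 'a mps)" for r
    by (simp add: sgn_es_def sg)
  have "rho N ?f = (\<Sum>r\<le>K. (- 1) ^ r * rho N (es (int r)) * rho N (hs (int K - int r)))"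
    unfolding rho_sum by (rule sum.cong) (simp_all add: rho_hom(2) sgr of_nat_diff)
  also have "\<dots> = 0"
    by (rule rho_sgn_es_hs[OF assms])
  finally have "coef (rho N ?f) m = 0"
    by simp
  then show "coef ?f m = coef 0 m"
    using N by (simp add: rho_def)
qed

text \<open>The entry in row \<open>i\<close> and column \<open>t\<close> has the parity of
  \<open>\<beta> ! i + i + t\<close>. Along a permutation the row and column indices add up to an
  even number, which leaves the size of \<open>\<beta>\<close>.\<close>

lemma ldet_sgn_es:
  assumes "length \<beta> = a"
  shows "ldet a (\<lambda>i t. sgn_es (int (\<beta> ! i) - int i + int t)) =
    (- 1) ^ sum_list \<beta> * (ldet a (\<lambda>i t. es (int (\<beta> ! i) - int i + int t)) :: 'k::comm_ring_1 mps)"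
proof -
  let ?r = "\<lambda>i t. int (\<beta> ! i) - int i + int t"
  have s: "sgn_es (?r i t) = (- 1) ^ (\<beta> ! i + i + t) * (es (?r i t) :: 'k mps)" for i t
  proof (cases "?r i t < 0")
    case False
    then have "nat (?r i t) + 2 * i = \<beta> ! i + i + t"
      by linarith
    then have "even (nat (?r i t)) \<longleftrightarrow> even (\<beta> ! i + i + t)"
      by (metis even_add even_mult_iff even_numeral)
    then show ?thesis
      by (auto simp: sgn_es_def minus_one_power_iff)
  qed (simp add: sgn_es_def es_neg)
  have "(\<Prod>i<a. (- 1) ^ (\<beta> ! i + i + p i)) = ((- 1) ^ sum_list \<beta> :: 'k mps)" if p: "p permutes {..<a}" for p
  proof -
    have "(\<Sum>i<a. p i) = (\<Sum>i<a. i)"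
      using sum.permute[OF p, of "\<lambda>i. i"] by (simp add: comp_def)
    moreover have "(\<Sum>i<a. \<beta> ! i) = sum_list \<beta>"
      by (simp add: sum_list_sum_nth assms atLeast0LessThan)
    ultimately have "(\<Sum>i<a. \<beta> ! i + i + p i) = sum_list \<beta> + 2 * (\<Sum>i<a. i)"
      by (simp add: sum.distrib)
    then show ?thesis
      unfolding power_sum[symmetric] by (simp add: power_add power_mult)
  qed
  then show ?thesis
    unfolding ldet_def s by (simp add: prod.distrib sum_distrib_left mult_ac)
qed

text \<open>Exchanging two exponents exchanges two rows of the determinant. Exponents from index
  \<open>a\<close> on do not enter it and are normalised to zero, to fit
  \<open>alternating_schur\<close>.\<close>

lemma (in subring_map) schur_alternating:
  fixes q :: nat and z :: int
  assumes g: "\<And>r. g r \<in> S" and l: "antimono l" "l a = 0"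
  defines "A \<equiv> \<lambda>k. \<Phi> ((- 1) ^ q * ldet a (\<lambda>i t. g (int (k i) + z + int t)))"
  shows "(\<Sum>T\<in>tableaux (shape l a) a. A (\<lambda>i. card {x \<in> shape l a. T x = i} + (a - 1 - i))) =
    A (\<lambda>i. l i + (a - 1 - i))"
proof -
  have A_if: "A k = A (\<lambda>i. if i < a then k i + 0 else 0)" for k
    unfolding A_def by (intro arg_cong[of _ _ \<Phi>] arg_cong2[of _ _ _ _ "(*)"] refl ldet_cong) simp
  have mem: "(- 1) ^ q * ldet a (\<lambda>i t. g (K i t)) \<in> S" for K
    by (intro sign_mem ldet_mem g)
  have "(\<Sum>T\<in>tableaux (shape l a) a.
      A (\<lambda>i. if i < a then card {x \<in> shape l a. T x = i} + (a - 1 - i) + 0 else 0)) =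
    A (\<lambda>i. if i < a then l i + (a - 1 - i) + 0 else 0)"
  proof (rule alternating_schur[of a a A])
    fix k :: "nat \<Rightarrow> nat" and i j assume ij: "i < a" "j < a" "i \<noteq> j"
    show "A (k \<circ> transpose i j) = - A k"
      using ldet_swap_rows[OF ij, of "\<lambda>i t. g (int (k i) + z + int t)"] map_uminus[OF mem]
      by (simp add: A_def)
    assume "k i = k j"
    then show "A k = 0"
      using ldet_equal_rows[OF ij, of "\<lambda>i t. g (int (k i) + z + int t)"] by (simp add: A_def map_zero)
  qed (use l in auto)
  then show ?thesis
    by (simp only: A_if[symmetric])
qed

lemma cell_bubble_det:
  assumes "subring_map S \<Phi>" and unit: "\<Phi> 1 = cid [] n"
    and g: "\<And>r. g r \<in> S" "\<And>s t. cell (B s t) = \<Phi> (g (K s t))"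
  shows "cell (bubble_det n a B) = \<Phi> (ldet a (\<lambda>s t. g (K s t)))"
proof -
  interpret subring_map S \<Phi> by fact
  have prod: "prod_list (map (\<lambda>s. g (f s)) xs) \<in> S \<and>
      foldr (*) (map (\<lambda>s. \<Phi> (g (f s))) xs) (cid [] n) = \<Phi> (prod_list (map (\<lambda>s. g (f s)) xs))" for f xs
    by (induction xs) (simp_all add: unit one mult map_mult g)
  have "smul (of_int (sign p)) (cell (vlist (idm [] n) (map (\<lambda>s. B s (p s)) [0..<a]))) =
      \<Phi> (of_int (sign p) * (\<Prod>s<a. g (K s (p s))))" for p :: "nat \<Rightarrow> nat"
  proof -
    have "cell (vlist (idm [] n) (map (\<lambda>s. B s (p s)) [0..<a])) = \<Phi> (prod_list (map (\<lambda>s. g (K s (p s))) [0..<a]))"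
      using prod[of "\<lambda>s. K s (p s)" "[0..<a]"] by (simp add: cell_vlist comp_def g cid_def)
    also have "prod_list (map (\<lambda>s. g (K s (p s))) [0..<a]) = (\<Prod>s<a. g (K s (p s)))"
      by (simp add: prod.distinct_set_conv_list[symmetric] atLeast0LessThan)
    finally show ?thesis
      by (auto simp: sign_def smul_smul smul_uminus map_uminus prod_mem g)
  qed
  moreover have "of_int (sign p) * (\<Prod>s<a. g (K s (p s))) \<in> S" for p :: "nat \<Rightarrow> nat"
    by (auto simp: sign_def uminus prod_mem g)
  ultimately show ?thesis
    unfolding bubble_det_def ldet_def by (simp add: cell_sum cell_hom map_sum)
qed

section \<open>Boundaries of thick bubbles, and the endomorphism ring\<close>

lemma typed_nh_dot: "i < a \<Longrightarrow> nh_dot n a i \<in> typed n (replicate a \<E>) (replicate a \<E>)"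
proof -
  assume "i < a"
  then obtain j where j: "a = Suc (i + j)"
    using less_iff_Suc_add by auto
  show ?thesis
    unfolding nh_dot_def
    by (rule typed_hcomp[OF typed_idm typed_hcomp[OF typed_gens(1) typed_idm _ refl refl]])
      (simp_all add: j replicate_add replicate_Suc replicate_app_Cons_same)
qed

lemma typed_nh_cross: "Suc i < a \<Longrightarrow> nh_cross n a i \<in> typed n (replicate a \<E>) (replicate a \<E>)"
proof -
  assume "Suc i < a"
  then obtain j where j: "a = Suc (Suc (i + j))"
    using less_iff_Suc_add by auto
  show ?thesis
    unfolding nh_cross_def
    by (rule typed_hcomp[OF typed_idm typed_hcomp[OF typed_gens(3) typed_idm _ refl refl]])
      (simp_all add: j replicate_add replicate_Suc replicate_app_Cons_same)
qed

lemma typed_nh_monomial: "nh_monomial n a m \<in> typed n (replicate a \<E>) (replicate a \<E>)"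
  unfolding nh_monomial_def by (rule typed_vlist) (auto simp: typed_nh_dot typed_idm)

lemma typed_nh_poly: "nh_poly n a P \<in> typed n (replicate a \<E>) (replicate a \<E>)"
  unfolding nh_poly_def by (intro typed_sum typed_scal typed_nh_monomial)

lemma typed_nh_idem: "nh_idem n a \<in> typed n (replicate a \<E>) (replicate a \<E>)"
  unfolding nh_idem_def nh_longest_def staircase_word_concat[symmetric]
  by (intro typed_vcomp[OF typed_nh_monomial] typed_vlist)
    (auto intro!: typed_nh_cross typed_idm dest: staircase_word_less)

lemma typed_bubble_det: "(\<And>s t. B s t \<in> typed n [] []) \<Longrightarrow> bubble_det n a B \<in> typed n [] []"
  unfolding bubble_det_def by (intro typed_sum typed_scal typed_vlist typed_idm) auto

lemma typed_thick_cw: "thick_cw n a \<alpha> \<in> typed n [] []"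
  unfolding thick_cw_def
  by (auto intro!: typed_scal typed_bubble_det typed_ccw_cw typed_vcomp[OF typed_ncap'] typed_vcomp[OF _ typed_ncup']
      typed_hcomp[OF typed_vcomp[OF typed_nh_poly typed_nh_idem] typed_idm])

lemma typed_thick_ccw: "thick_ccw n a \<beta> \<in> typed n [] []"
  unfolding thick_ccw_def
  by (auto intro!: typed_scal typed_bubble_det typed_ccw_cw typed_vcomp[OF typed_ncap] typed_vcomp[OF _ typed_ncup]
      typed_hcomp[OF typed_idm typed_vcomp[OF typed_nh_poly typed_nh_idem]])

lemma END_U_carrier:
  assumes "x \<in> carrier (END_U n)"
  obtains f where "f \<in> typed n [] []" "x = cls f"
proof -
  obtain T g where T: "finite T" "\<forall>t\<in>T. g t \<in> Hom_U n [] t [] 0" and x: "x = (\<Sum>t\<in>T. g t)"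
    using assms by (auto simp: END_U_def)
  from T have "(\<Sum>t\<in>T. g t) \<in> cls ` typed n [] []"
  proof (induction T rule: finite_induct)
    case empty
    then show ?case
      using typed_zero by (auto simp: zero_mor_def)
  next
    case (insert t T)
    then obtain f f' where "g t = cls f" "f \<in> typed n [] []" "(\<Sum>t\<in>T. g t) = cls f'" "f' \<in> typed n [] []"
      unfolding Hom_U_def typed_def by auto
    then show ?case
      using insert by (auto simp: plus_mor.abs_eq intro!: imageI typed_add)
  qed
  then show ?thesis
    using that x by blast
qed

lemma cls_sum: "cls (sum f A) = (\<Sum>i\<in>A. cls (f i))"
  by (induction A rule: infinite_finite_induct) (simp_all add: zero_mor_def flip: plus_mor.abs_eq)

text \<open>Sorting the finitely many diagrams of \<open>f\<close> by degree exhibits the finite sum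
  of homogeneous pieces that the carrier asks for.\<close>

lemma cls_in_END_U:
  assumes "f \<in> typed n [] []"
  shows "cls f \<in> carrier (END_U n)"
proof -
  let ?T = "deg ` Poly_Mapping.keys f"
  let ?g = "\<lambda>t. part {d. deg d = t} f"
  have "(\<Sum>t\<in>?T. ?g t) = f"
    by (rule poly_mapping_eqI) (auto simp: lookup_sum lookup_part in_keys_iff)
  then have sum: "cls f = (\<Sum>t\<in>?T. cls (?g t))"
    by (simp flip: cls_sum)
  have "\<forall>d \<in> Poly_Mapping.keys (?g t). wf_diagram d \<and> rwt d = n \<and> src d = [] \<and> tgt d = [] \<and> deg d = t - 0" for t
    using assms by (auto simp: typed_def in_keys_iff lookup_part split: if_splits)
  then have H: "cls (?g t) \<in> Hom_U n [] t [] 0" for t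
    unfolding Hom_U_def by blast
  have "cls f \<in> {(\<Sum>t\<in>T. g t) | T g. finite T \<and> (\<forall>t\<in>T. g t \<in> Hom_U n [] t [] 0)}"
    unfolding sum by (intro CollectI exI[of _ ?T] exI[of _ "\<lambda>t. cls (?g t)"] conjI ballI refl H) simp
  then show ?thesis
    unfolding END_U_def by simp
qed

text \<open>Parts decrease, so the bound on the last part keeps all shifted parts nonnegative and
  \<open>nat\<close> truncates nothing.\<close>

lemma add_all_shape:
  assumes "\<alpha> \<in> partitions_atmost a" "1 \<le> a" "int (\<alpha> ! (a - 1)) + z \<ge> 0"
  obtains l where "antimono l" "l a = 0" "cells (add_all \<alpha> z) = shape l a"
    "\<And>i. i < a \<Longrightarrow> int (l i) = int (\<alpha> ! i) + z"
proof -
  have len: "length \<alpha> = a" and sorted: "sorted_wrt (\<ge>) \<alpha>"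
    using assms(1) by (auto simp: partitions_atmost_def)
  have le: "\<alpha> ! j \<le> \<alpha> ! i" if "i \<le> j" "j < a" for i j
    using sorted that len by (cases "i = j") (auto simp: sorted_wrt_iff_nth_less)
  define l where "l i = (if i < a then nat (int (\<alpha> ! i) + z) else 0)" for i
  show ?thesis
  proof
    have "nat (int (\<alpha> ! Suc i) + z) \<le> nat (int (\<alpha> ! i) + z)" if "Suc i < a" for i
      using le[of i "Suc i"] that by simp
    then show "antimono l"
      unfolding l_def by (rule antimono_extend)
    show "cells (add_all \<alpha> z) = shape l a"
      by (auto simp: cells_def shape_def add_all_def l_def len)
    show "int (l i) = int (\<alpha> ! i) + z" if "i < a" for i
    proof -
      have "\<alpha> ! (a - 1) \<le> \<alpha> ! i"
        by (rule le) (use that in auto)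
      then show ?thesis
        using that assms(3) by (simp add: l_def)
    qed
  qed (simp add: l_def)
qed

lemma coef_sign: "coef ((- 1) ^ j * f) m = (- 1) ^ j * coef f m"
  by (cases "even j") auto

lemma es_0: "es 0 = 1" and hs_0: "hs 0 = 1"
  by (rule mps_eqI, auto simp: es_def hs_def)+

theorem proposition4p10:
  fixes n :: int and a :: nat and \<alpha> \<beta> :: "nat list"
    and \<phi> :: "(nat multiset \<Rightarrow> 'k::comm_ring_1) \<Rightarrow> 'k mor"
  assumes "a \<ge> 1"
    and "\<phi> \<in> ring_iso Lambda (END_U n)"
    and "\<And>r. \<phi> (complete_sym r) = cls (cw n (int r))"
    and "\<alpha> \<in> partitions_atmost a"
    and "\<beta> \<in> partitions_atmost a"
  shows "cls (thick_cw n a \<alpha>) \<in> carrier (END_U n) \<and>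
         inv_into (carrier Lambda) \<phi> (cls (thick_cw n a \<alpha>)) =
           (\<lambda>m. (- 1) ^ (a * (a - 1) div 2) * schur \<alpha> m) \<and>
         cls (thick_ccw n a \<beta>) \<in> carrier (END_U n) \<and>
         inv_into (carrier Lambda) \<phi> (cls (thick_ccw n a \<beta>)) =
           (\<lambda>m. (- 1) ^ (a * (a - 1) div 2 + sum_list \<beta>) * schur (conjugate \<beta>) m)"
proof -
  have hom: "\<phi> \<in> ring_hom Lambda (END_U n)" and bij: "bij_betw \<phi> (carrier Lambda) (carrier (END_U n))"
    using assms(2) by (auto simp: ring_iso_def)
  \<comment> \<open>The isomorphism followed by the passage to cells, where all computations take
    place; \<open>cls_eq_of_cell_eq\<close> will undo that passage at the end.\<close>
  define \<Phi> where "\<Phi> f = of_mor (\<phi> (coef f))" for f :: "'k mps"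
  interpret subring_map "sym_funs :: 'k mps set" \<Phi>
  proof
    fix p q :: "'k mps" assume "p \<in> sym_funs" "q \<in> sym_funs"
    then have pq: "coef p \<in> carrier Lambda" "coef q \<in> carrier Lambda"
      by (auto simp: sym_funs_def)
    have "coef (p + q) = coef p \<oplus>\<^bsub>Lambda\<^esub> coef q" "coef (p * q) = coef p \<otimes>\<^bsub>Lambda\<^esub> coef q"
      by (simp_all add: Lambda_def fun_eq_iff times_mps.rep_eq)
    then have "\<phi> (coef (p + q)) = \<phi> (coef p) + \<phi> (coef q)"
      "\<phi> (coef (p * q)) = mor_vcomp (\<phi> (coef p)) (\<phi> (coef q))"
      using ring_hom_add[OF hom pq] ring_hom_mult[OF hom pq] by (simp_all add: END_U_def)
    then show "\<Phi> (p + q) = \<Phi> p + \<Phi> q" "\<Phi> (p * q) = \<Phi> p * \<Phi> q"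
      by (simp_all add: \<Phi>_def of_mor_hom)
  qed (rule sym_funs_simple sym_funs_mult; assumption)+
  have unit: "\<Phi> 1 = cid [] n"
  proof -
    have "coef (1 :: 'k mps) = \<one>\<^bsub>Lambda\<^esub>"
      by (simp add: Lambda_def fun_eq_iff)
    then show ?thesis
      using ring_hom_one[OF hom] by (simp add: \<Phi>_def END_U_def of_mor.abs_eq cid_def)
  qed
  have hs: "\<Phi> (hs r) = cell (cw n r)" for r
  proof (cases "r < 0")
    case True
    then show ?thesis
      by (simp add: hs_neg map_zero R.c_neg)
  next
    case False
    then have "coef (hs r :: 'k mps) = complete_sym (nat r)"
      by (auto simp: hs_def complete_sym_def Mps_inverse fun_eq_iff)
    then show ?thesis
      using False assms(3)[of "nat r"] by (simp add: \<Phi>_def of_mor.abs_eq)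
  qed
  \<comment> \<open>Signed elementary functions are inverse to complete ones as series, and
    counterclockwise bubbles are inverse to clockwise ones. Both therefore solve the same recursion,
    and \<Phi> matches them degree by degree.\<close>
  have es_nat: "sgn_es (int K) \<in> (sym_funs :: 'k mps set) \<and> \<Phi> (sgn_es (int K)) = cell (ccw n (int K))" for K
  proof (induction K rule: less_induct)
    case (less K)
    show ?case
    proof (cases "K = 0")
      case True
      then show ?thesis
        by (simp add: sgn_es_def es_0 unit one R.cc_zero)
    next
      case False
      then have K: "K > 0"
        by simp
      have split: "{..K} = insert K {..<K}"
        by auto
      have E: "sgn_es (int K) = - (\<Sum>r<K. sgn_es (int r) * hs (int (K - r)) :: 'k mps)"
        using sgn_es_hs[OF K] unfolding split by (simp add: hs_0 eq_neg_iff_add_eq_0)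
      have mem: "sgn_es (int r) * hs (int (K - r)) \<in> (sym_funs :: 'k mps set)" if "r < K" for r
        using less.IH[OF that] by (intro sym_funs_mult sym_funs_simple) auto
      have G: "(\<Sum>r\<le>K. cell (ccw n (int r)) * cell (cw n (int (K - r)))) = (0 :: 'k cell)"
        by (rule R.infinite_grassmannian[OF K])
      have "cell (ccw n (int K)) * cid [] n = (cell (ccw n (int K)) :: 'k cell)"
        by (rule cid_right[OF cell_in_hom[OF typed_ccw_cw(1)]])
      then have C: "cell (ccw n (int K)) = - (\<Sum>r<K. cell (ccw n (int r)) * cell (cw n (int (K - r))) :: 'k cell)"
        using G unfolding split by (simp add: R.c_zero eq_neg_iff_add_eq_0)
      have 1: "\<Phi> (sgn_es (int r) * hs (int (K - r))) = cell (ccw n (int r)) * cell (cw n (int (K - r)))" if "r < K" for r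
        using less.IH[OF that] map_mult[of "sgn_es (int r)" "hs (int (K - r))"] hs[of "int (K - r)"]
        by (simp only: sym_funs_simple)
      have "\<Phi> (sgn_es (int K)) = - \<Phi> (\<Sum>r<K. sgn_es (int r) * hs (int (K - r)))"
        unfolding E by (intro map_uminus sum_mem mem) simp
      also have "\<Phi> (\<Sum>r<K. sgn_es (int r) * hs (int (K - r))) = (\<Sum>r<K. \<Phi> (sgn_es (int r) * hs (int (K - r))))"
        by (intro map_sum mem) simp
      also have "\<dots> = (\<Sum>r<K. cell (ccw n (int r)) * cell (cw n (int (K - r))))"
        by (rule sum.cong) (simp_all only: 1 lessThan_iff)
      finally have "\<Phi> (sgn_es (int K)) = cell (ccw n (int K))"
        unfolding C .
      moreover have "sgn_es (int K) \<in> (sym_funs :: 'k mps set)"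
        unfolding E by (intro uminus sum_mem mem) simp
      ultimately show ?thesis
        by simp
    qed
  qed
  have es: "sgn_es r \<in> (sym_funs :: 'k mps set)" "\<Phi> (sgn_es r) = cell (ccw n r)" for r
  proof -
    have "sgn_es r \<in> (sym_funs :: 'k mps set) \<and> \<Phi> (sgn_es r) = cell (ccw n r)"
    proof (cases "r < 0")
      case True
      then show ?thesis
        by (simp add: sgn_es_def es_neg map_zero zero R.cc_neg)
    qed (use es_nat[of "nat r"] in simp)
    then show "sgn_es r \<in> (sym_funs :: 'k mps set)" "\<Phi> (sgn_es r) = cell (ccw n r)"
      by auto
  qed
  let ?j = "a * (a - 1) div 2"
  have smul_sign: "smul ((- 1) ^ j) y = alt j y" for j and y :: "'k cell"
    by (cases "even j") (simp_all add: alt_def smul_smul smul_uminus)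
  have cw: "cell (thick_cw n a \<alpha>) = \<Phi> ((- 1) ^ ?j * ldet a (\<lambda>i t. hs (int (\<alpha> ! i) - int i + int t)))"
  proof (cases "int (\<alpha> ! (a - 1)) \<ge> int a - n")
    case True
    then have nonneg: "int (\<alpha> ! (a - 1)) + (n - int a) \<ge> 0"
      by simp
    obtain l where l: "antimono l" "l a = 0" "cells (add_all \<alpha> (n - int a)) = shape l a"
      "\<And>i. i < a \<Longrightarrow> int (l i) = int (\<alpha> ! i) + (n - int a)"
      using add_all_shape[OF assms(4,1) nonneg] by metis
    have det: "R.closure_mon a n k = \<Phi> ((- 1) ^ ?j * ldet a (\<lambda>i t. hs (int (k i) + (1 - n) + int t)))" for k
      using R.closure_mon_det[OF subring_map_axioms unit sym_funs_simple(3) hs, of a k]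
      by (simp add: algebra_simps)
    have "cell (thick_cw n a \<alpha>) = \<Phi> ((- 1) ^ ?j * ldet a (\<lambda>i t. hs (int (l i + (a - 1 - i)) + (1 - n) + int t)))"
      unfolding cell_thick_cw_real[OF True] l(3) det
      by (rule schur_alternating[OF sym_funs_simple(3) l(1,2)])
    \<comment> \<open>The shift of the partition by \<open>n - a\<close> is made for this point:
      with the staircase \<open>a - 1 - i\<close> and the offset \<open>1 - n\<close> of the
      bubbles, all that is left is the Jacobi--Trudi index.\<close>
    also have "ldet a (\<lambda>i t. hs (int (l i + (a - 1 - i)) + (1 - n) + int t)) =
        (ldet a (\<lambda>i t. hs (int (\<alpha> ! i) - int i + int t)) :: 'k mps)"
    proof (rule ldet_cong, rule arg_cong[of _ _ hs])
      fix i t assume "i < a" "t < a"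
      then show "int (l i + (a - 1 - i)) + (1 - n) + int t = int (\<alpha> ! i) - int i + int t"
        using l(4)[of i] by (simp add: of_nat_diff)
    qed
    finally show ?thesis .
  next
    case False
    have "cell (thick_cw n a \<alpha>) = alt ?j (cell (bubble_det n a (\<lambda>s t. cw n (int (\<alpha> ! s) - int s + int t))) :: 'k cell)"
      using False by (simp add: thick_cw_def cell_hom smul_sign)
    also have "cell (bubble_det n a (\<lambda>s t. cw n (int (\<alpha> ! s) - int s + int t))) =
        \<Phi> (ldet a (\<lambda>i t. hs (int (\<alpha> ! i) - int i + int t)))"
      by (rule cell_bubble_det[OF subring_map_axioms unit sym_funs_simple(3)]) (simp add: hs)
    finally show ?thesis
      by (simp add: map_sign ldet_mem sym_funs_simple)
  qed
  have ccw: "cell (thick_ccw n a \<beta>) = \<Phi> ((- 1) ^ ?j * ldet a (\<lambda>i t. sgn_es (int (\<beta> ! i) - int i + int t)))"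
  proof (cases "int (\<beta> ! (a - 1)) \<ge> n + int a")
    case True
    then have nonneg: "int (\<beta> ! (a - 1)) + - (n + int a) \<ge> 0"
      by simp
    obtain l where l: "antimono l" "l a = 0" "cells (add_all \<beta> (- (n + int a))) = shape l a"
      "\<And>i. i < a \<Longrightarrow> int (l i) = int (\<beta> ! i) + - (n + int a)"
      using add_all_shape[OF assms(5,1) nonneg] by metis
    \<comment> \<open>Three signs of exponent a(a-1)/2 meet: from the reflected crossings, from the
      closure and from reversing the rows. Two of them cancel.\<close>
    have det: "alt ?j (M.closure_mon a (- n) (\<lambda>i. k (a - 1 - i))) =
        \<Phi> ((- 1) ^ ?j * ldet a (\<lambda>i t. sgn_es (int (k i) + (n + 1) + int t)))" for k
    proof -
      let ?D = "ldet a (\<lambda>i t. sgn_es (int (k i) + (n + 1) + int t)) :: 'k mps"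
      have u: "\<Phi> 1 = mcid [] (- n)"
        by (simp add: unit mcid_def)
      have e: "\<Phi> (sgn_es r) = cell (ccw (- (- n)) r)" for r
        by (simp add: es)
      have "M.closure_mon a (- n) (\<lambda>i. k (a - 1 - i)) =
          \<Phi> ((- 1) ^ ?j * ldet a (\<lambda>i t. sgn_es (int (k (a - 1 - i)) + (n + 1) + int t)))"
        using M.closure_mon_det[OF subring_map_axioms u es(1) e, of a "\<lambda>i. k (a - 1 - i)"]
        by (simp add: algebra_simps)
      also have "ldet a (\<lambda>i t. sgn_es (int (k (a - 1 - i)) + (n + 1) + int t)) = (- 1) ^ ?j * ?D"
        by (rule ldet_reverse_rows)
      finally show ?thesis
        by (simp add: map_sign sign_mem ldet_mem es)
    qed
    have "cell (thick_ccw n a \<beta>) = \<Phi> ((- 1) ^ ?j * ldet a (\<lambda>i t. sgn_es (int (l i + (a - 1 - i)) + (n + 1) + int t)))"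
      unfolding cell_thick_ccw_real[OF True] l(3) det[of "\<lambda>j. card {x \<in> shape l a. T x = j} + (a - 1 - j)" for T]
      by (rule schur_alternating[OF es(1) l(1,2)])
    also have "ldet a (\<lambda>i t. sgn_es (int (l i + (a - 1 - i)) + (n + 1) + int t)) =
        (ldet a (\<lambda>i t. sgn_es (int (\<beta> ! i) - int i + int t)) :: 'k mps)"
    proof (rule ldet_cong, rule arg_cong[of _ _ sgn_es])
      fix i t assume "i < a" "t < a"
      then show "int (l i + (a - 1 - i)) + (n + 1) + int t = int (\<beta> ! i) - int i + int t"
        using l(4)[of i] by (simp add: of_nat_diff)
    qed
    finally show ?thesis .
  next
    case False
    have "cell (thick_ccw n a \<beta>) = alt ?j (cell (bubble_det n a (\<lambda>s t. ccw n (int (\<beta> ! s) - int s + int t))) :: 'k cell)"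
      using False by (simp add: thick_ccw_def cell_hom smul_sign)
    also have "cell (bubble_det n a (\<lambda>s t. ccw n (int (\<beta> ! s) - int s + int t))) =
        \<Phi> (ldet a (\<lambda>i t. sgn_es (int (\<beta> ! i) - int i + int t)))"
      by (rule cell_bubble_det[OF subring_map_axioms unit es(1)]) (simp add: es)
    finally show ?thesis
      by (simp add: map_sign ldet_mem es)
  qed
  \<comment> \<open>A typed representative of the image of \<open>f\<close> is compared with
    \<open>X\<close> in the ring of cells. Equality there is equality of 2-morphisms, and
    injectivity on the carrier then determines the preimage.\<close>
  have inverse: "inv_into (carrier Lambda) \<phi> (cls X) = coef f"
    if X: "X \<in> typed n [] []" and f: "f \<in> sym_funs" "cell X = \<Phi> f" for X f
  proof -
    have mem: "coef f \<in> carrier Lambda"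
      using f by (simp add: sym_funs_def)
    then have im: "\<phi> (coef f) \<in> carrier (END_U n)"
      using bij by (auto simp: bij_betw_def)
    then obtain F where F: "F \<in> typed n [] []" "\<phi> (coef f) = cls F"
      by (rule END_U_carrier)
    then have "cell X = cell F"
      using f by (simp add: \<Phi>_def of_mor.abs_eq)
    then have "cls X = \<phi> (coef f)"
      using cls_eq_of_cell_eq[OF X F(1)] F(2) by simp
    then show ?thesis
      using mem bij by (simp add: bij_betw_def)
  qed
  have "inv_into (carrier Lambda) \<phi> (cls (thick_cw n a \<alpha>)) =
      coef ((- 1) ^ ?j * Mps (schur \<alpha>))"
    unfolding jacobi_trudi[OF assms(4)]
    by (rule inverse[OF typed_thick_cw _ cw]) (intro sign_mem ldet_mem sym_funs_simple)
  moreover have "inv_into (carrier Lambda) \<phi> (cls (thick_ccw n a \<beta>)) =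
      coef ((- 1) ^ ?j * ((- 1) ^ sum_list \<beta> * Mps (schur (conjugate \<beta>))))"
  proof -
    have len: "length \<beta> = a"
      using assms(5) by (simp add: partitions_atmost_def)
    show ?thesis
      unfolding dual_jacobi_trudi[OF assms(5)] ldet_sgn_es[OF len, symmetric]
      by (rule inverse[OF typed_thick_ccw _ ccw]) (intro sign_mem ldet_mem es)
  qed
  ultimately show ?thesis
    by (simp add: cls_in_END_U typed_thick_cw typed_thick_ccw coef_sign fun_eq_iff Mps_inverse power_add mult.assoc)
qed

end
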